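(* \textsc{RangeEqPairsQuery} can be solved online in time \[T(n,q)=\begin{cases}\tilde O\!\left(n\,q^{\frac{\omega-1}{\omega+1}}\right) & \text{if } q\le n,\\[2pt] \tilde O\!\left(n^{\frac{2\omega-2}{\omega+1}}\,q^{\frac{2}{\omega+1}}\right) & \text{if } q>n,\end{cases}\] where $n$ is the array length and $q$ the number of queries.
   Context: \textsc{RangeEqPairsQuery}: given an array of integers $A[1..n]$ and a sequence of $q$ ranges $[l,r]$, compute for each range $|\{(i,j): l\le i<j\le r,\ A[i]=A[j]\}|$. Online means each query must be answered before the next is revealed (the number $q$ need not be known in advance). $\omega$ denotes the exponent of square matrix multiplication; $\tilde O$ hides polylogarithmic factors.
   Formalization: For q > n² the printed bound falls below q, the time needed to answer q queries, so Õ(q) is proved there instead; the bound is shown with ω itself if matrix multiplication takes Õ(m^ω), and otherwise with ω+ε for every ε > 0. *)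

theory Defs
  imports Complex_Main "HOL-Library.Log_Nat"
begin

text \<open>
  Machine model: a deterministic random access machine on integers with indirect addressing and
  logarithmic cost, i.e. every operation is charged the bit lengths of its operands.  Up to
  polylogarithmic factors this agrees with the word RAM with words of logarithmic length, but no
  word size has to be fixed (which would be awkward when the number of queries is not known in
  advance), and nothing can be gained from huge numbers.  Programs are structured (while programs)
  instead of lists of instructions with jumps.  A program mentions only finitely many registers.
\<close>

record state =
  regs :: "nat \<Rightarrow> int"
  mem :: "int \<Rightarrow> int"

datatype binop = Add | Sub | Mul | Div

fun binop_val :: "binop \<Rightarrow> int \<Rightarrow> int \<Rightarrow> int" where
  "binop_val Add x y = x + y"
| "binop_val Sub x y = x - y"
| "binop_val Mul x y = x * y"
| "binop_val Div x y = x div y"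

datatype com =
    Skip
  | Const nat int          \<comment> \<open>\<open>Const r c\<close>: \<open>R[r] := c\<close>\<close>
  | Op binop nat nat nat   \<comment> \<open>\<open>Op f r x y\<close>: \<open>R[r] := f R[x] R[y]\<close>\<close>
  | Load nat nat           \<comment> \<open>\<open>Load r x\<close>: \<open>R[r] := M[R[x]]\<close>\<close>
  | Store nat nat          \<comment> \<open>\<open>Store x y\<close>: \<open>M[R[x]] := R[y]\<close>\<close>
  | Seq com com
  | IfPos nat com com      \<comment> \<open>test \<open>R[x] > 0\<close>\<close>
  | WhilePos nat com

definition len :: "int \<Rightarrow> nat" where
  "len x = floorlog 2 (nat \<bar>x\<bar>)"

text \<open>\<open>exec c s t s'\<close>: started in \<open>s\<close>, the program \<open>c\<close> halts in \<open>s'\<close> after time \<open>t\<close>.\<close>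

inductive exec :: "com \<Rightarrow> state \<Rightarrow> nat \<Rightarrow> state \<Rightarrow> bool" where
  Skip: "exec Skip s 1 s"
| Const: "exec (Const r c) s (1 + len c) (s\<lparr>regs := (regs s)(r := c)\<rparr>)"
| Op: "exec (Op f r x y) s (1 + len (regs s x) + len (regs s y))
        (s\<lparr>regs := (regs s)(r := binop_val f (regs s x) (regs s y))\<rparr>)"
| Load: "exec (Load r x) s (1 + len (regs s x) + len (mem s (regs s x)))
        (s\<lparr>regs := (regs s)(r := mem s (regs s x))\<rparr>)"
| Store: "exec (Store x y) s (1 + len (regs s x) + len (regs s y))
        (s\<lparr>mem := (mem s)(regs s x := regs s y)\<rparr>)"
| Seq: "exec c s t s' \<Longrightarrow> exec d s' u s'' \<Longrightarrow> exec (Seq c d) s (t + u) s''"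
| IfTrue: "regs s x > 0 \<Longrightarrow> exec c s t s' \<Longrightarrow>
        exec (IfPos x c d) s (1 + len (regs s x) + t) s'"
| IfFalse: "\<not> regs s x > 0 \<Longrightarrow> exec d s t s' \<Longrightarrow>
        exec (IfPos x c d) s (1 + len (regs s x) + t) s'"
| WhileTrue: "regs s x > 0 \<Longrightarrow> exec c s t s' \<Longrightarrow> exec (WhilePos x c) s' u s'' \<Longrightarrow>
        exec (WhilePos x c) s (1 + len (regs s x) + t + u) s''"
| WhileFalse: "\<not> regs s x > 0 \<Longrightarrow> exec (WhilePos x c) s (1 + len (regs s x)) s"

inductive_cases exec_SkipE: "exec Skip s t s'"
  and exec_ConstE: "exec (Const r c) s t s'"
  and exec_OpE: "exec (Op f r x y) s t s'"
  and exec_LoadE: "exec (Load r x) s t s'"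
  and exec_StoreE: "exec (Store x y) s t s'"
  and exec_SeqE: "exec (Seq c d) s t s'"
  and exec_IfPosE: "exec (IfPos x c d) s t s'"
  and exec_WhilePosE: "exec (WhilePos x c) s t s'"

lemma exec_deterministic:
  "exec c s t s' \<Longrightarrow> exec c s u s'' \<Longrightarrow> u = t \<and> s'' = s'"
proof (induction arbitrary: u s'' rule: exec.induct)
  case Skip
  from Skip.prems show ?case by (rule exec_SkipE) simp
next
  case Const
  from Const.prems show ?case by (rule exec_ConstE) simp
next
  case Op
  from Op.prems show ?case by (rule exec_OpE) simp
next
  case Load
  from Load.prems show ?case by (rule exec_LoadE) simp
next
  case Store
  from Store.prems show ?case by (rule exec_StoreE) simp
next
  case (Seq c s t s' d v s3)
  from Seq.prems show ?case by (rule exec_SeqE) (use Seq.IH in fast)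
next
  case (IfTrue s x c t s' d)
  from IfTrue.prems show ?case
    by (rule exec_IfPosE) (use IfTrue.hyps(1) in \<open>auto dest: IfTrue.IH\<close>)
next
  case (IfFalse s x d t s' c)
  from IfFalse.prems show ?case
    by (rule exec_IfPosE) (use IfFalse.hyps(1) in \<open>auto dest: IfFalse.IH\<close>)
next
  case (WhileTrue s x c t s' v s3)
  from WhileTrue.prems show ?case
    by (rule exec_WhilePosE) (use WhileTrue.hyps(1) in \<open>auto dest!: WhileTrue.IH\<close>)
next
  case (WhileFalse s x c)
  from WhileFalse.prems show ?case
    by (rule exec_WhilePosE) (use WhileFalse.hyps in auto)
qed


text \<open>
  Multiplication of \<open>m \<times> m\<close> integer matrices: \<open>R[0]\<close> holds \<open>m\<close>, and the two factors, followed by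
  the product, are stored row by row from address \<open>0\<close> on.
\<close>

definition mm_init :: "nat \<Rightarrow> (nat \<Rightarrow> nat \<Rightarrow> int) \<Rightarrow> (nat \<Rightarrow> nat \<Rightarrow> int) \<Rightarrow> state" where
  "mm_init m A B = \<lparr>regs = (\<lambda>_. 0)(0 := int m),
     mem = (\<lambda>a. if 0 \<le> a \<and> a < int (m * m) then A (nat a div m) (nat a mod m)
                else if int (m * m) \<le> a \<and> a < int (2 * m * m)
                then B ((nat a - m * m) div m) ((nat a - m * m) mod m)
                else 0)\<rparr>"

text \<open>
  \<open>mm_in_time w\<close>: matrix multiplication takes time \<open>O\<close>-tilde of \<open>m\<^sup>w\<close>, where the entries are
  bounded by \<open>K\<close> and the hidden factor is polylogarithmic in \<open>m\<close> and \<open>K\<close>.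
\<close>

definition mm_in_time :: "real \<Rightarrow> bool" where
  "mm_in_time w \<longleftrightarrow> (\<exists>P c k. \<forall>m \<ge> 1. \<forall>A B K.
     (\<forall>i<m. \<forall>j<m. \<bar>A i j\<bar> \<le> int K \<and> \<bar>B i j\<bar> \<le> int K) \<longrightarrow>
     (\<exists>t s. exec P (mm_init m A B) t s \<and>
        (\<forall>i<m. \<forall>j<m. mem s (int (2 * m * m + i * m + j)) = (\<Sum>l<m. A i l * B l j)) \<and>
        real t \<le> c * real m powr w * log 2 (real (m + K + 2)) ^ k))"

definition omega :: real where
  "omega = Inf {w. mm_in_time w}"


definition eq_pairs :: "(nat \<Rightarrow> int) \<Rightarrow> nat \<Rightarrow> nat \<Rightarrow> nat" where
  "eq_pairs A l r = card {(i, j). l \<le> i \<and> i < j \<and> j \<le> r \<and> A i = A j}"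

definition array_init :: "nat \<Rightarrow> (nat \<Rightarrow> int) \<Rightarrow> state" where
  "array_init n A = \<lparr>regs = (\<lambda>_. 0)(0 := int n),
     mem = (\<lambda>a. if 1 \<le> a \<and> a \<le> int n then A (nat a) else 0)\<rparr>"

text \<open>
  \<open>serve Q s qs as t\<close>: from state \<open>s\<close> on, the query program \<open>Q\<close> answers the queries \<open>qs\<close> one after
  the other by \<open>as\<close>, in total time \<open>t\<close>.  The range \<open>[l, r]\<close> arrives in \<open>R[0]\<close>, \<open>R[1]\<close> only after the
  previous answer has been delivered in \<open>R[0]\<close>; the rest of the state persists between queries.
\<close>

inductive serve :: "com \<Rightarrow> state \<Rightarrow> (nat \<times> nat) list \<Rightarrow> int list \<Rightarrow> nat \<Rightarrow> bool" for Q where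
  Nil: "serve Q s [] [] 0"
| Cons: "exec Q (s\<lparr>regs := (regs s)(0 := int l, 1 := int r)\<rparr>) t s' \<Longrightarrow> serve Q s' qs as u \<Longrightarrow>
    serve Q s ((l, r) # qs) (regs s' 0 # as) (t + u)"

text \<open>
  \<open>range_eq_pairs_online_in_time T\<close>: a preprocessing program \<open>P\<close> and a query program \<open>Q\<close>, neither
  of which is told the number \<open>q\<close> of queries, answer any \<open>q \<ge> 1\<close> queries online in total time
  (preprocessing included) \<open>O\<close>-tilde of \<open>T n q\<close>.  The array entries are bounded by \<open>K\<close>, and the
  hidden factor is polylogarithmic in \<open>n\<close>, \<open>q\<close> and \<open>K\<close>.
\<close>

definition range_eq_pairs_online_in_time :: "(nat \<Rightarrow> nat \<Rightarrow> real) \<Rightarrow> bool" where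
  "range_eq_pairs_online_in_time T \<longleftrightarrow> (\<exists>P Q c k. \<forall>n A K qs.
     qs \<noteq> [] \<and> (\<forall>(l, r) \<in> set qs. 1 \<le> l \<and> l \<le> r \<and> r \<le> n) \<and> (\<forall>i\<in>{1..n}. \<bar>A i\<bar> \<le> int K) \<longrightarrow>
     (\<exists>t s u. exec P (array_init n A) t s \<and>
        serve Q s qs (map (\<lambda>(l, r). int (eq_pairs A l r)) qs) u \<and>
        real (t + u) \<le> c * T n (length qs) * log 2 (real (n + length qs + K + 2)) ^ k))"

text \<open>
  For \<open>q > n\<^sup>2\<close> (more queries than ranges) the formula of the second case drops polynomially below
  \<open>q\<close>, the time needed merely to receive the queries; there the bound is \<open>q\<close>.  At \<open>q = n\<^sup>2\<close> the two
  expressions coincide.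
\<close>

definition time_bound :: "real \<Rightarrow> nat \<Rightarrow> nat \<Rightarrow> real" where
  "time_bound w n q =
     (if q \<le> n then real n * real q powr ((w - 1) / (w + 1))
      else if q \<le> n\<^sup>2 then real n powr ((2 * w - 2) / (w + 1)) * real q powr (2 / (w + 1))
      else real q)"

end

theory Submission
  imports Defs "HOL-Real_Asymp.Real_Asymp"
begin

text \<open>
  Split the array into blocks of length \<open>sz\<close>.  Given the numbers of equal pairs between any two
  prefixes that consist of whole blocks, a query only has to count, by binary search in lists of
  positions, the partners of the at most \<open>2 * sz\<close> remaining positions, so it costs \<open>sz\<close> up to logarithms.
  The table for pairs of blocks is the sum of a part for infrequent values, whose pairs
  are enumerated, and of a part for frequent values: the product of the matrix of occurrences of
  frequent values in blocks with its transpose, computed by products of \<open>d \<times> d\<close> matrices.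

  Neither the number of queries nor the exponent (possibly uncomputable) is known to the program.
  So the structure is rebuilt after \<open>1, 2, 4, ...\<close> queries, and every rebuilding for the next \<open>q\<close>
  queries tries \<open>sz = 1, 2, 4, ...\<close> until the construction succeeds within time \<open>q * sz\<close> up to
  logarithms.  To be interruptible, the matrix multiplication program is instrumented with a clock.
  It runs in a virtual memory, where cells carry a time stamp so that the memory can be
  cleared at no cost.
\<close>

section \<open>Time-bounded execution and expressions\<close>

text \<open>For \<open>q\<close> queries and block size \<open>sz\<close> the budget is about
  \<open>q * sz\<close>. A value is frequent if it occurs more than \<open>q * sz div n + 1\<close>
  times: enumerating the pairs of the others costs about \<open>n + q * sz\<close>, and at most
  \<open>n^2 / (q * sz)\<close> values are frequent. So the occurrence matrix has about
  \<open>n / sz\<close> rows and \<open>n^2 / (q * sz)\<close> columns, and \<open>d\<close> is the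
  smaller dimension up to constants. The products cost \<open>(n / q) * (n / sz)^w\<close> if
  \<open>q <= n\<close> and \<open>(q / n)^2 * (n^2 / (q * sz))^w\<close> if \<open>q > n\<close>;
  equating this with \<open>q * sz\<close> yields the two cases of the bound.

  Logarithmic cost shapes the rest. All numbers handled by the data structure are kept below a
  polynomial bound \<open>U\<close>, so each instruction costs at most some \<open>w\<close> of
  logarithmic size, and \<open>run w c k\<close> merely counts \<open>k\<close> instructions. The
  multiplication program is arbitrary and gives no such bound: its clock is charged by an
  approximation of bit lengths, found by repeated squaring, that is right up to constant
  factors.\<close>

definition run :: "nat => com => nat => state => (state => bool) => bool" where
  "run w c k s Q \<longleftrightarrow> (EX t s'. exec c s t s' & t <= k * w & Q s')"

lemma run_mono:
  assumes "run w c k s Q" "k <= k'" "\<And>s'. Q s' ==> Q' s'"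
  shows "run w c k' s Q'"
  using assms unfolding run_def by (meson le_trans mult_le_mono1)

lemma run_Seq:
  assumes "run w c k s (%s'. run w d l s' Q)"
  shows "run w (Seq c d) (k + l) s Q"
proof -
  obtain t s' u s'' where "exec c s t s'" "t <= k * w" "exec d s' u s''" "u <= l * w" "Q s''"
    using assms unfolding run_def by blast
  moreover from this have "t + u <= (k + l) * w" by (simp add: algebra_simps)
  ultimately show ?thesis unfolding run_def using exec.Seq by blast
qed

lemma run_Skip: "w >= 1 ==> Q s ==> run w Skip 1 s Q"
  unfolding run_def using exec.Skip by fastforce

lemma run_Const: "1 + len c <= w ==> Q (s(|regs := (regs s)(r := c)|)) ==> run w (Const r c) 1 s Q"
  unfolding run_def using exec.Const by fastforce

lemma run_Op: "1 + len (regs s x) + len (regs s y) <= w ==>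
    Q (s(|regs := (regs s)(r := binop_val f (regs s x) (regs s y))|)) ==> run w (Op f r x y) 1 s Q"
  unfolding run_def using exec.Op by fastforce

lemma run_Load: "1 + len (regs s x) + len (mem s (regs s x)) <= w ==>
    Q (s(|regs := (regs s)(r := mem s (regs s x))|)) ==> run w (Load r x) 1 s Q"
  unfolding run_def using exec.Load by fastforce

lemma run_Store: "1 + len (regs s x) + len (regs s y) <= w ==>
    Q (s(|mem := (mem s)(regs s x := regs s y)|)) ==> run w (Store x y) 1 s Q"
  unfolding run_def using exec.Store by fastforce

lemma run_IfPos:
  assumes "1 + len (regs s x) <= w" "regs s x > 0 ==> run w c k s Q"
    "\<not> regs s x > 0 ==> run w d k s Q"
  shows "run w (IfPos x c d) (Suc k) s Q"
proof (cases "regs s x > 0")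
  case True
  then obtain t s' where "exec c s t s'" "t <= k * w" "Q s'"
    using assms(2) unfolding run_def by blast
  then show ?thesis unfolding run_def
    using exec.IfTrue[of s x c t s' d] True assms(1) by fastforce
next
  case False
  then obtain t s' where "exec d s t s'" "t <= k * w" "Q s'"
    using assms(3) unfolding run_def by blast
  then show ?thesis unfolding run_def
    using exec.IfFalse[of s x d t s' c] False assms(1) by fastforce
qed

lemma run_WhilePos_unfold:
  assumes "1 + len (regs s x) <= w"
    "regs s x > 0 ==> run w c k s (%s'. run w (WhilePos x c) l s' Q)"
    "\<not> regs s x > 0 ==> Q s"
  shows "run w (WhilePos x c) (Suc (k + l)) s Q"
proof (cases "regs s x > 0")
  case True
  then obtain t s' u s'' where *: "exec c s t s'" "t <= k * w"
      "exec (WhilePos x c) s' u s''" "u <= l * w" "Q s''"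
    using assms(2) unfolding run_def by blast
  have "1 + len (regs s x) + t + u <= Suc (k + l) * w"
    using * assms(1) by (simp add: algebra_simps)
  then show ?thesis unfolding run_def using exec.WhileTrue[OF True *(1) *(3)] *(5) by blast
next
  case False
  have "1 + len (regs s x) <= Suc (k + l) * w"
    using assms(1) by (simp add: algebra_simps)
  then show ?thesis unfolding run_def using exec.WhileFalse[of s x c] False assms(3) by blast
qed

section \<open>Bit lengths and the compilation of arithmetic expressions\<close>

lemma len_le_iff: "len x <= b \<longleftrightarrow> \<bar>x\<bar> < 2 ^ b"
proof -
  have "len x <= b \<longleftrightarrow> nat \<bar>x\<bar> < 2 ^ b"
    unfolding len_def using floorlog_leD[of 2 "nat \<bar>x\<bar>" b] floorlog_leI[of "nat \<bar>x\<bar>" 2 b] by auto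
  also have "\<dots> \<longleftrightarrow> \<bar>x\<bar> < 2 ^ b"
    by (simp add: nat_less_iff)
  finally show ?thesis .
qed

datatype aexp = N int | V nat | Bin binop aexp aexp

fun ev :: "aexp => (nat => int) => int" where
  "ev (N c) R = c"
| "ev (V r) R = R r"
| "ev (Bin f a b) R = binop_val f (ev a R) (ev b R)"

text \<open>If all registers are at most \<open>U\<close> in absolute value and
  \<open>U >= 100\<close>, then the value of \<open>e\<close> is at most \<open>U ^ deg e\<close>. A
  sum needs one more power because \<open>2 <= U\<close>; 100 is also the limit for literals in
  \<open>wf_aexp\<close>.\<close>

fun deg :: "aexp => nat" where
  "deg (N c) = 1"
| "deg (V r) = 1"
| "deg (Bin f a b) = (case f of Mul => deg a + deg b | Div => deg a + deg b | _ => Suc (max (deg a) (deg b)))"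

fun wf_aexp :: "aexp => bool" where
  "wf_aexp (N c) \<longleftrightarrow> \<bar>c\<bar> <= 100"
| "wf_aexp (V r) \<longleftrightarrow> r < 100"
| "wf_aexp (Bin f a b) \<longleftrightarrow> wf_aexp a & wf_aexp b"

text \<open>The number of instructions emitted by \<open>comp_aexp\<close>; it also bounds the depth
  of the evaluation stack.\<close>

fun esz :: "aexp => nat" where
  "esz (N c) = 1"
| "esz (V r) = 2"
| "esz (Bin f a b) = esz a + esz b + 2"

text \<open>The registers from \<open>d\<close> on form an evaluation stack. Stack cells are reset
  to 0 after use, and adding a register that holds 0 replaces the missing move instruction.\<close>

fun comp_aexp :: "aexp => nat => com" where
  "comp_aexp (N c) d = Const d c"
| "comp_aexp (V r) d = Seq (Const d 0) (Op Add d r d)"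
| "comp_aexp (Bin f a b) d =
    Seq (comp_aexp a d) (Seq (comp_aexp b (Suc d)) (Seq (Op f d d (Suc d)) (Const (Suc d) 0)))"

abbreviation "eadd a b == Bin Add a b"
abbreviation "esub a b == Bin Sub a b"
abbreviation "emul a b == Bin Mul a b"
abbreviation "ediv a b == Bin Div a b"

lemma esz_pos: "esz e >= 1"
  by (induction e) auto

lemma ev_cong: "wf_aexp e ==> (\<And>r. r < 100 ==> R r = R' r) ==> ev e R = ev e R'"
  by (induction e) auto

lemma abs_div_le: "\<bar>x div y\<bar> <= \<bar>x\<bar>" for x y :: int
proof -
  have pos: "\<bar>a div b\<bar> <= \<bar>a\<bar>" if b: "b > 0" for a b :: int
  proof (cases "a >= 0")
    case True
    then have "a div b >= 0" using b by (simp add: pos_imp_zdiv_nonneg_iff)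
    moreover have "b * (a div b) <= a" using b by (simp add: minus_mod_eq_mult_div[symmetric])
    moreover have "1 * (a div b) <= b * (a div b)"
      using b calculation(1) by (intro mult_right_mono) auto
    ultimately show ?thesis using True by simp
  next
    case False
    then have "a div b < 0" using b by (simp add: pos_imp_zdiv_neg_iff)
    moreover have "a <= a div b"
    proof (rule ccontr)
      assume "\<not> a <= a div b"
      then have "a div b + 1 <= a" by simp
      have "a < b * (a div b) + b" using b pos_mod_bound[of b a] mult_div_mod_eq[of b a] by linarith
      also have "\<dots> = b * (a div b + 1)" by (simp add: algebra_simps)
      also have "\<dots> <= b * a" using b \<open>a div b + 1 <= a\<close> by (intro mult_left_mono) auto
      also have "\<dots> <= 1 * a" using b False by (intro mult_right_mono_neg) auto
      finally show False by simp
    qed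
    ultimately show ?thesis by simp
  qed
  show ?thesis
  proof (cases y "0 :: int" rule: linorder_cases)
    case less
    have "x div y = (- x) div (- y)" by simp
    then show ?thesis using pos[of "- y" "- x"] less by simp
  qed (use pos in auto)
qed

lemma ev_bound:
  assumes "wf_aexp e" "\<And>r. r < 100 ==> \<bar>R r\<bar> <= U" "U >= (100 :: int)"
  shows "\<bar>ev e R\<bar> <= U ^ deg e"
  using assms(1)
proof (induction e)
  case (N c)
  then show ?case using assms(3) by simp
next
  case (V r)
  then show ?case using assms(2) by simp
next
  case (Bin f a b)
  have IH: "\<bar>ev a R\<bar> <= U ^ deg a" "\<bar>ev b R\<bar> <= U ^ deg b" using Bin by auto
  let ?m = "max (deg a) (deg b)"
  have le: "U ^ deg a <= U ^ ?m" "U ^ deg b <= U ^ ?m"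
    using assms(3) by (auto intro!: power_increasing)
  have "U ^ ?m >= 0" using assms(3) by simp
  then have "2 * U ^ ?m <= U * U ^ ?m" using assms(3) by (intro mult_right_mono) auto
  then have two: "2 * U ^ ?m <= U ^ Suc ?m" by simp
  show ?case
  proof (cases f)
    case Add
    then show ?thesis using IH le two by simp
  next
    case Sub
    then show ?thesis using IH le two by simp
  next
    case Mul
    then show ?thesis using IH by (simp add: abs_mult power_add mult_mono')
  next
    case Div
    have "U ^ deg a <= U ^ (deg a + deg b)" using assms(3) by (intro power_increasing) auto
    then show ?thesis using Div IH abs_div_le[of "ev a R" "ev b R"] by simp
  qed
qed

text \<open>Between these constructs the registers 100 to 999 hold 0. Adding register 101 is
  therefore a move, and every construct restores the zeros.\<close>

definition "Ass r e = Seq (comp_aexp e 100) (Seq (Op Add r 100 101) (Const 100 0))"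
definition "LoadE r e = Seq (comp_aexp e 100) (Seq (Load r 100) (Const 100 0))"
definition "StoreE a e = Seq (comp_aexp a 100) (Seq (comp_aexp e 101)
  (Seq (Store 100 101) (Seq (Const 101 0) (Const 100 0))))"
definition "IfE e c d = Seq (comp_aexp e 100) (IfPos 100 (Seq (Const 100 0) c) (Seq (Const 100 0) d))"
definition "WhileE e c = Seq (comp_aexp e 100)
  (Seq (WhilePos 100 (Seq (Const 100 0) (Seq c (comp_aexp e 100)))) (Const 100 0))"

definition For :: "nat => nat => com => com" where
  "For i h c = Seq (Ass i (N 0)) (WhileE (esub (V h) (V i)) (Seq c (Ass i (eadd (V i) (N 1)))))"

definition ok_exp :: "aexp => bool" where
  "ok_exp e \<longleftrightarrow> wf_aexp e & deg e <= 64 & esz e <= 800"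

lemma len0: "len 0 = 0" by (simp add: len_def floorlog_def)

text \<open>\<open>U\<close> bounds the variables, \<open>\<beta>\<close> the bit length of every
  intermediate result of an \<open>ok_exp\<close>. Thus \<open>2 * \<beta> + 1\<close> bounds the
  charge of an instruction with two such operands.\<close>

locale mbound =
  fixes U :: int and \<beta> :: nat
  assumes U100: "100 <= U" and beta: "U ^ 64 < 2 ^ \<beta>"
begin

definition w :: nat where "w = 2 * \<beta> + 1"

definition good :: "state => bool" where
  "good s \<longleftrightarrow> (ALL r<100. \<bar>regs s r\<bar> <= U) & (ALL r>=100. r < 1000 --> regs s r = 0)"

lemma U_le_beta: "i <= 64 ==> \<bar>x\<bar> <= U ^ i ==> len x <= \<beta>"
proof -
  assume a: "i <= 64" "\<bar>x\<bar> <= U ^ i"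
  have "U ^ i <= U ^ 64" using a U100 by (intro power_increasing) auto
  then have "\<bar>x\<bar> < 2 ^ \<beta>" using a beta by linarith
  then show ?thesis by (simp add: len_le_iff)
qed

lemma U_len: "\<bar>x\<bar> <= U ==> len x <= \<beta>"
  using U_le_beta[of 1 x] by simp

lemma w1: "1 <= w" by (simp add: w_def)

lemma run_comp_aexp:
  assumes "wf_aexp e" "deg e <= 64" "100 <= d" "d + esz e <= 1000"
    "\<And>r. r < 100 ==> \<bar>regs s r\<bar> <= U"
    "\<And>r. d <= r ==> r < 1000 ==> regs s r = 0"
    "Q (s(|regs := (regs s)(d := ev e (regs s))|))"
  shows "run w (comp_aexp e d) (esz e) s Q"
  using assms
proof (induction e arbitrary: d s Q)
  case (N c)
  have "\<bar>c\<bar> <= U" using N U100 by simp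
  then have "len c <= \<beta>" by (rule U_len)
  moreover have "Q (s(|regs := (regs s)(d := c)|))" using N(7) by (simp only: ev.simps)
  ultimately have "run w (Const d c) 1 s Q" by (intro run_Const) (simp_all only: w_def)
  then show ?case by simp
next
  case (V r)
  have "len (regs s r) <= \<beta>" using V U_len by simp
  have u: "(regs s)(d := 0, d := binop_val Add (((regs s)(d := 0)) r) (((regs s)(d := 0)) d))
      = (regs s)(d := ev (V r) (regs s))"
    using V.prems by (auto simp: fun_eq_iff)
  have "run w (Seq (Const d 0) (Op Add d r d)) (1 + 1) s Q"
  proof (intro run_Seq run_Const run_Op)
    let ?s = "s(|regs := (regs s)(d := 0)|)"
    have "?s(|regs := (regs ?s)(d := binop_val Add (regs ?s r) (regs ?s d))|)
       = s(|regs := (regs s)(d := ev (V r) (regs s))|)" using u by simp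
    then show "Q (?s(|regs := (regs ?s)(d := binop_val Add (regs ?s r) (regs ?s d))|))"
      using V.prems(7) by (simp only:)
  qed (use V.prems \<open>len (regs s r) <= \<beta>\<close> in \<open>auto simp: w_def len0\<close>)
  then show ?case by (simp add: numeral_2_eq_2)
next
  case (Bin f a b)
  let ?x = "ev a (regs s)" and ?y = "ev b (regs s)"
  let ?s1 = "s(|regs := (regs s)(d := ?x)|)"
  let ?s2 = "s(|regs := (regs s)(d := ?x, Suc d := ?y)|)"
  have dega: "deg a <= 64" "deg b <= 64"
    using Bin.prems(2) by (auto split: binop.splits)
  have R: "\<bar>regs s r\<bar> <= U" if "r < 100" for r using Bin.prems(5) that .
  have "\<bar>?x\<bar> <= U ^ deg a" "\<bar>?y\<bar> <= U ^ deg b"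
    using Bin.prems(1) R U100 by (auto intro!: ev_bound)
  then have l: "len ?x <= \<beta>" "len ?y <= \<beta>" using U_le_beta dega by blast+
  have e: "ev b (regs ?s1) = ?y" using Bin.prems(1,3) by (intro ev_cong) auto
  have upd: "(regs s)(d := z, Suc d := 0) = (regs s)(d := z)" for z
    using Bin.prems(4) esz_pos[of a] Bin.prems(6)[of "Suc d"] by (intro ext) auto
  have b: "run w (comp_aexp b (Suc d)) (esz b) ?s1 (%s'. s' = ?s2)"
  proof (rule Bin.IH(2))
    show "?s1(|regs := (regs ?s1)(Suc d := ev b (regs ?s1))|) = ?s2" unfolding e by simp
  qed (use Bin.prems dega esz_pos[of a] in auto)
  have a: "run w (comp_aexp a d) (esz a) s (%s'. s' = ?s1)"
  proof (rule Bin.IH(1))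
    show "?s1 = ?s1" ..
  qed (use Bin.prems dega in auto)
  have c: "run w (Seq (Op f d d (Suc d)) (Const (Suc d) 0)) (1 + 1) ?s2 Q"
  proof (intro run_Seq run_Op run_Const)
    let ?s3 = "?s2(|regs := (regs ?s2)(d := binop_val f (regs ?s2 d) (regs ?s2 (Suc d)))|)"
    have "(regs s)(d := ?x, Suc d := ?y, d := binop_val f ?x ?y, Suc d := 0)
        = (regs s)(d := binop_val f ?x ?y, Suc d := 0)"
      by (simp add: fun_upd_twist)
    then have "?s3(|regs := (regs ?s3)(Suc d := 0)|) = s(|regs := (regs s)(d := ev (Bin f a b) (regs s))|)"
      using upd[of "binop_val f ?x ?y"] by simp
    then show "Q (?s3(|regs := (regs ?s3)(Suc d := 0)|))" using Bin.prems(7) by (simp only:)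
  qed (use l in \<open>auto simp: w_def len0\<close>)
  have "run w (Seq (comp_aexp a d) (Seq (comp_aexp b (Suc d))
      (Seq (Op f d d (Suc d)) (Const (Suc d) 0)))) (esz a + (esz b + (1 + 1))) s Q"
  proof (intro run_Seq run_mono[OF a order_refl])
    fix s' assume s': "s' = ?s1"
    show "run w (comp_aexp b (Suc d)) (esz b) s'
        (%s'. run w (Seq (Op f d d (Suc d)) (Const (Suc d) 0)) (1 + 1) s' Q)"
      unfolding s' by (rule run_mono[OF b order_refl]) (simp only: c)
  qed
  then show ?case by (simp add: add.assoc)
qed

lemma good_comp:
  assumes "good s" "ok_exp e" "Q (s(|regs := (regs s)(100 := ev e (regs s))|))"
  shows "run w (comp_aexp e 100) (esz e) s Q"
  using assms by (intro run_comp_aexp) (auto simp: good_def ok_exp_def)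

lemma good_ev_len:
  assumes "good s" "ok_exp e" shows "len (ev e (regs s)) <= \<beta>"
  using assms U100 by (intro U_le_beta[of "deg e"] ev_bound) (auto simp: good_def ok_exp_def)

lemma good_upd: "good s ==> r < 100 ==> \<bar>v\<bar> <= U ==> good (s(|regs := (regs s)(r := v)|))"
  by (auto simp: good_def)

lemma good_mem: "good (s(|mem := M|)) = good s"
  by (auto simp: good_def)

lemma good_temp: "good s ==> r >= 100 ==> r < 1000 ==> (regs s)(r := 0) = regs s"
  by (auto simp: good_def)

lemma good_temp2: "good s ==> r >= 100 ==> r < 1000 ==> (regs s)(r := v, r := 0) = regs s"
  by (auto simp: good_def)

lemma good_temp3: "good s ==> r >= 100 ==> r < 1000 ==> q ~= r ==>
    (regs s)(r := v, q := u, r := 0) = (regs s)(q := u)"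
  by (auto simp: good_def)

lemma good_temp4: "good s ==> r < 100 ==> (regs s)(100 := 0, r := u) = (regs s)(r := u)"
  by (auto simp: good_def)

lemma good_regs: "good s ==> r >= 100 ==> r < 1000 ==> regs s r = 0"
  by (auto simp: good_def)

lemma run_Ass:
  assumes "good s" "ok_exp e" "r < 100"
    "Q (s(|regs := (regs s)(r := ev e (regs s))|))"
  shows "run w (Ass r e) (esz e + 2) s Q"
proof -
  have "run w (Ass r e) (esz e + (1 + 1)) s Q"
    unfolding Ass_def using assms good_ev_len[OF assms(1,2)] good_regs[OF assms(1), of 101]
    by (intro run_Seq good_comp run_Op run_Const)
       (auto simp: w_def len0 good_temp3 good_temp4 fun_upd_twist[of r 100])
  then show ?thesis by simp
qed

lemma run_LoadE:
  assumes "good s" "ok_exp e" "r < 100" "\<bar>mem s (ev e (regs s))\<bar> <= U"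
    "Q (s(|regs := (regs s)(r := mem s (ev e (regs s)))|))"
  shows "run w (LoadE r e) (esz e + 2) s Q"
proof -
  have "run w (LoadE r e) (esz e + (1 + 1)) s Q"
    unfolding LoadE_def using assms good_ev_len[OF assms(1,2)] U_len[OF assms(4)]
    by (intro run_Seq good_comp run_Load run_Const)
       (auto simp: w_def len0 good_temp3)
  then show ?thesis by simp
qed

lemma run_StoreE:
  assumes "good s" "ok_exp a" "ok_exp e"
    "Q (s(|mem := (mem s)(ev a (regs s) := ev e (regs s))|))"
  shows "run w (StoreE a e) (esz a + esz e + 3) s Q"
proof -
  let ?s1 = "s(|regs := (regs s)(100 := ev a (regs s))|)"
  have e: "ev e (regs ?s1) = ev e (regs s)"
    using assms(3) by (intro ev_cong) (auto simp: ok_exp_def)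
  have 2: "run w (comp_aexp e 101) (esz e) ?s1 (%s'. s' = ?s1(|regs := (regs ?s1)(101 := ev e (regs s))|))"
    using assms e by (intro run_comp_aexp) (auto simp: good_def ok_exp_def)
  have u: "(regs s)(100 := x, 101 := y, 101 := 0, 100 := 0) = regs s" for x y
    using assms(1) by (auto simp: good_def)
  have "run w (StoreE a e) (esz a + (esz e + (1 + (1 + 1)))) s Q"
    unfolding StoreE_def using assms good_ev_len[OF assms(1,2)] good_ev_len[OF assms(1,3)]
    by (intro run_Seq good_comp run_mono[OF 2] run_Store run_Const order_refl)
       (auto simp: w_def len0 good_temp good_temp2 u fun_upd_twist)
  then show ?thesis by (rule run_mono) auto
qed

lemma run_IfE:
  assumes "good s" "ok_exp e" "ev e (regs s) > 0 ==> run w c k s Q" "ev e (regs s) <= 0 ==> run w d k s Q"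
  shows "run w (IfE e c d) (esz e + 2 + k) s Q"
proof -
  have u: "s(|regs := (regs s)(100 := x, 100 := 0)|) = s" for x
    using assms(1) good_temp2[of s 100] by simp
  have "run w (IfE e c d) (esz e + Suc (1 + k)) s Q"
    unfolding IfE_def using assms good_ev_len[OF assms(1,2)]
    by (intro run_Seq good_comp run_IfPos run_Const)
       (auto simp: w_def len0 good_temp good_temp2)
  then show ?thesis by simp
qed

text \<open>The invariant is indexed by the number of iterations still allowed; it has to be positive
  as long as the loop condition holds.\<close>

lemma run_WhileE_gen:
  fixes C :: "nat => state => nat"
  assumes g: "good s" and e: "ok_exp e" and "I n s"
    and step: "\<And>m s. m <= n ==> good s ==> I m s ==> ev e (regs s) > 0 ==>
      m > 0 & (EX k. run w c k s (%s'. good s' & I (m - 1) s' & k + esz e + 2 + C (m - 1) s' <= C m s))"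
  shows "run w (WhileE e c) (C n s + esz e + 2) s
     (%s'. good s' & ev e (regs s') <= 0 & (EX m<=n. I m s'))"
proof -
  let ?up = "%s. s(|regs := (regs s)(100 := ev e (regs s))|)"
  let ?Q = "%s'. good s' & ev e (regs s') <= 0 & (EX m<=n. I m s')"
  let ?W = "WhilePos 100 (Seq (Const 100 0) (Seq c (comp_aexp e 100)))"
  have L: "run w ?W (C m s + 1) (?up s) (%s'. EX s. s' = ?up s & ?Q s)" if "m <= n" "good s" "I m s" for m s
    using that
  proof (induction m arbitrary: s)
    case 0
    then have neg: "\<not> ev e (regs s) > 0" using step[of 0 s] by auto
    have "run w ?W (Suc (0 + 0)) (?up s) (%s'. EX s. s' = ?up s & ?Q s)"
    proof (intro run_WhilePos_unfold)
      show "EX s'. ?up s = ?up s' & ?Q s'"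
        by (rule exI[of _ s], rule conjI, rule refl) (use 0 neg in auto)
    qed (use 0 neg good_ev_len[OF 0(2) e] in \<open>auto simp: w_def\<close>)
    then show ?case by (rule run_mono) (assumption | simp)+
  next
    case (Suc m)
    have u: "s(|regs := (regs s)(100 := x, 100 := 0)|) = s" for x
      using Suc(3) good_temp2[of s 100] by simp
    show ?case
    proof (cases "ev e (regs s) > 0")
      case True
      obtain k where r: "run w c k s (%s'. good s' & I m s' & k + esz e + 2 + C m s' <= C (Suc m) s)"
        using step[of "Suc m" s] Suc.prems True by auto
      define l where "l = C (Suc m) s - (k + esz e + 2)"
      have body: "run w c k s (%s'. run w (comp_aexp e 100) (esz e) s' (%s'. run w ?W (l + 1) s' (%s'. EX s. s' = ?up s & ?Q s)))"
      proof (rule run_mono[OF r order_refl])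
        fix s' assume s': "good s' & I m s' & k + esz e + 2 + C m s' <= C (Suc m) s"
        have "run w ?W (C m s' + 1) (?up s') (%s'. EX s. s' = ?up s & ?Q s)"
          by (rule Suc.IH) (use s' Suc.prems in auto)
        then have "run w ?W (l + 1) (?up s') (%s'. EX s. s' = ?up s & ?Q s)"
        proof (rule run_mono)
          show "C m s' + 1 <= l + 1" using s' unfolding l_def by linarith
        qed
        then show "run w (comp_aexp e 100) (esz e) s' (%s'. run w ?W (l + 1) s' (%s'. EX s. s' = ?up s & ?Q s))"
          using s' e by (intro good_comp) auto
      qed
      have k: "k + esz e + 2 <= C (Suc m) s"
      proof -
        obtain s' where "k + esz e + 2 + C m s' <= C (Suc m) s" using r unfolding run_def by blast
        then show ?thesis by linarith
      qed
      have "run w ?W (Suc ((1 + (k + esz e)) + (l + 1))) (?up s) (%s'. EX s. s' = ?up s & ?Q s)"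
      proof (intro run_WhilePos_unfold)
        show "run w (Seq (Const 100 0) (Seq c (comp_aexp e 100))) (1 + (k + esz e)) (?up s)
           (%s'. run w ?W (l + 1) s' (%s'. EX s. s' = ?up s & ?Q s))"
        proof (intro run_Seq run_Const)
          show "1 + len 0 <= w" by (simp add: w_def len0)
          show "run w c k (?up s(|regs := (regs (?up s))(100 := 0)|)) (%s'. run w (comp_aexp e 100) (esz e) s'
              (%s'. run w ?W (l + 1) s' (%s'. EX s. s' = ?up s & ?Q s)))"
            using body u by simp
        qed
      qed (use True good_ev_len[OF Suc(3) e] in \<open>auto simp: w_def\<close>)
      moreover have "Suc ((1 + (k + esz e)) + (l + 1)) <= C (Suc m) s + 1" using k unfolding l_def by linarith
      ultimately show ?thesis by (rule run_mono) assumption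
    next
      case False
      have "run w ?W (Suc (0 + 0)) (?up s) (%s'. EX s. s' = ?up s & ?Q s)"
      proof (intro run_WhilePos_unfold)
        show "EX s'. ?up s = ?up s' & ?Q s'"
          by (rule exI[of _ s], rule conjI, rule refl) (use Suc.prems False in auto)
      qed (use False good_ev_len[OF Suc(3) e] in \<open>auto simp: w_def\<close>)
      then show ?thesis by (rule run_mono) (assumption | simp)+
    qed
  qed
  have "run w (WhileE e c) (esz e + ((C n s + 1) + 1)) s ?Q"
    unfolding WhileE_def using g e
    by (intro run_Seq good_comp run_mono[OF L[of n s]] order_refl)
       (use assms(3) in \<open>auto intro!: run_Const[unfolded One_nat_def] simp: w1[unfolded One_nat_def] len0 good_temp good_temp2\<close>)
  then show ?thesis by (simp add: algebra_simps)
qed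

text \<open>The cost is a potential \<open>C\<close> of the state instead of a constant per round:
  rounds that call the multiplication program are not bounded individually, but paid for by the
  clock. The two numbers 20 cover the loop test with the increment, and the initialisation.\<close>

lemma run_For_gen:
  fixes C :: "nat => state => nat"
  assumes g: "good s" and ih: "i < 100" "h < 100" "i ~= h" and h: "regs s h = int n"
    and I0: "I 0 (s(|regs := (regs s)(i := 0)|))"
    and step: "\<And>j s'. j < n ==> good s' ==> I j s' ==> regs s' i = int j ==> regs s' h = int n ==>
      EX k. run w c k s' (%s''. good s'' & regs s'' i = int j & regs s'' h = int n &
        I (Suc j) (s''(|regs := (regs s'')(i := int (Suc j))|)) &
        k + 20 + C (Suc j) (s''(|regs := (regs s'')(i := int (Suc j))|)) <= C j s')"
  shows "run w (For i h c) (C 0 (s(|regs := (regs s)(i := 0)|)) + 20) s (%s'. good s' & regs s' i = int n & regs s' h = int n & I n s')"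
proof -
  \<comment> \<open>\<open>run_WhileE_gen\<close> counts the rounds still allowed, whereas
    \<open>I\<close> counts those already done; hence \<open>n - m\<close>.\<close>
  let ?J = "%m s'. m <= n & regs s' i = int (n - m) & regs s' h = int n & I (n - m) s'"
  let ?s1 = "s(|regs := (regs s)(i := 0)|)"
  have nU: "int n <= U" using g h ih by (auto simp: good_def)
  have g1: "good ?s1" using g ih U100 by (intro good_upd) auto
  let ?a = "esz (eadd (V i) (N 1)) + 2"
  have W: "run w (WhileE (esub (V h) (V i)) (Seq c (Ass i (eadd (V i) (N 1)))))
     (C (n - n) ?s1 + esz (esub (V h) (V i)) + 2) ?s1
     (%s'. good s' & ev (esub (V h) (V i)) (regs s') <= 0 & (EX m<=n. ?J m s'))"
  proof (rule run_WhileE_gen[where I = ?J and C = "%m. C (n - m)"])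
    show "good ?s1" by (rule g1)
    show "ok_exp (esub (V h) (V i))" using ih by (simp add: ok_exp_def)
    show "?J n ?s1" using I0 h ih by simp
    fix m s' assume m: "m <= n" and g': "good s'" and J: "?J m s'" and p: "0 < ev (esub (V h) (V i)) (regs s')"
    let ?j = "n - m"
    have m0: "m > 0" using J p m by auto
    then have j: "?j < n" "Suc ?j = n - (m - 1)" using m by auto
    obtain k where k: "run w c k s' (%s''. good s'' & regs s'' i = int ?j & regs s'' h = int n &
        I (Suc ?j) (s''(|regs := (regs s'')(i := int (Suc ?j))|)) &
        k + 20 + C (Suc ?j) (s''(|regs := (regs s'')(i := int (Suc ?j))|)) <= C ?j s')"
      using step[OF j(1) g'] J by blast
    have "run w (Seq c (Ass i (eadd (V i) (N 1)))) (k + ?a) s' (%s'a. good s'a & ?J (m - 1) s'a &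
        (k + ?a) + esz (esub (V h) (V i)) + 2 + C (n - (m - 1)) s'a <= C ?j s')"
    proof (intro run_Seq run_mono[OF k] order_refl)
      fix s''
      assume *: "good s'' & regs s'' i = int ?j & regs s'' h = int n &
         I (Suc ?j) (s''(|regs := (regs s'')(i := int (Suc ?j))|)) &
         k + 20 + C (Suc ?j) (s''(|regs := (regs s'')(i := int (Suc ?j))|)) <= C ?j s'"
      have e: "int ?j + 1 = int (n - (m - 1))" using j(2) by linarith
      show "run w (Ass i (eadd (V i) (N 1))) ?a s'' (%s'a. good s'a & ?J (m - 1) s'a &
        (k + ?a) + esz (esub (V h) (V i)) + 2 + C (n - (m - 1)) s'a <= C ?j s')"
        using * ih nU m j(2) m0
        by (intro run_Ass) (auto simp: ok_exp_def e simp del: of_nat_diff intro!: good_upd)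
    qed
    then show "0 < m & (EX k. run w (Seq c (Ass i (eadd (V i) (N 1)))) k s' (%s'a. good s'a & ?J (m - 1) s'a &
        k + esz (esub (V h) (V i)) + 2 + C (n - (m - 1)) s'a <= C ?j s'))"
      using m0 by blast
  qed
  have A: "run w (Ass i (N 0)) (esz (N 0) + 2) s (%s'. s' = ?s1)"
    using g ih by (intro run_Ass) (auto simp: ok_exp_def)
  have F: "I n s'" "regs s' i = int n"
    if "ev (esub (V h) (V i)) (regs s') <= 0" "m <= n" "?J m s'" for m s'
  proof -
    have "m = 0" using that by auto
    then show "I n s'" "regs s' i = int n" using that by auto
  qed
  have "run w (For i h c) ((esz (N 0) + 2) + (C (n - n) ?s1 + esz (esub (V h) (V i)) + 2)) s
     (%s'. good s' & regs s' i = int n & regs s' h = int n & I n s')"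
    unfolding For_def
    by (intro run_Seq run_mono[OF A] order_refl) (auto intro!: run_mono[OF W] dest: F)
  then show ?thesis by (rule run_mono) (auto simp: algebra_simps)
qed

lemma run_For:
  assumes g: "good s" and ih: "i < 100" "h < 100" "i ~= h" and h: "regs s h = int n"
    and I0: "I 0 (s(|regs := (regs s)(i := 0)|))"
    and step: "\<And>j s'. j < n ==> good s' ==> I j s' ==> regs s' i = int j ==> regs s' h = int n ==>
      run w c k s' (%s''. good s'' & regs s'' i = int j & regs s'' h = int n &
        I (Suc j) (s''(|regs := (regs s'')(i := int (Suc j))|)))"
  shows "run w (For i h c) (n * (k + 20) + 20) s (%s'. good s' & regs s' i = int n & regs s' h = int n & I n s')"
proof -
  have "run w (For i h c) ((n - 0) * (k + 20) + 20) s (%s'. good s' & regs s' i = int n & regs s' h = int n & I n s')"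
  proof (rule run_For_gen[where I = I and C = "%j s. (n - j) * (k + 20)", OF g ih h I0])
    fix j s' assume *: "j < n" "good s'" "I j s'" "regs s' i = int j" "regs s' h = int n"
    have "Suc (n - Suc j) = n - j" using *(1) by simp
    then have "(n - j) * (k + 20) = k + 20 + (n - Suc j) * (k + 20)" by (metis mult_Suc)
    then show "EX k'. run w c k' s' (%s''. good s'' & regs s'' i = int j & regs s'' h = int n &
        I (Suc j) (s''(|regs := (regs s'')(i := int (Suc j))|)) & k' + 20 + (n - Suc j) * (k + 20) <= (n - j) * (k + 20))"
      by (intro exI[of _ k] run_mono[OF step[OF *] order_refl]) auto
  qed
  then show ?thesis by simp
qed

end

section \<open>Straight-line blocks\<close>

text \<open>Loop-free code gets a functional semantics, so that the simplifier can execute a block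
  symbolically; only the size conditions gathered in \<open>bnb\<close> remain to be shown.\<close>

datatype ins = As nat aexp | Ld nat aexp | St aexp aexp

fun exi :: "ins => state => state" where
  "exi (As r e) s = s(|regs := (regs s)(r := ev e (regs s))|)"
| "exi (Ld r e) s = s(|regs := (regs s)(r := mem s (ev e (regs s)))|)"
| "exi (St a e) s = s(|mem := (mem s)(ev a (regs s) := ev e (regs s))|)"

fun exb :: "ins list => state => state" where
  "exb [] s = s"
| "exb (i # is) s = exb is (exi i s)"

fun isz :: "ins => nat" where
  "isz (As r e) = esz e + 2"
| "isz (Ld r e) = esz e + 2"
| "isz (St a e) = esz a + esz e + 3"

fun bsz :: "ins list => nat" where
  "bsz [] = 1"
| "bsz (i # is) = isz i + bsz is"

fun insc :: "ins => com" where
  "insc (As r e) = Ass r e"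
| "insc (Ld r e) = LoadE r e"
| "insc (St a e) = StoreE a e"

fun blk :: "ins list => com" where
  "blk [] = Skip"
| "blk (i # is) = Seq (insc i) (blk is)"

fun ok_ins :: "ins => bool" where
  "ok_ins (As r e) \<longleftrightarrow> r < 100 & ok_exp e"
| "ok_ins (Ld r e) \<longleftrightarrow> r < 100 & ok_exp e"
| "ok_ins (St a e) \<longleftrightarrow> ok_exp a & ok_exp e"

context mbound begin

text \<open>\<open>good\<close> constrains registers only: a store needs no bound, while a loaded
  value does.\<close>

fun inb :: "ins => state => bool" where
  "inb (As r e) s \<longleftrightarrow> \<bar>ev e (regs s)\<bar> <= U"
| "inb (Ld r e) s \<longleftrightarrow> \<bar>mem s (ev e (regs s))\<bar> <= U"
| "inb (St a e) s \<longleftrightarrow> True"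

fun bnb :: "ins list => state => bool" where
  "bnb [] s \<longleftrightarrow> True"
| "bnb (i # is) s \<longleftrightarrow> inb i s & (inb i s --> bnb is (exi i s))"

lemma run_ins:
  assumes "good s" "ok_ins i" "inb i s" "good (exi i s) ==> Q (exi i s)"
  shows "run w (insc i) (isz i) s Q"
proof (cases i)
  case (As r e)
  then show ?thesis using assms run_Ass[of s e r Q] by (auto simp: good_upd)
next
  case (Ld r e)
  then show ?thesis using assms run_LoadE[of s e r Q] by (auto simp: good_upd)
next
  case (St a e)
  then show ?thesis using assms run_StoreE[of s a e Q] by (auto simp: good_mem)
qed

lemma run_blk:
  assumes "good s" "\<forall>i\<in>set is. ok_ins i" "bnb is s" "good (exb is s) ==> Q (exb is s)"
  shows "run w (blk is) (bsz is) s Q"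
  using assms
proof (induction "is" arbitrary: s)
  case Nil
  then show ?case using w1 by (auto intro: run_Skip[unfolded One_nat_def])
next
  case (Cons i "is")
  then show ?case by (auto intro!: run_Seq run_ins)
qed

lemma run_blkS:
  assumes "good s" "\<forall>i\<in>set is. ok_ins i" "bnb is s" "good (exb is s) ==> run w d l (exb is s) Q"
  shows "run w (Seq (blk is) d) (bsz is + l) s Q"
  using assms by (intro run_Seq run_blk) auto

end

section \<open>The exponent of matrix multiplication\<close>

text \<open>A polynomial bound on all numbers costs only a logarithmic factor in time: if
  \<open>V <= 2 ^ L\<close>, then \<open>64 * (a + p * L) + 1\<close> bits suffice for
  \<open>U ^ 64\<close>. The condition \<open>a >= 7\<close> gives \<open>U >= 128\<close>.\<close>

lemma mbound_powers:
  fixes V :: nat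
  assumes "V >= 2" "a >= 7"
  obtains b where "mbound (2 ^ a * int V ^ p) b" "real (2 * b + 1) <= real (128 * a + 256 * p + 3) * log 2 (real V)"
proof -
  define L where "L = nat \<lceil>log 2 (real V)\<rceil>"
  have lg: "log 2 (real V) >= 1" using assms by simp
  have "real V = 2 powr log 2 (real V)" using assms by simp
  also have "\<dots> <= 2 powr real L" unfolding L_def by (intro powr_mono real_nat_ceiling_ge) auto
  also have "\<dots> = real (2 ^ L)" by (simp add: powr_realpow)
  finally have VL: "V <= 2 ^ L" by simp
  have L: "real L <= 2 * log 2 (real V)" using lg unfolding L_def by linarith
  define b where "b = 64 * (a + p * L) + 1"
  let ?U = "2 ^ a * int V ^ p"
  have "int V ^ p <= (2 ^ L) ^ p" using VL by (intro power_mono) (simp_all flip: of_nat_power add: of_nat_le_iff[of _ "2 ^ _", simplified])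
  then have "?U <= 2 ^ a * (2 ^ L) ^ p" by simp
  also have "\<dots> = 2 ^ (a + p * L)" by (simp add: power_add power_mult mult.commute)
  finally have "?U ^ 64 <= (2 ^ (a + p * L)) ^ 64" by (intro power_mono) auto
  also have "\<dots> < 2 ^ b" unfolding b_def by (simp flip: power_mult add: mult.commute)
  finally have 1: "?U ^ 64 < 2 ^ b" .
  have "(2 :: int) ^ 7 <= 2 ^ a" using assms by (intro power_increasing) auto
  moreover have "1 <= int V ^ p" using assms by simp
  ultimately have "(2 :: int) ^ 7 * 1 <= ?U" by (intro mult_mono) auto
  then have 2: "100 <= ?U" by simp
  have "real (2 * b + 1) = 128 * real a + 128 * real p * real L + 3"
    unfolding b_def by (simp add: algebra_simps)
  also have "\<dots> <= (128 * real a) * log 2 (real V) + 128 * real p * (2 * log 2 (real V)) + 3 * log 2 (real V)"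
    using lg L by (intro add_mono mult_left_mono) (auto simp: mult_le_cancel_left1)
  also have "\<dots> = real (128 * a + 256 * p + 3) * log 2 (real V)" by (simp add: algebra_simps)
  finally show ?thesis using that[of b] 1 2 by (simp add: mbound_def)
qed

text \<open>Only a store changes memory, and it changes one cell at a cost of at least 1.\<close>

lemma exec_cells_changed:
  assumes "exec c s t s'"
  shows "finite {a. mem s' a ~= mem s a} & card {a. mem s' a ~= mem s a} <= t"
proof -
  have comb: "finite {a. mem s3 a ~= mem s1 a} & card {a. mem s3 a ~= mem s1 a} <= t + u"
    if "finite {a. mem s2 a ~= mem s1 a} & card {a. mem s2 a ~= mem s1 a} <= t"
      "finite {a. mem s3 a ~= mem s2 a} & card {a. mem s3 a ~= mem s2 a} <= u" for s1 s2 s3 t u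
  proof -
    have sub: "{a. mem s3 a ~= mem s1 a} \<subseteq> {a. mem s2 a ~= mem s1 a} \<union> {a. mem s3 a ~= mem s2 a}" by auto
    then have "card {a. mem s3 a ~= mem s1 a} <= card ({a. mem s2 a ~= mem s1 a} \<union> {a. mem s3 a ~= mem s2 a})"
      using that by (intro card_mono) auto
    also have "\<dots> <= t + u" using that by (intro order_trans[OF card_Un_le] add_mono) auto
    finally show ?thesis using that finite_subset[OF sub] by auto
  qed
  show ?thesis using assms
  proof (induction rule: exec.induct)
    case (Store x y s)
    have sub: "{a. mem (s(|mem := (mem s)(regs s x := regs s y)|)) a ~= mem s a} \<subseteq> {regs s x}" by auto
    then have "card {a. mem (s(|mem := (mem s)(regs s x := regs s y)|)) a ~= mem s a} <= 1"
      using card_mono[OF _ sub] by simp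
    then show ?case using finite_subset[OF sub] by simp
  next
    case (Seq c s t s' d u s'')
    then show ?case using comb by blast
  next
    case (WhileTrue s x c t s' u s'')
    then show ?case using comb[of s' s t s'' u] by auto
  qed auto
qed

text \<open>The product of two all-ones matrices has \<open>m ^ 2\<close> nonzero entries in cells
  that initially hold 0, so it takes time \<open>m ^ 2\<close>. This bounds the set of exponents
  from below, and \<open>w >= 2\<close> is needed when the costs are balanced.\<close>

lemma mm_in_time_ge_2:
  assumes "mm_in_time w" shows "w >= 2"
proof (rule ccontr)
  assume "\<not> w >= 2"
  then have w: "w < 2" by simp
  obtain P c k where P: "ALL m>=1. ALL A B K. (ALL i<m. ALL j<m. \<bar>A i j\<bar> <= int K & \<bar>B i j\<bar> <= int K) -->
     (EX t s. exec P (mm_init m A B) t s &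
        (ALL i<m. ALL j<m. mem s (int (2 * m * m + i * m + j)) = (\<Sum>l<m. A i l * B l j)) &
        real t <= c * real m powr w * log 2 (real (m + K + 2)) ^ k)"
    using assms unfolding mm_in_time_def by blast
  have bound: "real (m * m) <= \<bar>c\<bar> * real m powr w * log 2 (real m + 3) ^ k" if m: "m >= 1" for m
  proof -
    obtain t s where ts: "exec P (mm_init m (%_ _. 1) (%_ _. 1)) t s"
      "ALL i<m. ALL j<m. mem s (int (2 * m * m + i * m + j)) = (\<Sum>l<m. 1 * 1)"
      "real t <= c * real m powr w * log 2 (real (m + 1 + 2)) ^ k"
      using P[rule_format, of m "%_ _. 1" 1 "%_ _. 1"] m by auto
    let ?s0 = "mm_init m (%_ _. 1) (%_ _. 1)"
    have "(%x. int (2 * m * m + x)) ` {..<m * m} \<subseteq> {a. mem s a ~= mem ?s0 a}"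
    proof
      fix a assume "a \<in> (%x. int (2 * m * m + x)) ` {..<m * m}"
      then obtain x where x: "x < m * m" "a = int (2 * m * m + x)" by auto
      have "x div m < m" "x mod m < m" using x m by (auto simp: less_mult_imp_div_less)
      then have "mem s (int (2 * m * m + x div m * m + x mod m)) = (\<Sum>l<m. 1 * 1)" using ts(2) by blast
      moreover have "2 * m * m + x div m * m + x mod m = 2 * m * m + x" by simp
      ultimately have "mem s a = int m" unfolding x by simp
      moreover have "mem ?s0 a = 0" using x by (simp add: mm_init_def del: of_nat_mult of_nat_add)
      ultimately show "a \<in> {a. mem s a ~= mem ?s0 a}" using m by simp
    qed
    then have "card ((%x. int (2 * m * m + x)) ` {..<m * m}) <= t"
      using exec_cells_changed[OF ts(1)] by (meson card_mono le_trans)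
    then have "m * m <= t" by (simp add: card_image inj_on_def)
    then have "real (m * m) <= real t" by (rule of_nat_mono)
    also have "\<dots> <= c * real m powr w * log 2 (real m + 3) ^ k" using ts(3) by (simp add: add.commute)
    also have "\<dots> <= \<bar>c\<bar> * real m powr w * log 2 (real m + 3) ^ k"
      by (intro mult_right_mono) auto
    finally show ?thesis .
  qed
  have "(%m::nat. \<bar>c\<bar> * real m powr w * log 2 (real m + 3) ^ k / (real m ^ 2)) \<longlonglongrightarrow> 0"
    using w by real_asymp
  then have "eventually (%m::nat. \<bar>c\<bar> * real m powr w * log 2 (real m + 3) ^ k / (real m ^ 2) < 1) sequentially"
    by (rule order_tendstoD) simp
  then obtain m where m: "m >= 1" "\<bar>c\<bar> * real m powr w * log 2 (real m + 3) ^ k / (real m ^ 2) < 1"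
    using eventually_happens'[OF _ eventually_conj[OF _ eventually_ge_at_top[of 1]]] by force
  then have "\<bar>c\<bar> * real m powr w * log 2 (real m + 3) ^ k < real m ^ 2"
    by (simp add: divide_simps split: if_splits)
  with bound[OF m(1)] show False by (simp add: power2_eq_square)
qed

lemma mm_in_time_mono:
  assumes "mm_in_time w" "w <= w'" shows "mm_in_time w'"
proof -
  obtain P c k where P: "ALL m>=1. ALL A B K. (ALL i<m. ALL j<m. \<bar>A i j\<bar> <= int K & \<bar>B i j\<bar> <= int K) -->
     (EX t s. exec P (mm_init m A B) t s &
        (ALL i<m. ALL j<m. mem s (int (2 * m * m + i * m + j)) = (\<Sum>l<m. A i l * B l j)) &
        real t <= c * real m powr w * log 2 (real (m + K + 2)) ^ k)"
    using assms unfolding mm_in_time_def by blast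
  have "c * real m powr w * log 2 (real (m + K + 2)) ^ k <= \<bar>c\<bar> * real m powr w' * log 2 (real (m + K + 2)) ^ k"
    if "m >= 1" for m K
    using assms(2) that by (intro mult_right_mono mult_mono powr_mono) auto
  note le = this
  show ?thesis unfolding mm_in_time_def
  proof (rule exI[of _ P], rule exI[of _ "\<bar>c\<bar>"], rule exI[of _ k], intro allI impI)
    fix m :: nat and A B K
    assume "1 <= m" "ALL i<m. ALL j<m. \<bar>A i j\<bar> <= int K & \<bar>B i j\<bar> <= int K"
    then obtain t s where "exec P (mm_init m A B) t s"
      "ALL i<m. ALL j<m. mem s (int (2 * m * m + i * m + j)) = (\<Sum>l<m. A i l * B l j)"
      "real t <= c * real m powr w * log 2 (real (m + K + 2)) ^ k"
      using P by blast
    with le[OF \<open>1 <= m\<close>, of K] show "EX t s. exec P (mm_init m A B) t s &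
        (ALL i<m. ALL j<m. mem s (int (2 * m * m + i * m + j)) = (\<Sum>l<m. A i l * B l j)) &
        real t <= \<bar>c\<bar> * real m powr w' * log 2 (real (m + K + 2)) ^ k"
      by (intro exI[of _ t] exI[of _ s] conjI order_trans[OF _ le[OF \<open>1 <= m\<close>, of K]]) blast+
  qed
qed

text \<open>Register 20 runs through the product in row-major order; 21 and 22 are row and column,
  24 is the scalar product so far.\<close>

definition naive_body :: com where
  "naive_body = Seq (blk [As 21 (ediv (V 20) (V 2)), As 22 (esub (V 20) (emul (V 21) (V 2))), As 24 (N 0)])
    (Seq (For 25 2 (blk [Ld 26 (eadd (emul (V 21) (V 2)) (V 25)),
        Ld 27 (eadd (V 3) (eadd (emul (V 25) (V 2)) (V 22))),
        As 24 (eadd (V 24) (emul (V 26) (V 27)))]))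
      (blk [St (eadd (eadd (V 3) (V 3)) (V 20)) (V 24)]))"

definition naive_mm :: com where
  "naive_mm = Seq (blk [As 2 (V 0), As 3 (emul (V 2) (V 2))]) (For 20 3 naive_body)"

text \<open>Schoolbook multiplication: it makes the set whose infimum is \<open>omega\<close>
  nonempty.\<close>

lemma mm_in_time_3: "mm_in_time 3"
proof -
  have main: "EX t s. exec naive_mm (mm_init m A B) t s &
        (ALL i<m. ALL j<m. mem s (int (2 * m * m + i * m + j)) = (\<Sum>l<m. A i l * B l j)) &
        real t <= 2000000 * real m powr 3 * log 2 (real (m + K + 2)) ^ 1"
    if m: "m >= 1" and AB: "ALL i<m. ALL j<m. \<bar>A i j\<bar> <= int K & \<bar>B i j\<bar> <= int K" for m A B K
  proof -
    define X where "X = int m + int K + 2"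
    \<comment> \<open>Partial scalar products are at most \<open>m * K ^ 2 <= X ^ 3\<close>, and
      addresses are of order \<open>m ^ 2\<close>.\<close>
    define U where "U = 2 ^ 7 * X ^ 3"
    obtain \<beta> where b: "mbound U \<beta>" "real (2 * \<beta> + 1) <= real (128 * 7 + 256 * 3 + 3) * log 2 (real (m + K + 2))"
      using mbound_powers[of "m + K + 2" 7 3] unfolding U_def X_def by (auto simp: add.commute)
    interpret mbound U \<beta> by (rule b(1))
    define s0 where "s0 = mm_init m A B"
    have X: "X >= 3" "int m <= X" "int K <= X" using m by (auto simp: X_def)
    have UX: "3 * X ^ 3 <= U" using X by (simp add: U_def)
    have X13: "X <= X ^ 3" "X * X <= X ^ 3" using X by (auto simp: power3_eq_cube mult_le_cancel_left1 mult_le_cancel_right1 intro!: one_le_mult_iff[THEN iffD2] order_trans[OF _ mult_mono[of 1 X 1 X]])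
    have XU: "X <= U" "X * X <= U" using UX X13 X by linarith+
    let ?L = "%i l. A i l" and ?mm = "m * m"
    have memA: "mem s0 (int (i * m + l)) = A i l" if "i < m" "l < m" for i l
    proof -
      have "i * m + l < Suc i * m" using that by simp
      also have "\<dots> <= m * m" using that by (intro mult_le_mono1) auto
      finally show ?thesis using that by (simp add: s0_def mm_init_def del: of_nat_mult of_nat_add)
    qed
    have memB: "mem s0 (int (m * m + (l * m + j))) = B l j" if "l < m" "j < m" for l j
    proof -
      have "l * m + j < Suc l * m" using that by simp
      also have "\<dots> <= m * m" using that by (intro mult_le_mono1) auto
      finally have *: "l * m + j < m * m" .
      then have "int (m * m + (l * m + j)) < int (2 * m * m)" by (simp flip: of_nat_mult of_nat_add)
      moreover have "nat (int (m * m + (l * m + j))) - m * m = l * m + j" by (simp only: nat_int diff_add_inverse)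
      ultimately show ?thesis using that * by (simp add: s0_def mm_init_def del: of_nat_mult of_nat_add)
    qed
    define I where "I = (%e (s :: state). regs s 2 = int m & regs s 3 = int ?mm &
       (ALL x. x < int (2 * m * m) --> mem s x = mem s0 x) &
       (ALL x<e. mem s (int (2 * m * m + x)) = (\<Sum>l<m. A (x div m) l * B l (x mod m))))"
    have body: "run w naive_body (m * 200 + 200) s' (%s''. good s'' & regs s'' 20 = int e & regs s'' 3 = int ?mm &
        I (Suc e) (s''(|regs := (regs s'')(20 := int (Suc e))|)))"
      if e: "e < ?mm" and g: "good s'" and I: "I e s'" and r20: "regs s' 20 = int e" for e s'
    proof -
      define i j where "i = e div m" and "j = e mod m"
      have ij: "i < m" "j < m" "e = i * m + j" using e m by (auto simp: i_def j_def less_mult_imp_div_less)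
      define s1 where "s1 = exb [As 21 (ediv (V 20) (V 2)), As 22 (esub (V 20) (emul (V 21) (V 2))), As 24 (N 0)] s'"
      have ji: "int e - int i * int m = int j" using ij(3) by simp
      have ei: "int e div int m = int i" by (simp add: i_def of_nat_div)
      have iU: "int i <= U" "int j <= U" using ij XU X by linarith+
      have s1: "regs s1 2 = int m" "regs s1 3 = int ?mm" "regs s1 20 = int e" "regs s1 21 = int i"
        "regs s1 22 = int j" "regs s1 24 = 0" "mem s1 = mem s'"
        using I r20 ei ji by (simp_all add: s1_def I_def)
      let ?S = "%l. \<Sum>l'<l. A i l' * B l' j"
      define J where "J = (%l (s :: state). regs s 2 = int m & regs s 3 = int ?mm & regs s 20 = int e & regs s 21 = int i &
         regs s 22 = int j & regs s 24 = ?S l & mem s = mem s')"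
      have S: "\<bar>?S l\<bar> <= U" if "l <= m" for l
      proof -
        have "\<bar>?S l\<bar> <= (\<Sum>l'<l. \<bar>A i l' * B l' j\<bar>)" by (rule sum_abs)
        also have "\<dots> <= (\<Sum>l'<l. int K * int K)" using AB ij that
          by (intro sum_mono) (auto simp: abs_mult intro!: mult_mono)
        also have "\<dots> = int l * (int K * int K)" by simp
        also have "\<dots> <= X * (X * X)" using that X by (intro mult_mono) auto
        also have "\<dots> = X ^ 3" by (simp add: power3_eq_cube)
        also have "\<dots> <= U" using UX X13 X by linarith
        finally show ?thesis .
      qed
      have KU: "int K <= U" using X XU by linarith
      let ?b2 = "[Ld 26 (eadd (emul (V 21) (V 2)) (V 25)),
        Ld 27 (eadd (V 3) (eadd (emul (V 25) (V 2)) (V 22))),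
        As 24 (eadd (V 24) (emul (V 26) (V 27)))]"
      have inner: "run w (blk ?b2) (bsz ?b2) s2 (%s''. good s'' & regs s'' 25 = int l & regs s'' 2 = int m &
          J (Suc l) (s''(|regs := (regs s'')(25 := int (Suc l))|)))"
        if l: "l < m" and g2: "good s2" and J: "J l s2" and r25: "regs s2 25 = int l" for l s2
      proof (rule run_blk)
        have lt: "int (i * m + l) < int (2 * m * m)" "int (m * m + (l * m + j)) < int (2 * m * m)"
        proof -
          have "i * m + l < Suc i * m" using l by simp
          also have "\<dots> <= m * m" using ij by (intro mult_le_mono1) auto
          finally show "int (i * m + l) < int (2 * m * m)" by (simp flip: of_nat_mult of_nat_add)
          have "l * m + j < Suc l * m" using ij by simp
          also have "\<dots> <= m * m" using l by (intro mult_le_mono1) auto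
          finally show "int (m * m + (l * m + j)) < int (2 * m * m)" by (simp flip: of_nat_mult of_nat_add)
        qed
        have m1: "mem s' (int i * int m + int l) = A i l"
          using I lt memA[OF ij(1) l] by (simp add: I_def)
        have m2: "mem s' (int m * int m + (int l * int m + int j)) = B l j"
          using I lt memB[OF l ij(2)] by (simp add: I_def)
        have ab: "\<bar>A i l\<bar> <= U" "\<bar>B l j\<bar> <= U" using AB l ij KU by (meson order_trans)+
        show "\<forall>i\<in>set ?b2. ok_ins i" by (simp add: ok_exp_def)
        show "good s2" by (rule g2)
        show "bnb ?b2 s2" using J m1 m2 ab r25 S[of "Suc l"] l by (simp add: J_def)
        assume g: "good (exb ?b2 s2)"
        show "good (exb ?b2 s2) & regs (exb ?b2 s2) 25 = int l & regs (exb ?b2 s2) 2 = int m &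
          J (Suc l) ((exb ?b2 s2)(|regs := (regs (exb ?b2 s2))(25 := int (Suc l))|))"
          using g J m1 m2 r25 by (simp add: J_def)
      qed
      let ?b3 = "[St (eadd (eadd (V 3) (V 3)) (V 20)) (V 24)]"
      have "run w naive_body (bsz [As 21 (ediv (V 20) (V 2)), As 22 (esub (V 20) (emul (V 21) (V 2))), As 24 (N 0)] +
          ((m * (bsz ?b2 + 20) + 20) + bsz ?b3)) s' (%s''. good s'' & regs s'' 20 = int e & regs s'' 3 = int ?mm &
        I (Suc e) (s''(|regs := (regs s'')(20 := int (Suc e))|)))"
        unfolding naive_body_def
      proof (rule run_blkS, fold s1_def)
        show "good s'" by (rule g)
        show "\<forall>i\<in>set [As 21 (ediv (V 20) (V 2)), As 22 (esub (V 20) (emul (V 21) (V 2))), As 24 (N 0)]. ok_ins i"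
          by (simp add: ok_exp_def)
        show "bnb [As 21 (ediv (V 20) (V 2)), As 22 (esub (V 20) (emul (V 21) (V 2))), As 24 (N 0)] s'"
          using I r20 iU ei ji U100 by (simp add: I_def)
        assume g1: "good s1"
        show "run w (Seq (For 25 2 (blk ?b2)) (blk ?b3)) ((m * (bsz ?b2 + 20) + 20) + bsz ?b3) s1
          (%s''. good s'' & regs s'' 20 = int e & regs s'' 3 = int ?mm &
             I (Suc e) (s''(|regs := (regs s'')(20 := int (Suc e))|)))"
        proof (rule run_Seq, rule run_mono[OF run_For[where I = J and n = m]])
          show "J 0 (s1(|regs := (regs s1)(25 := 0)|))" using s1 by (simp add: J_def)
          fix s3 assume *: "good s3 & regs s3 25 = int m & regs s3 2 = int m & J m s3"
          show "run w (blk ?b3) (bsz ?b3) s3 (%s''. good s'' & regs s'' 20 = int e & regs s'' 3 = int ?mm &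
             I (Suc e) (s''(|regs := (regs s'')(20 := int (Suc e))|)))"
          proof (rule run_blk)
            assume g3: "good (exb ?b3 s3)"
            have "e div m = i" "e mod m = j" by (simp_all add: i_def j_def)
            then show "good (exb ?b3 s3) & regs (exb ?b3 s3) 20 = int e & regs (exb ?b3 s3) 3 = int ?mm &
             I (Suc e) ((exb ?b3 s3)(|regs := (regs (exb ?b3 s3))(20 := int (Suc e))|))"
              using * g3 I by (auto simp: J_def I_def less_Suc_eq)
          qed (use * in \<open>auto simp: ok_exp_def\<close>)
        qed (use g1 s1 inner in auto)
      qed
      then show ?thesis by (rule run_mono) auto
    qed
    have "run w naive_mm (bsz [As 2 (V 0), As 3 (emul (V 2) (V 2))] + (?mm * ((m * 200 + 200) + 20) + 20)) s0
        (%s'. good s' & regs s' 20 = int ?mm & regs s' 3 = int ?mm & I ?mm s')"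
      unfolding naive_mm_def
    proof (rule run_blkS)
      show "good s0" using X XU by (auto simp: good_def s0_def mm_init_def)
      show "bnb [As 2 (V 0), As 3 (emul (V 2) (V 2))] s0"
        using X XU mult_mono[of "int m" X "int m" X] by (auto simp: s0_def mm_init_def)
      assume g: "good (exb [As 2 (V 0), As 3 (emul (V 2) (V 2))] s0)"
      show "run w (For 20 3 naive_body) (?mm * ((m * 200 + 200) + 20) + 20) (exb [As 2 (V 0), As 3 (emul (V 2) (V 2))] s0)
         (%s'. good s' & regs s' 20 = int ?mm & regs s' 3 = int ?mm & I ?mm s')"
        by (rule run_For) (use g body in \<open>auto simp: I_def s0_def mm_init_def\<close>)
    qed (auto simp: ok_exp_def)
    then obtain t s where ts: "exec naive_mm s0 t s" "I ?mm s"
        "t <= (bsz [As 2 (V 0), As 3 (emul (V 2) (V 2))] + (?mm * ((m * 200 + 200) + 20) + 20)) * w"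
      unfolding run_def by blast
    have res: "mem s (int (2 * m * m + i * m + j)) = (\<Sum>l<m. A i l * B l j)" if "i < m" "j < m" for i j
    proof -
      have "i * m + j < Suc i * m" using that by simp
      also have "\<dots> <= m * m" using that by (intro mult_le_mono1) auto
      finally have "mem s (int (2 * m * m + (i * m + j))) = (\<Sum>l<m. A ((i * m + j) div m) l * B l ((i * m + j) mod m))"
        using ts(2) unfolding I_def by blast
      then show ?thesis using that by (simp add: add.assoc)
    qed
    have "t <= (500 * (m * m * m)) * w"
    proof (rule order_trans[OF ts(3) mult_le_mono1])
      have 1: "m * m <= m * m * m" "1 <= m * m * m" using m by auto
      have "m * m * (m * 200 + 200 + 20) = 200 * (m * m * m) + 220 * (m * m)" by (simp add: algebra_simps)
      moreover have "bsz [As 2 (V 0), As 3 (emul (V 2) (V 2))] <= 20" by simp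
      ultimately show "bsz [As 2 (V 0), As 3 (emul (V 2) (V 2))] + (m * m * (m * 200 + 200 + 20) + 20) <= 500 * (m * m * m)"
        using 1 by linarith
    qed
    then have "real t <= real (500 * (m * m * m) * w)" by (rule of_nat_mono)
    also have "\<dots> = 500 * real m ^ 3 * real w" by (simp add: power3_eq_cube)
    also have "\<dots> <= 500 * real m ^ 3 * (1667 * log 2 (real (m + K + 2)))"
      using b(2) by (intro mult_left_mono) (auto simp: w_def)
    also have "\<dots> <= 2000000 * real m powr 3 * log 2 (real (m + K + 2)) ^ 1"
      using m by (simp add: powr_numeral)
    finally show ?thesis using ts(1) res unfolding s0_def by blast
  qed
  show ?thesis unfolding mm_in_time_def
    by (rule exI[of _ naive_mm], rule exI[of _ 2000000], rule exI[of _ 1], intro allI impI, rule main)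
qed

text \<open>The infimum need not be attained, but some exponent below
  \<open>omega + \<epsilon>\<close> is achieved, and achieved exponents are closed upwards. A real
  infimum says this only because the set is nonempty and bounded below.\<close>

lemma mm_in_time_above_omega:
  assumes "\<epsilon> > 0" shows "mm_in_time (omega + \<epsilon>)"
proof -
  have "Inf {w. mm_in_time w} < omega + \<epsilon>" using assms by (simp add: omega_def)
  moreover have "bdd_below {w. mm_in_time w}" using mm_in_time_ge_2 by (intro bdd_belowI[of _ 2]) auto
  ultimately obtain w where "mm_in_time w" "w < omega + \<epsilon>"
    using mm_in_time_3 cInf_less_iff[of "{w. mm_in_time w}" "omega + \<epsilon>"] by auto
  then show ?thesis using mm_in_time_mono[of w "omega + \<epsilon>"] by simp
qed

section \<open>Running a program with a clock in a virtual memory\<close>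

lemma len_mono: "\<bar>a\<bar> <= \<bar>b\<bar> ==> len a <= len b"
  using len_le_iff[of a "len b"] len_le_iff[of b "len b"] by simp

lemma abs_less_len: "\<bar>a\<bar> < 2 ^ len a"
  using len_le_iff[of a "len a"] by simp

lemma len_mult: "len (a * b) <= len a + len b"
proof -
  have "\<bar>a * b\<bar> < 2 ^ len a * 2 ^ len b"
    unfolding abs_mult using abs_less_len by (intro mult_strict_mono') auto
  then show ?thesis by (simp add: len_le_iff power_add)
qed

lemma len_add: "len (a + b) <= len a + len b + 1"
proof -
  have "(2::int) ^ len a <= 2 ^ (len a + len b)" "(2::int) ^ len b <= 2 ^ (len a + len b)"
    by (intro power_increasing; simp)+
  then have "\<bar>a + b\<bar> < 2 * 2 ^ (len a + len b)"
    using abs_less_len[of a] abs_less_len[of b] by linarith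
  then have "\<bar>a + b\<bar> < 2 ^ (len a + len b + 1)" by simp
  then show ?thesis by (simp add: len_le_iff)
qed

lemma len_minus: "len (- a) = len a"
  by (simp add: len_def)

lemma len_diff: "len (a - b) <= len a + len b + 1"
  using len_add[of a "- b"] by (simp add: len_minus)

lemma len_div: "len (a div b) <= len a"
  by (intro len_mono abs_div_le)

lemma len_binop: "len (binop_val f a b) <= len a + len b + 1"
  using len_add[of a b] len_diff[of a b] len_mult[of a b] len_div[of a b] by (cases f) auto

lemma len_int_le: "len (int m) <= m"
proof -
  have "int m < int (2 ^ m)" by (simp only: of_nat_less_iff less_exp)
  then show ?thesis by (simp add: len_le_iff)
qed

lemma len_1: "len 1 <= 1" "len 2 <= 2"
  by (simp_all add: len_le_iff)

text \<open>The amount charged for an operand: \<open>1 + 2 + ... + 2 ^ j\<close> for the least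
  \<open>j\<close> with \<open>v ^ 2 <= 2 ^ (2 ^ j)\<close>. It lies between \<open>len v\<close>
  and \<open>8 * len v + 1\<close>, and can be found by repeated squaring without knowing the bit
  length. Squaring \<open>v\<close> disposes of its sign.\<close>

definition chv :: "int => nat" where
  "chv v = 2 ^ Suc (LEAST j. v * v <= 2 ^ (2 ^ j)) - 1"

definition chj :: "int => nat" where
  "chj v = (LEAST j. v * v <= 2 ^ (2 ^ j))"

lemma chv_chj: "chv v = 2 ^ Suc (chj v) - 1"
  by (simp add: chv_def chj_def)

lemma chj_le: "v * v <= 2 ^ (2 ^ chj v)"
proof -
  have "v * v <= 2 ^ (2 ^ len (v * v))"
  proof -
    have "\<bar>v * v\<bar> < 2 ^ len (v * v)" by (rule abs_less_len)
    also have "(2::int) ^ len (v * v) <= 2 ^ (2 ^ len (v * v))"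
      by (intro power_increasing less_imp_le[OF less_exp]) auto
    finally show ?thesis by simp
  qed
  then show ?thesis unfolding chj_def by (rule LeastI)
qed

lemma chj_less: "j < chj v ==> 2 ^ (2 ^ j) < v * v"
  unfolding chj_def using not_less_Least[of j] by (meson not_le)

lemma chj_pow: "2 ^ chj v <= 4 * len v + 1"
proof (cases "chj v")
  case (Suc j)
  have "(2::int) ^ (2 ^ j) < v * v" using chj_less[of j v] Suc by simp
  also have "\<dots> = \<bar>v * v\<bar>" by simp
  also have "\<dots> < 2 ^ (len v + len v)"
    unfolding abs_mult power_add using abs_less_len by (intro mult_strict_mono') auto
  finally have "(2::nat) ^ j < len v + len v"
    by (subst (asm) power_strict_increasing_iff) auto
  then show ?thesis using Suc by simp
qed simp

lemma len_le_chj: "len v <= 2 ^ chj v"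
proof (rule ccontr)
  assume "\<not> ?thesis"
  then have "(2::int) ^ (2 ^ chj v) <= \<bar>v\<bar>" by (simp add: len_le_iff not_less)
  then have "2 ^ (2 ^ chj v) * (2::int) ^ (2 ^ chj v) <= \<bar>v\<bar> * \<bar>v\<bar>" by (intro mult_mono) auto
  also have "\<dots> <= 2 ^ (2 ^ chj v) * 1" using chj_le[of v] by simp
  finally have "(2::int) ^ (2 ^ chj v) <= 1" by (subst (asm) mult_le_cancel_left_pos) auto
  moreover have "(2::int) ^ 1 <= 2 ^ (2 ^ chj v)" by (intro power_increasing) auto
  ultimately show False by simp
qed

lemma chv_ge: "len v <= chv v" "1 <= chv v"
proof -
  have "(1::nat) <= 2 ^ chj v" by simp
  then have *: "2 ^ chj v <= chv v" unfolding chv_chj power_Suc by linarith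
  show "len v <= chv v" using * len_le_chj[of v] by (rule order_trans[rotated])
  show "1 <= chv v" using * \<open>1 <= 2 ^ chj v\<close> by linarith
qed

lemma chv_le: "chv v <= 8 * len v + 1"
  using chj_pow[of v] unfolding chv_chj power_Suc by linarith

definition ptick :: com where
  "ptick = Seq (Const 100 1) (Seq (Op Sub 10 10 100) (Const 100 0))"

text \<open>After \<open>j\<close> rounds register 101 holds \<open>2 ^ (2 ^ j)\<close>, register
  102 holds \<open>2 ^ j\<close>, and \<open>2 ^ j - 1\<close> has been taken off the clock;
  register 103 tests whether \<open>v ^ 2\<close> is still larger.\<close>

definition chg_loop :: com where
  "chg_loop = WhilePos 103 (Seq (Op Mul 101 101 101) (Seq (Op Sub 10 10 102)
     (Seq (Op Add 102 102 102) (Op Sub 103 100 101))))"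

definition chg :: "nat => com" where
  "chg x = Seq (Op Mul 100 x x) (Seq (Const 101 2) (Seq (Const 102 1) (Seq (Op Sub 103 100 101)
     (Seq chg_loop (Seq (Op Sub 10 10 102)
       (Seq (Const 100 0) (Seq (Const 101 0) (Seq (Const 102 0) (Const 103 0)))))))))"

lemma run_to_1: "run w c k s Q ==> k * w <= l ==> run 1 c l s Q"
  unfolding run_def by (metis le_trans mult.right_neutral)

lemma run_then:
  assumes "run w c k s (%s'. s' = s1)" "run w d l s1 Q"
  shows "run w c k s (%s'. run w d l s' Q)"
  using assms(1) by (rule run_mono[OF _ order_refl]) (simp add: assms(2))

text \<open>There are fewer than \<open>b\<close> rounds because
  \<open>2 ^ J <= 4 * len v + 1 < 2 ^ b\<close>, and the numbers involved have
  \<open>O(len v + b)\<close> bits. So charging takes only a factor polynomial in \<open>b\<close>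
  more time than the amount it charges.\<close>

lemma run_chg:
  assumes x: "x >= 1000" and z: "\<forall>r\<in>{100..103}. regs s r = 0"
    and b: "\<bar>regs s 10\<bar> + int (chv (regs s x)) < 2 ^ b" "int (4 * len (regs s x) + 1) < 2 ^ b"
    and Q: "Q (s(|regs := (regs s)(10 := regs s 10 - int (chv (regs s x)))|))"
  shows "run 1 (chg x) ((5 * b + 12) * (2 * b + 17) * chv (regs s x)) s Q"
proof -
  define v where "v = regs s x"
  define l where "l = len v"
  define J where "J = chj v"
  define w where "w = 8 * l + 2 * b + 9"
  define c0 where "c0 = regs s 10"
  define S where "S = (%j. s(|regs := (regs s)(100 := v * v, 101 := 2 ^ (2 ^ j), 102 := 2 ^ j,
     103 := v * v - 2 ^ (2 ^ j), 10 := c0 - (2 ^ j - 1))|))"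
  have J2: "2 ^ J <= 4 * l + 1" using chj_pow[of v] by (simp add: J_def l_def)
  then have "int (2 ^ J) < 2 ^ b" using b(2) unfolding v_def[symmetric] l_def[symmetric] by linarith
  then have "(2::int) ^ J < 2 ^ b" by simp
  then have Jb: "J < b" by (subst (asm) power_strict_increasing_iff) auto
  have lens: "len (2 ^ (2 ^ j)) <= 4 * l + 2" "len (2 ^ j) <= b" "len (c0 - (2 ^ j - 1)) <= b"
    "len (v * v - 2 ^ (2 ^ j)) <= 4 * l + 2" if "j <= J" for j
  proof -
    have 1: "(2::nat) ^ j <= 4 * l + 1" using that J2 power_increasing[of j J "2::nat"] by linarith
    have 2: "\<bar>(2::int) ^ (2 ^ j)\<bar> < 2 ^ (4 * l + 2)" unfolding power_abs abs_numeral
      using 1 by (intro power_strict_increasing) linarith+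
    then show "len (2 ^ (2 ^ j)) <= 4 * l + 2" by (simp only: len_le_iff)
    have 3: "(2::int) ^ j <= 2 ^ J" "(1::int) <= 2 ^ j" using that by (auto intro: power_increasing)
    then show "len (2 ^ j) <= b" using \<open>(2::int) ^ J < 2 ^ b\<close> by (simp add: len_le_iff)
    have "int (chv v) = 2 * 2 ^ J - 1" unfolding chv_chj J_def by (simp add: of_nat_diff)
    then have "\<bar>c0 - (2 ^ j - 1)\<bar> < 2 ^ b" using b(1) 3 unfolding v_def[symmetric] c0_def[symmetric] by linarith
    then show "len (c0 - (2 ^ j - 1)) <= b" by (simp add: len_le_iff)
    have "\<bar>v * v\<bar> < 2 ^ (l + l)"
      unfolding abs_mult power_add l_def using abs_less_len by (intro mult_strict_mono') auto
    also have "(2::int) ^ (l + l) <= 2 ^ (4 * l + 2)" by (intro power_increasing) auto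
    finally have "\<bar>v * v\<bar> < 2 ^ (4 * l + 2)" .
    then have "\<bar>v * v - 2 ^ (2 ^ j)\<bar> < 2 ^ (4 * l + 2)"
      using 2 by (smt (verit) zero_le_power zero_le_square)
    then show "len (v * v - 2 ^ (2 ^ j)) <= 4 * l + 2" by (simp only: len_le_iff)
  qed
  have lvv: "len (v * v) <= 2 * l" using len_mult[of v v] by (simp add: l_def)
  have loop: "run w chg_loop (5 * (J - j) + 1) (S j) (%s'. s' = S J)" if "j <= J" for j
    using that
  proof (induction "J - j" arbitrary: j)
    case 0
    then have "j = J" by simp
    have "v * v - 2 ^ (2 ^ J) <= 0" using chj_le[of v] by (simp add: J_def)
    then show ?case using lens[of J] unfolding \<open>j = J\<close> chg_loop_def
      by (intro run_mono[OF run_WhilePos_unfold[where k = 0 and l = 0 and Q = "%s'. s' = S J"]])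
         (auto simp: S_def w_def)
  next
    case (Suc d)
    then have j: "j < J" "d = J - Suc j" by auto
    have pos: "v * v - 2 ^ (2 ^ j) > 0" using chj_less[of j v] j by (simp add: J_def)
    have e: "(2::int) ^ (2 ^ j) * 2 ^ (2 ^ j) = 2 ^ (2 ^ Suc j)" by (simp flip: power_add add: mult_2)
    have "run w chg_loop (Suc ((1 + (1 + (1 + 1))) + (5 * d + 1))) (S j) (%s'. s' = S J)"
      unfolding chg_loop_def
    proof (intro run_WhilePos_unfold, goal_cases)
      case 1
      then show ?case using lens[of j] j by (simp add: S_def w_def)
    next
      case 2
      let ?s1 = "S j(|regs := (regs (S j))(101 := 2 ^ (2 ^ Suc j))|)"
      let ?s2 = "?s1(|regs := (regs ?s1)(10 := c0 - (2 ^ Suc j - 1))|)"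
      let ?s3 = "?s2(|regs := (regs ?s2)(102 := 2 ^ Suc j)|)"
      have s4: "?s3(|regs := (regs ?s3)(103 := v * v - 2 ^ (2 ^ Suc j))|) = S (Suc j)"
        by (simp add: S_def fun_upd_twist)
      have a: "run w (Op Sub 103 100 101) 1 ?s3 (%s'. s' = S (Suc j))"
        using lens[of "Suc j"] j lvv s4 by (intro run_Op) (simp_all add: S_def w_def)
      have b: "run w (Op Add 102 102 102) 1 ?s2 (%s'. s' = ?s3)"
        using lens[of j] j by (intro run_Op) (simp_all add: S_def w_def)
      have c: "run w (Op Sub 10 10 102) 1 ?s1 (%s'. s' = ?s2)"
        using lens[of j] j by (intro run_Op) (simp_all add: S_def w_def diff_diff_eq2)
      have d: "run w (Op Mul 101 101 101) 1 (S j) (%s'. s' = ?s1)"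
        using lens[of j] j e by (intro run_Op) (simp_all add: S_def w_def)
      have rec: "run w chg_loop (5 * d + 1) (S (Suc j)) (%s'. s' = S J)"
        using Suc.hyps(1)[of "Suc j"] j by simp
      show ?case
        by (intro run_Seq run_then[OF d] run_then[OF c] run_then[OF b] run_then[OF a] rec[unfolded chg_loop_def])
    next
      case 3
      then show ?case using pos by (simp add: S_def)
    qed
    moreover have "Suc ((1 + (1 + (1 + 1))) + (5 * d + 1)) = 5 * (J - j) + 1" using j by simp
    ultimately show ?case by (simp only:)
  qed
  let ?t1 = "s(|regs := (regs s)(100 := v * v)|)"
  let ?t2 = "?t1(|regs := (regs ?t1)(101 := 2)|)"
  let ?t3 = "?t2(|regs := (regs ?t2)(102 := 1)|)"
  have S0: "?t3(|regs := (regs ?t3)(103 := v * v - 2)|) = S 0"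
    by (simp add: S_def c0_def fun_eq_iff)
  have 4: "run w (Op Sub 103 100 101) 1 ?t3 (%s'. s' = S 0)"
    using S0 lvv len_1 by (intro run_Op) (simp_all add: w_def)
  have 3: "run w (Const 102 1) 1 ?t2 (%s'. s' = ?t3)"
    using len_1 by (intro run_Const) (simp_all add: w_def)
  have 2: "run w (Const 101 2) 1 ?t1 (%s'. s' = ?t2)"
    using len_1 by (intro run_Const) (simp_all add: w_def)
  have 1: "run w (Op Mul 100 x x) 1 s (%s'. s' = ?t1)"
    by (intro run_Op) (simp_all add: w_def v_def[symmetric] l_def[symmetric])
  let ?u1 = "S J(|regs := (regs (S J))(10 := c0 - int (chv v))|)"
  have ch: "int (chv v) = 2 ^ J + (2 ^ J - 1)"
    unfolding chv_chj J_def by (simp add: of_nat_diff)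
  have 5: "run w (Op Sub 10 10 102) 1 (S J) (%s'. s' = ?u1)"
    using lens[of J] ch by (intro run_Op) (simp_all add: S_def w_def diff_diff_eq2)
  let ?u2 = "?u1(|regs := (regs ?u1)(100 := 0)|)"
  let ?u3 = "?u2(|regs := (regs ?u2)(101 := 0)|)"
  let ?u4 = "?u3(|regs := (regs ?u3)(102 := 0)|)"
  let ?u5 = "?u4(|regs := (regs ?u4)(103 := 0)|)"
  have 6: "run w (Const 100 0) 1 ?u1 (%s'. s' = ?u2)" "run w (Const 101 0) 1 ?u2 (%s'. s' = ?u3)"
     "run w (Const 102 0) 1 ?u3 (%s'. s' = ?u4)"
    by (intro run_Const; simp add: w_def len0)+
  have "?u5 = s(|regs := (regs s)(10 := regs s 10 - int (chv (regs s x)))|)"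
    using z by (auto simp: S_def c0_def v_def fun_eq_iff)
  then have 7: "run w (Const 103 0) 1 ?u4 Q" using Q by (intro run_Const) (simp_all add: w_def len0)
  have "run w (chg x) (1 + (1 + (1 + (1 + ((5 * (J - 0) + 1) + (1 + (1 + (1 + (1 + 1))))))))) s Q"
    unfolding chg_def
    by (intro run_Seq run_then[OF 1] run_then[OF 2] run_then[OF 3] run_then[OF 4] run_then[OF loop] run_then[OF 5] run_then[OF 6(1)] run_then[OF 6(2)] run_then[OF 6(3)] 7) simp
  then show ?thesis
  proof (rule run_to_1)
    have "l <= chv v" "1 <= chv v" using chv_ge[of v] by (auto simp: l_def)
    then have "8 * l <= 8 * chv v" "(2 * b + 9) * 1 <= (2 * b + 9) * chv v" by (auto simp del: mult_1_right)
    then have "w <= (2 * b + 17) * chv v" unfolding w_def by (simp add: algebra_simps)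
    moreover have "1 + (1 + (1 + (1 + ((5 * (J - 0) + 1) + (1 + (1 + (1 + (1 + 1)))))))) <= 5 * b + 12" using Jb by simp
    ultimately show "(1 + (1 + (1 + (1 + ((5 * (J - 0) + 1) + (1 + (1 + (1 + (1 + 1))))))))) * w
       <= (5 * b + 12) * (2 * b + 17) * chv (regs s x)"
      unfolding v_def[symmetric] mult.assoc[of "5 * b + 12"] by (intro mult_le_mono)
  qed
qed

text \<open>Interleaved memories, numbered by \<open>t\<close>, whose addresses \<open>k\<close>
  range over all integers. For \<open>1 <= t < 16\<close> they avoid the addresses from 0 to
  \<open>n\<close>, where the input array stands.\<close>

definition cell :: "int => int => int => int" where
  "cell n k t = (n + 16) * k + n + t"

lemma cell_eq_iff:
  assumes "n >= 0" "0 <= t" "t < 16" "0 <= t'" "t' < 16"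
  shows "cell n k t = cell n k' t' \<longleftrightarrow> k = k' & t = t'"
proof
  assume eq: "cell n k t = cell n k' t'"
  have *: "cell n k t div (n + 16) = k" if "0 <= t" "t < 16" for k t
  proof -
    have "cell n k t = (n + t) + k * (n + 16)" by (simp add: cell_def algebra_simps)
    also have "\<dots> div (n + 16) = k + (n + t) div (n + 16)" using assms(1) by (intro div_mult_self1) simp
    also have "(n + t) div (n + 16) = 0" using that assms(1) by simp
    finally show ?thesis by simp
  qed
  have "k = k'" using *[of t k] *[of t' k'] eq assms by simp
  then show "k = k' & t = t'" using eq by (simp add: cell_def)
qed simp

definition guard :: "com => com" where
  "guard c = IfPos 10 c Skip"

definition saddr :: "nat => com" where
  "saddr x = Seq (Const 100 16) (Seq (Op Add 100 2 100) (Seq (Op Mul 100 x 100)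
     (Seq (Op Add 100 100 2) (Seq (Const 101 2) (Op Add 100 100 101)))))"

text \<open>A loop can test only one register, so the conjunction of its own condition and of a
  positive clock is put into register 99.\<close>

definition setw :: "nat => com" where
  "setw x = Seq (Const 99 0) (IfPos 10 (IfPos x (Const 99 1) Skip) Skip)"

text \<open>Register \<open>r\<close> of the sandboxed program lives in register \<open>r + 1000\<close>, its cell \<open>a\<close> in
  \<open>cell n a 1\<close>, and is valid only if \<open>cell n a 2\<close> holds the current generation (register 11).
  Register 10 is the clock; nothing happens any more once it is not positive.\<close>

fun sb :: "com => com" where
  "sb Skip = guard ptick"
| "sb (Const r c) = guard (Seq (Const 100 (1 + int (len c))) (Seq (Op Sub 10 10 100)
     (Seq (Const 100 0) (Const (r + 1000) c))))"
| "sb (Op f r x y) = guard (Seq ptick (Seq (chg (x + 1000)) (Seq (chg (y + 1000))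
     (Op f (r + 1000) (x + 1000) (y + 1000)))))"
| "sb (Load r x) = guard (Seq (chg (x + 1000)) (Seq (saddr (x + 1000)) (Seq (Load 101 100)
     (Seq (Op Sub 101 11 101) (Seq (IfPos 101 (Const (r + 1000) 0)
        (Seq (Const 101 1) (Seq (Op Sub 100 100 101) (Load (r + 1000) 100))))
     (Seq (Const 100 0) (Seq (Const 101 0) (chg (r + 1000)))))))))"
| "sb (Store x y) = guard (Seq (chg (x + 1000)) (Seq (chg (y + 1000)) (Seq (saddr (x + 1000))
     (Seq (Store 100 11) (Seq (Const 101 1) (Seq (Op Sub 100 100 101) (Seq (Store 100 (y + 1000))
     (Seq (Const 100 0) (Const 101 0)))))))))"
| "sb (Seq c d) = Seq (sb c) (sb d)"
| "sb (IfPos x c d) = guard (Seq ptick (Seq (chg (x + 1000)) (IfPos (x + 1000) (sb c) (sb d))))"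
| "sb (WhilePos x c) = Seq (setw (x + 1000)) (Seq (WhilePos 99 (Seq ptick (Seq (chg (x + 1000))
     (Seq (sb c) (setw (x + 1000)))))) (guard (Seq ptick (chg (x + 1000)))))"

text \<open>Weight of the code that has to be skipped once the clock has expired. At a loop the
  factor 2 pays both for the rest of an interrupted body and for passing the loop itself.\<close>

fun csz :: "com => nat" where
  "csz (Seq c d) = csz c + csz d"
| "csz (IfPos x c d) = csz c + csz d + 1"
| "csz (WhilePos x c) = 2 * csz c + 2"
| "csz _ = 1"

fun cregs :: "com => nat" where
  "cregs Skip = 0"
| "cregs (Const r c) = Suc r"
| "cregs (Op f r x y) = Suc (max r (max x y))"
| "cregs (Load r x) = Suc (max r x)"
| "cregs (Store x y) = Suc (max x y)"
| "cregs (Seq c d) = max (cregs c) (cregs d)"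
| "cregs (IfPos x c d) = max (Suc x) (max (cregs c) (cregs d))"
| "cregs (WhilePos x c) = max (Suc x) (cregs c)"

fun cmax :: "com => nat" where
  "cmax (Const r c) = len c"
| "cmax (Seq c d) = max (cmax c) (cmax d)"
| "cmax (IfPos x c d) = max (cmax c) (cmax d)"
| "cmax (WhilePos x c) = cmax c"
| "cmax _ = 0"

lemma run1_guard:
  assumes "regs s 10 > 0" "len (regs s 10) <= b" "run 1 c k s Q"
  shows "run 1 (guard c) (b + 1 + k) s Q"
proof -
  obtain t s' where "exec c s t s'" "t <= k" "Q s'" using assms(3) unfolding run_def by auto
  then show ?thesis using exec.IfTrue[OF assms(1), of c t s' Skip] assms(2)
    unfolding run_def guard_def by fastforce
qed

lemma run1_guard_off:
  assumes "\<not> regs s 10 > 0" "len (regs s 10) <= b"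
  shows "run 1 (guard c) (b + 2) s (%s'. s' = s)"
  using exec.IfFalse[OF assms(1) exec.Skip, of c] assms(2) unfolding run_def guard_def by fastforce

lemma run1_Const: "1 + len c <= k ==> Q (s(|regs := (regs s)(r := c)|)) ==> run 1 (Const r c) k s Q"
  unfolding run_def using exec.Const by fastforce

lemma run1_Op: "1 + len (regs s x) + len (regs s y) <= k ==>
    Q (s(|regs := (regs s)(r := binop_val f (regs s x) (regs s y))|)) ==> run 1 (Op f r x y) k s Q"
  unfolding run_def using exec.Op by fastforce

lemma run1_Load: "1 + len (regs s x) + len (mem s (regs s x)) <= k ==>
    Q (s(|regs := (regs s)(r := mem s (regs s x))|)) ==> run 1 (Load r x) k s Q"
  unfolding run_def using exec.Load by fastforce

lemma run1_Store: "1 + len (regs s x) + len (regs s y) <= k ==>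
    Q (s(|mem := (mem s)(regs s x := regs s y)|)) ==> run 1 (Store x y) k s Q"
  unfolding run_def using exec.Store by fastforce

lemma run1_ptick:
  assumes "len (regs s 10) <= b" "regs s 100 = 0" "Q (s(|regs := (regs s)(10 := regs s 10 - 1)|))"
  shows "run 1 ptick (b + 5) s Q"
proof -
  have e: "(regs s)(100 := 1, 10 := regs s 10 - 1, 100 := 0) = (regs s)(10 := regs s 10 - 1)"
    using assms(2) by (auto simp: fun_eq_iff)
  have "run 1 ptick (2 + ((b + 2) + 1)) s Q"
    unfolding ptick_def
    by (intro run_Seq run1_Const run1_Op) (use assms len_1 in \<open>auto simp: len0 e\<close>)
  then show ?thesis by (rule run_mono) auto
qed

section \<open>Simulation of a program by its instrumented version\<close>

locale sandbox =
  fixes n gn :: int and b B mr :: nat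
  assumes n0: "n >= 0" and nb: "n + 16 < 2 ^ b" and gb: "\<bar>gn\<bar> < 2 ^ b" and Bb: "100 * B + 1000 < 2 ^ b"
begin

definition bs :: "state => bool" where
  "bs h \<longleftrightarrow> (\<forall>r\<in>{100..103}. regs h r = 0) & regs h 2 = n & regs h 11 = gn & regs h 99 \<in> {0, 1} &
     (ALL a. mem h (cell n a 2) <= gn & mem h (cell n a 2) >= 0)"

definition vmem :: "state => int => int" where
  "vmem h a = (if mem h (cell n a 2) = gn then mem h (cell n a 1) else 0)"

text \<open>The permitted bit length grows by 2 for every unit taken off the clock, which is what an
  instruction can add to its operands. Hence all simulated values have at most \<open>B\<close> bits
  while the clock is positive, whatever the program does; and since lengths are nonnegative, twice
  the clock is at most \<open>B\<close>.\<close>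

definition sim :: "state => state => bool" where
  "sim s h \<longleftrightarrow> bs h & (ALL r<mr. regs h (r + 1000) = regs s r) & (ALL a. vmem h a = mem s a) &
     (ALL r<mr. int (len (regs s r)) <= int B - 2 * regs h 10) &
     (ALL a. int (len (mem s a)) <= int B - 2 * regs h 10)"

definition frame :: "state => state => bool" where
  "frame h h' \<longleftrightarrow> (ALL r<1000. r ~= 10 --> r ~= 99 --> regs h' r = regs h r) &
     (ALL a. (ALL k. a ~= cell n k 1 & a ~= cell n k 2) --> mem h' a = mem h a)"

text \<open>The time overhead of charging, per unit charged, from \<open>run_chg\<close>.\<close>

definition K0 :: nat where "K0 = (5 * b + 12) * (2 * b + 17)"

text \<open>The clock is tied to both running times. It loses at most 40 per unit of the original
  time \<open>t\<close>, so a sufficiently large clock survives the run; and the real time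
  \<open>g\<close> is at most \<open>40 * K0\<close> per unit lost, plus the cost of skipping the
  rest after expiry. The last instruction may overdraw the clock, by at most
  \<open>18 * B + 20\<close>.\<close>

definition post :: "com => nat => state => state => nat => state => bool" where
  "post c t s' h g h' \<longleftrightarrow> bs h' & frame h h' & (regs h' 10 > 0 --> sim s' h') &
     regs h' 10 < regs h 10 & regs h 10 - regs h' 10 <= 40 * int t & - int (18 * B + 20) <= regs h' 10 &
     int g <= 40 * int K0 * (regs h 10 - regs h' 10) + (if regs h' 10 <= 0 then 40 * int (K0 * csz c) else 0)"

lemma K0_ge: "204 <= K0" "b <= K0" "x <= K0 * x"
proof -
  have "12 * 17 <= K0" "b * 1 <= K0" unfolding K0_def by (intro mult_mono; simp)+
  then show "204 <= K0" "b <= K0" by auto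
  then show "x <= K0 * x" by simp
qed

lemma frame_trans: "frame h h' ==> frame h' h'' ==> frame h h''"
  by (simp add: frame_def)

lemma sb_off_guard:
  assumes "regs h 10 <= 0" "len (regs h 10) <= b" "regs h 99 \<in> {0, 1}" "k >= 1"
  shows "run 1 (guard c) ((3 * b + 12) * k) h (%h'. \<exists>v\<in>{0, 1}. h' = h(|regs := (regs h)(99 := v)|))"
proof (rule run_mono[OF run1_guard_off[where b = b]])
  have "(3 * b + 12) * 1 <= (3 * b + 12) * k" using assms by (intro mult_le_mono) auto
  moreover have "b + 2 <= (3 * b + 12) * 1" by simp
  ultimately show "b + 2 <= (3 * b + 12) * k" by (rule order_trans[rotated])
  have "h(|regs := (regs h)(99 := regs h 99)|) = h" by simp
  then show "\<exists>v\<in>{0, 1}. s' = h(|regs := (regs h)(99 := v)|)" if "s' = h" for s'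
    using assms(3) that by metis
qed (use assms in auto)

text \<open>With an expired clock every guard skips its instruction and every loop is left at once;
  only the loop flag 99 can change.\<close>

lemma sb_off:
  assumes "regs h 10 <= 0" "len (regs h 10) <= b" "regs h 99 \<in> {0, 1}"
  shows "run 1 (sb c) ((3 * b + 12) * csz c) h (%h'. \<exists>v\<in>{0, 1}. h' = h(|regs := (regs h)(99 := v)|))"
  using assms
proof (induction c arbitrary: h)
  case (Seq c d)
  have "run 1 (Seq (sb c) (sb d)) ((3 * b + 12) * csz c + (3 * b + 12) * csz d) h
     (%h'. \<exists>v\<in>{0, 1}. h' = h(|regs := (regs h)(99 := v)|))"
  proof (rule run_Seq, rule run_mono[OF Seq.IH(1) order_refl])
    fix s' assume "\<exists>v\<in>{0, 1}. s' = h(|regs := (regs h)(99 := v)|)"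
    then obtain v where v: "v \<in> {0, 1}" "s' = h(|regs := (regs h)(99 := v)|)" by blast
    have up: "s'(|regs := (regs s')(99 := u)|) = h(|regs := (regs h)(99 := u)|)" for u
      unfolding v(2) by simp
    have "run 1 (sb d) ((3 * b + 12) * csz d) s' (%h'. \<exists>v\<in>{0, 1}. h' = s'(|regs := (regs s')(99 := v)|))"
      by (rule Seq.IH(2)) (use Seq.prems v in auto)
    then show "run 1 (sb d) ((3 * b + 12) * csz d) s' (%h'. \<exists>v\<in>{0, 1}. h' = h(|regs := (regs h)(99 := v)|))"
      by (simp only: up)
  qed (use Seq.prems in auto)
  then show ?case unfolding sb.simps csz.simps add_mult_distrib2 .
next
  case (WhilePos x c)
  let ?s = "h(|regs := (regs h)(99 := 0)|)"
  have 1: "run 1 (setw (x + 1000)) (1 + (b + 2)) h (%s'. s' = ?s)"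
    unfolding setw_def
  proof (intro run_Seq run1_Const)
    show "run 1 (IfPos 10 (IfPos (x + 1000) (Const 99 1) Skip) Skip) (b + 2) ?s (%s'. s' = ?s)"
      using run1_guard_off[of ?s b] WhilePos.prems unfolding guard_def by auto
  qed (simp add: len0)
  have 2: "run 1 (WhilePos 99 (Seq ptick (Seq (chg (x + 1000)) (Seq (sb c) (setw (x + 1000)))))) 1 ?s (%s'. s' = ?s)"
    using exec.WhileFalse[of ?s 99] unfolding run_def by (fastforce simp: len0)
  have 3: "run 1 (guard (Seq ptick (chg (x + 1000)))) (b + 2) ?s (%s'. s' = ?s)"
    using run1_guard_off[of ?s b] WhilePos.prems by auto
  have "run 1 (sb (WhilePos x c)) ((1 + (b + 2)) + (1 + (b + 2))) h (%s'. s' = ?s)"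
    unfolding sb.simps by (intro run_Seq run_then[OF 1] run_then[OF 2] 3)
  then have "run 1 (sb (WhilePos x c)) ((3 * b + 12) * csz (WhilePos x c)) h
     (%h'. \<exists>v\<in>{0, 1}. h' = h(|regs := (regs h)(99 := v)|))"
  proof (rule run_mono)
    show "(1 + (b + 2)) + (1 + (b + 2)) <= (3 * b + 12) * csz (WhilePos x c)" by (simp add: algebra_simps)
  qed blast
  then show ?case .
qed (simp only: sb.simps csz.simps, rule sb_off_guard; simp)+

lemma run_chgK:
  assumes "x >= 1000" "regs s x = v" "\<forall>r\<in>{100..103}. regs s r = 0"
    and "\<bar>regs s 10\<bar> <= 20 * int B + 100" "len v <= B"
    and "Q (s(|regs := (regs s)(10 := regs s 10 - int (chv v))|))"
  shows "run 1 (chg x) (K0 * chv v) s Q"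
proof -
  have Bi: "100 * int B + 1000 < 2 ^ b" using Bb by (simp flip: of_nat_less_iff[where 'a = int])
  have "chv v <= 8 * B + 1" using chv_le[of v] assms(5) by linarith
  then have "\<bar>regs s 10\<bar> + int (chv v) < 2 ^ b" using Bi assms(4) by linarith
  moreover have "int (4 * len v + 1) < 2 ^ b" using Bi assms(5) by linarith
  ultimately show ?thesis using run_chg[of x s b Q] assms unfolding K0_def by simp
qed

lemma vmem_regs: "vmem (h(|regs := R|)) a = vmem h a"
  by (simp add: vmem_def)

lemma vmem_sim: "sim s h ==> vmem h a = mem s a"
  by (simp add: sim_def)

lemma simD:
  assumes "sim s h" "0 < regs h 10"
  shows "2 * regs h 10 <= int B" "r < mr ==> len (regs s r) <= B" "len (mem s a) <= B"
proof -
  have *: "int (len (mem s a)) <= int B - 2 * regs h 10" for a using assms(1) by (simp add: sim_def)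
  from *[of 0] show "2 * regs h 10 <= int B" by linarith
  from *[of a] assms(2) show "len (mem s a) <= B" by linarith
  assume "r < mr"
  then have "int (len (regs s r)) <= int B - 2 * regs h 10" using assms(1) by (simp add: sim_def)
  with assms(2) show "len (regs s r) <= B" by linarith
qed

lemma len_ck: "\<bar>c\<bar> <= 20 * int B + 100 ==> len c <= b"
  using Bb by (simp add: len_le_iff flip: of_nat_less_iff[where 'a = int])

lemma len_n: "len n <= b" "len (n + 16) <= b"
  using n0 nb by (simp_all add: len_le_iff)

lemma len_gn: "len gn <= b"
  using gb by (simp add: len_le_iff)

lemma len_16: "len 16 <= 5"
  by (simp add: len_le_iff)

lemma len_cell: "0 <= t ==> t <= 2 ==> len (cell n a t) <= len a + 2 * b + 4"
proof -
  assume t: "0 <= t" "t <= 2"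
  then have "len t <= 2" by (simp add: len_le_iff)
  moreover have "len (cell n a t) <= len ((n + 16) * a + n) + len t + 1"
    unfolding cell_def by (rule len_add)
  moreover have "len ((n + 16) * a + n) <= len ((n + 16) * a) + len n + 1" by (rule len_add)
  moreover have "len ((n + 16) * a) <= len (n + 16) + len a" by (rule len_mult)
  ultimately show ?thesis using len_n by linarith
qed

lemma run_saddr:
  assumes "x >= 1000" "regs s x = a" "regs s 2 = n"
    "Q (s(|regs := (regs s)(100 := cell n a 2, 101 := 2)|))"
  shows "run 1 (saddr x) (3 * len a + 6 * b + 30) s Q"
proof -
  have 1: "len ((n + 16) * a) <= b + len a" using len_mult[of "n + 16" a] len_n by linarith
  have 2: "len ((n + 16) * a + n) <= 2 * b + len a + 1"
    using len_add[of "(n + 16) * a" n] len_n 1 by linarith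
  let ?s1 = "s(|regs := (regs s)(100 := 16)|)"
  let ?s2 = "s(|regs := (regs s)(100 := n + 16)|)"
  let ?s3 = "s(|regs := (regs s)(100 := (n + 16) * a)|)"
  let ?s4 = "s(|regs := (regs s)(100 := (n + 16) * a + n)|)"
  let ?s5 = "s(|regs := (regs s)(100 := (n + 16) * a + n, 101 := 2)|)"
  have r1: "run 1 (Const 100 16) 6 s (%s'. s' = ?s1)" using len_16 by (intro run1_Const) auto
  have r2: "run 1 (Op Add 100 2 100) (b + 6) ?s1 (%s'. s' = ?s2)"
    using assms len_16 len_n by (intro run1_Op) auto
  have r3: "run 1 (Op Mul 100 x 100) (b + len a + 1) ?s2 (%s'. s' = ?s3)"
    using assms len_n by (intro run1_Op) (auto simp: mult.commute)
  have r4: "run 1 (Op Add 100 100 2) (2 * b + len a + 1) ?s3 (%s'. s' = ?s4)"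
    using assms 1 len_n by (intro run1_Op) auto
  have r5: "run 1 (Const 101 2) 3 ?s4 (%s'. s' = ?s5)" using len_1 by (intro run1_Const) auto
  have r6: "run 1 (Op Add 100 100 101) (2 * b + len a + 4) ?s5 Q"
    using assms 2 len_1 by (intro run1_Op) (auto simp: cell_def fun_upd_twist)
  have "run 1 (saddr x) (6 + ((b + 6) + ((b + len a + 1) + ((2 * b + len a + 1) + (3 + (2 * b + len a + 4)))))) s Q"
    unfolding saddr_def
    by (intro run_Seq run_then[OF r1] run_then[OF r2] run_then[OF r3] run_then[OF r4] run_then[OF r5] r6)
  then show ?thesis by (rule run_mono) auto
qed

text \<open>The common part of the basic instructions: \<open>e\<close> is the amount charged. A new
  value is either an old one or has at most \<open>2 * e\<close> bits, which is exactly what the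
  length bound in \<open>sim\<close> gains.\<close>

lemma postI:
  assumes "sim s h" "0 < regs h 10" "run 1 (sb c) k h (%h'. h' = F)"
    "frame h F" "bs F" "\<And>r. r < mr ==> regs F (r + 1000) = regs s' r" "\<And>a. vmem F a = mem s' a"
    "regs F 10 = regs h 10 - int e" "1 <= e" "e <= 40 * t" "e <= 18 * B + 20" "k <= 40 * K0 * e"
    "\<And>r. r < mr ==> (EX r'<mr. len (regs s' r) <= len (regs s r')) \<or> (EX a. len (regs s' r) <= len (mem s a)) \<or> len (regs s' r) <= 2 * e"
    "\<And>a. (EX r<mr. len (mem s' a) <= len (regs s r)) \<or> (EX a'. len (mem s' a) <= len (mem s a'))"
  shows "EX g h'. exec (sb c) h g h' & post c t s' h g h'"
proof -
  obtain g where g: "exec (sb c) h g F" "g <= k" using assms(3) unfolding run_def by auto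
  have lr: "int (len (regs s r)) <= int B - 2 * regs h 10" if "r < mr" for r
    using assms(1) that by (simp add: sim_def)
  have lm: "int (len (mem s a)) <= int B - 2 * regs h 10" for a
    using assms(1) by (simp add: sim_def)
  have r: "int (len (regs s' r)) <= int B - 2 * regs F 10" if "r < mr" for r
    using assms(13)[OF that]
  proof (elim disjE exE conjE)
    fix r' assume "r' < mr" "len (regs s' r) <= len (regs s r')"
    then show ?thesis using lr[of r'] assms(8) by linarith
  next
    fix a assume "len (regs s' r) <= len (mem s a)"
    then show ?thesis using lm[of a] assms(8) by linarith
  next
    assume "len (regs s' r) <= 2 * e"
    then show ?thesis using simD(1)[OF assms(1,2)] assms(8) by linarith
  qed
  have m: "int (len (mem s' a)) <= int B - 2 * regs F 10" for a
    using assms(14)[of a]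
  proof (elim disjE exE conjE)
    fix r' assume "r' < mr" "len (mem s' a) <= len (regs s r')"
    then show ?thesis using lr[of r'] assms(8) by linarith
  next
    fix a' assume "len (mem s' a) <= len (mem s a')"
    then show ?thesis using lm[of a'] assms(8) by linarith
  qed
  have "sim s' F" using assms r m by (simp add: sim_def)
  moreover have "int g <= 40 * int K0 * int e" using order_trans[OF g(2) assms(12)]
    by (simp flip: of_nat_le_iff[where 'a = int])
  moreover have "int g <= 40 * int K0 * (regs h 10 - regs F 10) + (if regs F 10 <= 0 then 40 * int (K0 * csz c) else 0)"
    using calculation(2) assms(8) by (auto intro: add_increasing2)
  moreover have "- int (18 * B + 20) <= regs F 10" using assms(2,8,11) by linarith
  ultimately have "post c t s' h g F" unfolding post_def using assms(4,5,8-10) by auto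
  then show ?thesis using g(1) by blast
qed

lemma sb_Const:
  assumes "sim s h" "0 < regs h 10" "r < mr" "len c <= B"
  shows "EX g h'. exec (sb (Const r c)) h g h' &
    post (Const r c) (1 + len c) (s(|regs := (regs s)(r := c)|)) h g h'"
proof -
  let ?e = "1 + len c"
  let ?F = "h(|regs := (regs h)(10 := regs h 10 - int ?e, r + 1000 := c)|)"
  have z: "regs h 100 = 0" and bs: "bs h" using assms(1) by (auto simp: sim_def bs_def)
  have ck: "2 * regs h 10 <= int B" by (rule simD[OF assms(1,2)])
  have le: "len (int ?e) <= ?e" by (rule len_int_le)
  have lck: "len (regs h 10) <= b" using ck assms(2) by (intro len_ck) auto
  let ?s1 = "h(|regs := (regs h)(100 := int ?e)|)"
  let ?s2 = "h(|regs := (regs h)(100 := int ?e, 10 := regs h 10 - int ?e)|)"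
  let ?s3 = "h(|regs := (regs h)(10 := regs h 10 - int ?e)|)"
  have r1: "run 1 (Const 100 (1 + int (len c))) (1 + ?e) h (%s'. s' = ?s1)"
    using le by (intro run1_Const) auto
  have r2: "run 1 (Op Sub 10 10 100) (1 + b + ?e) ?s1 (%s'. s' = ?s2)"
    using le lck by (intro run1_Op) auto
  have "(regs h)(100 := int ?e, 10 := regs h 10 - int ?e, 100 := 0) = (regs h)(10 := regs h 10 - int ?e)"
    using z by (auto simp: fun_eq_iff)
  then have r3: "run 1 (Const 100 0) 1 ?s2 (%s'. s' = ?s3)" by (intro run1_Const) (auto simp: len0)
  have r4: "run 1 (Const (r + 1000) c) ?e ?s3 (%s'. s' = ?F)" by (intro run1_Const) auto
  have R: "run 1 (sb (Const r c)) (b + 1 + ((1 + ?e) + ((1 + b + ?e) + (1 + ?e)))) h (%s'. s' = ?F)"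
    unfolding sb.simps
    by (intro run1_guard run_Seq run_then[OF r1] run_then[OF r2] run_then[OF r3] r4 assms(2) lck)
  show ?thesis
  proof (rule postI[OF assms(1,2) R, where e = ?e])
    show "frame h ?F" by (auto simp: frame_def)
    show "bs ?F" using bs by (auto simp: bs_def)
    show "vmem ?F a = mem (s(|regs := (regs s)(r := c)|)) a" for a
      using assms(1) by (simp add: vmem_sim vmem_regs)
    show "b + 1 + ((1 + ?e) + ((1 + b + ?e) + (1 + ?e))) <= 40 * K0 * ?e"
    proof -
      have "K0 * 1 <= K0 * ?e" "?e <= K0 * ?e" by (intro mult_le_mono K0_ge; simp)+
      then have "b + 1 + ((1 + ?e) + ((1 + b + ?e) + (1 + ?e))) <= 40 * (K0 * ?e)"
        using K0_ge(1,2) by linarith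
      then show ?thesis by (simp only: mult.assoc)
    qed
  qed (use assms in \<open>auto simp: sim_def\<close>)
qed

lemma sb_Op:
  assumes "sim s h" "0 < regs h 10" "r < mr" "x < mr" "y < mr"
  shows "EX g h'. exec (sb (Op f r x y)) h g h' &
    post (Op f r x y) (1 + len (regs s x) + len (regs s y))
      (s(|regs := (regs s)(r := binop_val f (regs s x) (regs s y))|)) h g h'"
proof -
  define u v where "u = regs s x" and "v = regs s y"
  have uv: "regs h (x + 1000) = u" "regs h (y + 1000) = v" using assms by (auto simp: sim_def u_def v_def)
  have l: "len u <= B" "len v <= B" unfolding u_def v_def using simD[OF assms(1,2)] assms by auto
  define e where "e = 1 + chv u + chv v"
  let ?F = "h(|regs := (regs h)(10 := regs h 10 - int e, r + 1000 := binop_val f u v)|)"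
  have z: "\<forall>r\<in>{100..103}. regs h r = 0" and bs: "bs h" using assms(1) by (auto simp: sim_def bs_def)
  have ck: "2 * regs h 10 <= int B" by (rule simD[OF assms(1,2)])
  have lck: "len (regs h 10) <= b" using ck assms(2) by (intro len_ck) auto
  have ch: "chv u <= 8 * len u + 1" "chv v <= 8 * len v + 1" by (rule chv_le)+
  have ch': "len u <= chv u" "len v <= chv v" by (rule chv_ge)+
  let ?s1 = "h(|regs := (regs h)(10 := regs h 10 - 1)|)"
  let ?s2 = "h(|regs := (regs h)(10 := regs h 10 - 1 - int (chv u))|)"
  let ?s3 = "h(|regs := (regs h)(10 := regs h 10 - int e)|)"
  have r1: "run 1 ptick (b + 5) h (%s'. s' = ?s1)" using z lck by (intro run1_ptick) auto
  have r2: "run 1 (chg (x + 1000)) (K0 * chv u) ?s1 (%s'. s' = ?s2)"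
    using z uv l ck assms(2) by (intro run_chgK) auto
  have r3: "run 1 (chg (y + 1000)) (K0 * chv v) ?s2 (%s'. s' = ?s3)"
    using z uv l ck assms(2) ch by (intro run_chgK) (auto simp: e_def algebra_simps)
  have r4: "run 1 (Op f (r + 1000) (x + 1000) (y + 1000)) (1 + len u + len v) ?s3 (%s'. s' = ?F)"
    using uv by (intro run1_Op) auto
  have R: "run 1 (sb (Op f r x y)) (b + 1 + ((b + 5) + (K0 * chv u + (K0 * chv v + (1 + len u + len v))))) h (%s'. s' = ?F)"
    unfolding sb.simps
    by (intro run1_guard run_Seq run_then[OF r1] run_then[OF r2] run_then[OF r3] r4 assms(2) lck)
  show ?thesis unfolding u_def[symmetric] v_def[symmetric]
  proof (rule postI[OF assms(1,2) R, where e = e])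
    show "frame h ?F" by (auto simp: frame_def)
    show "bs ?F" using bs by (auto simp: bs_def)
    show "vmem ?F a = mem (s(|regs := (regs s)(r := binop_val f u v)|)) a" for a
      using assms(1) by (simp add: vmem_sim vmem_regs)
    show "e <= 18 * B + 20" "e <= 40 * (1 + len u + len v)" "1 <= e" using ch l by (auto simp: e_def)
    have "K0 * chv u + K0 * chv v + K0 = K0 * e" by (simp add: e_def algebra_simps)
    moreover have "len u <= K0 * chv u" "len v <= K0 * chv v" using K0_ge(3) ch' le_trans by blast+
    ultimately have "b + 1 + ((b + 5) + (K0 * chv u + (K0 * chv v + (1 + len u + len v)))) <= 40 * (K0 * e)"
      using K0_ge(1,2) by linarith
    then show "b + 1 + ((b + 5) + (K0 * chv u + (K0 * chv v + (1 + len u + len v)))) <= 40 * K0 * e"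
      by (simp only: mult.assoc)
    show "(EX r''<mr. len (regs (s(|regs := (regs s)(r := binop_val f u v)|)) r') <= len (regs s r'')) \<or>
      (EX a. len (regs (s(|regs := (regs s)(r := binop_val f u v)|)) r') <= len (mem s a)) \<or>
      len (regs (s(|regs := (regs s)(r := binop_val f u v)|)) r') <= 2 * e" if "r' < mr" for r'
      using len_binop[of f u v] ch' that by (auto simp: e_def)
  qed (use assms in \<open>auto simp: sim_def\<close>)
qed

text \<open>A stamp never exceeds the current generation, so a positive difference means that the
  cell is stale and its virtual content is 0. The loaded value can be charged only after it has
  arrived.\<close>

lemma sb_Load:
  assumes "sim s h" "0 < regs h 10" "r < mr" "x < mr"
  shows "EX g h'. exec (sb (Load r x)) h g h' &
    post (Load r x) (1 + len (regs s x) + len (mem s (regs s x)))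
      (s(|regs := (regs s)(r := mem s (regs s x))|)) h g h'"
proof -
  define a v where "a = regs s x" and "v = mem s a"
  have ra: "regs h (x + 1000) = a" using assms by (auto simp: sim_def a_def)
  have l: "len a <= B" "len v <= B" unfolding a_def v_def using simD[OF assms(1,2)] assms by auto
  define e where "e = chv a + chv v"
  define st where "st = mem h (cell n a 2)"
  let ?c1 = "regs h 10 - int (chv a)"
  let ?F = "h(|regs := (regs h)(10 := regs h 10 - int e, r + 1000 := v)|)"
  have z: "\<forall>r\<in>{100..103}. regs h r = 0" "regs h 2 = n" "regs h 11 = gn" and bs: "bs h"
    using assms(1) by (auto simp: sim_def bs_def)
  have st: "0 <= st" "st <= gn" using bs by (auto simp: bs_def st_def)
  have lst: "len st <= b" "len (gn - st) <= b" using st gb by (auto simp: len_le_iff)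
  have v: "v = (if gn - st > 0 then 0 else mem h (cell n a 1))"
    using vmem_sim[OF assms(1), of a] st by (auto simp: v_def vmem_def st_def)
  have ck: "2 * regs h 10 <= int B" by (rule simD[OF assms(1,2)])
  have lck: "len (regs h 10) <= b" using ck assms(2) by (intro len_ck) auto
  have ch: "chv a <= 8 * len a + 1" "chv v <= 8 * len v + 1" by (rule chv_le)+
  have ch': "len a <= chv a" "len v <= chv v" "1 <= chv a" by (rule chv_ge)+
  have lc: "len (cell n a 2) <= len a + 2 * b + 4" "len (cell n a 1) <= len a + 2 * b + 4"
    by (rule len_cell; simp)+
  have c21: "cell n a 2 - 1 = cell n a 1" by (simp add: cell_def)
  let ?s1 = "h(|regs := (regs h)(10 := ?c1)|)"
  let ?s2 = "h(|regs := (regs h)(10 := ?c1, 100 := cell n a 2, 101 := 2)|)"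
  let ?s3 = "h(|regs := (regs h)(10 := ?c1, 100 := cell n a 2, 101 := st)|)"
  let ?s4 = "h(|regs := (regs h)(10 := ?c1, 100 := cell n a 2, 101 := gn - st)|)"
  let ?P5 = "%s. EX p q. s = h(|regs := (regs h)(10 := ?c1, 100 := p, 101 := q, r + 1000 := v)|)"
  let ?s7 = "h(|regs := (regs h)(10 := ?c1, r + 1000 := v)|)"
  have r1: "run 1 (chg (x + 1000)) (K0 * chv a) h (%s'. s' = ?s1)"
    using z ra l ck assms(2) by (intro run_chgK) auto
  have r2: "run 1 (saddr (x + 1000)) (3 * len a + 6 * b + 30) ?s1 (%s'. s' = ?s2)"
    using z ra by (intro run_saddr[where a = a]) auto
  have r3: "run 1 (Load 101 100) (len a + 3 * b + 5) ?s2 (%s'. s' = ?s3)"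
    using lc lst by (intro run1_Load) (auto simp: st_def)
  have r4: "run 1 (Op Sub 101 11 101) (1 + b + b) ?s3 (%s'. s' = ?s4)"
    using lst len_gn z by (intro run1_Op) auto
  have r5: "run 1 (IfPos 101 (Const (r + 1000) 0) (Seq (Const 101 1) (Seq (Op Sub 100 100 101) (Load (r + 1000) 100))))
      (1 + b + (2 * len a + 4 * b + 15 + len v)) ?s4 ?P5"
  proof (cases "gn - st > 0")
    case True
    have "exec (Const (r + 1000) 0) ?s4 (1 + len 0) (?s4(|regs := (regs ?s4)(r + 1000 := 0)|))" by (rule exec.Const)
    then have "exec (IfPos 101 (Const (r + 1000) 0) (Seq (Const 101 1) (Seq (Op Sub 100 100 101) (Load (r + 1000) 100))))
      ?s4 (1 + len (regs ?s4 101) + (1 + len 0)) (?s4(|regs := (regs ?s4)(r + 1000 := 0)|))"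
      using True by (intro exec.IfTrue) auto
    moreover have "?P5 (?s4(|regs := (regs ?s4)(r + 1000 := 0)|))"
      using v True by (intro exI[of _ "cell n a 2"] exI[of _ "gn - st"]) simp
    moreover have "1 + len (regs ?s4 101) + (1 + len 0) <= (1 + b + (2 * len a + 4 * b + 15 + len v)) * 1"
      using lst by (simp add: len0)
    ultimately show ?thesis unfolding run_def by blast
  next
    case False
    let ?t1 = "h(|regs := (regs h)(10 := ?c1, 100 := cell n a 2, 101 := 1)|)"
    let ?t2 = "h(|regs := (regs h)(10 := ?c1, 100 := cell n a 1, 101 := 1)|)"
    have vF: "mem h (cell n a 1) = v" using v False by simp
    have q1: "run 1 (Const 101 1) 2 ?s4 (%s'. s' = ?t1)" using len_1 by (intro run1_Const) auto
    have q2: "run 1 (Op Sub 100 100 101) (len a + 2 * b + 6) ?t1 (%s'. s' = ?t2)"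
      using lc len_1 c21 by (intro run1_Op) (auto simp: fun_upd_twist)
    have q3: "run 1 (Load (r + 1000) 100) (len a + 2 * b + 5 + len v) ?t2 ?P5"
      using lc vF by (intro run1_Load exI[of _ "cell n a 1"] exI[of _ 1]) auto
    have "run 1 (Seq (Const 101 1) (Seq (Op Sub 100 100 101) (Load (r + 1000) 100)))
        (2 + ((len a + 2 * b + 6) + (len a + 2 * b + 5 + len v))) ?s4 ?P5"
      by (intro run_Seq run_then[OF q1] run_then[OF q2] q3)
    then obtain t s' where ex: "exec (Seq (Const 101 1) (Seq (Op Sub 100 100 101) (Load (r + 1000) 100))) ?s4 t s'"
       "t <= 2 + ((len a + 2 * b + 6) + (len a + 2 * b + 5 + len v))" "?P5 s'" unfolding run_def by auto
    have "exec (IfPos 101 (Const (r + 1000) 0) (Seq (Const 101 1) (Seq (Op Sub 100 100 101) (Load (r + 1000) 100))))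
      ?s4 (1 + len (regs ?s4 101) + t) s'"
      using False ex(1) by (intro exec.IfFalse) auto
    moreover have "1 + len (regs ?s4 101) + t <= (1 + b + (2 * len a + 4 * b + 15 + len v)) * 1"
      using lst ex(2) by simp
    ultimately show ?thesis using ex(3) unfolding run_def by blast
  qed
  have r6: "run 1 (Seq (Const 100 0) (Seq (Const 101 0) (chg (r + 1000)))) (1 + (1 + K0 * chv v)) s5 (%s'. s' = ?F)"
    if "?P5 s5" for s5
  proof -
    from that obtain p q where s5: "s5 = h(|regs := (regs h)(10 := ?c1, 100 := p, 101 := q, r + 1000 := v)|)" by blast
    have "s5(|regs := (regs s5)(100 := 0, 101 := 0)|) = ?s7"
      using z unfolding s5 by (auto simp: fun_eq_iff)
    moreover have "run 1 (chg (r + 1000)) (K0 * chv v) ?s7 (%s'. s' = ?F)"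
      using z l ck assms(2) ch by (intro run_chgK) (auto simp: e_def fun_upd_twist algebra_simps)
    ultimately show ?thesis by (intro run_Seq run1_Const) (simp_all add: len0)
  qed
  have R: "run 1 (sb (Load r x)) (b + 1 + (K0 * chv a + ((3 * len a + 6 * b + 30) + ((len a + 3 * b + 5) + ((1 + b + b) +
      ((1 + b + (2 * len a + 4 * b + 15 + len v)) + (1 + (1 + K0 * chv v)))))))) h (%s'. s' = ?F)"
    unfolding sb.simps
    by (intro run1_guard run_Seq run_then[OF r1] run_then[OF r2] run_then[OF r3] run_then[OF r4]
      run_mono[OF r5 order_refl] r6[unfolded One_nat_def] r6 assms(2) lck)
  show ?thesis unfolding a_def[symmetric] v_def[symmetric]
  proof (rule postI[OF assms(1,2) R, where e = e])
    show "frame h ?F" by (auto simp: frame_def)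
    show "bs ?F" using bs by (auto simp: bs_def)
    show "vmem ?F a' = mem (s(|regs := (regs s)(r := v)|)) a'" for a'
      using assms(1) by (simp add: vmem_sim vmem_regs)
    show "e <= 18 * B + 20" "e <= 40 * (1 + len a + len v)" "1 <= e" using ch ch' l by (auto simp: e_def)
    have 1: "K0 * chv a + K0 * chv v = K0 * e" by (simp add: e_def algebra_simps)
    have 2: "K0 * 1 <= K0 * e" using \<open>1 <= e\<close> by (intro mult_le_mono) auto
    have "len a <= K0 * chv a" "len v <= K0 * chv v" using K0_ge(3) ch' le_trans by blast+
    then have "b + 1 + (K0 * chv a + ((3 * len a + 6 * b + 30) + ((len a + 3 * b + 5) + ((1 + b + b) +
      ((1 + b + (2 * len a + 4 * b + 15 + len v)) + (1 + (1 + K0 * chv v))))))) <= 40 * (K0 * e)"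
      using K0_ge(1,2) 1 2 by linarith
    then show "b + 1 + (K0 * chv a + ((3 * len a + 6 * b + 30) + ((len a + 3 * b + 5) + ((1 + b + b) +
      ((1 + b + (2 * len a + 4 * b + 15 + len v)) + (1 + (1 + K0 * chv v))))))) <= 40 * K0 * e"
      by (simp only: mult.assoc)
    show "(EX r''<mr. len (regs (s(|regs := (regs s)(r := v)|)) r') <= len (regs s r'')) \<or>
      (EX a. len (regs (s(|regs := (regs s)(r := v)|)) r') <= len (mem s a)) \<or>
      len (regs (s(|regs := (regs s)(r := v)|)) r') <= 2 * e" if "r' < mr" for r'
      using that by (auto simp: v_def)
  qed (use assms in \<open>auto simp: sim_def\<close>)
qed

lemma sb_Store:
  assumes "sim s h" "0 < regs h 10" "x < mr" "y < mr"
  shows "EX g h'. exec (sb (Store x y)) h g h' &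
    post (Store x y) (1 + len (regs s x) + len (regs s y))
      (s(|mem := (mem s)(regs s x := regs s y)|)) h g h'"
proof -
  define a v where "a = regs s x" and "v = regs s y"
  have ra: "regs h (x + 1000) = a" "regs h (y + 1000) = v" using assms by (auto simp: sim_def a_def v_def)
  have l: "len a <= B" "len v <= B" unfolding a_def v_def using simD[OF assms(1,2)] assms by auto
  define e where "e = chv a + chv v"
  let ?c1 = "regs h 10 - int (chv a)"
  let ?c2 = "regs h 10 - int e"
  let ?m1 = "(mem h)(cell n a 2 := gn)"
  let ?m2 = "(mem h)(cell n a 2 := gn, cell n a 1 := v)"
  let ?F = "h(|regs := (regs h)(10 := ?c2), mem := ?m2|)"
  have z: "\<forall>r\<in>{100..103}. regs h r = 0" "regs h 2 = n" "regs h 11 = gn" and bs: "bs h"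
    using assms(1) by (auto simp: sim_def bs_def)
  have gn0: "0 <= gn" using bs by (force simp: bs_def)
  have ck: "2 * regs h 10 <= int B" by (rule simD[OF assms(1,2)])
  have lck: "len (regs h 10) <= b" using ck assms(2) by (intro len_ck) auto
  have ch: "chv a <= 8 * len a + 1" "chv v <= 8 * len v + 1" by (rule chv_le)+
  have ch': "len a <= chv a" "len v <= chv v" "1 <= chv a" by (rule chv_ge)+
  have lc: "len (cell n a 2) <= len a + 2 * b + 4" "len (cell n a 1) <= len a + 2 * b + 4"
    by (rule len_cell; simp)+
  have c21: "cell n a 2 - 1 = cell n a 1" by (simp add: cell_def)
  let ?s1 = "h(|regs := (regs h)(10 := ?c1)|)"
  let ?s2 = "h(|regs := (regs h)(10 := ?c2)|)"
  let ?s3 = "h(|regs := (regs h)(10 := ?c2, 100 := cell n a 2, 101 := 2)|)"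
  let ?s4 = "h(|regs := (regs h)(10 := ?c2, 100 := cell n a 2, 101 := 2), mem := ?m1|)"
  let ?s5 = "h(|regs := (regs h)(10 := ?c2, 100 := cell n a 2, 101 := 1), mem := ?m1|)"
  let ?s6 = "h(|regs := (regs h)(10 := ?c2, 100 := cell n a 1, 101 := 1), mem := ?m1|)"
  let ?s7 = "h(|regs := (regs h)(10 := ?c2, 100 := cell n a 1, 101 := 1), mem := ?m2|)"
  have r1: "run 1 (chg (x + 1000)) (K0 * chv a) h (%s'. s' = ?s1)"
    using z ra l ck assms(2) by (intro run_chgK) auto
  have r2: "run 1 (chg (y + 1000)) (K0 * chv v) ?s1 (%s'. s' = ?s2)"
    using z ra l ck assms(2) ch by (intro run_chgK) (auto simp: e_def algebra_simps)
  have r3: "run 1 (saddr (x + 1000)) (3 * len a + 6 * b + 30) ?s2 (%s'. s' = ?s3)"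
    using z ra by (intro run_saddr[where a = a]) auto
  have r4: "run 1 (Store 100 11) (len a + 3 * b + 5) ?s3 (%s'. s' = ?s4)"
    using lc z len_gn by (intro run1_Store) auto
  have r5: "run 1 (Const 101 1) 2 ?s4 (%s'. s' = ?s5)" using len_1 by (intro run1_Const) auto
  have r6: "run 1 (Op Sub 100 100 101) (len a + 2 * b + 6) ?s5 (%s'. s' = ?s6)"
    using lc len_1 c21 by (intro run1_Op) (auto simp: fun_upd_twist)
  have r7: "run 1 (Store 100 (y + 1000)) (len a + 2 * b + 5 + len v) ?s6 (%s'. s' = ?s7)"
    using lc ra by (intro run1_Store) auto
  have "(regs h)(10 := ?c2, 100 := cell n a 1, 101 := 1, 100 := 0, 101 := 0) = (regs h)(10 := ?c2)"
    using z by (auto simp: fun_eq_iff)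
  then have r8: "run 1 (Seq (Const 100 0) (Const 101 0)) (1 + 1) ?s7 (%s'. s' = ?F)"
    by (intro run_Seq run1_Const) (simp_all add: len0)
  have R: "run 1 (sb (Store x y)) (b + 1 + (K0 * chv a + (K0 * chv v + ((3 * len a + 6 * b + 30) + ((len a + 3 * b + 5) +
      (2 + ((len a + 2 * b + 6) + ((len a + 2 * b + 5 + len v) + (1 + 1))))))))) h (%s'. s' = ?F)"
    unfolding sb.simps
    by (intro run1_guard run_Seq run_then[OF r1] run_then[OF r2] run_then[OF r3] run_then[OF r4]
      run_then[OF r5] run_then[OF r6] run_then[OF r7] r8 assms(2) lck)
  have ceq: "cell n k t = cell n k' t' \<longleftrightarrow> k = k' & t = t'" if "t \<in> {1, 2}" "t' \<in> {1, 2}" for k t k' t'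
    using that n0 by (intro cell_eq_iff) auto
  show ?thesis unfolding a_def[symmetric] v_def[symmetric]
  proof (rule postI[OF assms(1,2) R, where e = e])
    show "frame h ?F" by (auto simp: frame_def)
    show "bs ?F" using bs gn0 by (auto simp: bs_def ceq)
    show "vmem ?F a' = mem (s(|mem := (mem s)(a := v)|)) a'" for a'
      using vmem_sim[OF assms(1), of a'] by (simp add: vmem_def ceq split: if_splits)
    show "e <= 18 * B + 20" "e <= 40 * (1 + len a + len v)" "1 <= e" using ch ch' l by (auto simp: e_def)
    have 1: "K0 * chv a + K0 * chv v = K0 * e" by (simp add: e_def algebra_simps)
    have 2: "K0 * 1 <= K0 * e" using \<open>1 <= e\<close> by (intro mult_le_mono) auto
    have "len a <= K0 * chv a" "len v <= K0 * chv v" using K0_ge(3) ch' le_trans by blast+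
    then have "b + 1 + (K0 * chv a + (K0 * chv v + ((3 * len a + 6 * b + 30) + ((len a + 3 * b + 5) +
      (2 + ((len a + 2 * b + 6) + ((len a + 2 * b + 5 + len v) + (1 + 1)))))))) <= 40 * (K0 * e)"
      using K0_ge(1,2) 1 2 by linarith
    then show "b + 1 + (K0 * chv a + (K0 * chv v + ((3 * len a + 6 * b + 30) + ((len a + 3 * b + 5) +
      (2 + ((len a + 2 * b + 6) + ((len a + 2 * b + 5 + len v) + (1 + 1)))))))) <= 40 * K0 * e"
      by (simp only: mult.assoc)
    show "(EX r<mr. len (mem (s(|mem := (mem s)(a := v)|)) a') <= len (regs s r)) \<or>
      (EX a''. len (mem (s(|mem := (mem s)(a := v)|)) a') <= len (mem s a''))" for a'
      using assms(4) by (auto simp: v_def)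
  qed (use assms in \<open>auto simp: sim_def\<close>)
qed

lemma post_step:
  assumes "post c t s' h g h'"
  shows "bs h'" "frame h h'" "regs h' 10 > 0 ==> sim s' h'" "regs h' 10 < regs h 10"
    "regs h 10 - regs h' 10 <= 40 * int t" "- int (18 * B + 20) <= regs h' 10"
    "int g <= 40 * int K0 * (regs h 10 - regs h' 10) + (if regs h' 10 <= 0 then 40 * int (K0 * csz c) else 0)"
  using assms by (auto simp: post_def)

lemma sb_off_exec:
  assumes "regs h 10 <= 0" "- int (18 * B + 20) <= regs h 10" "bs h"
  obtains g h' where "exec (sb c) h g h'" "bs h'" "frame h h'" "regs h' 10 = regs h 10" "g <= K0 * csz c"
proof -
  have "len (regs h 10) <= b" using assms by (intro len_ck) auto
  moreover have "regs h 99 \<in> {0, 1}" using assms by (simp add: bs_def)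
  ultimately have "run 1 (sb c) ((3 * b + 12) * csz c) h (%h'. \<exists>v\<in>{0, 1}. h' = h(|regs := (regs h)(99 := v)|))"
    using assms(1) by (intro sb_off)
  then obtain g v where 1: "exec (sb c) h g (h(|regs := (regs h)(99 := v)|))" "v \<in> {0, 1}" "g <= (3 * b + 12) * csz c"
    unfolding run_def by auto
  have "(3 * b + 12) * 1 <= (5 * b + 12) * (2 * b + 17)" by (intro mult_le_mono) auto
  then have "(3 * b + 12) * csz c <= K0 * csz c" unfolding K0_def by (intro mult_le_mono) auto
  then have "g <= K0 * csz c" using 1(3) by linarith
  then show ?thesis using that[OF 1(1)] 1(2) assms(3) by (auto simp: bs_def frame_def)
qed

lemma frame_temps: "frame h h' ==> r < 1000 ==> r ~= 10 ==> r ~= 99 ==> regs h' r = regs h r"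
  by (simp add: frame_def)

lemma charge_step:
  assumes "sim s h" "0 < regs h 10" "x < mr"
  obtains g h' where "exec (Seq ptick (chg (x + 1000))) h g h'" "h' = h(|regs := (regs h)(10 := regs h 10 - 1 - int (chv (regs s x)))|)"
    "sim s h'" "frame h h'" "g <= b + 5 + K0 * chv (regs s x)" "chv (regs s x) <= 8 * B + 1"
proof -
  have z: "\<forall>r\<in>{100..103}. regs h r = 0" and bs: "bs h" using assms(1) by (auto simp: sim_def bs_def)
  have ck: "2 * regs h 10 <= int B" by (rule simD[OF assms(1,2)])
  have lck: "len (regs h 10) <= b" using ck assms(2) by (intro len_ck) auto
  have l: "len (regs s x) <= B" using simD[OF assms(1,2)] assms by auto
  have rx: "regs h (x + 1000) = regs s x" using assms by (auto simp: sim_def)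
  let ?s1 = "h(|regs := (regs h)(10 := regs h 10 - 1)|)"
  let ?s2 = "h(|regs := (regs h)(10 := regs h 10 - 1 - int (chv (regs s x)))|)"
  have r1: "run 1 ptick (b + 5) h (%s'. s' = ?s1)" using z lck by (intro run1_ptick) auto
  have r2: "run 1 (chg (x + 1000)) (K0 * chv (regs s x)) ?s1 (%s'. s' = ?s2)"
    using z rx l ck assms(2) by (intro run_chgK) auto
  have "run 1 (Seq ptick (chg (x + 1000))) (b + 5 + K0 * chv (regs s x)) h (%s'. s' = ?s2)"
    by (intro run_Seq run_then[OF r1] r2)
  then obtain g where "exec (Seq ptick (chg (x + 1000))) h g ?s2" "g <= b + 5 + K0 * chv (regs s x)"
    unfolding run_def by auto
  moreover have "sim s ?s2"
    unfolding sim_def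
  proof (intro conjI allI impI)
    show "bs ?s2" using bs by (auto simp: bs_def)
    fix r assume "r < mr"
    then have "int (len (regs s r)) <= int B - 2 * regs h 10" using assms(1) by (simp add: sim_def)
    then show "int (len (regs s r)) <= int B - 2 * regs ?s2 10" by simp
  next
    fix a
    have "int (len (mem s a)) <= int B - 2 * regs h 10" using assms(1) by (simp add: sim_def)
    then show "int (len (mem s a)) <= int B - 2 * regs ?s2 10" by simp
  qed (use assms(1) in \<open>auto simp: sim_def vmem_regs\<close>)
  moreover have "frame h ?s2" by (auto simp: frame_def)
  moreover have "chv (regs s x) <= 8 * B + 1" using chv_le[of "regs s x"] l by linarith
  ultimately show ?thesis using that by blast
qed

lemma setw_exec:
  assumes "bs h" "- int (18 * B + 20) <= regs h 10" "2 * regs h 10 <= int B"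
    "regs h 10 > 0 ==> regs h x = v" "x >= 1000"
  obtains g h' where "exec (setw x) h g h'" "h' = h(|regs := (regs h)(99 := (if regs h 10 > 0 & v > 0 then 1 else 0))|)"
    "g <= b + 6 + (if regs h 10 > 0 then len v else 0)"
proof -
  have lck: "len (regs h 10) <= b" using assms by (intro len_ck) auto
  let ?s1 = "h(|regs := (regs h)(99 := 0)|)"
  have c: "exec (Const 99 0) h (1 + len 0) ?s1" by (rule exec.Const)
  consider (a) "regs h 10 > 0" "v > 0" | (b) "regs h 10 > 0" "\<not> v > 0" | (c) "\<not> regs h 10 > 0" by blast
  then show ?thesis
  proof cases
    case a
    have "exec (Const 99 1) ?s1 (1 + len 1) (?s1(|regs := (regs ?s1)(99 := 1)|))" by (rule exec.Const)
    moreover have "regs ?s1 x > 0" "regs ?s1 10 > 0" "regs ?s1 x = v" using assms(4,5) a by auto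
    ultimately have "exec (IfPos 10 (IfPos x (Const 99 1) Skip) Skip) ?s1
       (1 + len (regs ?s1 10) + (1 + len (regs ?s1 x) + (1 + len 1))) (?s1(|regs := (regs ?s1)(99 := 1)|))"
      by (intro exec.IfTrue)
    from exec.Seq[OF c this] show ?thesis
      using a \<open>regs ?s1 x = v\<close> lck len_1 by (intro that) (auto simp: setw_def len0)
  next
    case b
    have "exec Skip ?s1 1 ?s1" by (rule exec.Skip)
    moreover have "\<not> regs ?s1 x > 0" "regs ?s1 10 > 0" "regs ?s1 x = v" using assms(4,5) b by auto
    ultimately have "exec (IfPos 10 (IfPos x (Const 99 1) Skip) Skip) ?s1
       (1 + len (regs ?s1 10) + (1 + len (regs ?s1 x) + 1)) ?s1"
      by (intro exec.IfTrue exec.IfFalse)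
    from exec.Seq[OF c this] show ?thesis
      using b \<open>regs ?s1 x = v\<close> lck by (intro that) (auto simp: setw_def len0)
  next
    case c': c
    have "exec Skip ?s1 1 ?s1" by (rule exec.Skip)
    moreover have "\<not> regs ?s1 10 > 0" using c' by auto
    ultimately have "exec (IfPos 10 (IfPos x (Const 99 1) Skip) Skip) ?s1 (1 + len (regs ?s1 10) + 1) ?s1"
      by (intro exec.IfFalse)
    from exec.Seq[OF c this] show ?thesis
      using c' lck by (intro that) (auto simp: setw_def len0)
  qed
qed

text \<open>The variant of \<open>post\<close> for a fragment that may start with an expired clock.
  The skipping cost is then paid without the factor 40, which leaves room for adding up several
  fragments.\<close>

definition postw :: "com => nat => state => state => nat => state => bool" where
  "postw c t s' h g h' \<longleftrightarrow> bs h' & frame h h' & (regs h' 10 > 0 --> sim s' h') &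
     regs h' 10 <= regs h 10 & regs h 10 - regs h' 10 <= 40 * int t & - int (18 * B + 20) <= regs h' 10 &
     int g <= 40 * int K0 * (regs h 10 - regs h' 10) +
       (if regs h 10 <= 0 then int (K0 * csz c) else if regs h' 10 <= 0 then 40 * int (K0 * csz c) else 0)"

lemma postw_bound:
  assumes "postw c t s' h g h'"
  shows "int g <= 40 * int K0 * (regs h 10 - regs h' 10) + (if regs h' 10 <= 0 then 40 * int (K0 * csz c) else 0)"
proof -
  have "0 <= int (K0 * csz c)" by (rule of_nat_0_le_iff)
  then show ?thesis using assms unfolding postw_def by (simp del: of_nat_mult split: if_splits)
qed

text \<open>Unites the two ways to go on inside a composite program: by the induction hypothesis
  while the clock is positive, by skipping otherwise.\<close>

lemma sb_continue:
  assumes "bs h" "- int (18 * B + 20) <= regs h 10"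
    "regs h 10 > 0 ==> EX g h'. exec (sb c) h g h' & post c t s' h g h'"
  obtains g h' where "exec (sb c) h g h'" "postw c t s' h g h'"
proof (cases "regs h 10 > 0")
  case True
  then obtain g h' where "exec (sb c) h g h'" "post c t s' h g h'" using assms(3) by blast
  then show ?thesis using that True unfolding post_def postw_def by auto
next
  case False
  then obtain g h' where *: "exec (sb c) h g h'" "bs h'" "frame h h'" "regs h' 10 = regs h 10" "g <= K0 * csz c"
    using sb_off_exec[of h c thesis] assms(1,2) by auto
  have "int g <= int (K0 * csz c)" using *(5) by (simp only: of_nat_le_iff)
  then have "postw c t s' h g h'" using * False assms(2) unfolding postw_def by auto
  then show ?thesis using *(1) that by blast
qed

lemma exec_Seq_assoc: "exec (Seq (Seq c1 c2) c3) s t s' ==> exec (Seq c1 (Seq c2 c3)) s t s'"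
  by (elim exec_SeqE) (auto simp: add.assoc intro!: exec.Seq)

lemma sb_If:
  assumes sim: "sim s h" and pos: "0 < regs h 10" and x: "x < mr"
    and IH: "\<And>h. sim s h ==> 0 < regs h 10 ==> EX g h'. exec (sb e) h g h' & post e t s' h g h'"
    and e: "e = (if regs s x > 0 then c else d)"
  shows "EX g h'. exec (sb (IfPos x c d)) h g h' & post (IfPos x c d) (1 + len (regs s x) + t) s' h g h'"
proof -
  let ?v = "regs s x"
  have ck: "2 * regs h 10 <= int B" by (rule simD[OF sim pos])
  have lck: "len (regs h 10) <= b" using ck pos by (intro len_ck) auto
  obtain g1 h1 where 1: "exec (Seq ptick (chg (x + 1000))) h g1 h1"
    "h1 = h(|regs := (regs h)(10 := regs h 10 - 1 - int (chv ?v))|)"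
    "sim s h1" "frame h h1" "g1 <= b + 5 + K0 * chv ?v" "chv ?v <= 8 * B + 1"
    using charge_step[OF sim pos x] by blast
  have ck1: "regs h1 10 = regs h 10 - 1 - int (chv ?v)" using 1(2) by simp
  have bs1: "bs h1" using 1(3) by (simp add: sim_def)
  have low1: "- int (18 * B + 20) <= regs h1 10" using ck1 1(6) pos by linarith
  obtain g2 h2 where 2: "exec (sb e) h1 g2 h2" "postw e t s' h1 g2 h2"
    using sb_continue[OF bs1 low1 IH[OF 1(3)]] by blast
  have vx: "regs h1 (x + 1000) = ?v" using 1(3) x by (simp add: sim_def)
  have "exec (IfPos (x + 1000) (sb c) (sb d)) h1 (1 + len ?v + g2) h2"
    using exec.IfTrue[of h1 "x + 1000" "sb c" g2 h2 "sb d"] exec.IfFalse[of h1 "x + 1000" "sb d" g2 h2 "sb c"] 2(1) vx e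
    by (auto split: if_splits)
  from exec_Seq_assoc[OF exec.Seq[OF 1(1) this]]
  have ex: "exec (sb (IfPos x c d)) h (1 + len (regs h 10) + (g1 + (1 + len ?v + g2))) h2"
    unfolding sb.simps guard_def using pos by (intro exec.IfTrue)
  have ch: "len ?v <= chv ?v" "chv ?v <= 8 * len ?v + 1" "1 <= chv ?v" by (rule chv_ge chv_le)+
  have cs: "csz e <= csz (IfPos x c d)" using e by auto
  then have cs': "int (K0 * csz e) <= int (K0 * csz (IfPos x c d))" by (simp only: of_nat_le_iff mult_le_mono2)
  have t1: "1 + len (regs h 10) + (g1 + (1 + len ?v)) <= 40 * (K0 * (1 + chv ?v))"
    using 1(5) ch K0_ge(1,2) K0_ge(3)[of "chv ?v"] lck unfolding add_mult_distrib2 mult_1_right by linarith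
  then have t1': "int (1 + len (regs h 10) + (g1 + (1 + len ?v))) <= 40 * int K0 * (regs h 10 - regs h1 10)"
    unfolding ck1 by (simp add: algebra_simps flip: of_nat_le_iff[where 'a = int])
  have tt: "int (1 + len (regs h 10) + (g1 + (1 + len ?v + g2))) <= 40 * int K0 * (regs h 10 - regs h1 10) + int g2"
    using t1' by simp
  have "int (1 + len (regs h 10) + (g1 + (1 + len ?v + g2))) <= 40 * int K0 * (regs h 10 - regs h2 10) +
     (if regs h2 10 <= 0 then 40 * int (K0 * csz (IfPos x c d)) else 0)"
  proof -
    have "int g2 <= 40 * int K0 * (regs h1 10 - regs h2 10) + (if regs h2 10 <= 0 then 40 * int (K0 * csz (IfPos x c d)) else 0)"
      using postw_bound[OF 2(2)] cs' by (auto simp del: of_nat_mult csz.simps of_nat_le_iff)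
    moreover have "40 * int K0 * (regs h 10 - regs h2 10) = 40 * int K0 * (regs h 10 - regs h1 10) + 40 * int K0 * (regs h1 10 - regs h2 10)"
      by (simp add: algebra_simps)
    ultimately show ?thesis using tt by linarith
  qed
  then have "post (IfPos x c d) (1 + len ?v + t) s' h (1 + len (regs h 10) + (g1 + (1 + len ?v + g2))) h2"
    using 2(2) ck1 ch frame_trans[OF 1(4)] unfolding post_def postw_def by auto
  then show ?thesis using ex by blast
qed

text \<open>Induction over the run of the original program. If the clock expires within a composite,
  the remainder is skipped, and the weight \<open>csz\<close> pays for it.\<close>

theorem sb_correct:
  assumes "exec c s t s'" "cregs c <= mr" "cmax c <= B" "sim s h" "0 < regs h 10"
  shows "EX g h'. exec (sb c) h g h' & post c t s' h g h'"
  using assms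
proof (induction arbitrary: h rule: exec.induct)
  case (Skip s)
  note sim = \<open>sim s h\<close> and pos = \<open>0 < regs h 10\<close>
  let ?F = "h(|regs := (regs h)(10 := regs h 10 - 1)|)"
  have ck: "2 * regs h 10 <= int B" by (rule simD[OF sim pos])
  have lck: "len (regs h 10) <= b" using ck pos by (intro len_ck) auto
  have R: "run 1 (sb Skip) (b + 1 + (b + 5)) h (%s'. s' = ?F)"
    unfolding sb.simps using sim lck pos by (intro run1_guard run1_ptick) (auto simp: sim_def bs_def)
  show ?case
    by (rule postI[OF sim pos R, where e = 1])
       (use sim K0_ge in \<open>auto simp: sim_def bs_def frame_def vmem_regs\<close>)
next
  case (Const r c s)
  then show ?case using sb_Const[of s h r c] by simp
next
  case (Op f r x y s)
  then show ?case using sb_Op[of s h r x y f] by simp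
next
  case (Load r x s)
  then show ?case using sb_Load[of s h r x] by simp
next
  case (Store x y s)
  then show ?case using sb_Store[of s h x y] by simp
next
  case (Seq c s t s' d u s'')
  obtain g1 h1 where 1: "exec (sb c) h g1 h1" "post c t s' h g1 h1"
    using Seq.IH(1)[of h] Seq.prems by auto
  note p1 = post_step[OF 1(2)]
  show ?case
  proof (cases "regs h1 10 > 0")
    case True
    obtain g2 h2 where 2: "exec (sb d) h1 g2 h2" "post d u s'' h1 g2 h2"
      using Seq.IH(2)[of h1] Seq.prems p1(3) True by auto
    note p2 = post_step[OF 2(2)]
    have "int (g1 + g2) <= 40 * int K0 * (regs h 10 - regs h2 10) + (if regs h2 10 <= 0 then 40 * int (K0 * csz (Seq c d)) else 0)"
      using p1(7) p2(7) True add_increasing[of "int K0 * int (csz c) * 40"] by (auto simp: algebra_simps intro: add_increasing)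
    then have "post (Seq c d) (t + u) s'' h (g1 + g2) h2"
      using p1 p2 frame_trans[OF p1(2) p2(2)] unfolding post_def by auto
    then show ?thesis using exec.Seq[OF 1(1) 2(1)] unfolding sb.simps by blast
  next
    case False
    then obtain g2 h2 where 2: "exec (sb d) h1 g2 h2" "bs h2" "frame h1 h2" "regs h2 10 = regs h1 10" "g2 <= K0 * csz d"
      using sb_off_exec[of h1 d thesis] p1(1,6) by auto
    have "int g2 <= int (K0 * csz d)" using 2(5) by (simp only: of_nat_le_iff)
    then have "int (g1 + g2) <= 40 * int K0 * (regs h 10 - regs h2 10) + (if regs h2 10 <= 0 then 40 * int (K0 * csz (Seq c d)) else 0)"
      using p1(7) 2(4) False by (simp add: algebra_simps)
    then have "post (Seq c d) (t + u) s'' h (g1 + g2) h2"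
      using p1 2 False frame_trans[OF p1(2) 2(3)] unfolding post_def by auto
    then show ?thesis using exec.Seq[OF 1(1) 2(1)] unfolding sb.simps by blast
  qed
next
  case (IfTrue s x c t s' d)
  show ?case
    by (rule sb_If[where e = c]) (use IfTrue in auto)
next
  case (IfFalse s x d t s' c)
  show ?case
    by (rule sb_If[where e = d]) (use IfFalse in auto)
next
  case (WhileTrue s x c t s' u s'')
  note sim = \<open>sim s h\<close> and pos = \<open>0 < regs h 10\<close>
  let ?v = "regs s x"
  let ?B = "Seq ptick (Seq (chg (x + 1000)) (Seq (sb c) (setw (x + 1000))))"
  let ?G = "guard (Seq ptick (chg (x + 1000)))"
  have x: "x < mr" using WhileTrue.prems by simp
  have ck: "2 * regs h 10 <= int B" by (rule simD[OF sim pos])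
  have vx: "regs h (x + 1000) = ?v" and bs: "bs h" using sim x by (auto simp: sim_def)
  obtain g0 h0 where 0: "exec (setw (x + 1000)) h g0 h0" "h0 = h(|regs := (regs h)(99 := 1)|)" "g0 <= b + 6 + len ?v"
    using setw_exec[of h "x + 1000" ?v thesis] bs pos ck vx WhileTrue.hyps by auto
  have f0: "frame h h0" using 0(2) by (auto simp: frame_def)
  have sim0: "sim s h0" using sim 0(2) by (auto simp: sim_def bs_def vmem_regs)
  have pos0: "0 < regs h0 10" and ck0: "regs h0 10 = regs h 10" using pos 0(2) by auto
  obtain g1 h1 where 1: "exec (Seq ptick (chg (x + 1000))) h0 g1 h1"
    "h1 = h0(|regs := (regs h0)(10 := regs h0 10 - 1 - int (chv ?v))|)"
    "sim s h1" "frame h0 h1" "g1 <= b + 5 + K0 * chv ?v" "chv ?v <= 8 * B + 1"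
    using charge_step[OF sim0 pos0 x] by blast
  have ck1: "regs h1 10 = regs h 10 - 1 - int (chv ?v)" using 1(2) ck0 by simp
  have bs1: "bs h1" using 1(3) by (simp add: sim_def)
  have low1: "- int (18 * B + 20) <= regs h1 10" using ck1 1(6) pos by linarith
  have IH1: "EX g h'. exec (sb c) h1 g h' & post c t s' h1 g h'" if "regs h1 10 > 0"
    using WhileTrue.IH(1)[of h1] WhileTrue.prems 1(3) that by auto
  obtain g2 h2 where 2: "exec (sb c) h1 g2 h2" "postw c t s' h1 g2 h2"
    using sb_continue[OF bs1 low1 IH1] by blast
  have bs2: "bs h2" and low2: "- int (18 * B + 20) <= regs h2 10" using 2(2) by (auto simp: postw_def)
  have IH2: "EX g h'. exec (sb (WhilePos x c)) h2 g h' & post (WhilePos x c) u s'' h2 g h'" if "regs h2 10 > 0"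
    using WhileTrue.IH(2)[of h2] WhileTrue.prems 2(2) that by (auto simp: postw_def)
  obtain g3 h3 where 3: "exec (sb (WhilePos x c)) h2 g3 h3" "postw (WhilePos x c) u s'' h2 g3 h3"
    using sb_continue[OF bs2 low2 IH2] by blast
  \<comment> \<open>The run for the remaining rounds begins with \<open>setw\<close>, which is also
    the end of the first round. It is taken apart here so that its first piece can be moved into the
    body.\<close>
  obtain ta sa tb sb' tc where q: "exec (setw (x + 1000)) h2 ta sa" "exec (WhilePos 99 ?B) sa tb sb'" "exec ?G sb' tc h3"
    "g3 = ta + (tb + tc)"
    using 3(1) unfolding sb.simps by (elim exec_SeqE) blast
  have body: "exec ?B h0 (g1 + (g2 + ta)) sa"
    using exec_Seq_assoc[OF exec.Seq[OF 1(1) exec.Seq[OF 2(1) q(1)]]] .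
  have W: "exec (WhilePos 99 ?B) h0 (1 + len 1 + (g1 + (g2 + ta)) + tb) sb'"
    using exec.WhileTrue[OF _ body q(2)] 0(2) by simp
  let ?T = "g0 + ((1 + len 1 + (g1 + (g2 + ta)) + tb) + tc)"
  have ex: "exec (sb (WhilePos x c)) h ?T h3"
    unfolding sb.simps by (intro exec.Seq[OF 0(1)] exec.Seq[OF W] q(3))
  have ch: "len ?v <= chv ?v" "chv ?v <= 8 * len ?v + 1" "1 <= chv ?v" by (rule chv_ge chv_le)+
  have t1: "g0 + (1 + len 1 + g1) <= 40 * (K0 * (1 + chv ?v))"
    using 0(3) 1(5) ch K0_ge(1,2) K0_ge(3)[of "chv ?v"] len_1 unfolding add_mult_distrib2 mult_1_right by linarith
  have t1': "int (g0 + (1 + len 1 + g1)) <= 40 * int K0 * (regs h 10 - regs h1 10)"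
    using t1 unfolding ck1 by (simp add: algebra_simps flip: of_nat_le_iff[where 'a = int])
  have TT: "int ?T = int (g0 + (1 + len 1 + g1)) + int g2 + int g3" using q(4) by simp
  have split: "40 * int K0 * (regs h 10 - regs h3 10) = 40 * int K0 * (regs h 10 - regs h1 10) +
      40 * int K0 * (regs h1 10 - regs h2 10) + 40 * int K0 * (regs h2 10 - regs h3 10)"
    by (simp add: algebra_simps)
  have cs: "int (K0 * csz (WhilePos x c)) = 2 * int (K0 * csz c) + 2 * int K0" by (simp add: algebra_simps)
  have nn: "0 <= int (K0 * csz c)" "0 <= int K0" by (rule of_nat_0_le_iff)+
  have mono3: "regs h3 10 <= regs h2 10" "regs h2 10 <= regs h1 10" using 2(2) 3(2) by (auto simp: postw_def)
  have "int g2 + int g3 <= 40 * int K0 * (regs h1 10 - regs h2 10) + 40 * int K0 * (regs h2 10 - regs h3 10) +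
     (if regs h3 10 <= 0 then 40 * int (K0 * csz (WhilePos x c)) else 0)"
  proof (cases "regs h2 10 > 0")
    case True
    then have "int g2 <= 40 * int K0 * (regs h1 10 - regs h2 10)" using 2(2) mono3 by (auto simp: postw_def)
    moreover have "int g3 <= 40 * int K0 * (regs h2 10 - regs h3 10) + (if regs h3 10 <= 0 then 40 * int (K0 * csz (WhilePos x c)) else 0)"
      using 3(2) True by (auto simp: postw_def)
    ultimately show ?thesis by linarith
  next
    case False
    then have "int g2 <= 40 * int K0 * (regs h1 10 - regs h2 10) + 40 * int (K0 * csz c)"
      using postw_bound[OF 2(2)] nn by (simp del: of_nat_mult split: if_splits)
    moreover have "int g3 <= 40 * int K0 * (regs h2 10 - regs h3 10) + int (K0 * csz (WhilePos x c))"
      using 3(2) False by (auto simp: postw_def)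
    moreover have "regs h3 10 <= 0" using False mono3 by linarith
    ultimately show ?thesis using cs nn by (simp del: of_nat_mult csz.simps)
  qed
  then have "int ?T <= 40 * int K0 * (regs h 10 - regs h3 10) + (if regs h3 10 <= 0 then 40 * int (K0 * csz (WhilePos x c)) else 0)"
    using t1' unfolding TT split by linarith
  then have "post (WhilePos x c) (1 + len ?v + t + u) s'' h ?T h3"
    using 2(2) 3(2) ck1 ch mono3 frame_trans[OF frame_trans[OF frame_trans[OF f0 1(4)]]]
    unfolding post_def postw_def by auto
  then show ?case using ex by blast
next
  case (WhileFalse s x c)
  note sim = \<open>sim s h\<close> and pos = \<open>0 < regs h 10\<close>
  let ?v = "regs s x"
  have x: "x < mr" using WhileFalse.prems by simp
  have ck: "2 * regs h 10 <= int B" by (rule simD[OF sim pos])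
  have lck: "len (regs h 10) <= b" using ck pos by (intro len_ck) auto
  have vx: "regs h (x + 1000) = ?v" and bs: "bs h" using sim x by (auto simp: sim_def)
  obtain g0 h0 where 0: "exec (setw (x + 1000)) h g0 h0" "h0 = h(|regs := (regs h)(99 := 0)|)" "g0 <= b + 6 + len ?v"
    using setw_exec[of h "x + 1000" ?v thesis] bs pos ck vx WhileFalse.hyps by auto
  have f0: "frame h h0" using 0(2) by (auto simp: frame_def)
  have sim0: "sim s h0" using sim 0(2) by (auto simp: sim_def bs_def vmem_regs)
  have pos0: "0 < regs h0 10" and ck0: "regs h0 10 = regs h 10" using pos 0(2) by auto
  obtain g1 h1 where 1: "exec (Seq ptick (chg (x + 1000))) h0 g1 h1"
    "h1 = h0(|regs := (regs h0)(10 := regs h0 10 - 1 - int (chv ?v))|)"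
    "sim s h1" "frame h0 h1" "g1 <= b + 5 + K0 * chv ?v" "chv ?v <= 8 * B + 1"
    using charge_step[OF sim0 pos0 x] by blast
  have ck1: "regs h1 10 = regs h 10 - 1 - int (chv ?v)" using 1(2) ck0 by simp
  have W: "exec (WhilePos 99 (Seq ptick (Seq (chg (x + 1000)) (Seq (sb c) (setw (x + 1000)))))) h0 (1 + len 0) h0"
    using exec.WhileFalse[of h0 99] 0(2) by auto
  have G: "exec (guard (Seq ptick (chg (x + 1000)))) h0 (1 + len (regs h0 10) + g1) h1"
    unfolding guard_def using pos0 1(1) by (intro exec.IfTrue)
  let ?T = "g0 + ((1 + len 0) + (1 + len (regs h0 10) + g1))"
  have ex: "exec (sb (WhilePos x c)) h ?T h1"
    unfolding sb.simps by (intro exec.Seq[OF 0(1)] exec.Seq[OF W] G)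
  have ch: "len ?v <= chv ?v" "chv ?v <= 8 * len ?v + 1" "1 <= chv ?v" by (rule chv_ge chv_le)+
  have t1: "?T <= 40 * (K0 * (1 + chv ?v))"
    using 0(3) 1(5) ch K0_ge(1,2) K0_ge(3)[of "chv ?v"] lck unfolding add_mult_distrib2 mult_1_right ck0 len0 by linarith
  have t1': "int ?T <= 40 * int K0 * (regs h 10 - regs h1 10)"
    using t1 unfolding ck1 by (simp add: algebra_simps flip: of_nat_le_iff[where 'a = int])
  moreover have "0 <= 40 * int (K0 * csz (WhilePos x c))" by simp
  ultimately have tt: "int ?T <= 40 * int K0 * (regs h 10 - regs h1 10) + (if regs h1 10 <= 0 then 40 * int (K0 * csz (WhilePos x c)) else 0)"
    by (simp only: split: if_split) linarith
  have "- int (18 * B + 20) <= regs h1 10" using ck1 1(6) pos by linarith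
  then have "post (WhilePos x c) (1 + len ?v) s h ?T h1"
    using 1(3) ck1 ch tt frame_trans[OF f0 1(4)] unfolding post_def by (auto simp: sim_def)
  then show ?case using ex by blast
qed

end

section \<open>Counting equal pairs by prefixes\<close>

definition rank :: "(nat => nat) => nat => nat => nat" where
  "rank a v y = card {j. j < y & a j = v}"

text \<open>The number of pairs \<open>(i, j)\<close> with \<open>i < x\<close>,
  \<open>j < y\<close> and equal values. Both orders and \<open>i = j\<close> are included, which
  makes it symmetric in the two prefixes.\<close>

definition gg :: "(nat => nat) => nat => nat => nat" where
  "gg a x y = (\<Sum>i<x. rank a (a i) y)"

lemma rank_0 [simp]: "rank a v 0 = 0"
  by (simp add: rank_def)

lemma rank_Suc: "rank a v (Suc y) = rank a v y + (if a y = v then 1 else 0)"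
proof -
  have "{j. j < Suc y & a j = v} = (if a y = v then insert y {j. j < y & a j = v} else {j. j < y & a j = v})"
    by (auto simp: less_Suc_eq)
  then show ?thesis by (simp add: rank_def)
qed

lemma rank_sum: "rank a v y = (\<Sum>j<y. if a j = v then 1 else 0)"
  by (induction y) (auto simp: rank_Suc)

lemma rank_mono: "x <= y ==> rank a v x <= rank a v y"
  unfolding rank_def by (intro card_mono) auto

lemma rank_le: "rank a v y <= y"
  by (induction y) (auto simp: rank_Suc)

text \<open>For occurrences of \<open>v\<close>, comparing positions amounts to comparing ranks; the
  binary search rests on this.\<close>

lemma rank_pos_iff: "a i = v ==> rank a v i < rank a v y \<longleftrightarrow> i < y"
proof
  assume "a i = v" "i < y"
  then show "rank a v i < rank a v y"
    using rank_mono[of "Suc i" y a v] by (simp add: rank_Suc)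
next
  assume "rank a v i < rank a v y"
  then show "i < y" using rank_mono[of y i a v] by (meson not_le)
qed

lemma rank_surj: "k < rank a v y ==> EX i<y. a i = v & rank a v i = k"
proof (induction y)
  case (Suc y)
  then show ?case by (cases "k < rank a v y") (auto simp: rank_Suc less_Suc_eq split: if_splits)
qed simp

lemma gg_Suc1: "gg a (Suc x) y = gg a x y + rank a (a x) y"
  by (simp add: gg_def)

lemma gg_sum: "gg a x y = (\<Sum>i<x. \<Sum>j<y. if a j = a i then 1 else 0)"
  by (simp add: gg_def rank_sum)

lemma gg_sym: "gg a x y = gg a y x"
  unfolding gg_sum by (subst sum.swap) (simp add: eq_commute)

lemma gg_Suc2: "gg a x (Suc y) = gg a x y + rank a (a y) x"
  using gg_Suc1[of a y x] by (simp add: gg_sym[of a x])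

lemma gg_le: "gg a x y <= x * y"
proof -
  have "gg a x y <= (\<Sum>i<x. y)" unfolding gg_def by (intro sum_mono rank_le)
  then show ?thesis by simp
qed

text \<open>The square of the interval from \<open>l - 1\<close> to \<open>r\<close> is obtained
  from products of prefixes by inclusion and exclusion. It contains each wanted pair twice and
  \<open>r - l + 1\<close> diagonal pairs. The additive form avoids truncated subtraction; the array
  \<open>A\<close> counts from 1, \<open>a\<close> from 0.\<close>

lemma eq_pairs_gg:
  assumes "1 <= l" "l <= r" "\<And>i j. i < r ==> j < r ==> a i = a j \<longleftrightarrow> A (Suc i) = A (Suc j)"
  shows "gg a r r + gg a (l - 1) (l - 1) = 2 * gg a (l - 1) r + 2 * eq_pairs A l r + (r - l + 1)"
proof -
  define f where "f = (%i j. (if a j = a i then 1 else 0) :: nat)"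
  define k where "k = l - 1"
  have kr: "k <= r" using assms by (simp add: k_def)
  have g: "gg a x y = (\<Sum>i<x. \<Sum>j<y. f i j)" for x y by (simp add: gg_sum f_def)
  have sp: "{..<r} = {..<k} \<union> {k..<r}" "{..<k} \<inter> {k..<r} = {}" using kr by auto
  have s: "(\<Sum>i<r. h i) = (\<Sum>i<k. h i) + (\<Sum>i=k..<r. h i)" for h :: "nat => nat"
    unfolding sp(1) by (rule sum.union_disjoint) auto
  have sym: "(\<Sum>i=k..<r. \<Sum>j<k. f i j) = (\<Sum>i<k. \<Sum>j=k..<r. f i j)"
    by (subst sum.swap) (simp add: f_def eq_commute)
  define C where "C = (\<Sum>i=k..<r. \<Sum>j=k..<r. f i j)"
  have rr: "gg a r r + gg a k k = 2 * gg a k r + C"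
    unfolding g C_def s sum.distrib sym by simp
  let ?S = "%R. {(i, j). k <= i & i < r & k <= j & j < r & R i j & a i = a j}"
  have fin: "finite (?S R)" for R
    by (rule finite_subset[of _ "{..<r} \<times> {..<r}"]) auto
  have "C = card (SIGMA i:{k..<r}. {j \<in> {k..<r}. a j = a i})"
    by (simp add: C_def f_def sum.If_cases Int_def)
  also have "(SIGMA i:{k..<r}. {j \<in> {k..<r}. a j = a i}) = ?S (<) \<union> (?S (>) \<union> ?S (=))"
    by (auto simp: not_less)
  also have "card \<dots> = card (?S (<)) + card (?S (>) \<union> ?S (=))"
    by (intro card_Un_disjoint fin finite_UnI) auto
  also have "card (?S (>) \<union> ?S (=)) = card (?S (>)) + card (?S (=))"
    by (intro card_Un_disjoint fin) auto
  also have "?S (>) = prod.swap ` ?S (<)" by (auto simp: image_iff)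
  also have "card (prod.swap ` ?S (<)) = card (?S (<))" by (intro card_image) (auto simp: inj_on_def)
  also have "?S (=) = (%i. (i, i)) ` {k..<r}" by auto
  also have "card \<dots> = r - k" by (subst card_image) (auto simp: inj_on_def)
  also have "card (?S (<)) = eq_pairs A l r"
  proof -
    have "{(i, j). l <= i & i < j & j <= r & A i = A j} = map_prod Suc Suc ` ?S (<)"
    proof (intro set_eqI iffI)
      fix p assume "p \<in> {(i, j). l <= i & i < j & j <= r & A i = A j}"
      then obtain i j where p: "p = (i, j)" "l <= i" "i < j" "j <= r" "A i = A j" by auto
      then have "(i - 1, j - 1) \<in> ?S (<)" using assms by (auto simp: k_def)
      moreover have "p = map_prod Suc Suc (i - 1, j - 1)" using p assms by auto
      ultimately show "p \<in> map_prod Suc Suc ` ?S (<)" by blast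
    next
      fix p assume "p \<in> map_prod Suc Suc ` ?S (<)"
      then show "p \<in> {(i, j). l <= i & i < j & j <= r & A i = A j}" using assms by (auto simp: k_def)
    qed
    then show ?thesis unfolding eq_pairs_def
      by (simp add: card_image inj_on_def map_prod_def split_beta prod_eq_iff)
  qed
  finally have "C = 2 * eq_pairs A l r + (r - k)" by simp
  then show ?thesis using rr assms unfolding k_def by simp
qed

section \<open>Tables in memory\<close>

text \<open>A pairing function that is a polynomial, so that addresses are expressions of small
  degree. It is injective on nonnegative arguments since \<open>y <= x + y\<close> is below the gap
  \<open>2 * (x + y) + 1\<close> between consecutive squares.\<close>

definition pr :: "int => int => int" where
  "pr x y = (x + y) * (x + y) + y"

lemma pr_nonneg: "0 <= x ==> 0 <= y ==> 0 <= pr x y"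
  by (simp add: pr_def)

lemma pr_inj:
  assumes "0 <= x" "0 <= y" "0 <= x'" "0 <= y'" "pr x y = pr x' y'"
  shows "x = x' & y = y'"
proof -
  have le: "x' + y' <= x + y" if "0 <= x" "0 <= y" "0 <= x'" "0 <= y'" "pr x y = pr x' y'" for x y x' y' :: int
  proof (rule ccontr)
    assume "\<not> x' + y' <= x + y"
    then have 1: "x + y + 1 <= x' + y'" by simp
    have "(x + y + 1) * (x + y + 1) <= (x' + y') * (x' + y')" using 1 that by (intro mult_mono) auto
    then have "pr x y < pr x' y'" using that by (simp add: pr_def algebra_simps)
    then show False using that by simp
  qed
  have "x + y = x' + y'" using le[OF assms] le[OF assms(3,4,1,2) assms(5)[symmetric]] by simp
  then show ?thesis using assms(5) by (simp add: pr_def)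
qed

text \<open>Entry \<open>(x, y)\<close> of table \<open>t\<close>; \<open>w\<close> is the number of
  the construction that owns the table, 0 for the permanent ones.\<close>

definition loc :: "int => int => int => int => int => int" where
  "loc n t w x y = cell n (pr (pr w x) y) t"

lemma loc_eq_iff:
  assumes "0 <= n" "0 <= t" "t < 16" "0 <= t'" "t' < 16" "0 <= w" "0 <= x" "0 <= y" "0 <= w'" "0 <= x'" "0 <= y'"
  shows "loc n t w x y = loc n t' w' x' y' \<longleftrightarrow> t = t' & w = w' & x = x' & y = y'"
  using cell_eq_iff[OF assms(1-5)] pr_inj[of "pr w x" y "pr w' x'" y'] pr_inj[of w x w' x'] pr_nonneg assms
  unfolding loc_def by auto

lemma loc_cell_neq:
  assumes "0 <= n" "0 <= t" "t < 16" "0 <= t'" "t' < 16" "t ~= t'"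
  shows "loc n t w x y ~= cell n k t'"
  using cell_eq_iff[OF assms(1-5)] assms(6) unfolding loc_def by auto

definition pE :: "aexp => aexp => aexp" where
  "pE a b = eadd (emul (eadd a b) (eadd a b)) b"

definition cellE :: "aexp => int => aexp" where
  "cellE k t = eadd (eadd (emul (eadd (V 2) (N 16)) k) (V 2)) (N t)"

definition locE :: "int => aexp => aexp => aexp => aexp" where
  "locE t w x y = cellE (pE (pE w x) y) t"

lemma ev_pE: "ev (pE a b) R = pr (ev a R) (ev b R)"
  by (simp add: pE_def pr_def)

lemma ev_cellE: "ev (cellE k t) R = cell (R 2) (ev k R) t"
  by (simp add: cellE_def cell_def)

lemma ev_locE: "ev (locE t w x y) R = loc (R 2) t (ev w R) (ev x R) (ev y R)"
  by (simp add: locE_def loc_def ev_pE ev_cellE)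

lemma deg_pE: "deg (pE a b) = 2 * max (deg a) (deg b) + 3"
  by (auto simp: pE_def max_def)

lemma deg_cellE: "deg (cellE k t) = deg k + 4"
  by (simp add: cellE_def)

lemma deg_locE: "deg (locE t w x y) = 2 * max (2 * max (deg w) (deg x) + 3) (deg y) + 7"
  by (simp add: locE_def deg_pE deg_cellE)

lemma wf_pE: "wf_aexp (pE a b) \<longleftrightarrow> wf_aexp a & wf_aexp b"
  by (auto simp: pE_def)

lemma wf_cellE: "wf_aexp (cellE k t) \<longleftrightarrow> wf_aexp k & \<bar>t\<bar> <= 100"
  by (auto simp: cellE_def)

lemma wf_locE: "wf_aexp (locE t w x y) \<longleftrightarrow> wf_aexp w & wf_aexp x & wf_aexp y & \<bar>t\<bar> <= 100"
  by (auto simp: locE_def wf_pE wf_cellE)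

lemma esz_pE: "esz (pE a b) = 2 * esz a + 3 * esz b + 8"
  by (simp add: pE_def)

lemma esz_cellE: "esz (cellE k t) = esz k + 14"
  by (simp add: cellE_def)

lemma esz_locE: "esz (locE t w x y) = 4 * esz w + 6 * esz x + 3 * esz y + 38"
  by (simp add: locE_def esz_pE esz_cellE)

lemmas locE_simps = ev_locE deg_locE wf_locE esz_locE ev_cellE deg_cellE wf_cellE esz_cellE

text \<open>The memory \<open>m\<close> with all entries of one table replaced by \<open>F\<close>.
  A loop that fills a table thus changes only \<open>F\<close>. The choice operator inverts
  \<open>loc\<close>, which is injective on these arguments.\<close>

definition utab :: "int => (int => int) => int => int => (nat => nat => int) => int => int" where
  "utab n m t w F z = (if EX x y. z = loc n t w (int x) (int y)
     then F (fst (SOME p. z = loc n t w (int (fst p)) (int (snd p)))) (snd (SOME p. z = loc n t w (int (fst p)) (int (snd p))))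
     else m z)"

lemma utab_same:
  assumes "0 <= n" "0 <= t" "t < 16" "0 <= w"
  shows "utab n m t w F (loc n t w (int x) (int y)) = F x y"
proof -
  have "(loc n t w (int x) (int y) = loc n t w (int (fst p)) (int (snd p))) \<longleftrightarrow> p = (x, y)" for p
    using loc_eq_iff[OF assms(1-3) assms(2,3), of w "int x" "int y" w "int (fst p)" "int (snd p)"] assms(4)
    by (auto simp: prod_eq_iff)
  then show ?thesis by (auto simp: utab_def)
qed

lemma utab_other: "(\<And>x y. z ~= loc n t w (int x) (int y)) ==> utab n m t w F z = m z"
  by (auto simp: utab_def)

lemma utab_loc:
  assumes "0 <= n" "0 <= t" "t < 16" "0 <= w" "0 <= t'" "t' < 16" "0 <= w'"
  shows "utab n m t w F (loc n t' w' (int x) (int y)) = (if t' = t & w' = w then F x y else m (loc n t' w' (int x) (int y)))"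
proof (cases "t' = t & w' = w")
  case False
  then show ?thesis using assms by (subst utab_other) (auto simp: loc_eq_iff)
qed (use assms in \<open>auto simp: utab_same\<close>)

lemma utab_upd:
  assumes "0 <= n" "0 <= t" "t < 16" "0 <= w"
  shows "(utab n m t w F)(loc n t w (int x) (int y) := v) = utab n m t w (%x' y'. if x' = x & y' = y then v else F x' y')"
proof
  fix z
  show "((utab n m t w F)(loc n t w (int x) (int y) := v)) z = utab n m t w (%x' y'. if x' = x & y' = y then v else F x' y') z"
  proof (cases "EX x y. z = loc n t w (int x) (int y)")
    case True
    then show ?thesis using assms by (auto simp: utab_same loc_eq_iff)
  next
    case False
    then have o: "utab n m t w G z = m z" for G by (intro utab_other) auto
    show ?thesis using False by (auto simp: o)
  qed
qed

lemma utab_upd_other: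
  assumes "0 <= n" "0 <= t" "t < 16" "0 <= w" "0 <= t'" "t' < 16" "0 <= w'" "0 <= x" "0 <= y" "t' ~= t"
  shows "(utab n m t w F)(loc n t' w' x y := v) = utab n (m(loc n t' w' x y := v)) t w F"
proof
  fix z
  show "((utab n m t w F)(loc n t' w' x y := v)) z = utab n (m(loc n t' w' x y := v)) t w F z"
  proof (cases "EX x y. z = loc n t w (int x) (int y)")
    case True
    then show ?thesis using assms by (auto simp: utab_same loc_eq_iff)
  next
    case False
    then show ?thesis by (auto simp: utab_other)
  qed
qed

text \<open>Brings the current memory into the form required by the loop invariants.\<close>

lemma utab_id: "utab n m t w (%x y. m (loc n t w (int x) (int y))) = m"
proof
  fix z
  show "utab n m t w (%x y. m (loc n t w (int x) (int y))) z = m z"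
  proof (cases "EX x y. z = loc n t w (int x) (int y)")
    case True
    then have "EX p. z = loc n t w (int (fst p)) (int (snd p))" by auto
    from someI_ex[OF this] show ?thesis using True by (simp add: utab_def)
  qed (auto simp: utab_other)
qed

section \<open>Register frames and ranks by binary search\<close>

definition fr :: "nat set => state => state => bool" where
  "fr T s s' \<longleftrightarrow> (ALL r. r \<notin> T --> regs s' r = regs s r)"

lemma frD: "fr T s s' ==> r \<notin> T ==> regs s' r = regs s r"
  by (simp add: fr_def)

lemma fr_trans: "fr T s s' ==> fr T' s' s'' ==> T \<subseteq> T'' ==> T' \<subseteq> T'' ==> fr T'' s s''"
  unfolding fr_def by (metis subsetD)

lemma fr_upd: "fr T s s' ==> r \<in> T ==> fr T s (s'(|regs := (regs s')(r := v)|))"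
  by (auto simp: fr_def)

text \<open>Counts the occurrences of the value \<open>R[40]\<close> before position
  \<open>R[41]\<close> by bisecting its list of positions; the answer stays between
  \<open>R[42]\<close> and \<open>R[43]\<close>.\<close>

definition rankc :: com where
  "rankc = Seq (blk [As 42 (N 0), Ld 43 (locE 5 (N 0) (N 0) (V 40))])
    (For 44 3 (IfE (esub (V 43) (V 42))
      (Seq (blk [As 45 (ediv (eadd (V 42) (V 43)) (N 2)), Ld 46 (locE 6 (N 0) (V 40) (V 45))])
        (IfE (esub (V 41) (V 46)) (blk [As 42 (eadd (V 45) (N 1))]) (blk [As 43 (V 45)]))) Skip))"

locale tabs = mbound U \<beta> for U \<beta> +
  fixes n L :: nat and a :: "nat => nat"
  assumes n1: "1 <= n" and nnU: "4 * (int n * int n + int n + 10) <= U" and aid: "\<And>i. i < n ==> a i <= n"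
    and nL: "n < 2 ^ L" and LU: "int L <= U"
begin

definition base :: "(int => int) => bool" where
  "base m \<longleftrightarrow> (ALL i<n. m (loc (int n) 4 0 0 (int i)) = int (a i)) &
     (ALL v<=n. m (loc (int n) 5 0 0 (int v)) = int (rank a v n)) &
     (ALL i<n. m (loc (int n) 6 0 (int (a i)) (int (rank a (a i) i))) = int i)"

lemma nU: "int n <= U" "int n * int n <= U" "int n + 1 <= U"
proof -
  have aux: "N <= U & q <= U & N + 1 <= U" if "0 <= q" "0 <= N" "4 * (q + N + 10) <= U" for q N :: int
    using that by auto
  have "int n <= U & int n * int n <= U & int n + 1 <= U"
    by (rule aux) (use nnU in auto)
  then show "int n <= U" "int n * int n <= U" "int n + 1 <= U" by auto
qed

lemma run_rankc:
  assumes g: "good s" and b: "base (mem s)" and r: "regs s 2 = int n" "regs s 3 = int L"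
    "regs s 40 = int v" "regs s 41 = int y" and vy: "v <= n" "y <= n"
  shows "run w rankc (400 * (L + 1)) s (%s'. good s' & mem s' = mem s & regs s' 42 = int (rank a v y) & fr {42..46} s s')"
proof -
  let ?b1 = "[As 42 (N 0), Ld 43 (locE 5 (N 0) (N 0) (V 40))]"
  let ?b2 = "[As 45 (ediv (eadd (V 42) (V 43)) (N 2)), Ld 46 (locE 6 (N 0) (V 40) (V 45))]"
  define R where "R = rank a v n"
  define c where "c = rank a v y"
  have cR: "c <= R" unfolding c_def R_def using vy by (intro rank_mono)
  have Rn: "R <= n" unfolding R_def by (rule rank_le)
  have m5: "mem s (loc (int n) 5 0 0 (int v)) = int R" using b vy by (simp add: base_def R_def)
  \<comment> \<open>The interval has length at most \<open>R / 2 ^ j\<close>. As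
    \<open>R <= n < 2 ^ L\<close>, it has shrunk to a point after \<open>L\<close> rounds.\<close>
  define J where "J = (%j (s'::state). EX lo hi. regs s' 42 = int lo & regs s' 43 = int hi & lo <= c & c <= hi & hi <= R &
      (hi - lo) * 2 ^ j <= R & mem s' = mem s & fr {42..46} s s')"
  have body: "run w (IfE (esub (V 43) (V 42)) (Seq (blk ?b2)
        (IfE (esub (V 41) (V 46)) (blk [As 42 (eadd (V 45) (N 1))]) (blk [As 43 (V 45)]))) Skip) 200 s'
       (%s''. good s'' & regs s'' 44 = int j & regs s'' 3 = int L & J (Suc j) (s''(|regs := (regs s'')(44 := int (Suc j))|)))"
    if j: "j < L" and g': "good s'" and Js: "J j s'" and r44: "regs s' 44 = int j" and r3: "regs s' 3 = int L" for j s'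
  proof -
    obtain lo hi where lh: "regs s' 42 = int lo" "regs s' 43 = int hi" "lo <= c" "c <= hi" "hi <= R"
      "(hi - lo) * 2 ^ j <= R" "mem s' = mem s" "fr {42..46} s s'" using Js unfolding J_def by blast
    have rr: "regs s' 2 = int n" "regs s' 40 = int v" "regs s' 41 = int y" using lh(8) r by (auto simp: frD)
    have "run w (IfE (esub (V 43) (V 42)) (Seq (blk ?b2)
        (IfE (esub (V 41) (V 46)) (blk [As 42 (eadd (V 45) (N 1))]) (blk [As 43 (V 45)]))) Skip)
        (esz (esub (V 43) (V 42)) + 2 + (bsz ?b2 + (esz (esub (V 41) (V 46)) + 2 + 8))) s'
       (%s''. good s'' & regs s'' 44 = int j & regs s'' 3 = int L & J (Suc j) (s''(|regs := (regs s'')(44 := int (Suc j))|)))"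
    proof (rule run_IfE)
      assume "ev (esub (V 43) (V 42)) (regs s') > 0"
      then have lt: "lo < hi" using lh by simp
      define mid where "mid = (lo + hi) div 2"
      have mid: "lo <= mid" "mid < hi" "mid < R" using lt lh(5) by (auto simp: mid_def)
      have midi: "(int lo + int hi) div 2 = int mid" by (simp add: mid_def)
      obtain i where i: "i < n" "a i = v" "rank a v i = mid" using rank_surj[of mid a v n] mid(3) by (auto simp: R_def)
      have m6: "mem s (loc (int n) 6 0 (int v) (int mid)) = int i" using b i unfolding base_def by blast
      have im: "i < y \<longleftrightarrow> mid < c" using rank_pos_iff[of a i v y] i(2,3) by (simp add: c_def)
      have half: "(mid - lo) * 2 ^ Suc j <= R" "(hi - Suc mid) * 2 ^ Suc j <= R"
      proof -
        have "2 * (mid - lo) <= hi - lo" "2 * (hi - Suc mid) <= hi - lo" by (auto simp: mid_def)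
        from this[THEN mult_le_mono1, of "2 ^ j"] show "(mid - lo) * 2 ^ Suc j <= R" "(hi - Suc mid) * 2 ^ Suc j <= R" using lh(6) by (simp_all add: algebra_simps)
      qed
      have bb: "int mid <= U" "int i <= U" "int mid + 1 <= U" using mid(3) Rn i nU by linarith+
      show "run w (Seq (blk ?b2) (IfE (esub (V 41) (V 46)) (blk [As 42 (eadd (V 45) (N 1))]) (blk [As 43 (V 45)])))
        (bsz ?b2 + (esz (esub (V 41) (V 46)) + 2 + 8)) s'
        (%s''. good s'' & regs s'' 44 = int j & regs s'' 3 = int L & J (Suc j) (s''(|regs := (regs s'')(44 := int (Suc j))|)))"
      proof (rule run_blkS[OF g'])
        define s2 where "s2 = exb ?b2 s'"
        have s2: "regs s2 45 = int mid" "regs s2 46 = int i" "mem s2 = mem s" "fr {45, 46} s' s2"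
          using lh rr midi m6 by (simp_all add: s2_def ev_locE fr_def)
        show "\<forall>i\<in>set ?b2. ok_ins i" by (simp add: ok_exp_def locE_simps)
        show "bnb ?b2 s'" using lh rr midi m6 bb by (simp add: ev_locE)
        assume "good (exb ?b2 s')"
        then have g2: "good s2" by (simp add: s2_def)
        have r2: "regs s2 41 = int y" "regs s2 42 = int lo" "regs s2 43 = int hi" "regs s2 44 = int j" "regs s2 3 = int L"
          using s2(4) rr lh r44 r3 by (auto simp: frD)
        have f2: "fr {42..46} s s2" by (rule fr_trans[OF lh(8) s2(4)]) auto
        show "run w (IfE (esub (V 41) (V 46)) (blk [As 42 (eadd (V 45) (N 1))]) (blk [As 43 (V 45)]))
          (esz (esub (V 41) (V 46)) + 2 + 8) (exb ?b2 s')
          (%s''. good s'' & regs s'' 44 = int j & regs s'' 3 = int L & J (Suc j) (s''(|regs := (regs s'')(44 := int (Suc j))|)))"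
          unfolding s2_def[symmetric]
        proof (rule run_IfE[OF g2])
          assume "ev (esub (V 41) (V 46)) (regs s2) > 0"
          then have "mid < c" using im r2 s2 by simp
          show "run w (blk [As 42 (eadd (V 45) (N 1))]) 8 s2 (%s''. good s'' & regs s'' 44 = int j & regs s'' 3 = int L & J (Suc j) (s''(|regs := (regs s'')(44 := int (Suc j))|)))"
          proof (rule run_mono[OF run_blk[OF g2, where Q = "%s'. s' = exb [As 42 (eadd (V 45) (N 1))] s2 & good s'"]])
            fix s3 assume s3: "s3 = exb [As 42 (eadd (V 45) (N 1))] s2 & good s3"
            have "J (Suc j) (s3(|regs := (regs s3)(44 := int (Suc j))|))"
              unfolding J_def
              by (rule exI[of _ "Suc mid"], rule exI[of _ hi])
                 (use s3 s2 r2 f2 lh half \<open>mid < c\<close> in \<open>auto simp: fr_def\<close>)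
            then show "good s3 & regs s3 44 = int j & regs s3 3 = int L & J (Suc j) (s3(|regs := (regs s3)(44 := int (Suc j))|))"
              using s3 r2 by auto
          qed (use s2 bb in \<open>auto simp: ok_exp_def\<close>)
        next
          assume "ev (esub (V 41) (V 46)) (regs s2) <= 0"
          then have "c <= mid" using im r2 s2 by simp
          show "run w (blk [As 43 (V 45)]) 8 s2 (%s''. good s'' & regs s'' 44 = int j & regs s'' 3 = int L & J (Suc j) (s''(|regs := (regs s'')(44 := int (Suc j))|)))"
          proof (rule run_mono[OF run_blk[OF g2, where Q = "%s'. s' = exb [As 43 (V 45)] s2 & good s'"]])
            fix s3 assume s3: "s3 = exb [As 43 (V 45)] s2 & good s3"
            have "J (Suc j) (s3(|regs := (regs s3)(44 := int (Suc j))|))"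
              unfolding J_def
              by (rule exI[of _ lo], rule exI[of _ mid])
                 (use s3 s2 r2 f2 lh half mid \<open>c <= mid\<close> in \<open>auto simp: fr_def\<close>)
            then show "good s3 & regs s3 44 = int j & regs s3 3 = int L & J (Suc j) (s3(|regs := (regs s3)(44 := int (Suc j))|))"
              using s3 r2 by auto
          qed (use s2 bb in \<open>auto simp: ok_exp_def\<close>)
        qed (simp add: ok_exp_def)
      qed
    next
      assume "ev (esub (V 43) (V 42)) (regs s') <= 0"
      then have eq: "lo = hi" "hi = c" using lh by simp_all
      have "J (Suc j) (s'(|regs := (regs s')(44 := int (Suc j))|))"
        unfolding J_def by (rule exI[of _ lo], rule exI[of _ hi]) (use lh eq in \<open>auto simp: fr_def\<close>)
      then have "run w Skip 1 s' (%s''. good s'' & regs s'' 44 = int j & regs s'' 3 = int L & J (Suc j) (s''(|regs := (regs s'')(44 := int (Suc j))|)))"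
        using w1 g' r44 r3 by (intro run_Skip) auto
      then show "run w Skip (bsz ?b2 + (esz (esub (V 41) (V 46)) + 2 + 8)) s' (%s''. good s'' & regs s'' 44 = int j & regs s'' 3 = int L & J (Suc j) (s''(|regs := (regs s'')(44 := int (Suc j))|)))"
        by (rule run_mono) auto
    qed (use g' in \<open>auto simp: ok_exp_def\<close>)
    then show ?thesis by (rule run_mono) (auto simp: esz_locE)
  qed
  have "run w rankc (bsz ?b1 + (L * (200 + 20) + 20)) s (%s'. good s' & mem s' = mem s & regs s' 42 = int (rank a v y) & fr {42..46} s s')"
    unfolding rankc_def
  proof (rule run_blkS[OF g])
    show "\<forall>i\<in>set ?b1. ok_ins i" by (simp add: ok_exp_def locE_simps)
    show "bnb ?b1 s" using r m5 Rn nU by (simp add: ev_locE)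
    assume g1: "good (exb ?b1 s)"
    show "run w (For 44 3 (IfE (esub (V 43) (V 42)) (Seq (blk ?b2)
        (IfE (esub (V 41) (V 46)) (blk [As 42 (eadd (V 45) (N 1))]) (blk [As 43 (V 45)]))) Skip)) (L * (200 + 20) + 20) (exb ?b1 s)
        (%s'. good s' & mem s' = mem s & regs s' 42 = int (rank a v y) & fr {42..46} s s')"
    proof (rule run_mono[OF run_For[where I = J, OF g1 _ _ _ _ _ body]])
      show "J 0 (exb ?b1 s(|regs := (regs (exb ?b1 s))(44 := 0)|))"
        unfolding J_def by (rule exI[of _ 0], rule exI[of _ R])
          (use r m5 cR in \<open>auto simp: ev_locE fr_def\<close>)
      fix s' assume "good s' & regs s' 44 = int L & regs s' 3 = int L & J L s'"
      then obtain lo hi where lh: "good s'" "regs s' 42 = int lo" "lo <= c" "c <= hi"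
        "(hi - lo) * 2 ^ L <= R" "mem s' = mem s" "fr {42..46} s s'" unfolding J_def by blast
      have "lo = c"
      proof (rule ccontr)
        assume "lo ~= c"
        then have "1 * 2 ^ L <= (hi - lo) * 2 ^ L" using lh by (intro mult_le_mono1) auto
        then show False using lh Rn nL by linarith
      qed
      then show "good s' & mem s' = mem s & regs s' 42 = int (rank a v y) & fr {42..46} s s'"
        using lh by (simp add: c_def)
    qed (use r in auto)
  qed
  then show ?thesis by (rule run_mono) (auto simp: esz_locE)
qed

end

context mbound begin

lemma run_For_blk:
  assumes "good s" "i < 100" "h < 100" "i ~= h" "regs s h = int M" "\<forall>i\<in>set is. ok_ins i"
    "I 0 (s(|regs := (regs s)(i := 0)|))"
    and step: "\<And>j s'. j < M ==> good s' ==> I j s' ==> regs s' i = int j ==> regs s' h = int M ==>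
      bnb is s' & regs (exb is s') i = int j & regs (exb is s') h = int M &
        I (Suc j) ((exb is s')(|regs := (regs (exb is s'))(i := int (Suc j))|))"
  shows "run w (For i h (blk is)) (M * (bsz is + 20) + 20) s (%s'. good s' & regs s' i = int M & regs s' h = int M & I M s')"
proof (rule run_For[where I = I, OF assms(1-5,7)])
  fix j s' assume *: "j < M" "good s'" "I j s'" "regs s' i = int j" "regs s' h = int M"
  show "run w (blk is) (bsz is) s' (%s''. good s'' & regs s'' i = int j & regs s'' h = int M &
        I (Suc j) (s''(|regs := (regs s'')(i := int (Suc j))|)))"
    using step[OF *] *(2) assms(6) by (intro run_blk) auto
qed

end

definition addranks :: "nat => nat => nat => com" where
  "addranks h p c = For 39 h (Seq (blk [Ld 40 (locE 4 (N 0) (N 0) (eadd (V p) (V 39))), As 41 (V c)])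
     (Seq rankc (blk [As 32 (eadd (V 32) (V 42))])))"

text \<open>Both prefixes are rounded down to whole blocks, for which the table has the answer. Then
  the first and afterwards the second prefix is extended position by position, each position adding
  its rank in the other prefix.\<close>

definition gcode :: com where
  "gcode = Seq (blk [As 33 (ediv (V 30) (V 7)), As 34 (ediv (V 31) (V 7)), Ld 32 (locE 10 (V 9) (V 33) (V 34)),
       As 35 (emul (V 33) (V 7)), As 36 (emul (V 34) (V 7)), As 37 (esub (V 30) (V 35)), As 38 (esub (V 31) (V 36))])
     (Seq (addranks 37 35 36) (addranks 38 36 30))"

context tabs begin

lemma run_addranks:
  assumes g: "good s" and b: "base (mem s)" and r: "regs s 2 = int n" "regs s 3 = int L"
    "regs s h = int H" "regs s p = int P" "regs s c = int C" "regs s 32 = int Z"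
    and hpc: "h \<in> {30..38}" "p \<in> {30..38}" "c \<in> {30..38}" "h ~= 32" "p ~= 32" "c ~= 32"
    and le: "P + H <= n" "C <= n" "int (Z + (\<Sum>t<H. rank a (a (P + t)) C)) <= U"
  shows "run w (addranks h p c) (H * (400 * (L + 1) + 150) + 20) s (%s'. good s' & mem s' = mem s &
     regs s' 32 = int (Z + (\<Sum>t<H. rank a (a (P + t)) C)) & fr ({32} \<union> {39..46}) s s')"
proof -
  let ?T = "({32} \<union> {39..46}) :: nat set"
  let ?b1 = "[Ld 40 (locE 4 (N 0) (N 0) (eadd (V p) (V 39))), As 41 (V c)]"
  define J where "J = (%j (s'::state). mem s' = mem s & regs s' 32 = int (Z + (\<Sum>t<j. rank a (a (P + t)) C)) & fr ?T s s')"
  have body: "run w (Seq (blk ?b1) (Seq rankc (blk [As 32 (eadd (V 32) (V 42))]))) (400 * (L + 1) + 130) s'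
       (%s''. good s'' & regs s'' 39 = int j & regs s'' h = int H & J (Suc j) (s''(|regs := (regs s'')(39 := int (Suc j))|)))"
    if j: "j < H" and g': "good s'" and Js: "J j s'" and r39: "regs s' 39 = int j" and rh: "regs s' h = int H" for j s'
  proof -
    have f: "fr ?T s s'" and m: "mem s' = mem s" and r32: "regs s' 32 = int (Z + (\<Sum>t<j. rank a (a (P + t)) C))"
      using Js by (auto simp: J_def)
    have rr: "regs s' 2 = int n" "regs s' 3 = int L" "regs s' p = int P" "regs s' c = int C"
      using frD[OF f, of 2] frD[OF f, of 3] frD[OF f, of p] frD[OF f, of c] r hpc by auto
    have pj: "P + j < n" using j le by simp
    have ma: "mem s (loc (int n) 4 0 0 (int P + int j)) = int (a (P + j))"
      using b pj unfolding base_def by (metis of_nat_add)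
    define s1 where "s1 = exb ?b1 s'"
    have s1: "regs s1 40 = int (a (P + j))" "regs s1 41 = int C" "mem s1 = mem s" "fr {40, 41} s' s1"
      using rr r39 ma m hpc by (auto simp: s1_def ev_locE fr_def)
    have f1: "fr ?T s s1" by (rule fr_trans[OF f s1(4)]) auto
    have bb: "int (a (P + j)) <= U" "int C <= U" using aid[OF pj] le nU by linarith+
    have bs: "bsz ?b1 + (400 * (L + 1) + 9) <= 400 * (L + 1) + 130" by (simp add: esz_locE)
    show ?thesis
    proof (rule run_mono[OF run_blkS[OF g'] bs])
      show "\<forall>i\<in>set ?b1. ok_ins i" using hpc by (auto simp: ok_exp_def locE_simps)
      show "bnb ?b1 s'" using rr r39 ma m bb hpc by (auto simp: ev_locE)
      assume "good (exb ?b1 s')"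
      then have g1: "good s1" by (simp add: s1_def)
      have q: "run w rankc (400 * (L + 1)) s1 (%s'. good s' & mem s' = mem s1 & regs s' 42 = int (rank a (a (P + j)) C) & fr {42..46} s1 s')"
        using g1 s1 b rr frD[OF s1(4), of 2] frD[OF s1(4), of 3] aid[OF pj] le by (intro run_rankc) auto
      show "run w (Seq rankc (blk [As 32 (eadd (V 32) (V 42))])) (400 * (L + 1) + 9) (exb ?b1 s')
         (%s''. good s'' & regs s'' 39 = int j & regs s'' h = int H & J (Suc j) (s''(|regs := (regs s'')(39 := int (Suc j))|)))"
        unfolding s1_def[symmetric]
      proof (rule run_Seq, rule run_mono[OF q order_refl])
        fix s2 assume s2: "good s2 & mem s2 = mem s1 & regs s2 42 = int (rank a (a (P + j)) C) & fr {42..46} s1 s2"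
        have f2: "fr ?T s s2" by (rule fr_trans[OF f1, where T' = "{42..46}"]) (use s2 in auto)
        have r2: "regs s2 32 = int (Z + (\<Sum>t<j. rank a (a (P + t)) C))" "regs s2 39 = int j" "regs s2 h = int H"
          using frD[OF conjunct2[OF conjunct2[OF conjunct2[OF s2]]]] frD[OF s1(4)] r32 r39 rh hpc by auto
        have "(\<Sum>t<Suc j. rank a (a (P + t)) C) <= (\<Sum>t<H. rank a (a (P + t)) C)"
          using j by (intro sum_mono2) auto
        then have "int (Z + (\<Sum>t<Suc j. rank a (a (P + t)) C)) <= U" using le(3) by linarith
        then have U: "int (Z + (\<Sum>t<j. rank a (a (P + t)) C)) + int (rank a (a (P + j)) C) <= U" by simp
        have eq: "bsz [As 32 (eadd (V 32) (V 42))] = 9" by simp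
        have g2: "good s2" using s2 by simp
        have v: "ev (eadd (V 32) (V 42)) (regs s2) = int (Z + (\<Sum>t<Suc j. rank a (a (P + t)) C))"
          using s2 r2 by simp
        show "run w (blk [As 32 (eadd (V 32) (V 42))]) 9 s2
          (%s''. good s'' & regs s'' 39 = int j & regs s'' h = int H & J (Suc j) (s''(|regs := (regs s'')(39 := int (Suc j))|)))"
          unfolding eq[symmetric]
        proof (rule run_blk[OF g2])
          have "\<bar>ev (eadd (V 32) (V 42)) (regs s2)\<bar> <= U"
            unfolding v abs_of_nat using \<open>int (Z + (\<Sum>t<Suc j. rank a (a (P + t)) C)) <= U\<close> .
          then show "bnb [As 32 (eadd (V 32) (V 42))] s2" by (simp only: bnb.simps inb.simps simp_thms)
          assume g3: "good (exb [As 32 (eadd (V 32) (V 42))] s2)"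
          show "good (exb [As 32 (eadd (V 32) (V 42))] s2) & regs (exb [As 32 (eadd (V 32) (V 42))] s2) 39 = int j &
             regs (exb [As 32 (eadd (V 32) (V 42))] s2) h = int H &
             J (Suc j) ((exb [As 32 (eadd (V 32) (V 42))] s2)(|regs := (regs (exb [As 32 (eadd (V 32) (V 42))] s2))(39 := int (Suc j))|))"
            using g3 r2 s2 s1(3) f2 hpc by (auto simp: J_def fr_def)
        qed (simp add: ok_exp_def)
      qed
    qed
  qed
  have "run w (addranks h p c) (H * (400 * (L + 1) + 130 + 20) + 20) s
     (%s'. good s' & regs s' 39 = int H & regs s' h = int H & J H s')"
    unfolding addranks_def
    by (rule run_For[where I = J, OF g _ _ _ r(3) _ body]) (use hpc r in \<open>auto simp: J_def fr_def\<close>)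
  then show ?thesis by (rule run_mono) (auto simp: J_def add.assoc)
qed

definition gtab :: "(int => int) => nat => nat => bool" where
  "gtab m tt sz \<longleftrightarrow> (ALL x y. x * sz <= n --> y * sz <= n -->
     m (loc (int n) 10 (int tt) (int x) (int y)) = int (gg a (x * sz) (y * sz)))"

lemma gg_add1: "gg a (x + k) y = gg a x y + (\<Sum>t<k. rank a (a (x + t)) y)"
  by (induction k) (auto simp: gg_Suc1)

lemma gg_add2: "gg a x (y + k) = gg a x y + (\<Sum>t<k. rank a (a (y + t)) x)"
  by (induction k) (auto simp: gg_Suc2)

lemma gg_U: "x <= n ==> y <= n ==> int (gg a x y) <= U"
proof -
  assume "x <= n" "y <= n"
  then have "gg a x y <= n * n" using gg_le[of a x y] mult_le_mono[of x n y n] by linarith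
  then have "int (gg a x y) <= int n * int n" by (simp flip: of_nat_mult)
  then show ?thesis using nU by linarith
qed

lemma run_gcode:
  assumes g: "good s" and b: "base (mem s)" and gt: "gtab (mem s) tt sz" and sz: "sz >= 1"
    and r: "regs s 2 = int n" "regs s 3 = int L" "regs s 7 = int sz" "regs s 9 = int tt"
      "regs s 30 = int x" "regs s 31 = int y" and xy: "x <= n" "y <= n"
  shows "run w gcode (2000 * (sz * (L + 1))) s (%s'. good s' & mem s' = mem s & regs s' 32 = int (gg a x y) & fr {32..46} s s')"
proof -
  let ?b = "[As 33 (ediv (V 30) (V 7)), As 34 (ediv (V 31) (V 7)), Ld 32 (locE 10 (V 9) (V 33) (V 34)),
       As 35 (emul (V 33) (V 7)), As 36 (emul (V 34) (V 7)), As 37 (esub (V 30) (V 35)), As 38 (esub (V 31) (V 36))]"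
  define xb yb where "xb = x div sz" and "yb = y div sz"
  define xs ys where "xs = xb * sz" and "ys = yb * sz"
  have le: "xs <= x" "ys <= y" "x - xs <= sz" "y - ys <= sz" "xb <= x" "yb <= y"
    using sz mod_less_divisor[of sz x] mod_less_divisor[of sz y]
    by (auto simp: xs_def ys_def xb_def yb_def minus_div_mult_eq_mod)
  have ib: "int x div int sz = int xb" "int y div int sz = int yb" "int xb * int sz = int xs" "int yb * int sz = int ys"
    by (simp_all add: xb_def yb_def xs_def ys_def zdiv_int)
  have mg: "mem s (loc (int n) 10 (int tt) (int xb) (int yb)) = int (gg a xs ys)"
    using gt le xy unfolding gtab_def xs_def ys_def by simp
  have isub: "int x - int xs = int (x - xs)" "int y - int ys = int (y - ys)" using le by auto
  have bU: "int xb <= U" "int yb <= U" "int xs <= U" "int ys <= U" "int (x - xs) <= U" "int (y - ys) <= U"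
    using le xy nU by linarith+
  have gU: "int (gg a xs ys) <= U" using gg_U le xy by simp
  define s1 where "s1 = exb ?b s"
  have s1: "regs s1 32 = int (gg a xs ys)" "regs s1 35 = int xs" "regs s1 36 = int ys" "regs s1 37 = int (x - xs)"
    "regs s1 38 = int (y - ys)" "regs s1 30 = int x" "regs s1 31 = int y" "regs s1 2 = int n" "regs s1 3 = int L" "mem s1 = mem s"
    "fr {32..46} s s1"
    using r ib mg isub by (simp_all add: s1_def ev_locE fr_def del: of_nat_diff)
  have e1: "gg a x ys = gg a xs ys + (\<Sum>t<x - xs. rank a (a (xs + t)) ys)" using gg_add1[of xs "x - xs" ys] le by simp
  have e2: "gg a x y = gg a x ys + (\<Sum>t<y - ys. rank a (a (ys + t)) x)" using gg_add2[of x ys "y - ys"] le by simp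
  let ?k = "%k. k * (400 * (L + 1) + 150) + 20"
  have "run w gcode (bsz ?b + (?k (x - xs) + ?k (y - ys))) s (%s'. good s' & mem s' = mem s & regs s' 32 = int (gg a x y) & fr {32..46} s s')"
    unfolding gcode_def
  proof (rule run_blkS[OF g])
    show "\<forall>i\<in>set ?b. ok_ins i" by (simp add: ok_exp_def locE_simps)
    show "bnb ?b s" using r ib mg isub bU gU by (simp add: ev_locE del: of_nat_diff)
    assume "good (exb ?b s)"
    then have g1: "good s1" by (simp add: s1_def)
    have q1: "run w (addranks 37 35 36) (?k (x - xs)) s1 (%s'. good s' & mem s' = mem s1 &
       regs s' 32 = int (gg a x ys) & fr ({32} \<union> {39..46}) s1 s')"
      unfolding e1 by (rule run_addranks) (use g1 s1 b le xy gg_U[of x ys] e1 in auto)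
    show "run w (Seq (addranks 37 35 36) (addranks 38 36 30)) (?k (x - xs) + ?k (y - ys)) (exb ?b s)
      (%s'. good s' & mem s' = mem s & regs s' 32 = int (gg a x y) & fr {32..46} s s')"
      unfolding s1_def[symmetric]
    proof (rule run_Seq, rule run_mono[OF q1 order_refl])
      fix s2 assume *: "good s2 & mem s2 = mem s1 & regs s2 32 = int (gg a x ys) & fr ({32} \<union> {39..46}) s1 s2"
      have f: "fr ({32} \<union> {39..46}) s1 s2" using * by simp
      have f': "fr {32..46} s s2" by (rule fr_trans[OF s1(11) f]) auto
      have q2: "run w (addranks 38 36 30) (?k (y - ys)) s2 (%s'. good s' & mem s' = mem s2 &
         regs s' 32 = int (gg a x y) & fr ({32} \<union> {39..46}) s2 s')"
        unfolding e2 by (rule run_addranks) (use * s1 b le xy gg_U[of x y] e2 frD[OF f] in auto)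
      show "run w (addranks 38 36 30) (?k (y - ys)) s2
        (%s'. good s' & mem s' = mem s & regs s' 32 = int (gg a x y) & fr {32..46} s s')"
        by (rule run_mono[OF q2 order_refl]) (use * s1(10) fr_trans[OF f'] in auto)
    qed
  qed
  then show ?thesis
  proof (rule run_mono)
    have "?k (x - xs) <= ?k sz" "?k (y - ys) <= ?k sz" using le by (auto intro: mult_le_mono1)
    moreover have "bsz ?b <= 250" by (simp add: esz_locE)
    moreover have "sz * (400 * (L + 1) + 150) = 400 * (sz * (L + 1)) + 150 * sz" by (simp add: algebra_simps)
    moreover have "sz <= sz * (L + 1)" "1 <= sz" using sz by auto
    ultimately show "bsz ?b + (?k (x - xs) + ?k (y - ys)) <= 2000 * (sz * (L + 1))" by linarith
  qed auto
qed

end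

section \<open>Preprocessing\<close>

text \<open>
  Registers: 0 and 1 query and answer, 2 \<open>n\<close>, 3 \<open>L\<close> with \<open>n < 2 ^ L\<close>, 4 the polylogarithmic factor of the
  time budget, 5 number of queries the current table is built for, 6 how many of them are left,
  7 block size, 8 whether a table is still missing, 9 number of attempts so far, 10 clock,
  11 generation of the virtual memory, 12 frequency threshold, 13 number of blocks, 14 size of the
  matrices to be multiplied, 15 number of frequent values, 16 and 17 numbers of submatrices per
  dimension, 53 number of queries before the next rebuilding.

  Tables: 3 value to identifier, 4 identifier of a position, 5 number of occurrences, 6 positions
  of a value, 7 number of a frequent value, 8 its occurrences in a block, 9 equal pairs in a
  pair of blocks, 10 their prefix sums.  Tables 7 to 10 are separate for every attempt, so that
  they start out as zero.
\<close>

definition eind :: "aexp => aexp" where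
  "eind e = ediv (N 1) (eadd e (N 1))"

lemma ind_div: "0 <= x ==> 1 div (x + 1) = (if x = 0 then 1 else 0)" for x :: int
  by (auto intro: div_pos_pos_trivial)

lemma ev_eind: "ev (eind e) R = 1 div (ev e R + 1)"
  by (simp add: eind_def)

definition pre1 :: "ins list" where
  "pre1 = [Ld 21 (eadd (V 20) (N 1)), Ld 22 (cellE (V 21) 3),
     As 22 (eadd (V 22) (emul (eadd (V 20) (N 1)) (eind (V 22)))),
     St (cellE (V 21) 3) (V 22), St (locE 4 (N 0) (N 0) (V 20)) (V 22), Ld 23 (locE 5 (N 0) (N 0) (V 22)),
     St (locE 6 (N 0) (V 22) (V 23)) (V 20), St (locE 5 (N 0) (N 0) (V 22)) (eadd (V 23) (N 1))]"

text \<open>Doubles \<open>R[21]\<close> and increments \<open>R[3]\<close> as long as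
  \<open>R[21] <= n\<close>. Running this \<open>n\<close> times is affordable and avoids a loop
  with an unknown number of rounds.\<close>

definition pre2 :: "ins list" where
  "pre2 = [As 22 (esub (N 1) (eind (ediv (V 2) (V 21)))), As 3 (eadd (V 3) (V 22)), As 21 (eadd (V 21) (emul (V 21) (V 22)))]"

text \<open>Computes the budget factor \<open>cb * L ^ kb\<close>. Literals in expressions are
  limited to 100, hence \<open>cb\<close> is built up in unary.\<close>

definition pre3 :: "nat => nat => ins list" where
  "pre3 cb kb = As 4 (N 0) # replicate cb (As 4 (eadd (V 4) (N 1))) @ replicate kb (As 4 (emul (V 4) (V 3))) @ [As 53 (N 1)]"

definition pre :: "nat => nat => com" where
  "pre cb kb = Seq (blk [As 2 (V 0)]) (Seq (For 20 2 (blk pre1)) (Seq (blk [As 3 (N 0), As 21 (N 1)])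
     (Seq (For 20 2 (blk pre2)) (blk (pre3 cb kb)))))"

text \<open>Replaces arbitrary integers by identifiers of size at most \<open>n\<close> with the
  same equality pattern: the first position of the value, shifted by 1 so that 0 stays free.\<close>

definition ids :: "(nat => int) => nat => nat" where
  "ids A i = Suc (LEAST j. A (Suc j) = A (Suc i))"

lemma ids_le: "ids A i <= Suc i"
  unfolding ids_def by (simp add: Least_le)

lemma ids_eq_iff: "ids A i = ids A j \<longleftrightarrow> A (Suc i) = A (Suc j)"
proof -
  have *: "A (Suc (LEAST j. A (Suc j) = A (Suc i))) = A (Suc i)" for i
    by (rule LeastI[of "%j. A (Suc j) = A (Suc i)" i]) simp
  show ?thesis
  proof
    assume "ids A i = ids A j"
    then have "(LEAST k. A (Suc k) = A (Suc i)) = (LEAST k. A (Suc k) = A (Suc j))" by (simp add: ids_def)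
    note eq = this
    have "A (Suc i) = A (Suc (LEAST k. A (Suc k) = A (Suc i)))" by (rule *[symmetric])
    also have "\<dots> = A (Suc (LEAST k. A (Suc k) = A (Suc j)))" by (simp only: eq)
    also have "\<dots> = A (Suc j)" by (rule *)
    finally show "A (Suc i) = A (Suc j)" .
  qed (simp add: ids_def)
qed

lemma cell_input: "1 <= t ==> t < 16 ==> 1 <= z ==> z <= n ==> z ~= cell n k t"
proof
  assume a: "1 <= t" "t < 16" "1 <= z" "z <= n" "z = cell n k t"
  define X where "X = (n + 16) * k"
  have z: "z = X + n + t" using a by (simp add: X_def cell_def)
  consider "k <= -1" | "k = 0" | "k >= 1" by linarith
  then show False
  proof cases
    case 1
    then have "X <= (n + 16) * (-1)" unfolding X_def using a by (intro mult_left_mono) auto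
    then show False using a z by simp
  next
    case 2
    then show False using a z by (simp add: X_def)
  next
    case 3
    then have "(n + 16) * 1 <= X" unfolding X_def using a by (intro mult_left_mono) auto
    then show False using a z by simp
  qed
qed

lemma cell_0:
  assumes "1 <= t" "t < 16" "0 <= n" shows "0 ~= cell n k t" "cell n k t ~= 0"
proof -
  have "cell n k t div (n + 16) = k"
  proof -
    have "cell n k t = (n + t) + k * (n + 16)" by (simp add: cell_def algebra_simps)
    also have "\<dots> div (n + 16) = k + (n + t) div (n + 16)" using assms by (intro div_mult_self1) simp
    also have "(n + t) div (n + 16) = 0" using assms by simp
    finally show ?thesis by simp
  qed
  then show "0 ~= cell n k t" using assms by (auto simp: cell_def)
  then show "cell n k t ~= 0" by simp
qed

lemma loc_input: "1 <= t ==> t < 16 ==> 1 <= z ==> z <= n ==> z ~= loc n t w x y"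
  unfolding loc_def by (rule cell_input)

context mbound begin

definition fresh :: "int => (int => int) => nat => bool" where
  "fresh n m k \<longleftrightarrow> (\<forall>t\<in>{7..10}. ALL w>k. ALL x y. m (loc n t (int w) (int x) (int y)) = 0)"

lemma run_pre1:
  assumes g: "good s" and r: "regs s 2 = int n" and n: "1 <= n" "int n + 1 <= U"
    and A: "\<And>i. 1 <= i ==> i <= n ==> \<bar>A i\<bar> <= U"
    and m: "mem s = (%z. if 1 <= z & z <= int n then A (nat z) else 0)"
  shows "run w (For 20 2 (blk pre1)) (n * 500 + 20) s (%s'. good s' & fr {20..23} s s' &
     (ALL i<n. mem s' (loc (int n) 4 0 0 (int i)) = int (ids A i)) &
     (ALL v. mem s' (loc (int n) 5 0 0 (int v)) = int (rank (ids A) v n)) &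
     (ALL i<n. mem s' (loc (int n) 6 0 (int (ids A i)) (int (rank (ids A) (ids A i) i))) = int i) &
     (ALL k. mem s' (cell (int n) k 2) = 0) & fresh (int n) (mem s') 0 & mem s' 0 = 0)"
proof -
  let ?a = "ids A" and ?n = "int n"
  \<comment> \<open>Contents of table 3 after the first \<open>i\<close> positions.\<close>
  define D where "D = (%i v. if EX j<i. A (Suc j) = v then int (Suc (LEAST j. A (Suc j) = v)) else 0)"
  define I where "I = (%i (s'::state). fr {20..23} s s' &
     (ALL z. 1 <= z --> z <= ?n --> mem s' z = A (nat z)) & (ALL v. mem s' (cell ?n v 3) = D i v) &
     (ALL j<i. mem s' (loc ?n 4 0 0 (int j)) = int (?a j)) &
     (ALL v. mem s' (loc ?n 5 0 0 (int v)) = int (rank ?a v i)) &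
     (ALL j<i. mem s' (loc ?n 6 0 (int (?a j)) (int (rank ?a (?a j) j))) = int j) &
     (ALL k. mem s' (cell ?n k 2) = 0) & (\<forall>t\<in>{7..10}. ALL w x y. mem s' (loc ?n t (int w) (int x) (int y)) = 0) & mem s' 0 = 0)"
  have zc: "mem s (cell ?n v t) = 0" if "1 <= t" "t < 16" for v t
    using cell_input[OF that, of "cell ?n v t" ?n v] by (auto simp: m)
  then have zl: "mem s (loc ?n t u x y) = 0" if "1 <= t" "t < 16" for t u x y
    using that by (simp add: loc_def)
  have I0: "I 0 (s(|regs := (regs s)(20 := 0)|))"
    unfolding I_def by (auto simp: D_def fr_def zc zl) (simp_all add: m)
  have step: "bnb pre1 s' & regs (exb pre1 s') 20 = int i & regs (exb pre1 s') 2 = ?n &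
      I (Suc i) ((exb pre1 s')(|regs := (regs (exb pre1 s'))(20 := int (Suc i))|))"
    if i: "i < n" and Is: "I i s'" and r20: "regs s' 20 = int i" and r2: "regs s' 2 = ?n" for i s'
  proof -
    define v where "v = A (Suc i)"
    have ms: "mem s' (int i + 1) = v" using Is i by (auto simp: I_def v_def nat_add_distrib)
    have d: "mem s' (cell ?n v 3) = D i v" using Is by (simp add: I_def)
    have D0: "0 <= D i v" by (simp add: D_def)
    have x: "D i v + (int i + 1) * (1 div (D i v + 1)) = int (?a i)"
    proof (cases "EX j<i. A (Suc j) = v")
      case True
      then show ?thesis unfolding ind_div[OF D0] by (simp add: D_def ids_def v_def)
    next
      case False
      then have "(LEAST j. A (Suc j) = v) = i" unfolding v_def by (intro Least_equality) (auto simp: not_less[symmetric])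
      then show ?thesis unfolding ind_div[OF D0] using False by (simp add: D_def ids_def v_def)
    qed
    define k where "k = rank ?a (?a i) i"
    have k: "mem s' (loc ?n 5 0 0 (int (?a i))) = int k" using Is by (simp add: I_def k_def)
    have ki: "k <= i" unfolding k_def by (rule rank_le)
    have bU: "\<bar>v\<bar> <= U" "int (?a i) <= U" "\<bar>D i v\<bar> <= U" "int k <= U"
    proof -
      show "\<bar>v\<bar> <= U" unfolding v_def using A i by simp
      show "int (?a i) <= U" using ids_le[of A i] i n by linarith
      moreover have "D i v <= int (?a i)" using x D0 unfolding ind_div[OF D0] by (auto split: if_splits)
      ultimately show "\<bar>D i v\<bar> <= U" using D0 by linarith
      show "int k <= U" using ki i n by linarith
    qed
    have neq: "loc ?n 4 0 0 p ~= cell ?n q 3" "loc ?n 5 0 0 p ~= cell ?n q 3" "loc ?n 6 0 p p' ~= cell ?n q 3"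
      "cell ?n q 2 ~= cell ?n q' 3" "cell ?n q 2 ~= loc ?n 4 w' p p'" "cell ?n q 2 ~= loc ?n 5 w' p p'" "cell ?n q 2 ~= loc ?n 6 w' p p'"
      "cell ?n q 3 ~= loc ?n 4 w' p p'" "cell ?n q 3 ~= loc ?n 5 w' p p'" "cell ?n q 3 ~= loc ?n 6 w' p p'" for p p' q q' w'
      using loc_cell_neq[of ?n 4 3] loc_cell_neq[of ?n 5 3] loc_cell_neq[of ?n 6 3] loc_cell_neq[of ?n 4 2] loc_cell_neq[of ?n 5 2]
        loc_cell_neq[of ?n 6 2] cell_eq_iff[of ?n 2 3 q q'] by (auto dest: sym)
    have M: "mem (exb pre1 s') = (mem s')(cell ?n v 3 := int (?a i), loc ?n 4 0 0 (int i) := int (?a i),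
        loc ?n 6 0 (int (?a i)) (int k) := int i, loc ?n 5 0 0 (int (?a i)) := int k + 1)"
      using r20 r2 ms d x k by (simp add: pre1_def ev_locE ev_cellE ev_eind loc_eq_iff neq)
    have R: "fr {20..23} s' (exb pre1 s')" "regs (exb pre1 s') 20 = int i" "regs (exb pre1 s') 2 = ?n"
      using r20 r2 by (simp_all add: pre1_def fr_def)
    have B: "bnb pre1 s'" using r20 r2 ms d x k bU by (simp add: pre1_def ev_locE ev_cellE ev_eind loc_eq_iff neq)
    have Dn: "D (Suc i) v' = (if v' = v then int (?a i) else D i v')" for v'
    proof (cases "v' = v")
      case True
      then show ?thesis by (auto simp: D_def v_def ids_def less_Suc_eq)
    next
      case False
      then show ?thesis by (auto simp: D_def v_def less_Suc_eq)
    qed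
    \<comment> \<open>Earlier occurrences of the value have smaller ranks, so the new entry of table
      6 overwrites none of theirs.\<close>
    have a_k: "?a j = ?a i ==> j < i ==> rank ?a (?a i) j ~= k" for j
      using rank_pos_iff[of ?a j "?a i" i] unfolding k_def by auto
    have "I (Suc i) ((exb pre1 s')(|regs := (regs (exb pre1 s'))(20 := int (Suc i))|))"
      unfolding I_def
    proof (intro conjI allI impI ballI)
      show "fr {20..23} s ((exb pre1 s')(|regs := (regs (exb pre1 s'))(20 := int (Suc i))|))"
        using Is fr_trans[OF _ R(1), of "{20..23}" s "{20..23}"] by (auto simp: I_def fr_def)
    next
      fix z assume "1 <= z" "z <= ?n"
      then show "mem ((exb pre1 s')(|regs := (regs (exb pre1 s'))(20 := int (Suc i))|)) z = A (nat z)"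
        using Is cell_input[of 3 z ?n v] loc_input[of _ z ?n] by (simp add: I_def M)
    next
      fix v'
      show "mem ((exb pre1 s')(|regs := (regs (exb pre1 s'))(20 := int (Suc i))|)) (cell ?n v' 3) = D (Suc i) v'"
        using Is cell_eq_iff[of ?n 3 3 v' v] by (auto simp: I_def M neq Dn)
    next
      fix j assume "j < Suc i"
      then show "mem ((exb pre1 s')(|regs := (regs (exb pre1 s'))(20 := int (Suc i))|)) (loc ?n 4 0 0 (int j)) = int (?a j)"
        using Is by (auto simp: I_def M neq loc_eq_iff less_Suc_eq)
    next
      fix v'
      show "mem ((exb pre1 s')(|regs := (regs (exb pre1 s'))(20 := int (Suc i))|)) (loc ?n 5 0 0 (int v')) = int (rank ?a v' (Suc i))"
        using Is by (auto simp: I_def M neq loc_eq_iff rank_Suc k_def)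
    next
      fix j assume "j < Suc i"
      then show "mem ((exb pre1 s')(|regs := (regs (exb pre1 s'))(20 := int (Suc i))|)) (loc ?n 6 0 (int (?a j)) (int (rank ?a (?a j) j))) = int j"
        using Is a_k[of j] by (auto simp: I_def M neq loc_eq_iff less_Suc_eq k_def)
    next
      fix k'
      show "mem ((exb pre1 s')(|regs := (regs (exb pre1 s'))(20 := int (Suc i))|)) (cell ?n k' 2) = 0"
        using Is by (simp add: I_def M neq)
    next
      fix t :: int and w x y assume t: "t \<in> {7..10}"
      then have "loc ?n t (int w) (int x) (int y) ~= cell ?n v 3" by (intro loc_cell_neq) auto
      then show "mem ((exb pre1 s')(|regs := (regs (exb pre1 s'))(20 := int (Suc i))|)) (loc ?n t (int w) (int x) (int y)) = 0"
        using Is t by (auto simp: I_def M loc_eq_iff)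
    next
      show "mem ((exb pre1 s')(|regs := (regs (exb pre1 s'))(20 := int (Suc i))|)) 0 = 0"
        using Is cell_0[of 3 ?n] by (simp add: I_def M loc_def cell_0)
    qed
    then show ?thesis using B R by simp
  qed
  have ok: "\<forall>i\<in>set pre1. ok_ins i" by (simp add: pre1_def ok_exp_def locE_simps eind_def)
  have "run w (For 20 2 (blk pre1)) (n * (bsz pre1 + 20) + 20) s (%s'. good s' & regs s' 20 = int n & regs s' 2 = int n & I n s')"
    by (rule run_For_blk[where I = I, OF g _ _ _ r ok I0]) (use step in auto)
  then show ?thesis
  proof (rule run_mono)
    show "n * (bsz pre1 + 20) + 20 <= n * 500 + 20" by (simp add: pre1_def esz_locE esz_cellE eind_def)
  qed (auto simp: I_def fresh_def)
qed

end

lemma exb_append: "exb (xs @ ys) s = exb ys (exb xs s)"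
  by (induction xs arbitrary: s) auto

context mbound begin

lemma bnb_append: "bnb (xs @ ys) s \<longleftrightarrow> bnb xs s & bnb ys (exb xs s)"
  by (induction xs arbitrary: s) auto

lemma exb_inc: "exb (replicate k (As 4 (eadd (V 4) (N 1)))) s = s(|regs := (regs s)(4 := regs s 4 + int k)|)"
  by (induction k arbitrary: s) (auto simp: add_ac)

lemma exb_mul: "exb (replicate k (As 4 (emul (V 4) (V 3)))) s = s(|regs := (regs s)(4 := regs s 4 * regs s 3 ^ k)|)"
  by (induction k arbitrary: s) (auto simp: mult_ac)

lemma bnb_inc: "0 <= regs s 4 ==> regs s 4 + int k <= U ==> bnb (replicate k (As 4 (eadd (V 4) (N 1)))) s"
  by (induction k arbitrary: s) auto

lemma bnb_mul: "0 <= regs s 4 ==> 1 <= regs s 3 ==> regs s 4 * regs s 3 ^ k <= U ==> bnb (replicate k (As 4 (emul (V 4) (V 3)))) s"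
proof (induction k arbitrary: s)
  case (Suc k)
  have "1 <= regs s 3 ^ k" using Suc.prems by simp
  then have "regs s 4 * regs s 3 * 1 <= regs s 4 * regs s 3 * regs s 3 ^ k"
    using Suc.prems by (intro mult_left_mono) auto
  also have "\<dots> <= U" using Suc.prems by (simp add: mult.assoc)
  finally show ?case using Suc.prems by (auto intro!: Suc.IH simp: mult.assoc)
qed simp

lemma run_pre3:
  assumes g: "good s" and r: "regs s 3 = int l" and b: "1 <= l" "int cb * int l ^ kb <= U"
  shows "run w (blk (pre3 cb kb)) (bsz (pre3 cb kb)) s (%s'. good s' & mem s' = mem s &
     regs s' 4 = int cb * int l ^ kb & regs s' 53 = 1 & fr {4, 53} s s')"
proof (rule run_blk[OF g])
  show "\<forall>i\<in>set (pre3 cb kb). ok_ins i" by (auto simp: pre3_def ok_exp_def)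
  have "int cb * 1 <= int cb * int l ^ kb" using b by (intro mult_left_mono) auto
  then have "int cb <= U" using b by simp
  then show "bnb (pre3 cb kb) s" using r b U100
    by (simp add: pre3_def bnb_append exb_append exb_inc exb_mul bnb_inc bnb_mul)
  show "good (exb (pre3 cb kb) s) ==> good (exb (pre3 cb kb) s) & mem (exb (pre3 cb kb) s) = mem s &
     regs (exb (pre3 cb kb) s) 4 = int cb * int l ^ kb & regs (exb (pre3 cb kb) s) 53 = 1 & fr {4, 53} s (exb (pre3 cb kb) s)"
    using r by (simp add: pre3_def exb_append exb_inc exb_mul fr_def)
qed

lemma run_pre2:
  assumes g: "good s" and r: "regs s 2 = int n" "regs s 3 = 0" "regs s 21 = 1" and n: "1 <= n" "2 * int n + 1 <= U"
  shows "run w (For 20 2 (blk pre2)) (n * 100 + 20) s (%s'. good s' & fr {3, 20, 21, 22} s s' & mem s' = mem s &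
     (EX l. regs s' 3 = int l & n < 2 ^ l & 2 ^ l <= 2 * n))"
proof -
  define I where "I = (%j (s'::state). fr {3, 20, 21, 22} s s' & mem s' = mem s &
     (EX l. regs s' 3 = int l & regs s' 21 = int (2 ^ l) & (l = j \<or> n < 2 ^ l) & 2 ^ l <= 2 * n & l <= j))"
  have ok: "\<forall>i\<in>set pre2. ok_ins i" by (simp add: pre2_def ok_exp_def eind_def)
  have "run w (For 20 2 (blk pre2)) (n * (bsz pre2 + 20) + 20) s (%s'. good s' & regs s' 20 = int n & regs s' 2 = int n & I n s')"
  proof (rule run_For_blk[where I = I, OF g _ _ _ r(1) ok])
    show "I 0 (s(|regs := (regs s)(20 := 0)|))" using r n by (auto simp: I_def fr_def)
    fix j s' assume j: "j < n" "good s'" "I j s'" "regs s' 20 = int j" "regs s' 2 = int n"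
    then obtain l where l: "regs s' 3 = int l" "regs s' 21 = int (2 ^ l)" "l = j \<or> n < 2 ^ l" "2 ^ l <= 2 * n" "l <= j"
      by (auto simp: I_def)
    have f: "fr {3, 20, 21, 22} s s'" "mem s' = mem s" using j by (auto simp: I_def)
    have "int (2 ^ l) <= int (2 * n)" using l(4) by (simp only: of_nat_le_iff)
    then have bU: "int (2 ^ l) <= U" "int l + 1 <= U" using n l(5) j(1) by linarith+
    show "bnb pre2 s' & regs (exb pre2 s') 20 = int j & regs (exb pre2 s') 2 = int n &
        I (Suc j) ((exb pre2 s')(|regs := (regs (exb pre2 s'))(20 := int (Suc j))|))"
    proof (cases "n < 2 ^ l")
      case True
      then have "int n div int (2 ^ l) = 0" by (metis div_less of_nat_0 zdiv_int)
      then have e: "1 div (regs s' 2 div regs s' 21 + 1) = 1" using l j by simp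
      have "I (Suc j) ((exb pre2 s')(|regs := (regs (exb pre2 s'))(20 := int (Suc j))|))"
        using f l e True by (auto simp: I_def pre2_def ev_eind fr_def intro!: exI[of _ l])
      then show ?thesis using j l e bU U100 by (simp add: pre2_def ev_eind)
    next
      case False
      then have "n div 2 ^ l > 0" by (simp add: div_greater_zero_iff)
      then have "int n div int (2 ^ l) > 0" by (metis of_nat_0_less_iff zdiv_int)
      then have e: "1 div (regs s' 2 div regs s' 21 + 1) = 0" using l j by (simp add: ind_div)
      have "int (2 ^ l) <= int n" using False by (simp only: of_nat_le_iff not_less)
      then have le: "2 * int (2 ^ l) <= U" using n(2) by linarith
      have "I (Suc j) ((exb pre2 s')(|regs := (regs (exb pre2 s'))(20 := int (Suc j))|))"
        using f l e False by (auto simp: I_def pre2_def ev_eind fr_def intro!: exI[of _ "Suc l"])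
      then show ?thesis using j l e bU le n by (simp add: pre2_def ev_eind)
    qed
  qed simp_all
  then show ?thesis
  proof (rule run_mono)
    show "n * (bsz pre2 + 20) + 20 <= n * 100 + 20" by (simp add: pre2_def eind_def)
    fix s' assume "good s' & regs s' 20 = int n & regs s' 2 = int n & I n s'"
    \<comment> \<open>A counter that was incremented in every round equals \<open>n\<close>, and
      \<open>n < 2 ^ n\<close>.\<close>
    moreover have "l = n \<or> n < 2 ^ l ==> n < 2 ^ l" for l using less_exp[of n] by auto
    ultimately show "good s' & fr {3, 20, 21, 22} s s' & mem s' = mem s & (EX l. regs s' 3 = int l & n < 2 ^ l & 2 ^ l <= 2 * n)"
      unfolding I_def by blast
  qed
qed

text \<open>The invariant of the data structure: \<open>k\<close> is the number of attempts at building it so far.\<close>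

definition inv :: "nat => nat => nat => (nat => nat) => nat => state => bool" where
  "inv n L LK a k s \<longleftrightarrow> good s & regs s 2 = int n & regs s 3 = int L & regs s 4 = int LK & regs s 9 = int k &
     tabs.base n a (mem s) & mem s 0 = 0 & (ALL j. 0 <= mem s (cell (int n) j 2) & mem s (cell (int n) j 2) <= regs s 11) &
     fresh (int n) (mem s) k & 0 <= regs s 11 & regs s 99 \<in> {0, 1}"

lemma run_pre:
  assumes n: "1 <= n" "int n <= int N0" "4 * (int n * int n + int n + 10) <= U"
    and A: "\<And>i. 1 <= i ==> i <= n ==> \<bar>A i\<bar> <= U"
    and cb: "\<And>l. 2 ^ l <= 2 * n ==> int cb * int l ^ kb <= U"
  shows "run w (pre cb kb) (1000 * n + 200 + bsz (pre3 cb kb)) (array_init n A)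
    (%s'. EX l. n < 2 ^ l & 2 ^ l <= 2 * n & inv n l (cb * l ^ kb) (ids A) 0 s' & regs s' 53 = 1 & regs s' 6 = 0 & regs s' 11 = 0)"
proof -
  let ?s = "array_init n A"
  have nn: "int n + 1 <= U" "2 * int n + 1 <= U" "int n <= U"
  proof -
    have aux: "N + 1 <= U & 2 * N + 1 <= U & N <= U" if "0 <= q" "0 <= N" "4 * (q + N + 10) <= U" for q N :: int
      using that by auto
    have "int n + 1 <= U & 2 * int n + 1 <= U & int n <= U"
      by (rule aux[of "int n * int n"]) (use n in auto)
    then show "int n + 1 <= U" "2 * int n + 1 <= U" "int n <= U" by auto
  qed
  have g: "good ?s" using nn U100 by (auto simp: good_def array_init_def)
  define s1 where "s1 = exb [As 2 (V 0)] ?s"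
  have s1: "regs s1 2 = int n" "mem s1 = (%z. if 1 <= z & z <= int n then A (nat z) else 0)"
    "\<And>r. r ~= 0 ==> r ~= 2 ==> regs s1 r = 0"
    by (auto simp: s1_def array_init_def)
  have "run w (pre cb kb) (bsz [As 2 (V 0)] + ((n * 500 + 20) + (bsz [As 3 (N 0), As 21 (N 1)] + ((n * 100 + 20) + bsz (pre3 cb kb))))) ?s
    (%s'. EX l. n < 2 ^ l & 2 ^ l <= 2 * n & inv n l (cb * l ^ kb) (ids A) 0 s' & regs s' 53 = 1 & regs s' 6 = 0 & regs s' 11 = 0)"
    unfolding pre_def
  proof (rule run_blkS[OF g])
    show "\<forall>i\<in>set [As 2 (V 0)]. ok_ins i" by (simp add: ok_exp_def)
    show "bnb [As 2 (V 0)] ?s" using nn by (simp add: array_init_def)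
    assume "good (exb [As 2 (V 0)] ?s)"
    then have g1: "good s1" by (simp add: s1_def)
    show "run w (Seq (For 20 2 (blk pre1)) (Seq (blk [As 3 (N 0), As 21 (N 1)]) (Seq (For 20 2 (blk pre2)) (blk (pre3 cb kb)))))
       ((n * 500 + 20) + (bsz [As 3 (N 0), As 21 (N 1)] + ((n * 100 + 20) + bsz (pre3 cb kb)))) (exb [As 2 (V 0)] ?s)
       (%s'. EX l. n < 2 ^ l & 2 ^ l <= 2 * n & inv n l (cb * l ^ kb) (ids A) 0 s' & regs s' 53 = 1 & regs s' 6 = 0 & regs s' 11 = 0)"
      unfolding s1_def[symmetric]
    proof (rule run_Seq, rule run_mono[OF run_pre1[OF g1 s1(1) n(1) nn(1) A s1(2)] order_refl])
      fix s2 assume s2: "good s2 & fr {20..23} s1 s2 &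
       (ALL i<n. mem s2 (loc (int n) 4 0 0 (int i)) = int (ids A i)) &
       (ALL v. mem s2 (loc (int n) 5 0 0 (int v)) = int (rank (ids A) v n)) &
       (ALL i<n. mem s2 (loc (int n) 6 0 (int (ids A i)) (int (rank (ids A) (ids A i) i))) = int i) &
       (ALL k. mem s2 (cell (int n) k 2) = 0) & fresh (int n) (mem s2) 0 & mem s2 0 = 0"
      show "run w (Seq (blk [As 3 (N 0), As 21 (N 1)]) (Seq (For 20 2 (blk pre2)) (blk (pre3 cb kb))))
        (bsz [As 3 (N 0), As 21 (N 1)] + ((n * 100 + 20) + bsz (pre3 cb kb))) s2
        (%s'. EX l. n < 2 ^ l & 2 ^ l <= 2 * n & inv n l (cb * l ^ kb) (ids A) 0 s' & regs s' 53 = 1 & regs s' 6 = 0 & regs s' 11 = 0)"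
      proof (rule run_blkS)
        show "good s2" using s2 by simp
        show "bnb [As 3 (N 0), As 21 (N 1)] s2" using U100 by simp
        show "\<forall>i\<in>set [As 3 (N 0), As 21 (N 1)]. ok_ins i" by (simp add: ok_exp_def)
        define s3 where "s3 = exb [As 3 (N 0), As 21 (N 1)] s2"
        have f2: "fr {20..23} s1 s2" using s2 by simp
        have s3: "regs s3 2 = int n" "regs s3 3 = 0" "regs s3 21 = 1" "mem s3 = mem s2" "fr {3, 20, 21, 22, 23} s1 s3"
          using frD[OF f2, of 2] s1 f2 by (auto simp: s3_def fr_def)
        assume "good (exb [As 3 (N 0), As 21 (N 1)] s2)"
        then have g3: "good s3" by (simp add: s3_def)
        show "run w (Seq (For 20 2 (blk pre2)) (blk (pre3 cb kb))) ((n * 100 + 20) + bsz (pre3 cb kb)) (exb [As 3 (N 0), As 21 (N 1)] s2)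
          (%s'. EX l. n < 2 ^ l & 2 ^ l <= 2 * n & inv n l (cb * l ^ kb) (ids A) 0 s' & regs s' 53 = 1 & regs s' 6 = 0 & regs s' 11 = 0)"
          unfolding s3_def[symmetric]
        proof (rule run_Seq, rule run_mono[OF run_pre2[OF g3 s3(1-3) n(1) nn(2)] order_refl])
          fix s4 assume s4: "good s4 & fr {3, 20, 21, 22} s3 s4 & mem s4 = mem s3 & (EX l. regs s4 3 = int l & n < 2 ^ l & 2 ^ l <= 2 * n)"
          then obtain l where l: "regs s4 3 = int l" "n < 2 ^ l" "2 ^ l <= 2 * n" by blast
          have l1: "1 <= l" using l n by (cases l) auto
          have f4: "fr {3, 20, 21, 22, 23} s1 s4" using fr_trans[OF s3(5), of "{3, 20, 21, 22}" s4] s4 by auto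
          have g4: "good s4" using s4 by simp
          show "run w (blk (pre3 cb kb)) (bsz (pre3 cb kb)) s4
             (%s'. EX l. n < 2 ^ l & 2 ^ l <= 2 * n & inv n l (cb * l ^ kb) (ids A) 0 s' & regs s' 53 = 1 & regs s' 6 = 0 & regs s' 11 = 0)"
          proof (rule run_mono[OF run_pre3[OF g4 l(1) l1 cb[OF l(3)]] order_refl])
            fix s5 assume s5: "good s5 & mem s5 = mem s4 & regs s5 4 = int cb * int l ^ kb & regs s5 53 = 1 & fr {4, 53} s4 s5"
            have f5: "fr {3, 4, 20, 21, 22, 23, 53} s1 s5" using fr_trans[OF f4, of "{4, 53}" s5] s5 by auto
            have m5: "mem s5 = mem s2" using s5 s4 s3 by simp
            have rr: "regs s5 2 = int n" "regs s5 9 = 0" "regs s5 11 = 0" "regs s5 99 = 0" "regs s5 6 = 0"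
              using frD[OF f5] s1 by auto
            have r3: "regs s5 3 = int l" using s5 l frD[of "{4, 53}" s4 s5 3] by auto
            interpret tabs U \<beta> n l "ids A"
            proof
              show "ids A i <= n" if "i < n" for i using ids_le[of A i] that by simp
              have "int l <= int (2 ^ l)" using less_imp_le[OF less_exp[of l]] by (simp only: of_nat_le_iff)
              moreover have "int (2 ^ l) <= int (2 * n)" using l(3) by (simp only: of_nat_le_iff)
              ultimately show "int l <= U" using nn by linarith
            qed (use n l in auto)
            have "base (mem s5)" using s2 m5 by (simp add: base_def)
            then have "inv n l (cb * l ^ kb) (ids A) 0 s5"
              unfolding inv_def using s5 s2 rr r3 m5 by auto
            then show "EX l. n < 2 ^ l & 2 ^ l <= 2 * n & inv n l (cb * l ^ kb) (ids A) 0 s5 & regs s5 53 = 1 & regs s5 6 = 0 & regs s5 11 = 0"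
              using l rr s5 by blast
          qed
        qed
      qed
    qed
  qed
  then show ?thesis by (rule run_mono) auto
qed

end

section \<open>Frequent values\<close>

definition ht1 :: "ins list" where
  "ht1 = [Ld 21 (locE 4 (N 0) (N 0) (V 20)), Ld 22 (locE 5 (N 0) (N 0) (V 21)),
     As 23 (esub (N 1) (eind (ediv (V 22) (eadd (V 12) (N 1))))), Ld 24 (locE 7 (V 9) (V 21) (V 21)),
     As 25 (emul (V 23) (eind (V 24))), As 15 (eadd (V 15) (V 25)), As 24 (eadd (V 24) (emul (V 25) (V 15))),
     St (locE 7 (V 9) (V 21) (V 21)) (V 24), As 26 (ediv (V 20) (V 7)), Ld 27 (locE 8 (V 9) (V 26) (V 24)),
     St (locE 8 (V 9) (V 26) (V 24)) (eadd (V 27) (V 23))]"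

locale blocks = tabs U \<beta> n L a for U \<beta> n L a +
  fixes sz f :: nat
  assumes sz1: "1 <= sz" and f1: "1 <= f"
begin

definition hv :: "nat => bool" where "hv v \<longleftrightarrow> f < rank a v n"
definition Hs :: "nat => nat set" where "Hs i = {v. hv v & (EX j<i. a j = v)}"
text \<open>The number of a frequent value in order of first occurrence, counted from 1: the
  frequent values met up to its first occurrence, itself included.\<close>

definition hid :: "nat => nat" where "hid v = (if v \<in> Hs n then card (Hs (Suc (LEAST j. a j = v))) else 0)"
definition Xc :: "nat => nat => nat => nat" where
  "Xc i x k = (\<Sum>j<i. if j div sz = x & hv (a j) & hid (a j) = k then 1 else 0)"
definition pairM :: "nat => nat => nat" where
  "pairM x y = (\<Sum>i<n. \<Sum>j<n. if i div sz = x & j div sz = y & a i = a j then 1 else 0)"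
definition heavyM :: "nat => nat => nat" where
  "heavyM x y = (\<Sum>i<n. \<Sum>j<n. if i div sz = x & j div sz = y & a i = a j & hv (a i) then 1 else 0)"
definition lightM :: "nat => nat => nat => nat" where
  "lightM m x y = (\<Sum>i<m. \<Sum>j<n. if i div sz = x & j div sz = y & a i = a j & \<not> hv (a i) then 1 else 0)"
definition PG :: "nat => nat => nat" where
  "PG x y = (\<Sum>x'<x. \<Sum>y'<y. pairM x' y')"

lemma finite_Hs: "finite (Hs i)"
proof -
  have "Hs i \<subseteq> a ` {..<i}" by (auto simp: Hs_def)
  then show ?thesis by (rule finite_subset) simp
qed

lemma Hs_Suc: "Hs (Suc i) = (if hv (a i) then insert (a i) (Hs i) else Hs i)"
  by (auto simp: Hs_def less_Suc_eq)

lemma Hs_mono: "i <= j ==> Hs i \<subseteq> Hs j"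
  by (force simp: Hs_def)

lemma card_Hs_le: "card (Hs i) <= i"
proof -
  have "Hs i \<subseteq> a ` {..<i}" by (auto simp: Hs_def)
  then have "card (Hs i) <= card (a ` {..<i})" by (intro card_mono) auto
  also have "\<dots> <= i" using card_image_le[of "{..<i}" a] by simp
  finally show ?thesis .
qed

lemma hid_new:
  assumes "i < n" "hv (a i)" "a i \<notin> Hs i" shows "hid (a i) = Suc (card (Hs i))"
proof -
  have "(LEAST j. a j = a i) = i"
    using assms by (intro Least_equality) (auto simp: Hs_def not_less[symmetric])
  then show ?thesis using assms finite_Hs by (auto simp: hid_def Hs_Suc) (auto simp: Hs_def)
qed

lemma hid_bounds: "v \<in> Hs n ==> 1 <= hid v & hid v <= card (Hs n)"
proof -
  assume v: "v \<in> Hs n"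
  then obtain j where j: "j < n" "a j = v" "hv v" by (auto simp: Hs_def)
  let ?f = "LEAST j. a j = v"
  have f: "a ?f = v" "?f <= j" using j by (auto intro: LeastI Least_le)
  have "v \<in> Hs (Suc ?f)" using f j by (auto simp: Hs_def)
  then have "card (Hs (Suc ?f)) ~= 0" using finite_Hs by auto
  moreover have "card (Hs (Suc ?f)) <= card (Hs n)" using f j by (intro card_mono finite_Hs Hs_mono) auto
  ultimately show ?thesis using v by (simp add: hid_def)
qed

text \<open>If \<open>v\<close> first occurs later than \<open>u\<close>, then the frequent values
  met up to the first occurrence of \<open>v\<close> contain those met up to \<open>u\<close> and,
  in addition, \<open>v\<close> itself.\<close>

lemma hid_inj: "inj_on hid (Hs n)"
proof -
  have less: "hid u < hid v" if uv: "u \<in> Hs n" "v \<in> Hs n" "(LEAST j. a j = u) < (LEAST j. a j = v)" for u v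
  proof -
    let ?f = "%v. LEAST j. a j = v"
    obtain j where j: "j < n" "a j = v" "hv v" using uv(2) by (auto simp: Hs_def)
    have f: "a (?f v) = v" using j by (auto intro: LeastI)
    have "v \<notin> Hs (Suc (?f u))"
    proof
      assume "v \<in> Hs (Suc (?f u))"
      then obtain i where "i < Suc (?f u)" "a i = v" by (auto simp: Hs_def)
      then show False using uv(3) Least_le[of "%j. a j = v" i] by simp
    qed
    moreover have "v \<in> Hs (Suc (?f v))" using f j by (auto simp: Hs_def)
    moreover have "Hs (Suc (?f u)) \<subseteq> Hs (Suc (?f v))" using uv by (intro Hs_mono) simp
    ultimately have "card (Hs (Suc (?f u))) < card (Hs (Suc (?f v)))" by (intro psubset_card_mono finite_Hs) auto
    then show ?thesis using uv by (simp add: hid_def)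
  qed
  show ?thesis
  proof (rule inj_onI, rule ccontr)
    fix u v assume uv: "u \<in> Hs n" "v \<in> Hs n" "hid u = hid v" "u ~= v"
    have "a (LEAST j. a j = u) = u" "a (LEAST j. a j = v) = v" using uv by (auto simp: Hs_def intro: LeastI)
    then have "(LEAST j. a j = u) ~= (LEAST j. a j = v)" using uv(4) by metis
    then show False using less[of u v] less[of v u] uv by (metis less_irrefl nat_neq_iff)
  qed
qed

lemma hid_eq_iff: "i < n ==> j < n ==> hv (a i) ==> hv (a j) ==> hid (a i) = hid (a j) \<longleftrightarrow> a i = a j"
  using inj_onD[OF hid_inj, of "a i" "a j"] by (auto simp: Hs_def)

text \<open>The position sets of frequent values are disjoint, and each has more than
  \<open>f\<close> elements.\<close>

lemma heavy_bound: "card (Hs n) * (f + 1) <= n"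
proof -
  have "card (Hs n) * (f + 1) <= (\<Sum>v\<in>Hs n. rank a v n)"
    using sum_mono[of "Hs n" "%_. f + 1" "%v. rank a v n"] by (simp add: Hs_def hv_def)
  also have "\<dots> = card (\<Union>v\<in>Hs n. {j. j < n & a j = v})"
    unfolding rank_def by (rule card_UN_disjoint[symmetric]) (auto simp: finite_Hs)
  also have "\<dots> <= card {..<n}" by (intro card_mono) auto
  finally show ?thesis by simp
qed

lemma Xc_Suc: "Xc (Suc i) x k = Xc i x k + (if i div sz = x & hv (a i) & hid (a i) = k then 1 else 0)"
  by (simp add: Xc_def)

lemma Xc_le: "Xc i x k <= i"
  by (induction i) (auto simp: Xc_Suc, simp add: Xc_def)

lemma sum_prod_ind: "(\<Sum>i<n. if P i then 1 else 0) * (\<Sum>j<n. if Q j then 1 else (0::nat)) = (\<Sum>i<n. \<Sum>j<n. if P i & Q j then 1 else 0)"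
  by (simp add: sum_product) (intro sum.cong refl, auto)

text \<open>A pair of positions with the same frequent value contributes to exactly one summand,
  that of the number of this value. Columns beyond \<open>card (Hs n)\<close> are zero, which
  permits padding to a multiple of the matrix size.\<close>

lemma X_prod:
  assumes "card (Hs n) <= T"
  shows "(\<Sum>t<T. Xc n x (Suc t) * Xc n y (Suc t)) = heavyM x y"
proof -
  have "(\<Sum>t<T. Xc n x (Suc t) * Xc n y (Suc t)) =
     (\<Sum>t<T. \<Sum>i<n. \<Sum>j<n. if (i div sz = x & hv (a i) & hid (a i) = Suc t) & (j div sz = y & hv (a j) & hid (a j) = Suc t) then 1 else 0)"
    unfolding Xc_def by (simp only: sum_prod_ind)
  also have "\<dots> = (\<Sum>i<n. \<Sum>j<n. \<Sum>t<T. if (i div sz = x & hv (a i) & hid (a i) = Suc t) & (j div sz = y & hv (a j) & hid (a j) = Suc t) then 1 else 0)"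
    by (subst sum.swap, rule sum.cong[OF refl], rule sum.swap)
  also have "\<dots> = heavyM x y"
    unfolding heavyM_def
  proof (intro sum.cong refl)
    fix i j assume ij: "i \<in> {..<n}" "j \<in> {..<n}"
    show "(\<Sum>t<T. if (i div sz = x & hv (a i) & hid (a i) = Suc t) & (j div sz = y & hv (a j) & hid (a j) = Suc t) then 1 else 0) =
      (if i div sz = x & j div sz = y & a i = a j & hv (a i) then 1 else (0::nat))"
    proof (cases "i div sz = x & j div sz = y & a i = a j & hv (a i)")
      case True
      then have "a i \<in> Hs n" using ij by (auto simp: Hs_def)
      then obtain t where t: "hid (a i) = Suc t" "t < T" using hid_bounds[of "a i"] assms by (cases "hid (a i)") auto
      have "(\<Sum>t'<T. if (i div sz = x & hv (a i) & hid (a i) = Suc t') & (j div sz = y & hv (a j) & hid (a j) = Suc t') then 1 else 0) =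
        (\<Sum>t'<T. if t' = t then 1 else (0::nat))" using True t by (intro sum.cong) auto
      also have "\<dots> = 1" using t by simp
      finally show ?thesis unfolding if_P[OF True] .
    next
      case False
      then have "\<not> ((i div sz = x & hv (a i) & hid (a i) = Suc t) & (j div sz = y & hv (a j) & hid (a j) = Suc t))" for t
        using hid_eq_iff[of i j] ij by auto
      then show ?thesis using False by auto
    qed
  qed
  finally show ?thesis .
qed

lemma heavy_light: "heavyM x y + lightM n x y = pairM x y"
  unfolding heavyM_def lightM_def pairM_def sum.distrib[symmetric] by (intro sum.cong) auto

lemma pairM_le: "pairM x y <= n * n"
proof -
  have "pairM x y <= (\<Sum>i<n. \<Sum>j<n. 1)" unfolding pairM_def by (intro sum_mono) auto
  then show ?thesis by simp
qed

lemma PG_sum: "PG x y = (\<Sum>i<n. \<Sum>j<n. if i < x * sz & j < y * sz & a i = a j then 1 else 0)"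
proof -
  have lt: "i div sz < x \<longleftrightarrow> i < x * sz" for i x
    using sz1 by (simp add: div_less_iff_less_mult)
  have "PG x y = (\<Sum>i<n. \<Sum>j<n. \<Sum>x'<x. \<Sum>y'<y. if i div sz = x' & j div sz = y' & a i = a j then 1 else 0)"
  proof -
    have "PG x y = (\<Sum>x'<x. \<Sum>i<n. \<Sum>j<n. \<Sum>y'<y. if i div sz = x' & j div sz = y' & a i = a j then 1 else 0)"
      unfolding PG_def pairM_def
      by (rule sum.cong[OF refl], subst sum.swap, rule sum.cong[OF refl], rule sum.swap)
    also have "\<dots> = (\<Sum>i<n. \<Sum>x'<x. \<Sum>j<n. \<Sum>y'<y. if i div sz = x' & j div sz = y' & a i = a j then 1 else 0)"
      by (rule sum.swap)
    also have "\<dots> = (\<Sum>i<n. \<Sum>j<n. \<Sum>x'<x. \<Sum>y'<y. if i div sz = x' & j div sz = y' & a i = a j then 1 else 0)"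
      by (rule sum.cong[OF refl], rule sum.swap)
    finally show ?thesis .
  qed
  also have "\<dots> = (\<Sum>i<n. \<Sum>j<n. if i < x * sz & j < y * sz & a i = a j then 1 else 0)"
  proof (intro sum.cong refl)
    fix i j
    have "(\<Sum>x'<x. \<Sum>y'<y. if i div sz = x' & j div sz = y' & a i = a j then 1 else 0) =
      (\<Sum>x'<x. if x' = i div sz then (\<Sum>y'<y. if y' = j div sz then (if a i = a j then 1 else 0) else 0) else (0::nat))"
      by (intro sum.cong refl) auto
    also have "\<dots> = (if i < x * sz & j < y * sz & a i = a j then 1 else 0)"
      by (simp add: lt)
    finally show "(\<Sum>x'<x. \<Sum>y'<y. if i div sz = x' & j div sz = y' & a i = a j then 1 else 0) =
      (if i < x * sz & j < y * sz & a i = a j then 1 else (0::nat))" .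
  qed
  finally show ?thesis .
qed

lemma PG_le: "PG x y <= n * n"
proof -
  have "PG x y <= (\<Sum>i<n. \<Sum>j<n. 1)" unfolding PG_sum by (intro sum_mono) auto
  then show ?thesis by simp
qed

lemma PG_eq: assumes "x * sz <= n" "y * sz <= n" shows "PG x y = gg a (x * sz) (y * sz)"
proof -
  have "PG x y = (\<Sum>i<n. \<Sum>j<n. if i < x * sz & j < y * sz & a i = a j then 1 else 0)" by (rule PG_sum)
  also have "\<dots> = (\<Sum>i<n. if i < x * sz then (\<Sum>j<n. if j < y * sz then (if a j = a i then 1 else 0) else 0) else 0)"
    by (intro sum.cong refl) (auto intro!: sum.cong)
  also have "\<dots> = gg a (x * sz) (y * sz)"
  proof -
    have r: "(\<Sum>i<n. if i < m then g i else 0) = (\<Sum>i<m. g i)" if "m <= n" for m and g :: "nat => nat"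
    proof -
      have "{..<n} \<inter> {i. i < m} = {..<m}" using that by auto
      then show ?thesis by (simp add: sum.If_cases)
    qed
    show ?thesis unfolding gg_sum r[OF assms(1)] by (intro sum.cong refl r assms(2))
  qed
  finally show ?thesis .
qed

lemma PG_Suc: "PG (Suc x) (Suc y) + PG x y = PG x (Suc y) + PG (Suc x) y + pairM x y"
  by (simp add: PG_def sum.distrib)

lemma run_ht1:
  assumes g: "good s" and b: "base (mem s)" and fresh: "fresh (int n) (mem s) k"
    and r: "regs s 2 = int n" "regs s 7 = int sz" "regs s 9 = int (Suc k)" "regs s 12 = int f" "regs s 15 = 0"
    and U: "int f + 1 <= U"
  shows "run w (For 20 2 (blk ht1)) (n * 700 + 20) s (%s'. good s' & fr ({15} \<union> {20..27}) s s' &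
     regs s' 15 = int (card (Hs n)) &
     mem s' = utab (int n) (utab (int n) (mem s) 7 (int (Suc k)) (%x y. if x = y & y \<in> Hs n then int (hid y) else 0))
       8 (int (Suc k)) (%x y. int (Xc n x y)))"
proof -
  let ?n = "int n" and ?w = "int (Suc k)"
  define F7 where "F7 = (%i x y. if x = y & y \<in> Hs i then int (hid y) else 0)"
  define F8 where "F8 = (%i x y. int (Xc i x y))"
  define I where "I = (%i (s'::state). fr ({15} \<union> {20..27}) s s' & regs s' 15 = int (card (Hs i)) &
     mem s' = utab ?n (utab ?n (mem s) 7 ?w (F7 i)) 8 ?w (F8 i))"
  have fz: "mem s (loc ?n t ?w (int x) (int y)) = 0" if "t \<in> {7..10}" for t x y
    using fresh that unfolding fresh_def by blast
  have z: "F7 0 = (%x y. mem s (loc ?n 7 ?w (int x) (int y)))" "F8 0 = (%x y. mem s (loc ?n 8 ?w (int x) (int y)))"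
    using fz by (auto simp: F7_def F8_def Hs_def Xc_def fun_eq_iff simp del: of_nat_Suc)
  have I0: "I 0 (s(|regs := (regs s)(20 := 0)|))"
    using r unfolding I_def z utab_id by (simp add: fr_def Hs_def)
  have ok: "\<forall>i\<in>set ht1. ok_ins i" by (simp add: ht1_def ok_exp_def locE_simps eind_def)
  have step: "bnb ht1 s' & regs (exb ht1 s') 20 = int i & regs (exb ht1 s') 2 = ?n &
      I (Suc i) ((exb ht1 s')(|regs := (regs (exb ht1 s'))(20 := int (Suc i))|))"
    if i: "i < n" and Is: "I i s'" and r20: "regs s' 20 = int i" and r2: "regs s' 2 = ?n" for i s'
  proof -
    define v where "v = a i"
    have f: "fr ({15} \<union> {20..27}) s s'" using Is by (simp add: I_def)
    have m: "mem s' = utab ?n (utab ?n (mem s) 7 ?w (F7 i)) 8 ?w (F8 i)" using Is by (simp add: I_def)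
    have rr: "regs s' 7 = int sz" "regs s' 9 = ?w" "regs s' 12 = int f" "regs s' 15 = int (card (Hs i))"
      using frD[OF f] r Is by (auto simp: I_def)
    have b4: "mem s (loc ?n 4 0 0 (int i)) = int v" using b i by (simp add: base_def v_def)
    have vn: "v <= n" using aid[OF i] by (simp add: v_def)
    have b5: "mem s (loc ?n 5 0 0 (int v)) = int (rank a v n)" using b vn by (simp add: base_def)
    have m4: "mem s' (loc ?n 4 0 0 (int i)) = int v" "mem s' (loc ?n 5 0 0 (int v)) = int (rank a v n)"
      unfolding m using utab_loc[of ?n 8 ?w 4 0 _ _ 0 i] utab_loc[of ?n 7 ?w 4 0 _ _ 0 i]
        utab_loc[of ?n 8 ?w 5 0 _ _ 0 v] utab_loc[of ?n 7 ?w 5 0 _ _ 0 v] b4 b5 by simp_all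
    define hvi where "hvi = (if hv v then 1 else 0 :: nat)"
    have hvi: "1 - 1 div (int (rank a v n) div (int f + 1) + 1) = int hvi"
    proof -
      have "int (rank a v n) div (int f + 1) = int (rank a v n div (f + 1))" by (simp add: zdiv_int add.commute)
      moreover have "rank a v n div (f + 1) = 0 \<longleftrightarrow> \<not> hv v" by (auto simp: hv_def div_eq_0_iff)
      ultimately show ?thesis using ind_div[of "int (rank a v n div (f + 1))"] by (auto simp: hvi_def)
    qed
    define o7 where "o7 = F7 i v v"
    have m7: "mem s' (loc ?n 7 ?w (int v) (int v)) = o7"
      unfolding m o7_def using utab_loc[of ?n 8 ?w 7 ?w] utab_loc[of ?n 7 ?w 7 ?w] by simp
    have o70: "0 <= o7" by (simp add: o7_def F7_def)
    define nw where "nw = (if hv v & v \<notin> Hs i then 1 else 0 :: nat)"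
    have hb: "v \<in> Hs i ==> 1 <= hid v & hid v <= card (Hs n)" using hid_bounds[of v] Hs_mono[of i n] i by auto
    have nw: "int hvi * (1 div (o7 + 1)) = int nw"
      unfolding ind_div[OF o70] using hb by (auto simp: hvi_def nw_def o7_def F7_def)
    have cH: "card (Hs (Suc i)) = card (Hs i) + nw"
      using finite_Hs by (auto simp: Hs_Suc nw_def v_def[symmetric] insert_absorb)
    have hidv: "o7 + int nw * (int (card (Hs i)) + int nw) = int (hid v)"
    proof (cases "v \<in> Hs i")
      case True
      then show ?thesis by (simp add: o7_def F7_def nw_def)
    next
      case False
      show ?thesis
      proof (cases "hv v")
        case True
        then show ?thesis using False hid_new[of i] i by (simp add: o7_def F7_def nw_def v_def)
      next
        case F: False
        then have "v \<notin> Hs n" by (simp add: Hs_def)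
        then show ?thesis using F False by (simp add: o7_def F7_def nw_def hid_def)
      qed
    qed
    define bx where "bx = i div sz"
    have bx: "int i div int sz = int bx" by (simp add: bx_def zdiv_int)
    have m8: "mem s' (loc ?n 8 ?w (int bx) (int (hid v))) = int (Xc i bx (hid v))"
      unfolding m F8_def using utab_loc[of ?n 8 ?w 8 ?w] by simp
    have hidn: "hid v <= n" using hid_bounds[of v] card_Hs_le[of n] by (auto simp: hid_def)
    have bU: "int v <= U" "int (rank a v n) <= U" "int hvi <= U" "\<bar>o7\<bar> <= U" "int nw <= U" "int (card (Hs i)) + int nw <= U"
      "int (hid v) <= U" "int bx <= U" "int (Xc i bx (hid v)) <= U"
    proof -
      have "o7 <= int (hid v)" unfolding o7_def F7_def by simp
      then show "\<bar>o7\<bar> <= U" using o70 hidn nU by linarith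
      show "int (card (Hs i)) + int nw <= U" using cH card_Hs_le[of "Suc i"] i nU by linarith
      show "int bx <= U" using div_le_dividend[of i sz] i nU unfolding bx_def by linarith
      show "int (Xc i bx (hid v)) <= U" using Xc_le[of i bx "hid v"] i nU by linarith
      show "int v <= U" "int (hid v) <= U" using vn hidn nU by linarith+
      show "int (rank a v n) <= U" using rank_le[of a v n] nU by linarith
      show "int hvi <= U" "int nw <= U" using U100 by (auto simp: hvi_def nw_def)
    qed
    have lne: "loc ?n 8 ?w (int bx) (int (hid v)) ~= loc ?n 7 ?w (int v) (int v)"
      using loc_eq_iff[of ?n 8 7] by simp
    have M: "mem (exb ht1 s') = (mem s')(loc ?n 7 ?w (int v) (int v) := int (hid v),
        loc ?n 8 ?w (int bx) (int (hid v)) := int (Xc i bx (hid v)) + int hvi)"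
      using r20 r2 rr m4 hvi m7 nw hidv bx m8 lne by (simp add: ht1_def ev_locE ev_eind)
    have R: "fr ({15} \<union> {20..27}) s' (exb ht1 s')" "regs (exb ht1 s') 20 = int i" "regs (exb ht1 s') 2 = ?n"
      "regs (exb ht1 s') 15 = int (card (Hs i)) + int nw"
      using r20 r2 rr m4 hvi m7 nw by (simp_all add: ht1_def fr_def ev_locE ev_eind)
    have B: "bnb ht1 s'" using r20 r2 rr m4 hvi m7 nw hidv bx m8 lne bU by (simp add: ht1_def ev_locE ev_eind)
    have "mem (exb ht1 s') = utab ?n (utab ?n (mem s) 7 ?w (F7 (Suc i))) 8 ?w (F8 (Suc i))"
    proof -
      have e7: "(%x' y'. if x' = v & y' = v then int (hid v) else F7 i x' y') = F7 (Suc i)"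
      proof (intro ext)
        fix x y
        have "v \<notin> Hs (Suc i) ==> hid v = 0"
        proof -
          assume "v \<notin> Hs (Suc i)"
          then have "\<not> hv v" by (auto simp: Hs_Suc v_def[symmetric] split: if_splits)
          then show "hid v = 0" by (simp add: hid_def Hs_def)
        qed
        then show "(if x = v & y = v then int (hid v) else F7 i x y) = F7 (Suc i) x y"
          by (auto simp: F7_def Hs_Suc v_def[symmetric])
      qed
      have e8: "(%x' y'. if x' = bx & y' = hid v then int (Xc i bx (hid v)) + int hvi else F8 i x' y') = F8 (Suc i)"
        by (auto simp: F8_def Xc_Suc hvi_def bx_def v_def fun_eq_iff)
      show ?thesis unfolding M m
        by (subst utab_upd_other, simp_all, subst utab_upd, simp_all, subst utab_upd, simp_all) (simp only: e7[unfolded of_nat_Suc] e8)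
    qed
    then have "I (Suc i) ((exb ht1 s')(|regs := (regs (exb ht1 s'))(20 := int (Suc i))|))"
      using R fr_trans[OF f R(1), of "{15} \<union> {20..27}"] cH by (auto simp: I_def fr_def)
    then show ?thesis using B R by simp
  qed
  have "run w (For 20 2 (blk ht1)) (n * (bsz ht1 + 20) + 20) s (%s'. good s' & regs s' 20 = int n & regs s' 2 = int n & I n s')"
    by (rule run_For_blk[where I = I, OF g _ _ _ r(1) ok I0]) (use step in auto)
  then show ?thesis
  proof (rule run_mono)
    show "n * (bsz ht1 + 20) + 20 <= n * 700 + 20" by (simp add: ht1_def esz_locE eind_def)
  qed (auto simp: I_def F7_def F8_def)
qed

end

section \<open>Calling the matrix multiplication program\<close>

text \<open>Decodes the call number \<open>R[30]\<close> into the row block \<open>R[29]\<close>,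
  the column block \<open>R[28]\<close> and the slice \<open>R[27]\<close> of the summation index.
  Increasing the generation empties the virtual memory.\<close>

definition cl1 :: "ins list" where
  "cl1 = [As 29 (ediv (V 30) (V 17)), As 27 (esub (V 30) (emul (V 29) (V 17))), As 28 (V 29),
     As 29 (ediv (V 28) (V 16)), As 28 (esub (V 28) (emul (V 29) (V 16))), As 11 (eadd (V 11) (N 1))]"

text \<open>Writes two \<open>d\<close> by \<open>d\<close> submatrices of table 8 into the virtual
  memory, the second one transposed. The summation index is shifted by 1 because frequent values are
  numbered from 1.\<close>

definition cp :: "ins list" where
  "cp = [As 21 (ediv (V 20) (V 14)), As 22 (esub (V 20) (emul (V 21) (V 14))),
     Ld 23 (locE 8 (V 9) (eadd (emul (V 29) (V 14)) (V 21)) (eadd (eadd (emul (V 27) (V 14)) (V 22)) (N 1))),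
     St (cellE (V 20) 1) (V 23), St (cellE (V 20) 2) (V 11),
     Ld 23 (locE 8 (V 9) (eadd (emul (V 28) (V 14)) (V 22)) (eadd (eadd (emul (V 27) (V 14)) (V 21)) (N 1))),
     St (cellE (eadd (V 18) (V 20)) 1) (V 23), St (cellE (eadd (V 18) (V 20)) 2) (V 11)]"

text \<open>Adds the product to table 9. A result cell without a current stamp counts as 0: its
  address is multiplied by 0, and cell 0 of the memory always contains 0.\<close>

definition ac :: "ins list" where
  "ac = [Ld 21 (cellE (eadd (eadd (V 18) (V 18)) (V 20)) 2), As 21 (eind (esub (V 11) (V 21))),
     Ld 22 (emul (cellE (eadd (eadd (V 18) (V 18)) (V 20)) 1) (V 21)),
     As 23 (ediv (V 20) (V 14)), As 24 (esub (V 20) (emul (V 23) (V 14))),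
     Ld 25 (locE 9 (V 9) (eadd (emul (V 29) (V 14)) (V 23)) (eadd (emul (V 28) (V 14)) (V 24))),
     St (locE 9 (V 9) (eadd (emul (V 29) (V 14)) (V 23)) (eadd (emul (V 28) (V 14)) (V 24))) (eadd (V 25) (V 22))]"

fun zregs :: "nat => com" where
  "zregs 0 = Skip"
| "zregs (Suc k) = Seq (zregs k) (Const (k + 1000) 0)"

definition callc :: "com => com" where
  "callc P = Seq (blk cl1) (Seq (For 20 18 (blk cp)) (Seq (Seq (zregs (Suc (cregs P))) (Seq (Op Add 1000 14 100) (sb P)))
     (IfE (V 10) (For 20 18 (blk ac)) Skip)))"

definition noP :: "int => int => bool" where
  "noP n z \<longleftrightarrow> (ALL k. z ~= cell n k 1 & z ~= cell n k 2)"

lemma noP_loc: "0 <= n ==> 3 <= t ==> t < 16 ==> noP n (loc n t w x y)"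
  unfolding noP_def using loc_cell_neq[of n t 1 w x y] loc_cell_neq[of n t 2 w x y] by auto

lemma noP_0: "0 <= n ==> noP n 0"
  unfolding noP_def using cell_0[of 1 n] cell_0[of 2 n] by auto

lemma zregs_exec: "EX s'. exec (zregs k) s (k + 1) s' & s' = s(|regs := (%r. if 1000 <= r & r < k + 1000 then 0 else regs s r)|)"
proof (induction k)
  case 0
  have "(%r. if 1000 <= r & r < 0 + 1000 then 0 else regs s r) = regs s" by auto
  then show ?case using exec.Skip[of s] by simp
next
  case (Suc k)
  let ?s = "s(|regs := (%r. if 1000 <= r & r < k + 1000 then 0 else regs s r)|)"
  have 1: "exec (zregs k) s (k + 1) ?s" using Suc by blast
  have 2: "exec (Const (k + 1000) 0) ?s (1 + len 0) (?s(|regs := (regs ?s)(k + 1000 := 0)|))" by (rule exec.Const)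
  have e: "?s(|regs := (regs ?s)(k + 1000 := 0)|) = s(|regs := (%r. if 1000 <= r & r < Suc k + 1000 then 0 else regs s r)|)"
    by (auto simp: fun_eq_iff)
  have t: "k + 1 + (1 + len 0) = Suc k + 1" by (simp add: len0)
  show ?case using exec.Seq[OF 1 2] unfolding e t zregs.simps by blast
qed

lemma run_zregs: "w >= 1 ==> run w (zregs k) (k + 1) s (%s'. s' = s(|regs := (%r. if 1000 <= r & r < k + 1000 then 0 else regs s r)|))"
  using zregs_exec[of k s] unfolding run_def by (metis mult_le_mono2 nat_mult_1_right)

lemma (in mbound) goodD: "good s ==> r < 100 ==> \<bar>regs s r\<bar> <= U"
  by (simp add: good_def)

lemma run_obtain: "run w c k s Q ==> EX s'. run w c k s (%s''. s'' = s') & Q s'"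
  unfolding run_def by blast

lemma utab_cong: "m z = m' z ==> utab n m t u F z = utab n m' t u F z"
  by (simp add: utab_def)

lemma utab_utab: "m' z = utab n m t u G z ==> utab n m' t u F z = utab n m t u F z"
  by (simp add: utab_def)

lemma sum_lessThan_add: "(\<Sum>c<a + h. f c) = (\<Sum>c<a. f c) + (\<Sum>q<h. f (a + q :: nat))" for f :: "nat => nat"
  by (induction h) auto

lemma sum_div_mod: "(\<Sum>c<m * h. g (c div h) (c mod h)) = (\<Sum>p<m. \<Sum>q<h. g p q)" for g :: "nat => nat => nat"
proof (induction m)
  case (Suc m)
  have "(\<Sum>c<Suc m * h. g (c div h) (c mod h)) = (\<Sum>c<m * h + h. g (c div h) (c mod h))" by (simp add: add.commute)
  also have "\<dots> = (\<Sum>p<m. \<Sum>q<h. g p q) + (\<Sum>q<h. g ((m * h + q) div h) ((m * h + q) mod h))"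
    unfolding sum_lessThan_add Suc ..
  also have "(\<Sum>q<h. g ((m * h + q) div h) ((m * h + q) mod h)) = (\<Sum>q<h. g m q)"
    by (intro sum.cong refl) auto
  finally show ?case by simp
qed simp

text \<open>\<open>nb\<close> and \<open>nh\<close> count the submatrices per dimension of the
  product and of the summation index. \<open>Tm\<close> bounds the running time of \<open>P\<close>,
  which the program does not know; \<open>CK\<close> bounds the initial clock.\<close>

locale calls = blocks U \<beta> n L a sz f for U \<beta> n L a sz f +
  fixes P :: com and Tm d nb nh k CK :: nat
  assumes d1: "1 <= d" and nb1: "1 <= nb"
    and P_ok: "\<And>A B. (ALL i<d. ALL j<d. \<bar>A i j\<bar> <= int n & \<bar>B i j\<bar> <= int n) ==>
       EX t s. exec P (mm_init d A B) t s & t <= Tm &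
         (ALL i<d. ALL j<d. mem s (int (2 * d * d + i * d + j)) = (\<Sum>l<d. A i l * B l j))"
    and Ubig: "100 * (int \<beta> + int (cmax P) + int CK) + 1000 <= U" and ddU: "int (d * d) <= U" "int (nb * nb * nh) <= U"
    and kU: "int (Suc k) <= U"
begin

definition LOW :: nat where "LOW = 18 * (\<beta> + cmax P + 2 * CK) + 20"
definition KK :: nat where "KK = (5 * \<beta> + 12) * (2 * \<beta> + 17)"
definition Am :: "nat => nat => nat => nat => int" where "Am I H i l = int (Xc n (I * d + i) (H * d + l + 1))"
definition Bm :: "nat => nat => nat => nat => int" where "Bm J H l j = int (Xc n (J * d + j) (H * d + l + 1))"
definition Rm :: "nat => nat => nat => nat => nat => nat" where
  "Rm I J H i j = (\<Sum>l<d. Xc n (I * d + i) (H * d + l + 1) * Xc n (J * d + j) (H * d + l + 1))"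

abbreviation "Pr == ({10, 99} \<union> {1000..} :: nat set)"

definition stamps :: "state => bool" where
  "stamps s \<longleftrightarrow> (ALL j. 0 <= mem s (cell (int n) j 2) & mem s (cell (int n) j 2) <= regs s 11)"

lemma run_sbP:
  assumes g: "good s" and r: "regs s 2 = int n" "regs s 14 = int d" "0 < regs s 10" "regs s 10 <= int CK" "regs s 99 \<in> {0, 1}"
    and st: "stamps s"
    and vm: "\<And>z. (if mem s (cell (int n) z 2) = regs s 11 then mem s (cell (int n) z 1) else 0) = mem (mm_init d A B) z"
    and AB: "ALL i<d. ALL j<d. \<bar>A i j\<bar> <= int n & \<bar>B i j\<bar> <= int n"
  shows "EX \<tau> s'. exec (Seq (zregs (Suc (cregs P))) (Seq (Op Add 1000 14 100) (sb P))) s \<tau> s' &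
     int \<tau> <= int ((cregs P + 4) * w) + 40 * int KK * (regs s 10 - regs s' 10) + 40 * int (KK * csz P) &
     good s' & fr Pr s s' & (ALL z. noP (int n) z --> mem s' z = mem s z) & stamps s' & regs s' 99 \<in> {0, 1} &
     regs s' 10 <= regs s 10 & - int LOW <= regs s' 10 & regs s 10 - regs s' 10 <= 40 * int Tm &
     (regs s' 10 > 0 --> (ALL i<d. ALL j<d. (
        (if mem s' (cell (int n) (int (2 * d * d + i * d + j)) 2) = regs s' 11
         then mem s' (cell (int n) (int (2 * d * d + i * d + j)) 1) else 0) = (\<Sum>l<d. A i l * B l j))))"
proof -
  obtain t sf where ex: "exec P (mm_init d A B) t sf" "t <= Tm"
     "ALL i<d. ALL j<d. mem sf (int (2 * d * d + i * d + j)) = (\<Sum>l<d. A i l * B l j)" using P_ok[OF AB] by blast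
  define ck where "ck = nat (regs s 10)"
  have ck: "regs s 10 = int ck" "0 < ck" "ck <= CK" using r by (auto simp: ck_def)
  \<comment> \<open>Initially lengths up to \<open>BB - 2 * ck\<close> are permitted. This leaves
    \<open>\<beta>\<close> bits for the input entries, and \<open>cmax P <= BB\<close> accommodates
    the constants of \<open>P\<close>.\<close>
  define BB where "BB = \<beta> + cmax P + 2 * ck"
  have U1: "U <= U ^ 64" using U100 self_le_power[of U 64] by simp
  have U2: "U * U <= U ^ 64" using U100 power_increasing[of 2 64 U] by (simp add: power2_eq_square)
  have "2 * U <= U * U" using U100 by (intro mult_right_mono) auto
  have BB1: "100 * int BB + 1000 < 2 ^ \<beta>"
  proof -
    have "int BB <= int \<beta> + int (cmax P) + 2 * int CK" using ck by (simp add: BB_def)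
    moreover have "100 * int \<beta> + 100 * int (cmax P) + 100 * int CK + 1000 <= U"
      using Ubig by (simp only: distrib_left)
    ultimately have "100 * int BB + 1000 <= 2 * U" by linarith
    then show ?thesis using \<open>2 * U <= U * U\<close> U2 beta by linarith
  qed
  have gnU: "\<bar>regs s 11\<bar> <= U" using g by (auto simp: good_def)
  interpret S: sandbox "int n" "regs s 11" \<beta> BB "Suc (cregs P)"
  proof
    have "int n + 16 <= 2 * U" using nU U100 by linarith
    then show "int n + 16 < 2 ^ \<beta>" using \<open>2 * U <= U * U\<close> U2 beta by linarith
    show "\<bar>regs s 11\<bar> < 2 ^ \<beta>" using gnU U1 beta by linarith
    have "int (100 * BB + 1000) < int (2 ^ \<beta>)" using BB1 by simp
    then show "100 * BB + 1000 < 2 ^ \<beta>" by (simp only: of_nat_less_iff)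
  qed simp
  let ?s1 = "s(|regs := (%r. if 1000 <= r & r < Suc (cregs P) + 1000 then 0 else regs s r)|)"
  let ?s2 = "?s1(|regs := (regs ?s1)(1000 := int d)|)"
  have z100: "regs s 100 = 0" "regs s 101 = 0" "regs s 102 = 0" "regs s 103 = 0" using g by (auto simp: good_def)
  obtain t1 where e1: "exec (zregs (Suc (cregs P))) s t1 ?s1" "t1 <= (cregs P + 2) * w"
    using run_zregs[OF w1, of "Suc (cregs P)" s] unfolding run_def by auto
  have dU: "int d <= U" using goodD[OF g, of 14] r(2) by simp
  have ld: "len (int d) <= \<beta>" using dU by (intro U_len) simp
  have "exec (Op Add 1000 14 100) ?s1 (1 + len (regs ?s1 14) + len (regs ?s1 100))
     (?s1(|regs := (regs ?s1)(1000 := binop_val Add (regs ?s1 14) (regs ?s1 100))|))" by (rule exec.Op)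
  then have e2: "exec (Op Add 1000 14 100) ?s1 (1 + len (int d) + len 0) ?s2" using z100 r by simp
  have sim: "S.sim (mm_init d A B) ?s2"
    unfolding S.sim_def
  proof (intro conjI allI impI)
    show "S.bs ?s2" using st r z100 unfolding S.bs_def stamps_def by (auto simp: numeral_eq_Suc atLeastAtMostSuc_conv)
    show "regs ?s2 (r + 1000) = regs (mm_init d A B) r" if "r < Suc (cregs P)" for r
      using that by (auto simp: mm_init_def)
    show "S.vmem ?s2 z = mem (mm_init d A B) z" for z using vm[of z] by (auto simp: S.vmem_def split: if_splits)
    have base: "int x <= int BB - 2 * regs ?s2 10" if "x <= \<beta>" for x using that ck by (simp add: BB_def)
    show "int (len (regs (mm_init d A B) r)) <= int BB - 2 * regs ?s2 10" for r
      by (rule base) (use ld in \<open>auto simp: mm_init_def len0\<close>)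
    have bd: "\<bar>A i j\<bar> <= U" "\<bar>B i j\<bar> <= U" if "i < d" "j < d" for i j
      using AB that nU by (meson order_trans)+
    have "\<bar>mem (mm_init d A B) z\<bar> <= U" for z
    proof -
      consider "0 <= z" "z < int (d * d)" | "int (d * d) <= z" "z < int (2 * d * d)" | "mem (mm_init d A B) z = 0"
        by (cases "0 <= z & z < int (d * d)"; cases "int (d * d) <= z & z < int (2 * d * d)")
           (auto simp: mm_init_def simp del: of_nat_mult)
      then show ?thesis
      proof cases
        case 1
        then have "nat z < d * d" by (simp add: nat_less_iff)
        then have "nat z div d < d" "nat z mod d < d" using d1 by (auto simp: less_mult_imp_div_less)
        then show ?thesis using 1 bd by (simp add: mm_init_def)
      next
        case 2
        have "0 <= z" by (rule order_trans[OF _ 2(1)]) simp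
        then have "nat z < 2 * d * d" using 2 by (subst nat_less_iff) auto
        then have "nat z - d * d < d * d" using d1 by auto
        then have "(nat z - d * d) div d < d" "(nat z - d * d) mod d < d" using d1 by (auto simp: less_mult_imp_div_less)
        then show ?thesis using 2 bd by (auto simp: mm_init_def)
      qed (use U100 in auto)
    qed
    then show "int (len (mem (mm_init d A B) z)) <= int BB - 2 * regs ?s2 10" for z
      by (intro base U_len)
  qed
  have pos: "0 < regs ?s2 10" using r by simp
  obtain \<tau> s' where sb: "exec (sb P) ?s2 \<tau> s'" "S.post P t sf ?s2 \<tau> s'"
    using S.sb_correct[OF ex(1) _ _ sim pos] by (auto simp: BB_def)
  note ps = S.post_step[OF sb(2)]
  have ck2: "regs ?s2 10 = regs s 10" by simp
  have frs: "\<And>r. r < 1000 ==> r ~= 10 ==> r ~= 99 ==> regs s' r = regs s r"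
    using S.frame_temps[OF ps(2)] by auto
  have 99: "regs s' 99 \<in> {0, 1}" and r11: "regs s' 11 = regs s 11" using ps(1) by (auto simp: S.bs_def)
  have low: "- int LOW <= regs s' 10"
  proof -
    have "18 * BB + 20 <= LOW" using ck by (simp add: LOW_def BB_def)
    then show ?thesis using ps(6) by linarith
  qed
  have "int LOW = 18 * int \<beta> + 18 * int (cmax P) + 36 * int CK + 20" by (simp add: LOW_def)
  moreover have "100 * int \<beta> + 100 * int (cmax P) + 100 * int CK + 1000 <= U"
    using Ubig by (simp only: distrib_left)
  ultimately have "int LOW <= U" by linarith
  then have ckU: "\<bar>regs s' 10\<bar> <= U" using low ps(4) ck2 goodD[OF g, of 10] by linarith
  have good': "good s'"
    unfolding good_def
  proof (intro conjI allI impI)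
    fix r :: nat assume "r < 100"
    then show "\<bar>regs s' r\<bar> <= U"
      using frs[of r] ckU 99 g U100 by (cases "r = 10"; cases "r = 99") (auto simp: good_def)
  next
    fix r :: nat assume "r >= 100" "r < 1000"
    then show "regs s' r = 0" using frs[of r] g by (auto simp: good_def)
  qed
  have KK: "S.K0 = KK" by (simp add: S.K0_def KK_def)
  have nn: "0 <= 40 * int (KK * csz P)" by simp
  have time: "int (t1 + (1 + len (int d) + len 0 + \<tau>)) <= int ((cregs P + 4) * w) + 40 * int KK * (regs s 10 - regs s' 10) + 40 * int (KK * csz P)"
  proof -
    have "int \<tau> <= 40 * int KK * (regs s 10 - regs s' 10) + 40 * int (KK * csz P)"
      using ps(7) nn unfolding KK ck2 by (auto simp del: of_nat_mult split: if_splits)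
    moreover have "t1 + (1 + len (int d) + len 0) <= (cregs P + 4) * w"
      using e1(2) ld by (simp add: w_def len0 algebra_simps)
    then have "int (t1 + (1 + len (int d) + len 0)) <= int ((cregs P + 4) * w)" by (simp only: of_nat_le_iff)
    ultimately show ?thesis by simp
  qed
  have fr': "fr Pr s s'" unfolding fr_def using frs by auto
  have memP: "ALL z. noP (int n) z --> mem s' z = mem s z" using ps(2) unfolding S.frame_def noP_def by auto
  have st': "stamps s'" using ps(1) unfolding S.bs_def stamps_def r11 by auto
  have dck: "regs s 10 - regs s' 10 <= 40 * int Tm" using ps(5) ex(2) ck2 by linarith
  have res: "regs s' 10 > 0 --> (ALL i<d. ALL j<d. (
        (if mem s' (cell (int n) (int (2 * d * d + i * d + j)) 2) = regs s' 11
         then mem s' (cell (int n) (int (2 * d * d + i * d + j)) 1) else 0) = (\<Sum>l<d. A i l * B l j)))"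
  proof (intro impI allI)
    fix i j assume p: "regs s' 10 > 0" and ij: "i < d" "j < d"
    have "S.vmem s' (int (2 * d * d + i * d + j)) = (\<Sum>l<d. A i l * B l j)"
      using S.vmem_sim[OF ps(3)[OF p]] ex(3) ij by simp
    then show "(if mem s' (cell (int n) (int (2 * d * d + i * d + j)) 2) = regs s' 11
         then mem s' (cell (int n) (int (2 * d * d + i * d + j)) 1) else 0) = (\<Sum>l<d. A i l * B l j)"
      unfolding S.vmem_def r11 Let_def .
  qed
  have "exec (Seq (zregs (Suc (cregs P))) (Seq (Op Add 1000 14 100) (sb P))) s (t1 + (1 + len (int d) + len 0 + \<tau>)) s'"
    by (intro exec.Seq[OF e1(1)] exec.Seq[OF e2] sb(1))
  moreover have "regs s' 10 <= regs s 10" using ps(4) ck2 by linarith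
  ultimately show ?thesis using time good' fr' memP st' 99 low dck res by blast
qed

lemma cell_eq: "t \<in> {1, 2} ==> t' \<in> {1, 2} ==> cell (int n) j t = cell (int n) j' t' \<longleftrightarrow> j = j' & t = t'"
  using cell_eq_iff[of "int n" t t' j j'] by auto

lemma noP_cell: "t \<in> {1, 2} ==> \<not> noP (int n) (cell (int n) j t)"
  unfolding noP_def by auto

lemma loc_noP: "t \<in> {3..15} ==> noP (int n) (loc (int n) t u x y)"
  by (rule noP_loc) auto

lemma run_cp:
  assumes g: "good s" and r: "regs s 2 = int n" "regs s 9 = int (Suc k)" "regs s 14 = int d" "regs s 18 = int (d * d)"
      "regs s 27 = int H" "regs s 28 = int J" "regs s 29 = int I" "0 <= regs s 11"
    and X: "\<And>x y. mem s (loc (int n) 8 (int (Suc k)) (int x) (int y)) = int (Xc n x y)"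
  shows "run w (For 20 18 (blk cp)) (d * d * 1200 + 20) s (%s'. good s' & fr {20..23} s s' &
     (ALL z. noP (int n) z --> mem s' z = mem s z) &
     (ALL z. mem s' (cell (int n) z 2) = (if 0 <= z & z < int (2 * d * d) then regs s 11 else mem s (cell (int n) z 2))) &
     (ALL j<d * d. mem s' (cell (int n) (int j) 1) = Am I H (j div d) (j mod d) &
        mem s' (cell (int n) (int (d * d) + int j) 1) = Bm J H (j div d) (j mod d)))"
proof -
  let ?n = "int n" and ?w = "int (Suc k)" and ?c = "cell (int n)" and ?D = "int (d * d)"
  define Inv where "Inv = (%e (s'::state). fr {20..23} s s' &
     (ALL z. noP ?n z --> mem s' z = mem s z) &
     (ALL z. mem s' (?c z 2) = (if 0 <= z & z < int e \<or> ?D <= z & z < ?D + int e then regs s 11 else mem s (?c z 2))) &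
     (ALL j<e. mem s' (?c (int j) 1) = Am I H (j div d) (j mod d) & mem s' (?c (?D + int j) 1) = Bm J H (j div d) (j mod d)))"
  have ok: "\<forall>i\<in>set cp. ok_ins i" by (simp add: cp_def ok_exp_def locE_simps)
  have step: "bnb cp s' & regs (exb cp s') 20 = int e & regs (exb cp s') 18 = ?D &
      Inv (Suc e) ((exb cp s')(|regs := (regs (exb cp s'))(20 := int (Suc e))|))"
    if e: "e < d * d" and Is: "Inv e s'" and r20: "regs s' 20 = int e" and r18: "regs s' 18 = ?D" for e s'
  proof -
    have f: "fr {20..23} s s'" using Is by (simp add: Inv_def)
    have rr: "regs s' 2 = ?n" "regs s' 9 = ?w" "regs s' 14 = int d" "regs s' 27 = int H" "regs s' 28 = int J" "regs s' 29 = int I"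
      "regs s' 11 = regs s 11"
      using frD[OF f] r by auto
    define l jj where "l = e div d" and "jj = e mod d"
    have lj: "int e div int d = int l" "int e - int l * int d = int jj"
      by (simp_all add: l_def jj_def zdiv_int zmod_int minus_div_mult_eq_mod)
    have ld: "l < d" "jj < d" using e d1 by (auto simp: l_def jj_def less_mult_imp_div_less)
    have m: "mem s' (loc ?n 8 ?w (int x) (int y)) = int (Xc n x y)" for x y
      using Is X loc_noP[of 8] by (simp add: Inv_def)
    define a1 where "a1 = loc ?n 8 ?w (int I * int d + int l) (int H * int d + int jj + 1)"
    define a2 where "a2 = loc ?n 8 ?w (int J * int d + int jj) (int H * int d + int l + 1)"
    have e1: "int I * int d + int l = int (I * d + l)" "int H * int d + int jj + 1 = int (H * d + jj + 1)"
      "int J * int d + int jj = int (J * d + jj)" "int H * int d + int l + 1 = int (H * d + l + 1)" by simp_all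
    have ma: "mem s' a1 = Am I H l jj" "mem s' a2 = Bm J H l jj"
      unfolding a1_def a2_def e1 m Am_def Bm_def by simp_all
    have na: "a2 ~= ?c z 1" "a2 ~= ?c z 2" for z
      unfolding a2_def using loc_cell_neq[of ?n 8 1] loc_cell_neq[of ?n 8 2] by simp_all
    have bU: "int l <= U" "int jj <= U" "\<bar>Am I H l jj\<bar> <= U" "\<bar>Bm J H l jj\<bar> <= U"
    proof -
      have "d * 1 <= d * d" using d1 by (intro mult_le_mono2)
      then show "int l <= U" "int jj <= U" using ld ddU(1) by linarith+
      have "int (Xc n x y) <= U" for x y using Xc_le[of n x y] nU(1) by linarith
      then show "\<bar>Am I H l jj\<bar> <= U" "\<bar>Bm J H l jj\<bar> <= U" by (auto simp: Am_def Bm_def)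
    qed
    have M: "mem (exb cp s') = (mem s')(?c (int e) 1 := Am I H l jj, ?c (int e) 2 := regs s 11,
        ?c (?D + int e) 1 := Bm J H l jj, ?c (?D + int e) 2 := regs s 11)"
      using r20 r18 rr lj ma[unfolded a1_def a2_def] na[unfolded a2_def] by (simp add: cp_def ev_locE ev_cellE)
    have R: "fr {20..23} s' (exb cp s')" "regs (exb cp s') 20 = int e" "regs (exb cp s') 18 = ?D"
      using r20 r18 by (simp_all add: cp_def fr_def)
    have B: "bnb cp s'"
      using r20 r18 rr lj ma[unfolded a1_def a2_def] na[unfolded a2_def] bU by (simp add: cp_def ev_locE ev_cellE)
    have "fr {20..23} s (exb cp s')" by (rule fr_trans[OF f R(1)]) auto
    moreover have "ALL z. noP ?n z --> mem (exb cp s') z = mem s z"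
      using Is noP_cell[of 1] noP_cell[of 2] unfolding M Inv_def by (auto simp del: of_nat_mult)
    moreover have "ALL z. mem (exb cp s') (?c z 2) = (if 0 <= z & z < int (Suc e) \<or> ?D <= z & z < ?D + int (Suc e) then regs s 11 else mem s (?c z 2))"
      using Is unfolding M Inv_def by (auto simp: cell_eq simp del: of_nat_mult)
    moreover have "ALL j<Suc e. mem (exb cp s') (?c (int j) 1) = Am I H (j div d) (j mod d) & mem (exb cp s') (?c (?D + int j) 1) = Bm J H (j div d) (j mod d)"
      using Is e unfolding M Inv_def by (auto simp: cell_eq less_Suc_eq l_def jj_def simp del: of_nat_mult)
    ultimately have "Inv (Suc e) ((exb cp s')(|regs := (regs (exb cp s'))(20 := int (Suc e))|))"
      unfolding Inv_def by (auto intro!: fr_upd simp del: of_nat_mult of_nat_Suc)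
    then show ?thesis using B R by simp
  qed
  have I0: "Inv 0 (s(|regs := (regs s)(20 := 0)|))" by (auto simp: Inv_def fr_def)
  have "run w (For 20 18 (blk cp)) (d * d * (bsz cp + 20) + 20) s (%s'. good s' & regs s' 20 = ?D & regs s' 18 = ?D & Inv (d * d) s')"
    by (rule run_For_blk[where I = Inv, OF g _ _ _ r(4) ok I0]) (use step in auto)
  then show ?thesis
  proof (rule run_mono)
    show "d * d * (bsz cp + 20) + 20 <= d * d * 1200 + 20"
      by (intro add_mono mult_le_mono2) (simp_all add: cp_def esz_locE esz_cellE)
    fix s' assume "good s' & regs s' 20 = ?D & regs s' 18 = ?D & Inv (d * d) s'"
    then show "good s' & fr {20..23} s s' &
     (ALL z. noP (int n) z --> mem s' z = mem s z) &
     (ALL z. mem s' (cell (int n) z 2) = (if 0 <= z & z < int (2 * d * d) then regs s 11 else mem s (cell (int n) z 2))) &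
     (ALL j<d * d. mem s' (cell (int n) (int j) 1) = Am I H (j div d) (j mod d) &
        mem s' (cell (int n) (int (d * d) + int j) 1) = Bm J H (j div d) (j mod d))"
    proof -
      have "int (2 * d * d) = ?D + ?D" by simp
      moreover assume "good s' & regs s' 20 = ?D & regs s' 18 = ?D & Inv (d * d) s'"
      moreover have "(0 <= z & z < ?D \<or> ?D <= z & z < ?D + ?D) = (0 <= z & z < ?D + ?D)" for z by auto
      ultimately show ?thesis unfolding Inv_def by metis
    qed
  qed
qed

lemma run_ac:
  assumes g: "good s" and r: "regs s 2 = int n" "regs s 9 = int (Suc k)" "regs s 14 = int d" "regs s 18 = int (d * d)"
      "regs s 28 = int J" "regs s 29 = int I"
    and st: "stamps s" and m0: "mem s 0 = 0"
    and F: "\<And>x y. mem s (loc (int n) 9 (int (Suc k)) (int x) (int y)) = int (F x y)" "\<And>x y. F x y <= n * n"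
    and Rn: "\<And>i j. Rm I J H i j <= n * n"
    and res: "\<And>i j. i < d ==> j < d ==> (if mem s (cell (int n) (int (2 * d * d + i * d + j)) 2) = regs s 11
         then mem s (cell (int n) (int (2 * d * d + i * d + j)) 1) else 0) = int (Rm I J H i j)"
  shows "run w (For 20 18 (blk ac)) (d * d * 1200 + 20) s (%s'. good s' & fr {20..25} s s' &
     mem s' = utab (int n) (mem s) 9 (int (Suc k)) (%x y. int (F x y +
       (if x div d = I & y div d = J then Rm I J H (x mod d) (y mod d) else 0))))"
proof -
  let ?n = "int n" and ?w = "int (Suc k)" and ?c = "cell (int n)" and ?D = "int (d * d)"
  define G where "G = (%e x y. int (F x y + (if x div d = I & y div d = J & x mod d * d + y mod d < e then Rm I J H (x mod d) (y mod d) else 0)))"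
  define Inv where "Inv = (%e (s'::state). fr {20..25} s s' & mem s' = utab ?n (mem s) 9 ?w (G e))"
  have ok: "\<forall>i\<in>set ac. ok_ins i" by (simp add: ac_def ok_exp_def locE_simps eind_def)
  have nU2: "int x <= U" if "x <= n * n" for x
  proof -
    have "int x <= int n * int n" using that by (simp flip: of_nat_mult)
    then show ?thesis using nU(2) by linarith
  qed
  have step: "bnb ac s' & regs (exb ac s') 20 = int e & regs (exb ac s') 18 = ?D &
      Inv (Suc e) ((exb ac s')(|regs := (regs (exb ac s'))(20 := int (Suc e))|))"
    if e: "e < d * d" and Is: "Inv e s'" and r20: "regs s' 20 = int e" and r18: "regs s' 18 = ?D" for e s'
  proof -
    have f: "fr {20..25} s s'" and m: "mem s' = utab ?n (mem s) 9 ?w (G e)" using Is by (simp_all add: Inv_def)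
    have rr: "regs s' 2 = ?n" "regs s' 9 = ?w" "regs s' 14 = int d" "regs s' 28 = int J" "regs s' 29 = int I"
      "regs s' 11 = regs s 11"
      using frD[OF f] r by auto
    define i j where "i = e div d" and "j = e mod d"
    have lj: "int e div int d = int i" "int e - int i * int d = int j"
      by (simp_all add: i_def j_def zdiv_int zmod_int minus_div_mult_eq_mod)
    have ij: "i < d" "j < d" "e = i * d + j" using e d1 by (auto simp: i_def j_def less_mult_imp_div_less)
    define z where "z = ?D + ?D + int e"
    have zz: "z = int (2 * d * d + i * d + j)" unfolding z_def ij(3) by (simp add: algebra_simps)
    have mP: "mem s' (?c z t) = mem s (?c z t)" if "t \<in> {1, 2}" for t
    proof -
      have "\<And>u x y. loc ?n 9 u x y ~= ?c z t" by (rule loc_cell_neq) (use that in auto)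
      then show ?thesis unfolding m by (intro utab_other) metis
    qed
    have m0': "mem s' 0 = 0"
      unfolding m by (subst utab_other) (use m0 cell_0[of 9 ?n] in \<open>auto simp: loc_def\<close>)
    define st' where "st' = mem s (?c z 2)"
    have stz: "0 <= regs s 11 - st'" "\<bar>st'\<bar> <= U"
    proof -
      have "0 <= st'" "st' <= regs s 11" using st unfolding stamps_def st'_def by auto
      moreover have "regs s 11 <= U" using goodD[OF g, of 11] by simp
      ultimately show "0 <= regs s 11 - st'" "\<bar>st'\<bar> <= U" by auto
    qed
    define q where "q = (if regs s 11 - st' = 0 then 1 else 0 :: int)"
    have q: "1 div (regs s 11 - st' + 1) = q" unfolding ind_div[OF stz(1)] q_def ..
    define v where "v = ?c z 1 * q"
    have mv: "mem s' v = int (Rm I J H i j)"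
    proof (cases "st' = regs s 11")
      case True
      then have "v = ?c z 1" by (simp add: v_def q_def)
      then show ?thesis using res[OF ij(1,2)] mP[of 1] True unfolding st'_def zz[symmetric] by simp
    next
      case False
      then have "v = 0" by (simp add: v_def q_def)
      then show ?thesis using res[OF ij(1,2)] m0' False unfolding st'_def zz[symmetric] by simp
    qed
    define x y where "x = I * d + i" and "y = J * d + j"
    have xy: "int I * int d + int i = int x" "int J * int d + int j = int y" by (simp_all add: x_def y_def)
    have xyd: "x div d = I" "y div d = J" "x mod d = i" "y mod d = j" using ij by (simp_all add: x_def y_def)
    have mG: "mem s' (loc ?n 9 ?w (int x) (int y)) = int (F x y)"
      unfolding m G_def using utab_loc[of ?n 9 ?w 9 ?w] xyd ij(3) by simp
    have bU: "\<bar>st'\<bar> <= U" "\<bar>q\<bar> <= U" "int (Rm I J H i j) <= U" "int i <= U" "int j <= U" "int (F x y) <= U"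
    proof -
      have "d * 1 <= d * d" using d1 by (intro mult_le_mono2)
      then show "int i <= U" "int j <= U" using ij ddU(1) by linarith+
    qed (use stz U100 nU2 Rn F in \<open>auto simp: q_def\<close>)
    have mz: "mem s' (?c z 2) = st'" using mP[of 2] by (simp add: st'_def)
    have M: "mem (exb ac s') = (mem s')(loc ?n 9 ?w (int x) (int y) := int (F x y) + int (Rm I J H i j))"
      using r20 r18 rr lj mz[unfolded z_def] q mv[unfolded v_def z_def] xy mG
      by (simp add: ac_def ev_locE ev_cellE ev_eind del: of_nat_mult)
    have R: "fr {20..25} s' (exb ac s')" "regs (exb ac s') 20 = int e" "regs (exb ac s') 18 = ?D"
      using r20 r18 by (simp_all add: ac_def fr_def)
    have B: "bnb ac s'"
      using r20 r18 rr lj mz[unfolded z_def] q mv[unfolded v_def z_def] xy mG bU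
      by (simp add: ac_def ev_locE ev_cellE ev_eind del: of_nat_mult)
    have "mem (exb ac s') = utab ?n (mem s) 9 ?w (G (Suc e))"
    proof -
      have "(%x' y'. if x' = x & y' = y then int (F x y) + int (Rm I J H i j) else G e x' y') = G (Suc e)"
      proof (intro ext)
        fix x' y'
        have "x' = x & y' = y" if *: "x' div d = I" "y' div d = J" "x' mod d * d + y' mod d = e"
        proof -
          have "x' mod d * d + y' mod d = i * d + j" using * ij by simp
          moreover have "(x' mod d * d + y' mod d) div d = x' mod d" "(x' mod d * d + y' mod d) mod d = y' mod d"
            "(i * d + j) div d = i" "(i * d + j) mod d = j" using d1 ij by simp_all
          ultimately have ee: "x' mod d = i" "y' mod d = j" by simp_all
          have "x' = x' div d * d + x' mod d" "y' = y' div d * d + y' mod d" by simp_all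
          then show ?thesis unfolding * ee x_def y_def by blast
        qed
        then show "(if x' = x & y' = y then int (F x y) + int (Rm I J H i j) else G e x' y') = G (Suc e) x' y'"
          using xyd ij(3) by (cases "x' = x & y' = y") (simp add: G_def, auto simp: G_def less_Suc_eq)
      qed
      then show ?thesis unfolding M m by (subst utab_upd) simp_all
    qed
    then have "Inv (Suc e) ((exb ac s')(|regs := (regs (exb ac s'))(20 := int (Suc e))|))"
      using fr_trans[OF f R(1), of "{20..25}"] by (auto simp: Inv_def intro!: fr_upd)
    then show ?thesis using B R by simp
  qed
  have "(%x y. mem s (loc ?n 9 ?w (int x) (int y))) = G 0" using F(1) by (auto simp: G_def fun_eq_iff)
  from utab_id[of ?n "mem s" 9 ?w, unfolded this]
  have I0: "Inv 0 (s(|regs := (regs s)(20 := 0)|))" by (auto simp: Inv_def fr_def)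
  have "run w (For 20 18 (blk ac)) (d * d * (bsz ac + 20) + 20) s (%s'. good s' & regs s' 20 = ?D & regs s' 18 = ?D & Inv (d * d) s')"
    by (rule run_For_blk[where I = Inv, OF g _ _ _ r(4) ok I0]) (use step in auto)
  then show ?thesis
  proof (rule run_mono)
    show "d * d * (bsz ac + 20) + 20 <= d * d * 1200 + 20"
      by (intro add_mono mult_le_mono2) (simp_all add: ac_def esz_locE esz_cellE eind_def)
    fix s' assume s': "good s' & regs s' 20 = ?D & regs s' 18 = ?D & Inv (d * d) s'"
    have lt: "x mod d * d + y mod d < d * d" for x y
    proof -
      have "y mod d < d" "Suc (x mod d) <= d" using d1 by (auto simp: Suc_le_eq)
      then have "x mod d * d + y mod d < Suc (x mod d) * d" "Suc (x mod d) * d <= d * d" by (simp, intro mult_le_mono1)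
      then show ?thesis by linarith
    qed
    show "good s' & fr {20..25} s s' & mem s' = utab (int n) (mem s) 9 (int (Suc k)) (%x y. int (F x y +
       (if x div d = I & y div d = J then Rm I J H (x mod d) (y mod d) else 0)))"
      using s' lt by (simp add: Inv_def G_def)
  qed
qed

lemma sum_Rm: "(\<Sum>H<h. Rm I J H i j) = (\<Sum>t<h * d. Xc n (I * d + i) (Suc t) * Xc n (J * d + j) (Suc t))"
proof -
  have "(\<Sum>H<h. Rm I J H i j) = (\<Sum>H<h. \<Sum>l<d. Xc n (I * d + i) (Suc (H * d + l)) * Xc n (J * d + j) (Suc (H * d + l)))"
    by (simp add: Rm_def)
  also have "\<dots> = (\<Sum>t<h * d. Xc n (I * d + i) (Suc (t div d * d + t mod d)) * Xc n (J * d + j) (Suc (t div d * d + t mod d)))"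
    by (rule sum_div_mod[symmetric])
  finally show ?thesis by simp
qed

text \<open>Partial scalar products never exceed the number of all pairs of positions, so
  intermediate table entries stay below \<open>U\<close>.\<close>

lemma sum_X_le: "(\<Sum>t<T. Xc n x (Suc t) * Xc n y (Suc t)) <= n * n"
proof -
  have "(\<Sum>t<T. Xc n x (Suc t) * Xc n y (Suc t)) <= (\<Sum>t<max T (card (Hs n)). Xc n x (Suc t) * Xc n y (Suc t))"
    by (intro sum_mono2) auto
  also have "\<dots> <= pairM x y" using X_prod[of "max T (card (Hs n))" x y] heavy_light[of x y] by simp
  finally show ?thesis using pairM_le[of x y] by linarith
qed

lemma Rm_le: "Rm I J H i j <= n * n"
proof -
  have "Rm I J H i j <= (\<Sum>H<Suc H. Rm I J H i j)" by simp
  then show ?thesis using sum_X_le[of "I * d + i" "J * d + j" "Suc H * d"] unfolding sum_Rm by linarith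
qed

definition Mc :: "nat => nat => nat => nat" where
  "Mc m x y = (\<Sum>c<m. if x div d = c div nh div nb & y div d = c div nh mod nb
     then Rm (c div nh div nb) (c div nh mod nb) (c mod nh) (x mod d) (y mod d) else 0)"

text \<open>Regrouping the calls by \<open>(I, J, H)\<close> joins the slices of the summation index
  to a full scalar product of length \<open>nh * d\<close>.\<close>

lemma Mc_all: "Mc (nb * nb * nh) x y = (if x div d < nb & y div d < nb
   then (\<Sum>t<nh * d. Xc n x (Suc t) * Xc n y (Suc t)) else 0)"
proof -
  define g where "g = (%I J H. if x div d = I & y div d = J then Rm I J H (x mod d) (y mod d) else 0)"
  have "Mc (nb * nb * nh) x y = (\<Sum>c<nb * nb * nh. g (c div nh div nb) (c div nh mod nb) (c mod nh))"
    by (simp add: Mc_def g_def)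
  also have "\<dots> = (\<Sum>p<nb * nb. \<Sum>H<nh. g (p div nb) (p mod nb) H)"
    by (rule sum_div_mod[of "%p. g (p div nb) (p mod nb)"])
  also have "\<dots> = (\<Sum>I<nb. \<Sum>J<nb. \<Sum>H<nh. g I J H)"
    by (rule sum_div_mod[of "%I J. \<Sum>H<nh. g I J H"])
  also have "\<dots> = (\<Sum>I<nb. \<Sum>J<nb. if I = x div d then (if J = y div d then (\<Sum>H<nh. Rm I J H (x mod d) (y mod d)) else 0) else 0)"
    by (intro sum.cong refl) (auto simp: g_def)
  also have "\<dots> = (\<Sum>I<nb. if I = x div d then (if y div d < nb then (\<Sum>H<nh. Rm I (y div d) H (x mod d) (y mod d)) else 0) else 0)"
    by (intro sum.cong refl) simp
  also have "\<dots> = (if x div d < nb & y div d < nb then (\<Sum>H<nh. Rm (x div d) (y div d) H (x mod d) (y mod d)) else 0)"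
    by simp
  finally show ?thesis by (simp add: sum_Rm)
qed

lemma Mc_le: "m <= nb * nb * nh ==> Mc m x y <= n * n"
proof -
  assume "m <= nb * nb * nh"
  then have "Mc m x y <= Mc (nb * nb * nh) x y" unfolding Mc_def by (intro sum_mono2) auto
  then show ?thesis using sum_X_le[of x y "nh * d"] unfolding Mc_all by (auto split: if_splits)
qed

definition kb0 :: nat where
  "kb0 = 2 * (d * d * 1200 + 20) + bsz cl1 + cregs P + 4 + 40 * (KK * csz P) + 10"

abbreviation "TT == ({10, 11, 99} \<union> {20..29} \<union> {1000..} :: nat set)"

lemma run_callc:
  assumes g: "good s" and r: "regs s 2 = int n" "regs s 9 = int (Suc k)" "regs s 14 = int d" "regs s 16 = int nb" "regs s 17 = int nh"
      "regs s 18 = int (d * d)" "regs s 30 = int c" "0 < regs s 10" "regs s 10 <= int CK" "0 <= regs s 11" "regs s 11 + 1 <= U" "regs s 99 \<in> {0, 1}"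
    and c: "c < nb * nb * nh" and st: "stamps s" and m0: "mem s 0 = 0"
    and X: "\<And>x y. mem s (loc (int n) 8 (int (Suc k)) (int x) (int y)) = int (Xc n x y)"
    and F: "\<And>x y. mem s (loc (int n) 9 (int (Suc k)) (int x) (int y)) = int (F x y)" "\<And>x y. F x y <= n * n"
  shows "EX \<kappa>. run w (callc P) \<kappa> s (%s'. good s' & fr TT s s' &
     int \<kappa> <= int kb0 + 40 * int KK * (regs s 10 - regs s' 10) & regs s' 99 \<in> {0, 1} & stamps s' & regs s' 11 = regs s 11 + 1 &
     regs s' 10 <= regs s 10 & - int LOW <= regs s' 10 & regs s 10 - regs s' 10 <= 40 * int Tm &
     (EX F'. (ALL z. noP (int n) z --> mem s' z = utab (int n) (mem s) 9 (int (Suc k)) F' z) &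
        (regs s' 10 > 0 --> F' = (%x y. int (F x y + (if x div d = c div nh div nb & y div d = c div nh mod nb
            then Rm (c div nh div nb) (c div nh mod nb) (c mod nh) (x mod d) (y mod d) else 0))))))"
proof -
  let ?n = "int n" and ?w = "int (Suc k)"
  define I J H where "I = c div nh div nb" and "J = c div nh mod nb" and "H = c mod nh"
  have cU: "int c <= U" using c ddU(2) by linarith
  have iv: "int c div int nh = int (c div nh)" "int c - int (c div nh) * int nh = int H"
     "int (c div nh) div int nb = int I" "int (c div nh) - int I * int nb = int J"
    by (simp_all add: I_def J_def H_def zdiv_int zmod_int minus_div_mult_eq_mod)
  have le: "c div nh <= c" "H <= c" "I <= c" "J <= c"
    unfolding I_def J_def H_def by (meson div_le_dividend mod_less_eq_dividend order_trans)+
  have bU: "int (c div nh) <= U" "int H <= U" "int I <= U" "int J <= U" using le cU by linarith+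
  define s1 where "s1 = exb cl1 s"
  have s1: "mem s1 = mem s" "regs s1 29 = int I" "regs s1 28 = int J" "regs s1 27 = int H" "regs s1 11 = regs s 11 + 1" "fr ({11} \<union> {27..29}) s s1"
    unfolding s1_def by (simp_all add: cl1_def r iv fr_def)
  have B1: "bnb cl1 s" using r iv bU by (simp add: cl1_def)
  have ok1: "\<forall>i\<in>set cl1. ok_ins i" by (simp add: cl1_def ok_exp_def)
  have R1: "run w (blk cl1) (bsz cl1) s (%s'. good s' & s' = s1)"
    by (rule run_blk[OF g ok1 B1]) (simp add: s1_def)
  then have g1: "good s1" unfolding run_def by blast
  have R1: "run w (blk cl1) (bsz cl1) s (%s'. s' = s1)" using R1 by (rule run_mono) auto
  have q1: "regs s1 2 = ?n" "regs s1 9 = ?w" "regs s1 14 = int d" "regs s1 18 = int (d * d)" "regs s1 10 = regs s 10" "regs s1 99 \<in> {0, 1}"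
    using frD[OF s1(6)] r by simp_all
  obtain s2 where R2: "run w (For 20 18 (blk cp)) (d * d * 1200 + 20) s1 (%s'. s' = s2)" and s2: "good s2" "fr {20..23} s1 s2"
     "\<And>z. noP ?n z ==> mem s2 z = mem s1 z"
     "\<And>z. mem s2 (cell ?n z 2) = (if 0 <= z & z < int (2 * d * d) then regs s1 11 else mem s1 (cell ?n z 2))"
     "\<And>j. j < d * d ==> mem s2 (cell ?n (int j) 1) = Am I H (j div d) (j mod d)"
     "\<And>j. j < d * d ==> mem s2 (cell ?n (int (d * d) + int j) 1) = Bm J H (j div d) (j mod d)"
    using run_obtain[OF run_cp[OF g1 q1(1-4) s1(4,3,2), unfolded s1(1,5)]] r X s1(1,5) by auto
  have q2: "regs s2 2 = ?n" "regs s2 9 = ?w" "regs s2 14 = int d" "regs s2 18 = int (d * d)" "regs s2 10 = regs s 10" "regs s2 99 \<in> {0, 1}"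
    "regs s2 11 = regs s 11 + 1" "regs s2 28 = int J" "regs s2 29 = int I"
    using frD[OF s2(2)] q1 s1 by simp_all
  have st2: "stamps s2"
    unfolding stamps_def
  proof
    fix j
    have "0 <= mem s (cell ?n j 2)" "mem s (cell ?n j 2) <= regs s 11" using st by (auto simp: stamps_def)
    then show "0 <= mem s2 (cell ?n j 2) & mem s2 (cell ?n j 2) <= regs s2 11"
      unfolding s2(4) q2(7) s1(1,5) using r(10) by auto
  qed
  have vm2: "(if mem s2 (cell ?n z 2) = regs s2 11 then mem s2 (cell ?n z 1) else 0) = mem (mm_init d (Am I H) (Bm J H)) z" for z
  proof (cases "0 <= z & z < int (2 * d * d)")
    case True
    then have e: "mem s2 (cell ?n z 2) = regs s2 11" unfolding s2(4) q2(7) s1(5) by simp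
    show ?thesis
    proof (cases "z < int (d * d)")
      case z: True
      then have "nat z < d * d" using True by (simp add: nat_less_iff)
      from s2(5)[OF this] show ?thesis using e z True by (simp add: mm_init_def del: of_nat_mult)
    next
      case z: False
      have "nat z < 2 * d * d" using True by (subst nat_less_iff) auto
      then have "nat z - d * d < d * d" by simp
      from s2(6)[OF this] have "mem s2 (cell ?n z 1) = Bm J H ((nat z - d * d) div d) ((nat z - d * d) mod d)"
        using z True by (simp add: of_nat_diff nat_le_iff le_nat_iff del: of_nat_mult)
      then show ?thesis using e z True by (simp add: mm_init_def del: of_nat_mult)
    qed
  next
    case False
    have "mem s (cell ?n z 2) <= regs s 11" using st by (auto simp: stamps_def)
    then have "mem s2 (cell ?n z 2) ~= regs s2 11" unfolding s2(4) q2(7) s1(1) using False by auto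
    moreover have "mem (mm_init d (Am I H) (Bm J H)) z = 0"
    proof -
      have "int (d * d) <= int (2 * d * d)" by (simp only: of_nat_le_iff)
      then have "\<not> (0 <= z & z < int (d * d))" "\<not> (int (d * d) <= z & z < int (2 * d * d))" using False by linarith+
      then show ?thesis unfolding mm_init_def by (simp only: state.simps if_False)
    qed
    ultimately show ?thesis by simp
  qed
  have AB: "ALL i<d. ALL j<d. \<bar>Am I H i j\<bar> <= int n & \<bar>Bm J H i j\<bar> <= int n" using Xc_le by (simp add: Am_def Bm_def)
  obtain \<tau> s3 where e3: "exec (Seq (zregs (Suc (cregs P))) (Seq (Op Add 1000 14 100) (sb P))) s2 \<tau> s3"
     and t3: "int \<tau> <= int ((cregs P + 4) * w) + 40 * int KK * (regs s2 10 - regs s3 10) + 40 * int (KK * csz P)"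
     and s3: "good s3" "fr Pr s2 s3" "\<And>z. noP ?n z ==> mem s3 z = mem s2 z" "stamps s3" "regs s3 99 \<in> {0, 1}"
     "regs s3 10 <= regs s2 10" "- int LOW <= regs s3 10" "regs s2 10 - regs s3 10 <= 40 * int Tm"
     and res3: "regs s3 10 > 0 ==> (ALL i<d. ALL j<d. (
        (if mem s3 (cell ?n (int (2 * d * d + i * d + j)) 2) = regs s3 11
         then mem s3 (cell ?n (int (2 * d * d + i * d + j)) 1) else 0) = (\<Sum>l<d. Am I H i l * Bm J H l j)))"
    using run_sbP[OF s2(1) q2(1,3) _ _ q2(6) st2 vm2 AB] r q2(5) by auto
  define \<kappa> where "\<kappa> = cregs P + 4 + 40 * KK * nat (regs s 10 - regs s3 10) + 40 * (KK * csz P)"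
  have ck3: "0 <= regs s 10 - regs s3 10" using s3(6) q2(5) by simp
  have \<kappa>i: "int \<kappa> = int (cregs P + 4) + 40 * int KK * (regs s 10 - regs s3 10) + 40 * int (KK * csz P)"
    using ck3 by (simp add: \<kappa>_def)
  have "\<tau> <= \<kappa> * w"
  proof -
    have "int \<tau> <= int ((cregs P + 4) * w) + int (40 * KK * nat (regs s 10 - regs s3 10) + 40 * (KK * csz P))"
      using t3 ck3 unfolding q2(5) by simp
    then have "\<tau> <= (cregs P + 4) * w + (40 * KK * nat (regs s 10 - regs s3 10) + 40 * (KK * csz P))"
      by (simp only: of_nat_add[symmetric] of_nat_le_iff)
    also have "\<dots> <= (cregs P + 4) * w + (40 * KK * nat (regs s 10 - regs s3 10) + 40 * (KK * csz P)) * w"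
      using w1 by (intro add_left_mono) (metis mult_le_mono2 nat_mult_1_right)
    finally show ?thesis unfolding \<kappa>_def by (simp only: distrib_right add.assoc)
  qed
  then have R3: "run w (Seq (zregs (Suc (cregs P))) (Seq (Op Add 1000 14 100) (sb P))) \<kappa> s2 (%s'. s' = s3)"
    using e3 unfolding run_def by blast
  have q3: "regs s3 2 = ?n" "regs s3 9 = ?w" "regs s3 14 = int d" "regs s3 18 = int (d * d)"
    "regs s3 11 = regs s 11 + 1" "regs s3 28 = int J" "regs s3 29 = int I"
    using frD[OF s3(2)] q2 by simp_all
  have m3: "mem s3 z = mem s z" if "noP ?n z" for z using that s3(3) s2(3) s1(1) by simp
  have f3: "fr TT s s3"
    by (rule fr_trans[OF fr_trans[OF s1(6) s2(2), where T'' = "{11} \<union> {20..29}"] s3(2)]) auto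
  define F1 where "F1 = (%x y. int (F x y + (if x div d = I & y div d = J then Rm I J H (x mod d) (y mod d) else 0)))"
  let ?Q = "%s'. good s' & fr TT s s' &
     int (bsz cl1 + ((d * d * 1200 + 20) + (\<kappa> + (esz (V 10) + 2 + (d * d * 1200 + 20))))) <= int kb0 + 40 * int KK * (regs s 10 - regs s' 10) &
     regs s' 99 \<in> {0, 1} & stamps s' & regs s' 11 = regs s 11 + 1 &
     regs s' 10 <= regs s 10 & - int LOW <= regs s' 10 & regs s 10 - regs s' 10 <= 40 * int Tm &
     (EX F'. (ALL z. noP ?n z --> mem s' z = utab ?n (mem s) 9 ?w F' z) & (regs s' 10 > 0 --> F' = F1))"
  have kap: "int (bsz cl1 + ((d * d * 1200 + 20) + (\<kappa> + (esz (V 10) + 2 + (d * d * 1200 + 20))))) <= int kb0 + 40 * int KK * (regs s 10 - regs s3 10)"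
    unfolding of_nat_add \<kappa>i kb0_def by simp
  have R4: "run w (IfE (V 10) (For 20 18 (blk ac)) Skip) (esz (V 10) + 2 + (d * d * 1200 + 20)) s3 ?Q"
  proof (rule run_IfE[OF s3(1)])
    show "ok_exp (V 10)" by (simp add: ok_exp_def)
    assume "ev (V 10) (regs s3) > 0"
    then have p: "regs s3 10 > 0" by simp
    have res: "(if mem s3 (cell ?n (int (2 * d * d + i * d + j)) 2) = regs s3 11
         then mem s3 (cell ?n (int (2 * d * d + i * d + j)) 1) else 0) = int (Rm I J H i j)" if "i < d" "j < d" for i j
    proof -
      have "(\<Sum>l<d. Am I H i l * Bm J H l j) = int (Rm I J H i j)" by (simp add: Am_def Bm_def Rm_def)
      then show ?thesis using res3[OF p] that by simp
    qed
    have "run w (For 20 18 (blk ac)) (d * d * 1200 + 20) s3 (%s'. good s' & fr {20..25} s3 s' &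
       mem s' = utab ?n (mem s3) 9 ?w (%x y. int (F x y + (if x div d = I & y div d = J then Rm I J H (x mod d) (y mod d) else 0))))"
      by (rule run_ac[OF s3(1) q3(1-4,6,7) s3(4)]) (use m3 m0 noP_0 F Rm_le res loc_noP[of 9] in auto)
    then show "run w (For 20 18 (blk ac)) (d * d * 1200 + 20) s3 ?Q"
    proof (rule run_mono[OF _ order_refl])
      fix s' assume "good s' & fr {20..25} s3 s' &
        mem s' = utab ?n (mem s3) 9 ?w (%x y. int (F x y + (if x div d = I & y div d = J then Rm I J H (x mod d) (y mod d) else 0)))"
      then have s': "good s'" "fr {20..25} s3 s'" "mem s' = utab ?n (mem s3) 9 ?w F1" by (auto simp: F1_def)
      have r': "regs s' 10 = regs s3 10" "regs s' 11 = regs s3 11" "regs s' 99 = regs s3 99" using frD[OF s'(2)] by simp_all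
      have "mem s' (cell ?n j 2) = mem s3 (cell ?n j 2)" for j
      proof -
        have "\<And>u x y. loc ?n 9 u x y ~= cell ?n j 2" by (rule loc_cell_neq) auto
        then show ?thesis unfolding s'(3) by (intro utab_other) metis
      qed
      then have st': "stamps s'" using s3(4) r' by (simp add: stamps_def)
      have mm: "ALL z. noP ?n z --> mem s' z = utab ?n (mem s) 9 ?w F1 z"
        unfolding s'(3) using utab_cong m3 by blast
      have f4: "fr TT s s'" by (rule fr_trans[OF f3 s'(2)]) auto
      show "?Q s'"
        using s'(1) f4 st' mm kap s3 ck3 q2(5) q3(5) unfolding r' by auto
    qed
  next
    assume "ev (V 10) (regs s3) <= 0"
    then have p: "\<not> regs s3 10 > 0" by simp
    have "?Q s3"
    proof (intro conjI exI[of _ "%x y. mem s (loc ?n 9 ?w (int x) (int y))"] allI impI)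
      show "mem s3 z = utab ?n (mem s) 9 ?w (%x y. mem s (loc ?n 9 ?w (int x) (int y))) z" if "noP ?n z" for z
        using m3[OF that] utab_id[of ?n "mem s" 9 ?w] by simp
    qed (use p s3 f3 kap ck3 q2(5) q3(5) in auto)
    then have "run w Skip 1 s3 ?Q" by (intro run_Skip w1)
    then show "run w Skip (d * d * 1200 + 20) s3 ?Q" by (rule run_mono) auto
  qed
  have "run w (callc P) (bsz cl1 + ((d * d * 1200 + 20) + (\<kappa> + (esz (V 10) + 2 + (d * d * 1200 + 20))))) s ?Q"
    unfolding callc_def by (intro run_Seq run_then[OF R1] run_then[OF R2] run_then[OF R3] R4)
  then show ?thesis unfolding F1_def I_def J_def H_def by blast
qed

definition kb1 :: nat where "kb1 = kb0 + 40"

text \<open>The calls share one clock. Their total time is bounded by the clock, not by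
  \<open>Tm\<close>; in turn the clock loses at most 40 times the total running time of
  \<open>P\<close>, so that enough initial clock forces completion.\<close>

lemma run_calls:
  assumes g: "good s" and r: "regs s 2 = int n" "regs s 9 = int (Suc k)" "regs s 14 = int d" "regs s 16 = int nb" "regs s 17 = int nh"
      "regs s 18 = int (d * d)" "regs s 19 = int (nb * nb * nh)" "regs s 10 <= int CK" "- int LOW <= regs s 10" "0 <= regs s 11" "regs s 11 + int (nb * nb * nh) <= U" "regs s 99 \<in> {0, 1}"
    and st: "stamps s" and m0: "mem s 0 = 0"
    and X: "\<And>x y. mem s (loc (int n) 8 (int (Suc k)) (int x) (int y)) = int (Xc n x y)"
    and F0: "\<And>x y. mem s (loc (int n) 9 (int (Suc k)) (int x) (int y)) = 0"
  shows "run w (For 30 19 (IfE (V 10) (callc P) Skip)) (nb * nb * nh * kb1 + 40 * KK * (CK + LOW) + 20) s (%s'. good s' & fr (TT \<union> {30}) s s' &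
     regs s' 99 \<in> {0, 1} & stamps s' & regs s 11 <= regs s' 11 & regs s' 11 <= regs s 11 + int (nb * nb * nh) &
     regs s' 10 <= regs s 10 & - int LOW <= regs s' 10 & regs s 10 - regs s' 10 <= 40 * int (nb * nb * nh) * int Tm &
     (EX F. (ALL z. noP (int n) z --> mem s' z = utab (int n) (mem s) 9 (int (Suc k)) F z) &
        (regs s' 10 > 0 --> F = (%x y. int (Mc (nb * nb * nh) x y)))))"
proof -
  let ?n = "int n" and ?w = "int (Suc k)" and ?N = "nb * nb * nh"
  define Inv where "Inv = (%c (s'::state). fr (TT \<union> {30}) s s' &
     regs s' 99 \<in> {0, 1} & stamps s' & regs s 11 <= regs s' 11 & regs s' 11 <= regs s 11 + int c &
     regs s' 10 <= regs s 10 & - int LOW <= regs s' 10 & regs s 10 - regs s' 10 <= 40 * int Tm * int c &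
     (EX F. (ALL z. noP ?n z --> mem s' z = utab ?n (mem s) 9 ?w F z) &
        (regs s' 10 > 0 --> F = (%x y. int (Mc c x y)))))"
  \<comment> \<open>The potential: a constant per outstanding call plus the remaining clock, raised
    by \<open>LOW\<close> so that it is nonnegative.\<close>
  define C where "C = (%c (s'::state). (?N - c) * kb1 + 40 * KK * nat (regs s' 10 + int LOW))"
  have I0: "Inv 0 (s(|regs := (regs s)(30 := 0)|))"
    unfolding Inv_def
  proof (intro conjI exI[of _ "%x y. 0 :: int"] allI impI)
    have "utab ?n (mem s) 9 ?w (%x y. 0) = mem s" using utab_id[of ?n "mem s" 9 ?w] unfolding F0 .
    then show "mem (s(|regs := (regs s)(30 := 0)|)) z = utab ?n (mem s) 9 ?w (%x y. 0) z" for z by simp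
  qed (use r st in \<open>auto simp: fr_def stamps_def Mc_def\<close>)
  have step: "EX \<kappa>. run w (IfE (V 10) (callc P) Skip) \<kappa> s' (%s''. good s'' & regs s'' 30 = int c & regs s'' 19 = int ?N &
        Inv (Suc c) (s''(|regs := (regs s'')(30 := int (Suc c))|)) &
        \<kappa> + 20 + C (Suc c) (s''(|regs := (regs s'')(30 := int (Suc c))|)) <= C c s')"
    if c: "c < ?N" and g': "good s'" and Is: "Inv c s'" and r30: "regs s' 30 = int c" and r19: "regs s' 19 = int ?N" for c s'
  proof -
    have f: "fr (TT \<union> {30}) s s'" using Is by (simp add: Inv_def)
    have rr: "regs s' 2 = ?n" "regs s' 9 = ?w" "regs s' 14 = int d" "regs s' 16 = int nb" "regs s' 17 = int nh" "regs s' 18 = int (d * d)"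
      using frD[OF f] r by simp_all
    have i: "regs s' 99 \<in> {0, 1}" "stamps s'" "regs s 11 <= regs s' 11" "regs s' 11 <= regs s 11 + int c"
       "regs s' 10 <= regs s 10" "- int LOW <= regs s' 10" "regs s 10 - regs s' 10 <= 40 * int Tm * int c"
      using Is by (auto simp: Inv_def)
    obtain F where F: "\<And>z. noP ?n z ==> mem s' z = utab ?n (mem s) 9 ?w F z" "regs s' 10 > 0 ==> F = (%x y. int (Mc c x y))"
      using Is unfolding Inv_def by blast
    have Ns: "?N - c = Suc (?N - Suc c)" using c by simp
    have Tn: "0 <= 40 * int Tm" by simp
    have ok: "ok_exp (V 10)" by (simp add: ok_exp_def)
    show ?thesis
    proof (cases "regs s' 10 > 0")
      case True
      have m0': "mem s' 0 = 0"
      proof -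
        have "utab ?n (mem s) 9 ?w F 0 = mem s 0" using cell_0[of 9 ?n] by (intro utab_other) (auto simp: loc_def)
        then show ?thesis using F(1)[OF noP_0] m0 by simp
      qed
      have X': "mem s' (loc ?n 8 ?w (int x) (int y)) = int (Xc n x y)" for x y
        using F(1)[OF loc_noP, of 8] utab_loc[of ?n 9 ?w 8 ?w] X by simp
      have F': "mem s' (loc ?n 9 ?w (int x) (int y)) = int (Mc c x y)" for x y
        using F(1)[OF loc_noP, of 9] utab_loc[of ?n 9 ?w 9 ?w] F(2)[OF True] by simp
      have h: "regs s' 10 <= int CK" "0 <= regs s' 11" "regs s' 11 + 1 <= U" using i r c by linarith+
      obtain \<kappa> where R: "run w (callc P) \<kappa> s' (%s''. good s'' & fr TT s' s'' &
         int \<kappa> <= int kb0 + 40 * int KK * (regs s' 10 - regs s'' 10) & regs s'' 99 \<in> {0, 1} & stamps s'' & regs s'' 11 = regs s' 11 + 1 &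
         regs s'' 10 <= regs s' 10 & - int LOW <= regs s'' 10 & regs s' 10 - regs s'' 10 <= 40 * int Tm &
         (EX F'. (ALL z. noP ?n z --> mem s'' z = utab ?n (mem s') 9 ?w F' z) &
            (regs s'' 10 > 0 --> F' = (%x y. int (Mc c x y + (if x div d = c div nh div nb & y div d = c div nh mod nb
                then Rm (c div nh div nb) (c div nh mod nb) (c mod nh) (x mod d) (y mod d) else 0))))))"
        using run_callc[OF g' rr r30 True h i(1) c i(2) m0' X' F' Mc_le[OF less_imp_le[OF c]]] by blast
      show ?thesis
      proof (rule exI[of _ "esz (V 10) + 2 + \<kappa>"], rule run_IfE[OF g' ok])
        assume "0 < ev (V 10) (regs s')"
        show "run w (callc P) \<kappa> s' (%s''. good s'' & regs s'' 30 = int c & regs s'' 19 = int ?N &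
          Inv (Suc c) (s''(|regs := (regs s'')(30 := int (Suc c))|)) &
          esz (V 10) + 2 + \<kappa> + 20 + C (Suc c) (s''(|regs := (regs s'')(30 := int (Suc c))|)) <= C c s')"
        proof (rule run_mono[OF R order_refl], elim conjE exE)
          fix s'' F'
          assume a: "good s''" "fr TT s' s''" "int \<kappa> <= int kb0 + 40 * int KK * (regs s' 10 - regs s'' 10)" "regs s'' 99 \<in> {0, 1}" "stamps s''"
            "regs s'' 11 = regs s' 11 + 1" "regs s'' 10 <= regs s' 10" "- int LOW <= regs s'' 10" "regs s' 10 - regs s'' 10 <= 40 * int Tm"
            "ALL z. noP ?n z --> mem s'' z = utab ?n (mem s') 9 ?w F' z"
            "0 < regs s'' 10 --> F' = (%x y. int (Mc c x y + (if x div d = c div nh div nb & y div d = c div nh mod nb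
                then Rm (c div nh div nb) (c div nh mod nb) (c mod nh) (x mod d) (y mod d) else 0)))"
          let ?s = "s''(|regs := (regs s'')(30 := int (Suc c))|)"
          have r'': "regs s'' 30 = int c" "regs s'' 19 = int ?N" using frD[OF a(2)] r30 r19 by simp_all
          have mm: "mem s'' z = utab ?n (mem s) 9 ?w F' z" if "noP ?n z" for z
            using a(10) F(1) that utab_utab[of "mem s'" z ?n "mem s" 9 ?w F F'] by simp
          have "Inv (Suc c) ?s"
            unfolding Inv_def
          proof (intro conjI exI[of _ F'] allI impI)
            show "fr (TT \<union> {30}) s ?s" by (intro fr_upd fr_trans[OF f a(2)]) auto
            show "mem ?s z = utab ?n (mem s) 9 ?w F' z" if "noP ?n z" for z using mm[OF that] by simp
            show "F' = (%x y. int (Mc (Suc c) x y))" if "0 < regs ?s 10" using a(11) that by (simp add: Mc_def)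
            have "40 * int Tm * int (Suc c) = 40 * int Tm * int c + 40 * int Tm" by (simp add: algebra_simps)
            then show "regs s 10 - regs ?s 10 <= 40 * int Tm * int (Suc c)" using a(9) i(7) by simp
          qed (use a i in \<open>auto simp: stamps_def\<close>)
          moreover have "esz (V 10) + 2 + \<kappa> + 20 + C (Suc c) ?s <= C c s'"
          proof -
            have "int (esz (V 10) + 2 + \<kappa> + 20 + C (Suc c) ?s) = 24 + int \<kappa> + int ((?N - Suc c) * kb1) + 40 * int KK * (regs s'' 10 + int LOW)"
              using a(8) by (simp add: C_def)
            also have "\<dots> <= 24 + (int kb0 + 40 * int KK * (regs s' 10 - regs s'' 10)) + int ((?N - Suc c) * kb1) + 40 * int KK * (regs s'' 10 + int LOW)"
              using a(3) by simp
            also have "\<dots> <= int ((?N - c) * kb1) + 40 * int KK * (regs s' 10 + int LOW)"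
              unfolding Ns by (simp add: kb1_def algebra_simps)
            also have "\<dots> = int (C c s')" using i(6) by (simp add: C_def)
            finally show ?thesis by (simp only: of_nat_le_iff)
          qed
          ultimately show "good s'' & regs s'' 30 = int c & regs s'' 19 = int ?N & Inv (Suc c) ?s &
            esz (V 10) + 2 + \<kappa> + 20 + C (Suc c) ?s <= C c s'" using a(1) r'' by blast
        qed
      qed (use True in simp)
    next
      case False
      let ?s = "s'(|regs := (regs s')(30 := int (Suc c))|)"
      have "Inv (Suc c) ?s"
        unfolding Inv_def
      proof (intro conjI exI[of _ F] allI impI)
        show "fr (TT \<union> {30}) s ?s" by (intro fr_upd f) auto
        have "40 * int Tm * int (Suc c) = 40 * int Tm * int c + 40 * int Tm" by (simp add: algebra_simps)
        then show "regs s 10 - regs ?s 10 <= 40 * int Tm * int (Suc c)" using i(7) Tn by simp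
      qed (use F i False in \<open>auto simp: stamps_def\<close>)
      moreover have "esz (V 10) + 2 + 1 + 20 + C (Suc c) ?s <= C c s'" by (simp add: C_def Ns kb1_def)
      ultimately have "good s' & regs s' 30 = int c & regs s' 19 = int ?N & Inv (Suc c) ?s & esz (V 10) + 2 + 1 + 20 + C (Suc c) ?s <= C c s'"
        using g' r30 r19 by blast
      then show ?thesis
        using False by (intro exI[of _ "esz (V 10) + 2 + 1"] run_IfE[OF g' ok] run_Skip[OF w1]) (simp, assumption)
    qed
  qed
  have "run w (For 30 19 (IfE (V 10) (callc P) Skip)) (C 0 (s(|regs := (regs s)(30 := 0)|)) + 20) s
    (%s'. good s' & regs s' 30 = int ?N & regs s' 19 = int ?N & Inv ?N s')"
    by (rule run_For_gen[where I = Inv and C = C, OF g _ _ _ r(7) I0]) (use step in auto)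
  then show ?thesis
  proof (rule run_mono)
    show "C 0 (s(|regs := (regs s)(30 := 0)|)) + 20 <= ?N * kb1 + 40 * KK * (CK + LOW) + 20"
      using r(8) by (simp add: C_def nat_le_iff)
  qed (auto simp: Inv_def mult.commute mult.left_commute)
qed

end

section \<open>Infrequent values and prefix sums\<close>

text \<open>\<open>R[22]\<close> becomes the number of occurrences of the value, but 0 for a
  frequent one. The inner loop of \<open>lightc\<close> therefore has at most as many rounds as the
  frequency threshold, and skips frequent values without a branch.\<close>

definition lt1 :: "ins list" where
  "lt1 = [Ld 21 (locE 4 (N 0) (N 0) (V 20)), Ld 22 (locE 5 (N 0) (N 0) (V 21)),
     As 22 (emul (V 22) (eind (ediv (V 22) (eadd (V 12) (N 1)))))]"

definition lt2 :: "ins list" where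
  "lt2 = [Ld 24 (locE 6 (N 0) (V 21) (V 23)), As 25 (ediv (V 20) (V 7)), As 26 (ediv (V 24) (V 7)),
     Ld 27 (locE 9 (V 9) (V 25) (V 26)), St (locE 9 (V 9) (V 25) (V 26)) (eadd (V 27) (N 1))]"

text \<open>Two-dimensional prefix sums by the recurrence \<open>PG_Suc\<close>. Row 0 and column 0
  need not be written, since the table starts out as zero.\<close>

definition pf :: "ins list" where
  "pf = [As 21 (ediv (V 20) (V 13)), As 22 (esub (V 20) (emul (V 21) (V 13))), Ld 23 (locE 10 (V 9) (V 21) (eadd (V 22) (N 1))),
     Ld 24 (locE 10 (V 9) (eadd (V 21) (N 1)) (V 22)), Ld 25 (locE 10 (V 9) (V 21) (V 22)), Ld 26 (locE 9 (V 9) (V 21) (V 22)),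
     St (locE 10 (V 9) (eadd (V 21) (N 1)) (eadd (V 22) (N 1))) (eadd (esub (eadd (V 23) (V 24)) (V 25)) (V 26))]"

definition lightc :: com where
  "lightc = For 20 2 (Seq (blk lt1) (For 23 22 (blk lt2)))"

definition finc :: com where
  "finc = Seq lightc (Seq (blk [As 28 (emul (V 13) (V 13))]) (Seq (For 20 28 (blk pf)) (blk [As 8 (N 0)])))"

context blocks begin

lemma base_utab: "t \<notin> {4, 5, 6} ==> 0 <= t ==> t < 16 ==> 0 <= u ==> base (utab (int n) m t u F) = base m"
  using utab_loc[of "int n" t u 4 0 m F 0] utab_loc[of "int n" t u 5 0 m F 0] utab_loc[of "int n" t u 6 0 m F]
  by (auto simp: base_def)

lemma nnU': "4 * (int n * int n) + 4 * int n + 40 <= U"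
  using nnU by (simp add: algebra_simps)

lemma n2U: "x <= n * n ==> y <= n * n ==> int (x + y) <= U"
proof -
  assume "x <= n * n" "y <= n * n"
  then have "int x <= int n * int n" "int y <= int n * int n" by (simp_all flip: of_nat_mult)
  moreover have "0 <= int n" "0 <= int n * int n" by simp_all
  ultimately show ?thesis using nnU' unfolding of_nat_add by linarith
qed

lemma lightM_le: "m <= n ==> lightM m x y <= n * n"
proof -
  assume m: "m <= n"
  have "lightM m x y <= (\<Sum>i<m. \<Sum>j<n. 1)" unfolding lightM_def by (intro sum_mono) auto
  also have "\<dots> = m * n" by simp
  also have "\<dots> <= n * n" using m by simp
  finally show ?thesis .
qed

text \<open>What position \<open>i\<close> has contributed to entry \<open>(x, y)\<close> after its
  first \<open>e\<close> partners, in order of rank.\<close>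

definition LI :: "nat => nat => nat => nat => nat" where
  "LI i e x y = (if i div sz = x then (\<Sum>j<n. if j div sz = y & a j = a i & rank a (a i) j < e then 1 else 0) else 0)"

lemma LI_0: "LI i 0 x y = 0"
  by (simp add: LI_def)

lemma LI_all: "lightM (Suc i) x y = lightM i x y + LI i (if hv (a i) then 0 else rank a (a i) n) x y"
proof (cases "hv (a i)")
  case True
  then show ?thesis by (simp add: lightM_def LI_0)
next
  case False
  have "(\<Sum>j<n. if i div sz = x & j div sz = y & a i = a j & \<not> hv (a i) then 1 else 0) = LI i (rank a (a i) n) x y"
    using False rank_pos_iff[of a _ "a i" n] by (auto simp: LI_def intro!: sum.cong)
  then show ?thesis using False by (simp add: lightM_def)
qed

lemma LI_Suc:
  assumes "i < n" "p < n" "a p = a i" "rank a (a i) p = e"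
  shows "LI i (Suc e) x y = LI i e x y + (if i div sz = x & p div sz = y then 1 else 0)"
proof (cases "i div sz = x")
  case True
  have un: "j = p" if "a j = a i" "rank a (a i) j = e" for j
  proof (rule ccontr)
    assume "j ~= p"
    then consider "j < p" | "p < j" by linarith
    then show False
      using rank_pos_iff[of a j "a i" p] rank_pos_iff[of a p "a i" j] assms that by cases simp_all
  qed
  have "(\<Sum>j<n. if j div sz = y & a j = a i & rank a (a i) j < Suc e then 1 else 0) =
    (\<Sum>j<n. (if j div sz = y & a j = a i & rank a (a i) j < e then 1 else 0) + (if j = p then (if p div sz = y then 1 else 0) else (0::nat)))"
  proof (intro sum.cong refl)
    fix j
    show "(if j div sz = y & a j = a i & rank a (a i) j < Suc e then 1 else 0) =
      (if j div sz = y & a j = a i & rank a (a i) j < e then 1 else 0) + (if j = p then (if p div sz = y then 1 else 0) else (0::nat))"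
    proof (cases "j = p")
      case True
      then show ?thesis using assms by simp
    next
      case False
      then have "\<not> (a j = a i & rank a (a i) j = e)" using un by blast
      then have "a j = a i & rank a (a i) j < Suc e \<longleftrightarrow> a j = a i & rank a (a i) j < e" by (metis less_Suc_eq)
      then show ?thesis using False by (simp only: if_False add_0_right)
    qed
  qed
  also have "\<dots> = (\<Sum>j<n. if j div sz = y & a j = a i & rank a (a i) j < e then 1 else 0) + (if p div sz = y then 1 else 0)"
    using assms by (simp add: sum.distrib)
  finally show ?thesis using True by (simp add: LI_def)
qed (simp add: LI_def)

lemma LI_le: "LI i e x y <= n * n"
proof -
  have "(\<Sum>j<n. if j div sz = y & a j = a i & rank a (a i) j < e then 1 else 0) <= (\<Sum>j<n. 1 :: nat)" by (intro sum_mono) auto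
  then have "LI i e x y <= n * 1" by (simp add: LI_def)
  also have "\<dots> <= n * n" using n1 by (intro mult_le_mono2)
  finally show ?thesis .
qed

lemma run_light:
  assumes g: "good s" and b: "base (mem s)"
    and r: "regs s 2 = int n" "regs s 7 = int sz" "regs s 9 = int (Suc k)" "regs s 12 = int f"
    and F: "\<And>x y. mem s (loc (int n) 9 (int (Suc k)) (int x) (int y)) = int (F x y)" "\<And>x y. F x y <= n * n"
    and U: "int f + 1 <= U"
  shows "run w lightc (n * (f * 600 + 600) + 20) s (%s'. good s' & fr {20..27} s s' &
     mem s' = utab (int n) (mem s) 9 (int (Suc k)) (%x y. int (F x y + lightM n x y)))"
proof -
  let ?n = "int n" and ?w = "int (Suc k)"
  define I where "I = (%i (s'::state). fr {20..27} s s' & mem s' = utab ?n (mem s) 9 ?w (%x y. int (F x y + lightM i x y)))"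
  have "(%x y. mem s (loc ?n 9 ?w (int x) (int y))) = (%x y. int (F x y + lightM 0 x y))"
    using F(1) by (auto simp: lightM_def fun_eq_iff)
  from utab_id[of ?n "mem s" 9 ?w, unfolded this]
  have I0: "I 0 (s(|regs := (regs s)(20 := 0)|))" by (auto simp: I_def fr_def)
  have ok1: "\<forall>i\<in>set lt1. ok_ins i" by (simp add: lt1_def ok_exp_def locE_simps eind_def)
  have ok2: "\<forall>i\<in>set lt2. ok_ins i" by (simp add: lt2_def ok_exp_def locE_simps)
  have fU: "F x y + lightM m x y <= n * n + n * n" if "m <= n" for m x y using F(2)[of x y] lightM_le[OF that] by (rule add_mono)
  have step: "run w (Seq (blk lt1) (For 23 22 (blk lt2))) (bsz lt1 + (f * 600 + 20)) s' (%s''. good s'' & regs s'' 20 = int i & regs s'' 2 = ?n &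
      I (Suc i) (s''(|regs := (regs s'')(20 := int (Suc i))|)))"
    if i: "i < n" and g': "good s'" and Is: "I i s'" and r20: "regs s' 20 = int i" and r2: "regs s' 2 = ?n" for i s'
  proof -
    define v where "v = a i"
    have f: "fr {20..27} s s'" and m: "mem s' = utab ?n (mem s) 9 ?w (%x y. int (F x y + lightM i x y))" using Is by (simp_all add: I_def)
    have rr: "regs s' 7 = int sz" "regs s' 9 = ?w" "regs s' 12 = int f" using frD[OF f] r by simp_all
    have b': "base (mem s')" unfolding m using b by (subst base_utab) auto
    have vn: "v <= n" using aid[OF i] by (simp add: v_def)
    have m4: "mem s' (loc ?n 4 0 0 (int i)) = int v" "mem s' (loc ?n 5 0 0 (int v)) = int (rank a v n)"
      using b' i vn by (auto simp: base_def v_def)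
    define cn where "cn = (if hv v then 0 else rank a v n)"
    have cn: "int (rank a v n) * (1 div (int (rank a v n) div (int f + 1) + 1)) = int cn"
    proof -
      have "int (rank a v n) div (int f + 1) = int (rank a v n div (f + 1))" by (simp add: zdiv_int add.commute)
      moreover have "rank a v n div (f + 1) = 0 \<longleftrightarrow> \<not> hv v" by (auto simp: hv_def div_eq_0_iff)
      ultimately show ?thesis using ind_div[of "int (rank a v n div (f + 1))"] by (auto simp: cn_def)
    qed
    have cf: "cn <= f" "cn <= n" using rank_le[of a v n] by (auto simp: cn_def hv_def)
    define s1 where "s1 = exb lt1 s'"
    have s1: "mem s1 = mem s'" "regs s1 21 = int v" "regs s1 22 = int cn" "fr {21..22} s' s1"
      unfolding s1_def using r20 r2 rr m4 cn by (simp_all add: lt1_def ev_locE ev_eind fr_def)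
    have B1: "bnb lt1 s'"
    proof -
      have "int v <= U" "int (rank a v n) <= U" "int cn <= U" using vn rank_le[of a v n] cf nU(1) by linarith+
      then show ?thesis using r20 r2 rr m4 cn by (simp add: lt1_def ev_locE ev_eind)
    qed
    define J where "J = (%e (s''::state). fr {23..27} s1 s'' & mem s'' = utab ?n (mem s) 9 ?w (%x y. int (F x y + lightM i x y + LI i e x y)))"
    have J0: "J 0 (s1(|regs := (regs s1)(23 := 0)|))" using s1 m by (simp add: J_def fr_def LI_0)
    have q1: "regs s1 20 = int i" "regs s1 2 = ?n" "regs s1 7 = int sz" "regs s1 9 = ?w" "regs s1 12 = int f"
      using frD[OF s1(4)] r20 r2 rr by simp_all
    have st2: "bnb lt2 s2 & regs (exb lt2 s2) 23 = int e & regs (exb lt2 s2) 22 = int cn &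
        J (Suc e) ((exb lt2 s2)(|regs := (regs (exb lt2 s2))(23 := int (Suc e))|))"
      if e: "e < cn" and Js: "J e s2" and r23: "regs s2 23 = int e" and r22: "regs s2 22 = int cn" for e s2
    proof -
      have f2: "fr {23..27} s1 s2" and m2: "mem s2 = utab ?n (mem s) 9 ?w (%x y. int (F x y + lightM i x y + LI i e x y))"
        using Js by (simp_all add: J_def)
      have q2: "regs s2 20 = int i" "regs s2 2 = ?n" "regs s2 7 = int sz" "regs s2 9 = ?w" "regs s2 21 = int v"
        using frD[OF f2] q1 s1 by simp_all
      have nh: "\<not> hv v" and er: "e < rank a v n" using e by (auto simp: cn_def split: if_splits)
      obtain p where p: "p < n" "a p = v" "rank a v p = e" using rank_surj[OF er] by blast
      have "base (mem s2)" unfolding m2 using b by (subst base_utab) auto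
      then have m6: "mem s2 (loc ?n 6 0 (int v) (int e)) = int p" using p by (auto simp: base_def)
      define bx b2 where "bx = i div sz" and "b2 = p div sz"
      have bb: "int i div int sz = int bx" "int p div int sz = int b2" by (simp_all add: bx_def b2_def zdiv_int)
      define V0 where "V0 = F bx b2 + lightM i bx b2 + LI i e bx b2"
      have m9: "mem s2 (loc ?n 9 ?w (int bx) (int b2)) = int V0"
        unfolding m2 V0_def using utab_loc[of ?n 9 ?w 9 ?w] by simp
      have LS: "LI i (Suc e) x y = LI i e x y + (if bx = x & b2 = y then 1 else 0)" for x y
        using LI_Suc[of i p e x y] i p by (simp add: v_def bx_def b2_def)
      have V0U: "int V0 <= U"
      proof -
        have "F bx b2 + (lightM i bx b2 + LI i e bx b2) <= n * n + n * n + n * n" using F(2)[of bx b2] lightM_le[of i bx b2] LI_le[of i e bx b2] i by linarith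
        then have "int V0 <= int (n * n + n * n + n * n)" by (simp only: of_nat_le_iff V0_def add.assoc)
        then have "int V0 <= 3 * (int n * int n)" by simp
        moreover have "0 <= int n" "0 <= int n * int n" by simp_all
        ultimately show ?thesis using nnU' by linarith
      qed
      have bU: "int p <= U" "int bx <= U" "int b2 <= U"
        using p(1) i div_le_dividend[of i sz] div_le_dividend[of p sz] nU(1) unfolding bx_def b2_def by linarith+
      have M: "mem (exb lt2 s2) = (mem s2)(loc ?n 9 ?w (int bx) (int b2) := int V0 + 1)"
        using q2 r23 r22 m6 bb m9 by (simp add: lt2_def ev_locE)
      have R: "fr {23..27} s2 (exb lt2 s2)" "regs (exb lt2 s2) 23 = int e" "regs (exb lt2 s2) 22 = int cn"
        using r23 r22 by (simp_all add: lt2_def fr_def)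
      have B: "bnb lt2 s2" using q2 r23 r22 m6 bb m9 bU V0U by (simp add: lt2_def ev_locE)
      have "mem (exb lt2 s2) = utab ?n (mem s) 9 ?w (%x y. int (F x y + lightM i x y + LI i (Suc e) x y))"
      proof -
        have "(%x' y'. if x' = bx & y' = b2 then int V0 + 1 else int (F x' y' + lightM i x' y' + LI i e x' y')) =
          (%x y. int (F x y + lightM i x y + LI i (Suc e) x y))"
          by (auto simp: LS V0_def fun_eq_iff)
        then show ?thesis unfolding M m2 by (subst utab_upd) simp_all
      qed
      moreover have "fr {23..27} s1 (exb lt2 s2)" by (rule fr_trans[OF f2 R(1)]) auto
      ultimately have "J (Suc e) ((exb lt2 s2)(|regs := (regs (exb lt2 s2))(23 := int (Suc e))|))"
        by (auto simp: J_def intro!: fr_upd)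
      then show ?thesis using B R by simp
    qed
    have inner: "run w (For 23 22 (blk lt2)) (f * 600 + 20) s1 (%s''. good s'' & regs s'' 20 = int i & regs s'' 2 = ?n &
      I (Suc i) (s''(|regs := (regs s'')(20 := int (Suc i))|)))" if g1: "good s1"
    proof -
      have "run w (For 23 22 (blk lt2)) (cn * (bsz lt2 + 20) + 20) s1 (%s''. good s'' & regs s'' 23 = int cn & regs s'' 22 = int cn & J cn s'')"
        by (rule run_For_blk[where I = J, OF g1 _ _ _ s1(3) ok2 J0]) (use st2 in auto)
      then show ?thesis
      proof (rule run_mono)
        have "bsz lt2 + 20 <= 600" by (simp add: lt2_def esz_locE)
        then show "cn * (bsz lt2 + 20) + 20 <= f * 600 + 20" using cf(1) by (simp add: mult_le_mono)
        fix s'' assume s'': "good s'' & regs s'' 23 = int cn & regs s'' 22 = int cn & J cn s''"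
        then have f3: "fr {23..27} s1 s''" by (simp add: J_def)
        have "fr {20..27} s s''" by (rule fr_trans[OF fr_trans[OF f s1(4), where T'' = "{20..27}"] f3]) auto
        moreover have "mem s'' = utab ?n (mem s) 9 ?w (%x y. int (F x y + lightM (Suc i) x y))"
        proof -
          have "(%x y. int (F x y + lightM (Suc i) x y)) = (%x y. int (F x y + lightM i x y + LI i cn x y))"
            unfolding LI_all cn_def v_def by (simp add: fun_eq_iff)
          then show ?thesis using s'' by (simp only: J_def)
        qed
        ultimately have "I (Suc i) (s''(|regs := (regs s'')(20 := int (Suc i))|))" by (auto simp: I_def intro!: fr_upd)
        then show "good s'' & regs s'' 20 = int i & regs s'' 2 = ?n & I (Suc i) (s''(|regs := (regs s'')(20 := int (Suc i))|))"
          using s'' frD[OF f3] q1 by simp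
      qed
    qed
    show ?thesis by (rule run_blkS[OF g' ok1 B1]) (use inner in \<open>simp add: s1_def\<close>)
  qed
  have "run w lightc (n * ((bsz lt1 + (f * 600 + 20)) + 20) + 20) s (%s'. good s' & regs s' 20 = int n & regs s' 2 = int n & I n s')"
    unfolding lightc_def by (rule run_For[where I = I, OF g _ _ _ r(1) I0]) (use step in auto)
  then show ?thesis
  proof (rule run_mono)
    have "bsz lt1 + (f * 600 + 20) + 20 <= f * 600 + 600" by (simp add: lt1_def esz_locE eind_def)
    then show "n * ((bsz lt1 + (f * 600 + 20)) + 20) + 20 <= n * (f * 600 + 600) + 20" by simp
  qed (auto simp: I_def)
qed

lemma run_prefix:
  assumes g: "good s" and r: "regs s 2 = int n" "regs s 9 = int (Suc k)" "regs s 13 = int b" "regs s 28 = int (b * b)"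
    and M9: "\<And>x y. x < b ==> y < b ==> mem s (loc (int n) 9 (int (Suc k)) (int x) (int y)) = int (pairM x y)"
    and Z: "\<And>x y. mem s (loc (int n) 10 (int (Suc k)) (int x) (int y)) = 0"
    and bU: "int b <= U" and b1: "1 <= b"
  shows "run w (For 20 28 (blk pf)) (b * b * 1000 + 20) s (%s'. good s' & fr {20..26} s s' &
     (EX G. mem s' = utab (int n) (mem s) 10 (int (Suc k)) G & (ALL x y. x <= b --> y <= b --> G x y = int (PG x y))))"
proof -
  let ?n = "int n" and ?w = "int (Suc k)"
  \<comment> \<open>Entries are filled in row-major order of \<open>(x - 1, y - 1)\<close>. The
    condition \<open>y <= b\<close> is needed to make this numbering unambiguous.\<close>
  define G where "G = (%e x y. if x = 0 \<or> y = 0 \<or> y <= b & (x - 1) * b + (y - 1) < e then int (PG x y) else 0)"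
  define I where "I = (%e (s'::state). fr {20..26} s s' & mem s' = utab ?n (mem s) 10 ?w (G e))"
  have "(%x y. mem s (loc ?n 10 ?w (int x) (int y))) = G 0" using Z by (auto simp: G_def PG_def fun_eq_iff)
  from utab_id[of ?n "mem s" 10 ?w, unfolded this]
  have I0: "I 0 (s(|regs := (regs s)(20 := 0)|))" by (auto simp: I_def fr_def)
  have ok: "\<forall>i\<in>set pf. ok_ins i" by (simp add: pf_def ok_exp_def locE_simps)
  have PU: "int (PG x y) <= U" for x y using n2U[OF PG_le[of x y], of 0] by simp
  have step: "bnb pf s' & regs (exb pf s') 20 = int e & regs (exb pf s') 28 = int (b * b) &
      I (Suc e) ((exb pf s')(|regs := (regs (exb pf s'))(20 := int (Suc e))|))"
    if e: "e < b * b" and Is: "I e s'" and r20: "regs s' 20 = int e" and r28: "regs s' 28 = int (b * b)" for e s'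
  proof -
    have f: "fr {20..26} s s'" and m: "mem s' = utab ?n (mem s) 10 ?w (G e)" using Is by (simp_all add: I_def)
    have rr: "regs s' 2 = ?n" "regs s' 9 = ?w" "regs s' 13 = int b" using frD[OF f] r by simp_all
    define x y where "x = e div b" and "y = e mod b"
    have lj: "int e div int b = int x" "int e - int x * int b = int y"
      by (simp_all add: x_def y_def zdiv_int zmod_int minus_div_mult_eq_mod)
    have xy: "x < b" "y < b" "e = x * b + y" using e b1 by (auto simp: x_def y_def less_mult_imp_div_less)
    have mG: "mem s' (loc ?n 10 ?w (int x) (int y)) = G e x y" for x y
      unfolding m using utab_loc[of ?n 10 ?w 10 ?w] by simp
    have s1: "int y + 1 = int (Suc y)" "int x + 1 = int (Suc x)" by simp_all
    have "G e x (Suc y) = int (PG x (Suc y))" using xy by (cases x) (auto simp: G_def)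
    then have g1: "mem s' (loc ?n 10 ?w (int x) (int y + 1)) = int (PG x (Suc y))" unfolding s1 mG .
    have "G e (Suc x) y = int (PG (Suc x) y)" using xy by (cases y) (auto simp: G_def)
    then have g2: "mem s' (loc ?n 10 ?w (int x + 1) (int y)) = int (PG (Suc x) y)" unfolding s1 mG .
    have "G e x y = int (PG x y)" using xy by (cases x; cases y) (auto simp: G_def)
    then have g3: "mem s' (loc ?n 10 ?w (int x) (int y)) = int (PG x y)" unfolding mG .
    have g4: "mem s' (loc ?n 9 ?w (int x) (int y)) = int (pairM x y)"
      unfolding m using utab_loc[of ?n 10 ?w 9 ?w] M9[OF xy(1,2)] by simp
    have val: "int (PG x (Suc y)) + int (PG (Suc x) y) - int (PG x y) + int (pairM x y) = int (PG (Suc x) (Suc y))"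
      using PG_Suc[of x y] by linarith
    have lU: "int x <= U" "int y <= U" "int (pairM x y) <= U" using xy bU n2U[OF pairM_le[of x y], of 0] by simp_all
    have M: "mem (exb pf s') = (mem s')(loc ?n 10 ?w (int x + 1) (int y + 1) := int (PG (Suc x) (Suc y)))"
      using r20 r28 rr lj g1 g2 g3 g4 val by (simp add: pf_def ev_locE)
    have R: "fr {20..26} s' (exb pf s')" "regs (exb pf s') 20 = int e" "regs (exb pf s') 28 = int (b * b)"
      using r20 r28 by (simp_all add: pf_def fr_def)
    have B: "bnb pf s'" using r20 r28 rr lj g1 g2 g3 g4 val lU PU by (simp add: pf_def ev_locE)
    have "mem (exb pf s') = utab ?n (mem s) 10 ?w (G (Suc e))"
    proof -
      have "(%x' y'. if x' = Suc x & y' = Suc y then int (PG (Suc x) (Suc y)) else G e x' y') = G (Suc e)"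
      proof (intro ext)
        fix x' y'
        have "x' = Suc x & y' = Suc y" if "x' ~= 0" "y' ~= 0" "y' <= b" "(x' - 1) * b + (y' - 1) = e"
        proof -
          have "y' - 1 < b" using that by simp
          then have "((x' - 1) * b + (y' - 1)) div b = x' - 1" "((x' - 1) * b + (y' - 1)) mod b = y' - 1" by simp_all
          then show ?thesis using that unfolding x_def y_def by auto
        qed
        then show "(if x' = Suc x & y' = Suc y then int (PG (Suc x) (Suc y)) else G e x' y') = G (Suc e) x' y'"
          using xy by (cases "x' = Suc x & y' = Suc y") (simp add: G_def, auto simp: G_def less_Suc_eq)
      qed
      then show ?thesis unfolding M m s1 by (subst utab_upd) simp_all
    qed
    moreover have "fr {20..26} s (exb pf s')" by (rule fr_trans[OF f R(1)]) auto
    ultimately have "I (Suc e) ((exb pf s')(|regs := (regs (exb pf s'))(20 := int (Suc e))|))"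
      by (auto simp: I_def intro!: fr_upd)
    then show ?thesis using B R by simp
  qed
  have "run w (For 20 28 (blk pf)) (b * b * (bsz pf + 20) + 20) s (%s'. good s' & regs s' 20 = int (b * b) & regs s' 28 = int (b * b) & I (b * b) s')"
    by (rule run_For_blk[where I = I, OF g _ _ _ r(4) ok I0]) (use step in auto)
  then show ?thesis
  proof (rule run_mono)
    show "b * b * (bsz pf + 20) + 20 <= b * b * 1000 + 20"
      by (intro add_mono mult_le_mono2) (simp_all add: pf_def esz_locE)
    fix s' assume s': "good s' & regs s' 20 = int (b * b) & regs s' 28 = int (b * b) & I (b * b) s'"
    have "G (b * b) x y = int (PG x y)" if "x <= b" "y <= b" for x y
    proof (cases "x = 0 \<or> y = 0")
      case False
      then have "y - 1 < b" using that by linarith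
      then have "(x - 1) * b + (y - 1) < (x - 1) * b + b" by (rule add_strict_left_mono)
      also have "\<dots> = x * b" using False by (cases x) simp_all
      also have "\<dots> <= b * b" using that by simp
      finally show ?thesis using that by (simp add: G_def)
    qed (auto simp: G_def)
    then show "good s' & fr {20..26} s s' &
      (EX G. mem s' = utab (int n) (mem s) 10 (int (Suc k)) G & (ALL x y. x <= b --> y <= b --> G x y = int (PG x y)))"
      using s' by (auto simp: I_def)
  qed
qed

lemma run_finc:
  assumes g: "good s" and b: "base (mem s)"
    and r: "regs s 2 = int n" "regs s 7 = int sz" "regs s 9 = int (Suc k)" "regs s 12 = int f" "regs s 13 = int b" "b = n div sz + 1"
    and F: "\<And>x y. mem s (loc (int n) 9 (int (Suc k)) (int x) (int y)) = int (F x y)" "\<And>x y. F x y <= n * n"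
      "\<And>x y. x < b ==> y < b ==> F x y = heavyM x y"
    and Z: "\<And>x y. mem s (loc (int n) 10 (int (Suc k)) (int x) (int y)) = 0"
    and U: "int f + 1 <= U"
  shows "run w finc (n * (f * 600 + 600) + b * b * 1000 + 100) s (%s'. good s' & fr ({8} \<union> {20..28}) s s' & regs s' 8 = 0 &
     gtab (mem s') (Suc k) sz & (EX F G. mem s' = utab (int n) (utab (int n) (mem s) 9 (int (Suc k)) F) 10 (int (Suc k)) G))"
proof -
  let ?n = "int n" and ?w = "int (Suc k)"
  have bn: "b <= n + 1" "1 <= b" using r(6) by auto
  then have "b * b <= (n + 1) * (n + 1)" by (intro mult_le_mono)
  then have "int (b * b) <= int ((n + 1) * (n + 1))" by (simp only: of_nat_le_iff)
  then have "int (b * b) <= int n * int n + 2 * int n + 1" by (simp add: algebra_simps)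
  moreover have "0 <= int n" "0 <= int n * int n" by simp_all
  ultimately have bbU: "int (b * b) <= U" using nnU' by linarith
  have bU: "int b <= U" using bn nU by linarith
  define F1 where "F1 = (%x y. int (F x y + lightM n x y))"
  obtain s1 where R1: "run w lightc (n * (f * 600 + 600) + 20) s (%s'. s' = s1)" and s1: "good s1" "fr {20..27} s s1"
    "mem s1 = utab ?n (mem s) 9 ?w F1"
    using run_obtain[OF run_light[OF g b r(1-4) F(1,2) U]] unfolding F1_def by blast
  define s2 where "s2 = s1(|regs := (regs s1)(28 := int (b * b))|)"
  have q1: "regs s1 2 = ?n" "regs s1 9 = ?w" "regs s1 13 = int b" using frD[OF s1(2)] r by simp_all
  have g2: "good s2" unfolding s2_def using bbU by (intro good_upd s1) auto
  have R2: "run w (blk [As 28 (emul (V 13) (V 13))]) (bsz [As 28 (emul (V 13) (V 13))]) s1 (%s'. s' = s2)"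
    by (rule run_blk[OF s1(1)]) (use q1 bbU in \<open>auto simp: ok_exp_def s2_def\<close>)
  have q2: "regs s2 2 = ?n" "regs s2 9 = ?w" "regs s2 13 = int b" "regs s2 28 = int (b * b)" using q1 by (simp_all add: s2_def)
  have M9: "mem s2 (loc ?n 9 ?w (int x) (int y)) = int (pairM x y)" if "x < b" "y < b" for x y
    using utab_loc[of ?n 9 ?w 9 ?w "mem s" F1 x y] s1(3) F(3)[OF that] heavy_light[of x y] by (simp add: s2_def F1_def)
  have Z2: "mem s2 (loc ?n 10 ?w (int x) (int y)) = 0" for x y
    using utab_loc[of ?n 9 ?w 10 ?w "mem s" F1 x y] s1(3) Z by (simp add: s2_def)
  obtain s3 G where R3: "run w (For 20 28 (blk pf)) (b * b * 1000 + 20) s2 (%s'. s' = s3)" and s3: "good s3" "fr {20..26} s2 s3"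
     "mem s3 = utab ?n (mem s2) 10 ?w G" "\<And>x y. x <= b ==> y <= b ==> G x y = int (PG x y)"
    using run_obtain[OF run_prefix[OF g2 q2 M9 Z2 bU bn(2)]] by blast
  have gt: "gtab (mem s3) (Suc k) sz"
    unfolding gtab_def
  proof (intro allI impI)
    fix x y assume xy: "x * sz <= n" "y * sz <= n"
    have "x <= b" "y <= b" using xy sz1 unfolding r(6)
      by (metis div_le_mono le_SucI Suc_eq_plus1 nonzero_mult_div_cancel_right not_one_le_zero)+
    then show "mem s3 (loc ?n 10 ?w (int x) (int y)) = int (gg a (x * sz) (y * sz))"
      using s3(3,4) utab_loc[of ?n 10 ?w 10 ?w "mem s2" G x y] PG_eq[OF xy] by simp
  qed
  let ?Q = "%s'. good s' & fr ({8} \<union> {20..28}) s s' & regs s' 8 = 0 &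
     gtab (mem s') (Suc k) sz & (EX F G. mem s' = utab ?n (utab ?n (mem s) 9 ?w F) 10 ?w G)"
  have f12: "fr {20..28} s s2" using s1(2) unfolding s2_def by (auto simp: fr_def)
  have f: "fr ({8} \<union> {20..28}) s s3" by (rule fr_trans[OF f12 s3(2)]) auto
  have R4: "run w (blk [As 8 (N 0)]) (bsz [As 8 (N 0)]) s3 ?Q"
    by (rule run_blk[OF s3(1)]) (use U100 gt f s3(3) s1(3) in \<open>auto simp: ok_exp_def s2_def intro!: fr_upd\<close>)
  have "run w finc ((n * (f * 600 + 600) + 20) + (bsz [As 28 (emul (V 13) (V 13))] + ((b * b * 1000 + 20) + bsz [As 8 (N 0)]))) s ?Q"
    unfolding finc_def by (intro run_Seq run_then[OF R1] run_then[OF R2] run_then[OF R3] R4)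
  then show ?thesis by (rule run_mono) auto
qed

end

section \<open>One attempt at building the data structure\<close>

text \<open>With the threshold \<open>f = q * sz div n + 1\<close> the enumeration for infrequent
  values takes \<open>n * f <= q * sz + n\<close> rounds, while at most
  \<open>n^2 / (q * sz)\<close> values are frequent.\<close>

definition att1 :: "ins list" where
  "att1 = [As 9 (eadd (V 9) (N 1)), As 13 (eadd (ediv (V 2) (V 7)) (N 1)), As 12 (eadd (ediv (emul (V 5) (V 7)) (V 2)) (N 1)), As 15 (N 0)]"

text \<open>The matrix size is \<open>n^2 / (sz * (q + n))\<close>, rounded: the inverse of the sum
  of the inverses of \<open>n / sz\<close> (blocks) and \<open>n^2 / (q * sz)\<close> (frequent
  values), hence their minimum up to a factor 2. The clock is the budget \<open>LK * q * sz\<close>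
  minus the foreseeable work on tables and copies; if nothing remains, no product is
  started.\<close>

definition att2 :: "ins list" where
  "att2 = [As 14 (eadd (ediv (emul (V 2) (V 2)) (emul (V 7) (eadd (V 5) (V 2)))) (N 1)), As 16 (eadd (ediv (V 13) (V 14)) (N 1)),
     As 17 (ediv (esub (eadd (V 15) (V 14)) (N 1)) (V 14)), As 18 (emul (V 14) (V 14)), As 19 (emul (emul (V 16) (V 16)) (V 17)),
     As 10 (esub (esub (emul (emul (V 4) (V 5)) (V 7)) (emul (V 13) (V 13))) (emul (V 19) (V 18)))]"

definition attempt :: "com => com" where
  "attempt P = Seq (blk att1) (Seq (For 20 2 (blk ht1)) (Seq (blk att2)
     (IfE (V 10) (Seq (For 30 19 (IfE (V 10) (callc P) Skip)) (IfE (V 10) finc Skip)) Skip)))"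

locale attempts = tabs U \<beta> n L a for U \<beta> n L a +
  fixes P :: com and Tm :: "nat => nat" and LK :: nat
  assumes P_ok: "\<And>d A B. 1 <= d ==> (ALL i<d. ALL j<d. \<bar>A i j\<bar> <= int n & \<bar>B i j\<bar> <= int n) ==>
       EX t s. exec P (mm_init d A B) t s & t <= Tm d &
         (ALL i<d. ALL j<d. mem s (int (2 * d * d + i * d + j)) = (\<Sum>l<d. A i l * B l j))"
begin

definition dat :: "(int => int) => int => nat => bool" where
  "dat m g k \<longleftrightarrow> base m & m 0 = 0 & (ALL j. 0 <= m (cell (int n) j 2) & m (cell (int n) j 2) <= g) & fresh (int n) m k"

lemma inv_dat: "inv n L LK a k s \<longleftrightarrow> good s & regs s 2 = int n & regs s 3 = int L & regs s 4 = int LK & regs s 9 = int k &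
     dat (mem s) (regs s 11) k & 0 <= regs s 11 & regs s 99 \<in> {0, 1}"
  unfolding inv_def dat_def by blast

lemma dat_mono: "dat m g k ==> k <= k' ==> g <= g' ==> dat m g' k'"
  unfolding dat_def fresh_def by (meson le_less_trans order_trans)

lemma dat_utab:
  assumes "dat m g (Suc k)" "t \<in> {7..10}" shows "dat (utab (int n) m t (int (Suc k)) F) g (Suc k)"
proof -
  have t: "0 <= t" "t < 16" "t \<notin> {4, 5, 6}" using assms(2) by auto
  have "utab (int n) m t (int (Suc k)) F 0 = m 0"
    using cell_0[of t "int n"] assms(2) by (intro utab_other) (auto simp: loc_def)
  moreover have "utab (int n) m t (int (Suc k)) F (cell (int n) j 2) = m (cell (int n) j 2)" for j
  proof -
    have "\<And>u x y. loc (int n) t u x y ~= cell (int n) j 2" by (rule loc_cell_neq) (use assms(2) in auto)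
    then show ?thesis by (intro utab_other) metis
  qed
  moreover have "base (utab (int n) m t (int (Suc k)) F) = base m"
    using utab_loc[of "int n" t "int (Suc k)" 4 0 m F 0] utab_loc[of "int n" t "int (Suc k)" 5 0 m F 0] utab_loc[of "int n" t "int (Suc k)" 6 0 m F] t
    by (auto simp: base_def)
  moreover have "fresh (int n) (utab (int n) m t (int (Suc k)) F) (Suc k)"
    unfolding fresh_def
  proof (intro ballI allI impI)
    fix t' v x y assume *: "t' \<in> {7..10 :: int}" "Suc k < v"
    then have "utab (int n) m t (int (Suc k)) F (loc (int n) t' (int v) (int x) (int y)) = m (loc (int n) t' (int v) (int x) (int y))"
      using t by (subst utab_loc) auto
    then show "utab (int n) m t (int (Suc k)) F (loc (int n) t' (int v) (int x) (int y)) = 0"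
      using assms(1) * unfolding dat_def fresh_def by simp
  qed
  ultimately show ?thesis using assms(1) unfolding dat_def by simp
qed

lemma dat_noP:
  assumes "dat m g k" "\<And>z. noP (int n) z ==> m' z = m z" "\<And>j. 0 <= m' (cell (int n) j 2) & m' (cell (int n) j 2) <= g'"
  shows "dat m' g' k"
proof -
  have e: "m' (loc (int n) t u x y) = m (loc (int n) t u x y)" if "t \<in> {3..15}" for t u x y
    by (rule assms(2), rule noP_loc) (use that in auto)
  have "base m' = base m" unfolding base_def by (simp add: e)
  moreover have "fresh (int n) m' k"
    using assms(1) e unfolding dat_def fresh_def by auto
  moreover have "m' 0 = m 0" by (rule assms(2), rule noP_0) simp
  ultimately show ?thesis using assms(1,3) unfolding dat_def by simp
qed

definition bb where "bb sz = n div sz + 1"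
definition ff where "ff q sz = q * sz div n + 1"
definition dd where "dd q sz = n * n div (sz * (q + n)) + 1"
definition nbb where "nbb q sz = bb sz div dd q sz + 1"
definition NN where "NN q sz h = nbb q sz * nbb q sz * ((h + dd q sz - 1) div dd q sz)"

text \<open>The budget covers the tables, the copying, and 40 clock units per unit of time of
  \<open>P\<close>. The actual number of frequent values depends on the array, so every
  \<open>h\<close> permitted by \<open>heavy_bound\<close> is included.\<close>

definition succ :: "nat => nat => bool" where
  "succ q sz \<longleftrightarrow> (ALL h. h * (ff q sz + 1) <= n -->
     bb sz * bb sz + NN q sz h * (dd q sz * dd q sz) + 40 * NN q sz h * Tm (dd q sz) < LK * q * sz)"

text \<open>Bounds the numbers that arise in a construction. The fifth power comes from
  \<open>NN * d ^ 2\<close>, a product of five factors that are each at most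
  \<open>n + 3\<close>.\<close>

definition M0 :: "nat => nat => nat" where
  "M0 q sz = 100 * (\<beta> + cmax P + LK * q * sz) + 1000 + 4 * (n + 3) ^ 5 + 2 * (q * sz)"

definition KB :: nat where "KB = (5 * \<beta> + 12) * (2 * \<beta> + 17)"

definition acost :: "nat => nat => nat" where
  "acost q sz = 2000 * n + 600 * (q * sz) +
     (LK * q * sz) * (5000 + bsz cl1 + cregs P + 40 * (KB * csz P)) + 40 * KB * (LK * q * sz + (18 * (\<beta> + cmax P + 2 * (LK * q * sz)) + 20)) + 1000"

abbreviation "TA == ({8..30} \<union> {99} \<union> {1000..} :: nat set)"

lemma dd_le: "1 <= sz ==> dd q sz <= n + 1"
proof -
  assume "1 <= sz"
  then have "1 * n <= sz * (q + n)" by (intro mult_le_mono) auto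
  then have "n * n div (sz * (q + n)) <= n * n div n" using n1 by (intro div_le_mono2) auto
  then show ?thesis using n1 by (simp add: dd_def)
qed

lemma sizes:
  assumes "1 <= sz" "h <= n"
  shows "NN q sz h * (dd q sz * dd q sz) <= (n + 3) ^ 5" "bb sz * bb sz <= (n + 3) ^ 5" "NN q sz h <= NN q sz h * (dd q sz * dd q sz)"
    "dd q sz * dd q sz <= (n + 3) ^ 5" "nbb q sz <= (n + 3) ^ 5" "(h + dd q sz - 1) div dd q sz <= (n + 3) ^ 5" "bb sz <= (n + 3) ^ 5"
    "n + 1 <= (n + 3) ^ 5"
proof -
  have d: "dd q sz <= n + 3" "1 <= dd q sz" using dd_le[OF assms(1), of q] by (auto simp: dd_def)
  have b: "bb sz <= n + 1" "1 <= bb sz" unfolding bb_def by auto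
  have nb: "nbb q sz <= n + 3" using b(1) div_le_dividend[of "bb sz" "dd q sz"] unfolding nbb_def by linarith
  define c where "c = dd q sz - 1"
  have dc: "dd q sz = Suc c" using d by (simp add: c_def)
  have "(h + dd q sz - 1) div dd q sz <= h"
  proof -
    have "h + dd q sz - 1 < dd q sz * (h + 1)" unfolding dc by (simp add: algebra_simps)
    then have "(h + dd q sz - 1) div dd q sz < h + 1" using d(2) by (subst div_less_iff_less_mult) (auto simp: mult.commute)
    then show ?thesis by simp
  qed
  then have nh: "(h + dd q sz - 1) div dd q sz <= n + 3" using assms by simp
  have "NN q sz h * (dd q sz * dd q sz) <= (n + 3) * (n + 3) * (n + 3) * ((n + 3) * (n + 3))"
    unfolding NN_def by (intro mult_le_mono nb nh d)
  also have "\<dots> = (n + 3) ^ 5"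
  proof -
    have "m * m * m * (m * m) = m ^ 5" for m :: nat by (simp add: numeral_eq_Suc mult.assoc)
    then show ?thesis .
  qed
  finally show "NN q sz h * (dd q sz * dd q sz) <= (n + 3) ^ 5" .
  have p: "(n + 3) ^ 2 <= (n + 3) ^ 5" "(n + 3) ^ 1 <= (n + 3) ^ 5" by (intro power_increasing; simp)+
  have "bb sz * bb sz <= (n + 3) * (n + 3)" "dd q sz * dd q sz <= (n + 3) * (n + 3)" using b d by (intro mult_le_mono; simp)+
  then show "bb sz * bb sz <= (n + 3) ^ 5" "dd q sz * dd q sz <= (n + 3) ^ 5" using p(1) unfolding power2_eq_square by linarith+
  show "nbb q sz <= (n + 3) ^ 5" "(h + dd q sz - 1) div dd q sz <= (n + 3) ^ 5" "bb sz <= (n + 3) ^ 5" "n + 1 <= (n + 3) ^ 5"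
    using p(2) nb nh b unfolding power_one_right by linarith+
  show "NN q sz h <= NN q sz h * (dd q sz * dd q sz)" using d(2) by simp
qed

lemma run_attempt:
  assumes inv: "inv n L LK a k s" and r: "regs s 5 = int q" "regs s 7 = int sz" "regs s 8 = 1" and q1: "1 <= q" "1 <= sz"
    and MU: "int (M0 q sz) <= U" and gU: "regs s 11 + int (LK * q * sz) <= U" and kU: "int (Suc k) <= U"
  shows "run w (attempt P) (acost q sz) s (%s'. inv n L LK a (Suc k) s' & fr TA s s' & regs s' 11 <= regs s 11 + int (LK * q * sz) &
     regs s' 8 \<in> {0, 1} & (regs s' 8 = 0 --> gtab (mem s') (Suc k) sz) & (succ q sz --> regs s' 8 = 0))"
proof -
  let ?n = "int n" and ?w = "int (Suc k)"
  define CK where "CK = LK * q * sz"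
  define f b d nb where "f = ff q sz" and "b = bb sz" and "d = dd q sz" and "nb = nbb q sz"
  interpret B: blocks U \<beta> n L a sz f by unfold_locales (use q1 in \<open>auto simp: f_def ff_def\<close>)
  have leU: "int x <= U" if "x <= M0 q sz" for x using that MU by linarith
  have p5: "4 * (n + 3) ^ 5 <= M0 q sz" by (simp add: M0_def)
  have i: "good s" "regs s 2 = ?n" "regs s 3 = int L" "regs s 4 = int LK" "regs s 9 = int k" "dat (mem s) (regs s 11) k" "0 <= regs s 11" "regs s 99 \<in> {0, 1}"
    using inv unfolding inv_dat by auto
  have iv: "?n div int sz + 1 = int b" "int q * int sz div ?n + 1 = int f"
    by (simp_all add: b_def bb_def f_def ff_def zdiv_int)
  have fU: "int f + 1 <= U"
  proof -
    have "f <= q * sz + 1" unfolding f_def ff_def using div_le_dividend by simp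
    then have "f + 1 <= M0 q sz" unfolding M0_def by linarith
    then show ?thesis using leU[of "f + 1"] by simp
  qed
  have bU: "int b <= U" using sizes(7)[OF q1(2) order_refl] p5 by (intro leU) (simp add: b_def)
  define s1 where "s1 = exb att1 s"
  have s1: "mem s1 = mem s" "regs s1 9 = ?w" "regs s1 13 = int b" "regs s1 12 = int f" "regs s1 15 = 0" "fr ({9} \<union> {12..15}) s s1"
    unfolding s1_def by (simp_all add: att1_def r i iv fr_def)
  have R1': "run w (blk att1) (bsz att1) s (%s'. good s' & s' = s1)"
    by (rule run_blk[OF i(1)]) (use r i iv bU fU kU U100 in \<open>simp_all add: att1_def ok_exp_def s1_def\<close>)
  then have g1: "good s1" unfolding run_def by blast
  have R1: "run w (blk att1) (bsz att1) s (%s'. s' = s1)" using R1' by (rule run_mono) auto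
  have q: "regs s1 2 = ?n" "regs s1 7 = int sz" "regs s1 4 = int LK" "regs s1 5 = int q" using frD[OF s1(6)] i r by simp_all
  have d0: "base (mem s1)" "fresh ?n (mem s1) k" using i(6) unfolding s1(1) dat_def by auto
  define h where "h = card (B.Hs n)"
  have hn: "h * (f + 1) <= n" "h <= n" using B.heavy_bound B.card_Hs_le[of n] by (simp_all add: h_def)
  obtain s2 F7 where R2: "run w (For 20 2 (blk ht1)) (n * 700 + 20) s1 (%s'. s' = s2)" and s2: "good s2" "fr ({15} \<union> {20..27}) s1 s2" "regs s2 15 = int h"
     "mem s2 = utab ?n (utab ?n (mem s) 7 ?w F7) 8 ?w (%x y. int (B.Xc n x y))"
    using run_obtain[OF B.run_ht1[OF g1 d0 q(1,2) s1(2,4,5) fU]] unfolding s1(1) h_def by auto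
  have dat1: "dat (mem s) (regs s 11) (Suc k)" using dat_mono[OF i(6)] by simp
  have dat2: "dat (mem s2) (regs s 11) (Suc k)" unfolding s2(4) by (intro dat_utab dat1) auto
  define nh where "nh = (h + d - 1) div d"
  have d1: "1 <= d" "1 <= nb" by (simp_all add: d_def dd_def nb_def nbb_def)
  have NN: "NN q sz h = nb * nb * nh" by (simp add: NN_def nb_def nh_def d_def)
  note sz = sizes(1,3,4,5,6)[OF q1(2) hn(2), of q, folded d_def nb_def, unfolded NN, folded nh_def]
    sizes(2,7,8)[OF q1(2) hn(2), folded b_def]
  define s3 where "s3 = exb att2 s2"
  define c0 where "c0 = int CK - int (b * b) - int (nb * nb * nh * (d * d))"
  have iv2: "?n * ?n div (int sz * (int q + ?n)) + 1 = int d" "int b div int d + 1 = int nb" "(int h + int d - 1) div int d = int nh"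
  proof -
    show "?n * ?n div (int sz * (int q + ?n)) + 1 = int d" by (simp add: d_def dd_def zdiv_int)
    show "int b div int d + 1 = int nb" by (simp add: nb_def nbb_def b_def d_def zdiv_int)
    have "int h + int d - 1 = int (h + d - 1)" using d1 by simp
    then show "(int h + int d - 1) div int d = int nh" by (simp only: nh_def zdiv_int)
  qed
  have q2: "regs s2 2 = ?n" "regs s2 3 = int L" "regs s2 7 = int sz" "regs s2 4 = int LK" "regs s2 5 = int q" "regs s2 13 = int b" "regs s2 9 = ?w" "regs s2 12 = int f"
     "regs s2 11 = regs s 11" "regs s2 99 \<in> {0, 1}" "regs s2 8 = 1"
    using frD[OF s2(2)] frD[OF s1(6)] q s1 i r by simp_all
  have s3: "mem s3 = mem s2" "regs s3 14 = int d" "regs s3 16 = int nb" "regs s3 17 = int nh" "regs s3 18 = int (d * d)" "regs s3 19 = int (nb * nb * nh)"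
    "regs s3 10 = c0" "fr ({10} \<union> {14..19}) s2 s3"
    unfolding s3_def using q2 s2(3) iv2 by (simp_all add: att2_def fr_def c0_def CK_def)
  have Us: "int d <= U" "int nb <= U" "int nh <= U" "int (d * d) <= U" "int (nb * nb * nh) <= U" "\<bar>c0\<bar> <= U"
  proof -
    have "d * 1 <= d * d" using d1 by (intro mult_le_mono2)
    then show "int d <= U" "int nb <= U" "int nh <= U" "int (d * d) <= U" "int (nb * nb * nh) <= U"
      using sz p5 by (intro leU; linarith)+
    have "CK <= M0 q sz" by (simp add: M0_def CK_def)
    moreover have "b * b + nb * nb * nh * (d * d) <= M0 q sz" using sz p5 by linarith
    ultimately have "int CK <= U" "int (b * b + nb * nb * nh * (d * d)) <= U" using leU by blast+
    then show "\<bar>c0\<bar> <= U" unfolding c0_def of_nat_add by linarith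
  qed
  have R3': "run w (blk att2) (bsz att2) s2 (%s'. good s' & s' = s3)"
  proof (rule run_blk[OF s2(1)])
    show "bnb att2 s2" using q2 s2(3) iv2 Us[unfolded c0_def CK_def] by (simp add: att2_def)
  qed (auto simp: att2_def ok_exp_def s3_def)
  then have g3: "good s3" unfolding run_def by blast
  have R3: "run w (blk att2) (bsz att2) s2 (%s'. s' = s3)" using R3' by (rule run_mono) auto
  have q3: "regs s3 2 = ?n" "regs s3 3 = int L" "regs s3 7 = int sz" "regs s3 4 = int LK" "regs s3 5 = int q" "regs s3 13 = int b" "regs s3 9 = ?w" "regs s3 12 = int f"
     "regs s3 11 = regs s 11" "regs s3 99 \<in> {0, 1}" "regs s3 8 = 1"
    using frD[OF s3(8)] q2 by simp_all
  have f3: "fr TA s s3"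
    by (rule fr_trans[OF fr_trans[OF s1(6) s2(2), where T'' = "{9} \<union> {12..30}"] s3(8)]) auto
  have dat3: "dat (mem s3) (regs s 11) (Suc k)" using dat2 s3(1) by simp
  let ?Q = "%s'. inv n L LK a (Suc k) s' & fr TA s s' & regs s' 11 <= regs s 11 + int CK &
     regs s' 8 \<in> {0, 1} & (regs s' 8 = 0 --> gtab (mem s') (Suc k) sz) & (succ q sz --> regs s' 8 = 0)"
  define cost where "cost = (CK * (4000 + bsz cl1 + cregs P + 40 * (KB * csz P)) + 40 * KB * (CK + (18 * (\<beta> + cmax P + 2 * CK) + 20)) + 20) +
    (esz (V 10) + 2 + (n * (f * 600 + 600) + CK * 1000 + 100))"
  have R4: "run w (IfE (V 10) (Seq (For 30 19 (IfE (V 10) (callc P) Skip)) (IfE (V 10) finc Skip)) Skip) (esz (V 10) + 2 + cost) s3 ?Q"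
  proof (rule run_IfE[OF g3])
    show "ok_exp (V 10)" by (simp add: ok_exp_def)
    assume "ev (V 10) (regs s3) > 0"
    then have c0: "0 < c0" by (simp add: s3)
    then have CKb: "b * b + nb * nb * nh * (d * d) < CK"
    proof -
      have "int (b * b + nb * nb * nh * (d * d)) < int CK" using c0 unfolding c0_def of_nat_add by linarith
      then show ?thesis by (simp only: of_nat_less_iff)
    qed
    interpret C: calls U \<beta> n L a sz f P "Tm d" d nb nh k CK
    proof
      show "100 * (int \<beta> + int (cmax P) + int CK) + 1000 <= U"
        using leU[of "100 * (\<beta> + cmax P + CK) + 1000"] by (simp add: M0_def CK_def)
    qed (use d1 Us kU P_ok[OF d1(1)] in auto)
    have LOWe: "C.LOW = 18 * (\<beta> + cmax P + 2 * CK) + 20" and KKe: "C.KK = KB" by (simp_all add: C.LOW_def C.KK_def KB_def)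
    have st: "C.stamps s3" using dat3 q3(9) unfolding C.stamps_def dat_def by simp
    have m0: "mem s3 0 = 0" using dat3 by (simp add: dat_def)
    have X: "mem s3 (loc ?n 8 ?w (int x) (int y)) = int (B.Xc n x y)" for x y
      unfolding s3(1) s2(4) using utab_loc[of ?n 8 ?w 8 ?w] by simp
    have fz: "mem s (loc ?n t ?w (int x) (int y)) = 0" if "t \<in> {7..10}" for t x y
      using i(6) that unfolding dat_def fresh_def by blast
    have F0: "mem s3 (loc ?n t ?w (int x) (int y)) = 0" if "t \<in> {9, 10}" for t x y
      unfolding s3(1) s2(4) using utab_loc[of ?n 8 ?w t ?w _ _ x y] utab_loc[of ?n 7 ?w t ?w _ _ x y] fz[of t x y] that by auto
    have c0C: "c0 <= int CK" unfolding c0_def by (simp del: of_nat_mult)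
    have g11: "regs s 11 + int (nb * nb * nh) <= U"
    proof -
      have "nb * nb * nh <= CK" using sz(2) CKb by linarith
      then show ?thesis using gU unfolding CK_def by linarith
    qed
    obtain s4 where R4: "run w (For 30 19 (IfE (V 10) (callc P) Skip)) (nb * nb * nh * C.kb1 + 40 * C.KK * (CK + C.LOW) + 20) s3 (%s'. s' = s4)"
      and s4: "good s4" "fr (({10, 11, 99} \<union> {20..29} \<union> {1000..}) \<union> {30}) s3 s4" "regs s4 99 \<in> {0, 1}" "C.stamps s4" "regs s3 11 <= regs s4 11"
      "regs s4 11 <= regs s3 11 + int (nb * nb * nh)" "regs s3 10 - regs s4 10 <= 40 * int (nb * nb * nh) * int (Tm d)"
      "EX F. (ALL z. noP ?n z --> mem s4 z = utab ?n (mem s3) 9 ?w F z) & (regs s4 10 > 0 --> F = (%x y. int (C.Mc (nb * nb * nh) x y)))"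
      using run_obtain[OF C.run_calls[OF g3 q3(1,7) s3(2,3,4,5,6) _ _ _ _ q3(10) st m0 X F0]] s3(7) c0 c0C i(7) g11 q3(9) by auto
    obtain F where F: "\<And>z. noP ?n z ==> mem s4 z = utab ?n (mem s3) 9 ?w F z" "regs s4 10 > 0 ==> F = (%x y. int (C.Mc (nb * nb * nh) x y))"
      using s4(8) by blast
    have dat4: "dat (mem s4) (regs s4 11) (Suc k)"
    proof (rule dat_noP)
      show "dat (utab ?n (mem s3) 9 ?w F) (regs s 11) (Suc k)" by (intro dat_utab dat3) auto
    qed (use F(1) s4(4) in \<open>auto simp: C.stamps_def\<close>)
    have q4: "regs s4 2 = ?n" "regs s4 3 = int L" "regs s4 7 = int sz" "regs s4 4 = int LK" "regs s4 5 = int q" "regs s4 13 = int b" "regs s4 9 = ?w" "regs s4 12 = int f" "regs s4 8 = 1"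
      using frD[OF s4(2)] q3 by simp_all
    have f4: "fr TA s s4" by (rule fr_trans[OF f3 s4(2)]) auto
    have gn: "regs s4 11 <= regs s 11 + int CK" "0 <= regs s4 11"
    proof -
      have "nb * nb * nh <= CK" using sz(2) CKb by linarith
      then show "regs s4 11 <= regs s 11 + int CK" "0 <= regs s4 11" using s4(5,6) q3(9) i(7) by linarith+
    qed
    have t4: "nb * nb * nh * C.kb1 + 40 * C.KK * (CK + C.LOW) + 20 <= CK * (4000 + bsz cl1 + cregs P + 40 * (KB * csz P)) + 40 * KB * (CK + (18 * (\<beta> + cmax P + 2 * CK) + 20)) + 20"
    proof -
      have a1: "nb * nb * nh <= nb * nb * nh * (d * d)" by (rule sz(2))
      define Z where "Z = nb * nb * nh"
      define Y where "Y = bsz cl1 + cregs P + 40 * (KB * csz P)"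
      have "Z * C.kb1 = 2400 * (Z * (d * d)) + Z * (94 + Y)" unfolding C.kb1_def C.kb0_def KKe Y_def by (simp add: algebra_simps)
      also have "\<dots> <= 2400 * CK + CK * (94 + Y)" using CKb a1 unfolding Z_def by (intro add_mono mult_le_mono) linarith+
      also have "\<dots> <= CK * (4000 + Y)" by (simp add: algebra_simps)
      finally show ?thesis unfolding Z_def Y_def LOWe KKe by (simp add: add.assoc)
    qed
    have inv4: "inv n L LK a (Suc k) s4" unfolding inv_dat using s4(1,3) q4 dat4 gn by simp
    have R5: "run w (IfE (V 10) finc Skip) (esz (V 10) + 2 + (n * (f * 600 + 600) + CK * 1000 + 100)) s4 ?Q"
    proof (rule run_IfE[OF s4(1)])
      show "ok_exp (V 10)" by (simp add: ok_exp_def)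
      assume "ev (V 10) (regs s4) > 0"
      then have p: "regs s4 10 > 0" by simp
      have F4: "mem s4 (loc ?n 9 ?w (int x) (int y)) = int (C.Mc (nb * nb * nh) x y)" for x y
        using F(1)[OF noP_loc, of 9 ?w "int x" "int y"] F(2)[OF p] utab_loc[of ?n 9 ?w 9 ?w] by simp
      have Mh: "C.Mc (nb * nb * nh) x y = B.heavyM x y" if "x < b" "y < b" for x y
      proof -
        have "x div d < nb" "y div d < nb" using that div_le_mono[of _ b d] unfolding nb_def nbb_def b_def[symmetric] d_def[symmetric]
          by (simp_all add: less_Suc_eq_le)
        moreover have "h <= nh * d"
        proof -
          have "h + d - 1 < (nh + 1) * d" using d1 unfolding nh_def by (metis add_mult_distrib dividend_less_div_times mult_1 add.commute mult.commute not_one_le_zero bot_nat_0.not_eq_extremum)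
          then show ?thesis by (simp add: algebra_simps)
        qed
        ultimately show ?thesis unfolding C.Mc_all using B.X_prod[of "nh * d" x y] by (simp add: h_def)
      qed
      have Z4: "mem s4 (loc ?n 10 ?w (int x) (int y)) = 0" for x y
        using F(1)[OF noP_loc, of 10 ?w "int x" "int y"] F0[of 10 x y] utab_loc[of ?n 9 ?w 10 ?w] by simp
      have b4: "base (mem s4)" using dat4 by (simp add: dat_def)
      have bz: "b = n div sz + 1" by (simp add: b_def bb_def)
      have "run w finc (n * (f * 600 + 600) + b * b * 1000 + 100) s4 (%s'. good s' & fr ({8} \<union> {20..28}) s4 s' & regs s' 8 = 0 &
         gtab (mem s') (Suc k) sz & (EX F G. mem s' = utab ?n (utab ?n (mem s4) 9 ?w F) 10 ?w G))"
        by (rule B.run_finc[OF s4(1) b4 q4(1,3,7,8,6) bz F4 C.Mc_le[OF order_refl] Mh Z4 fU])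
      then show "run w finc (n * (f * 600 + 600) + CK * 1000 + 100) s4 ?Q"
      proof (rule run_mono)
        show "n * (f * 600 + 600) + b * b * 1000 + 100 <= n * (f * 600 + 600) + CK * 1000 + 100" using CKb by linarith
        fix s' assume "good s' & fr ({8} \<union> {20..28}) s4 s' & regs s' 8 = 0 &
         gtab (mem s') (Suc k) sz & (EX F G. mem s' = utab ?n (utab ?n (mem s4) 9 ?w F) 10 ?w G)"
        then show "?Q s'"
        proof (elim conjE exE)
        fix F' G' assume a: "good s'" "fr ({8} \<union> {20..28}) s4 s'" "regs s' 8 = 0" "gtab (mem s') (Suc k) sz"
           "mem s' = utab ?n (utab ?n (mem s4) 9 ?w F') 10 ?w G'"
        have "dat (mem s') (regs s4 11) (Suc k)" unfolding a(5) by (intro dat_utab dat4) auto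
        then have "inv n L LK a (Suc k) s'" unfolding inv_dat using a(1) frD[OF a(2)] q4 gn s4(3) by simp
        moreover have "fr TA s s'" by (rule fr_trans[OF f4 a(2)]) auto
        ultimately show "?Q s'" using a gn frD[OF a(2)] by simp
        qed
      qed
    next
      assume "ev (V 10) (regs s4) <= 0"
      then have p: "regs s4 10 <= 0" by simp
      \<comment> \<open>Under \<open>succ\<close> the clock would start above
        \<open>40 * N * Tm\<close> for \<open>N\<close> calls, and it loses no more than that, so it
        could not have expired.\<close>
      have "\<not> succ q sz"
      proof
        assume "succ q sz"
        then have "b * b + nb * nb * nh * (d * d) + 40 * (nb * nb * nh) * Tm d < CK"
          using hn(1) unfolding succ_def NN[symmetric] b_def d_def f_def CK_def by blast
        then have "int (b * b) + int (nb * nb * nh * (d * d)) + int (40 * (nb * nb * nh) * Tm d) < int CK"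
          by (simp only: of_nat_add[symmetric] of_nat_less_iff)
        moreover have "int (40 * (nb * nb * nh) * Tm d) = 40 * int (nb * nb * nh) * int (Tm d)" by simp
        ultimately show False using p s4(7) s3(7) unfolding c0_def by linarith
      qed
      then have "?Q s4" using inv4 f4 gn q4(9) by simp
      then have "run w Skip 1 s4 ?Q" by (intro run_Skip w1)
      then show "run w Skip (n * (f * 600 + 600) + CK * 1000 + 100) s4 ?Q" by (rule run_mono) auto
    qed
    have R4': "run w (For 30 19 (IfE (V 10) (callc P) Skip)) (CK * (4000 + bsz cl1 + cregs P + 40 * (KB * csz P)) + 40 * KB * (CK + (18 * (\<beta> + cmax P + 2 * CK) + 20)) + 20) s3 (%s'. s' = s4)"
      by (rule run_mono[OF R4 t4])
    show "run w (Seq (For 30 19 (IfE (V 10) (callc P) Skip)) (IfE (V 10) finc Skip)) cost s3 ?Q"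
      unfolding cost_def by (intro run_Seq run_then[OF R4'] R5)
  next
    assume "ev (V 10) (regs s3) <= 0"
    then have p: "c0 <= 0" by (simp add: s3)
    have "\<not> succ q sz"
    proof
      assume "succ q sz"
      then have "b * b + nb * nb * nh * (d * d) + 40 * (nb * nb * nh) * Tm d < CK"
        using hn(1) unfolding succ_def NN[symmetric] b_def d_def f_def CK_def by blast
      then have "b * b + nb * nb * nh * (d * d) < CK" by linarith
      then have "int (b * b) + int (nb * nb * nh * (d * d)) < int CK" by (simp only: of_nat_add[symmetric] of_nat_less_iff)
      then show False using p unfolding c0_def by linarith
    qed
    moreover have "inv n L LK a (Suc k) s3" unfolding inv_dat using g3 q3 dat3 i(7) by simp
    ultimately have "?Q s3" using f3 q3 by simp
    then have "run w Skip 1 s3 ?Q" by (intro run_Skip w1)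
    then show "run w Skip cost s3 ?Q" by (rule run_mono) (simp add: cost_def)
  qed
  have "run w (attempt P) (bsz att1 + ((n * 700 + 20) + (bsz att2 + (esz (V 10) + 2 + cost)))) s ?Q"
    unfolding attempt_def by (intro run_Seq run_then[OF R1] run_then[OF R2] run_then[OF R3] R4)
  then show ?thesis unfolding CK_def[symmetric]
  proof (rule run_mono)
    have nf: "n * f <= q * sz + n" unfolding f_def ff_def by (simp add: algebra_simps)
    define Y where "Y = bsz cl1 + cregs P + 40 * (KB * csz P)"
    define W where "W = 40 * KB * (CK + (18 * (\<beta> + cmax P + 2 * CK) + 20))"
    have "cost = CK * (4000 + Y) + W + 600 * (n * f) + 600 * n + CK * 1000 + 124"
      unfolding cost_def Y_def W_def by (simp add: algebra_simps)
    moreover have "acost q sz = 2000 * n + 600 * (q * sz) + CK * (5000 + Y) + W + 1000"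
      unfolding acost_def CK_def[symmetric] Y_def W_def by (simp add: add.assoc)
    moreover have "CK * (4000 + Y) + CK * 1000 = CK * (5000 + Y)" by (simp add: algebra_simps)
    moreover have "bsz att1 + bsz att2 <= 400" by (simp add: att1_def att2_def)
    ultimately show "bsz att1 + ((n * 700 + 20) + (bsz att2 + (esz (V 10) + 2 + cost))) <= acost q sz" using nf by simp
  qed
qed

end

section \<open>Answering the queries\<close>

definition rebuild :: "com => com" where
  "rebuild P = Seq (blk [As 5 (V 53), As 6 (V 5), As 53 (eadd (V 5) (V 5)), As 7 (N 1), As 8 (N 1)])
     (WhileE (V 8) (Seq (attempt P) (IfE (V 8) (blk [As 7 (eadd (V 7) (V 7))]) Skip)))"

text \<open>Evaluates the identity \<open>eq_pairs_gg\<close>, with the three prefix counts obtained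
  from \<open>gcode\<close> and the first two collected in register 52.\<close>

definition answer :: com where
  "answer = Seq (blk [As 6 (esub (V 6) (N 1)), As 30 (V 1), As 31 (V 1)]) (Seq gcode
     (Seq (blk [As 52 (V 32), As 30 (esub (V 0) (N 1))]) (Seq gcode
     (Seq (blk [As 52 (esub (V 52) (emul (N 2) (V 32))), As 31 (esub (V 0) (N 1))]) (Seq gcode
     (blk [As 0 (ediv (esub (eadd (V 52) (V 32)) (eadd (esub (V 1) (V 0)) (N 1))) (N 2))]))))))"

definition query :: "com => com" where
  "query P = Seq (IfE (V 6) Skip (rebuild P)) answer"

context attempts begin

lemma inv_frame:
  assumes "inv n L LK a k s" "good s'" "mem s' = mem s" "fr T s s'" "T \<inter> {2, 3, 4, 9, 11, 99} = {}"
  shows "inv n L LK a k s'"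
proof -
  have "2 \<notin> T" "3 \<notin> T" "4 \<notin> T" "9 \<notin> T" "11 \<notin> T" "99 \<notin> T" using assms(5) by auto
  then have "regs s' 2 = regs s 2" "regs s' 3 = regs s 3" "regs s' 4 = regs s 4" "regs s' 9 = regs s 9" "regs s' 11 = regs s 11" "regs s' 99 = regs s 99"
    using frD[OF assms(4)] by auto
  then show ?thesis using assms(1-3) unfolding inv_dat by simp
qed

lemma run_answer:
  assumes inv: "inv n L LK a k s" and gt: "gtab (mem s) k sz" and sz: "1 <= sz" and r: "regs s 7 = int sz" "regs s 0 = int l" "regs s 1 = int r" "regs s 6 = int (Suc rem)"
    and lr: "1 <= l" "l <= r" "r <= n" and A: "\<And>i j. i < r ==> j < r ==> a i = a j \<longleftrightarrow> A (Suc i) = A (Suc j)"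
  shows "run w answer (6000 * (sz * (L + 1)) + 100) s (%s'. inv n L LK a k s' & mem s' = mem s & regs s' 0 = int (eq_pairs A l r) &
     regs s' 6 = int rem & fr ({0, 6} \<union> {30..46} \<union> {52}) s s')"
proof -
  let ?T = "{0, 6} \<union> {30..46} \<union> {52} :: nat set"
  have i: "good s" "regs s 2 = int n" "regs s 3 = int L" "regs s 9 = int k" "base (mem s)"
    using inv unfolding inv_dat dat_def by auto
  define l' where "l' = l - 1"
  have l': "int l - 1 = int l'" "l' <= n" using lr by (auto simp: l'_def)
  define x y z where "x = gg a r r" and "y = gg a l' r" and "z = gg a l' l'"
  have val: "(int x - 2 * int y + int z - (int r - int l + 1)) div 2 = int (eq_pairs A l r)"
  proof -
    have "x + z = 2 * y + 2 * eq_pairs A l r + (r - l + 1)"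
      using eq_pairs_gg[where a = a and A = A, OF lr(1,2) A] unfolding x_def y_def z_def l'_def .
    then have "int x + int z = int (2 * y + 2 * eq_pairs A l r + (r - l + 1))" by (metis of_nat_add)
    then have "int x - 2 * int y + int z - (int r - int l + 1) = 2 * int (eq_pairs A l r)" using lr by (simp add: of_nat_diff)
    then show ?thesis by simp
  qed
  have nn: "4 * (int n * int n) + 4 * int n + 40 <= U" using nnU by (simp add: algebra_simps)
  have bd: "int (gg a u v) <= int n * int n" if "u <= n" "v <= n" for u v
  proof -
    have "gg a u v <= n * n" using gg_le[of a u v] mult_le_mono[OF that] by linarith
    then show ?thesis by (simp flip: of_nat_mult)
  qed
  have xyz: "int x <= int n * int n" "int y <= int n * int n" "int z <= int n * int n" using bd lr l' by (auto simp: x_def y_def z_def)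
  have eU: "int (eq_pairs A l r) <= U"
  proof -
    have "2 * int (eq_pairs A l r) <= int x - 2 * int y + int z - (int r - int l + 1)" using val by presburger
    then show ?thesis using xyz nn lr by linarith
  qed
  let ?b1 = "[As 6 (esub (V 6) (N 1)), As 30 (V 1), As 31 (V 1)]"
  define s1 where "s1 = exb ?b1 s"
  have s1: "mem s1 = mem s" "regs s1 30 = int r" "regs s1 31 = int r" "regs s1 6 = int rem" "fr ({6} \<union> {30..31}) s s1"
    unfolding s1_def using r by (simp_all add: fr_def)
  have rU: "int (Suc rem) <= U" using goodD[OF i(1), of 6] r(4) by simp
  have U1: "int r <= U" "int l' <= U" using lr l'(2) nU(1) by linarith+
  have R1': "run w (blk ?b1) (bsz ?b1) s (%s'. good s' & s' = s1)"
    by (rule run_blk[OF i(1)]) (use r U1 rU in \<open>simp_all add: ok_exp_def s1_def\<close>)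
  then have g1: "good s1" unfolding run_def by blast
  have R1: "run w (blk ?b1) (bsz ?b1) s (%s'. s' = s1)" using R1' by (rule run_mono) auto
  have q1: "regs s1 2 = int n" "regs s1 3 = int L" "regs s1 7 = int sz" "regs s1 9 = int k" "regs s1 0 = int l" "regs s1 1 = int r"
    using frD[OF s1(5)] i r by simp_all
  note bg = i(5)[folded s1(1)] gt[folded s1(1)]
  obtain s2 where R2: "run w gcode (2000 * (sz * (L + 1))) s1 (%s'. s' = s2)" and s2: "good s2" "mem s2 = mem s1" "regs s2 32 = int x" "fr {32..46} s1 s2"
    using run_obtain[OF run_gcode[OF g1 bg sz q1(1-4) s1(2,3) lr(3,3)]] unfolding x_def by blast
  let ?b3 = "[As 52 (V 32), As 30 (esub (V 0) (N 1))]"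
  define s3 where "s3 = exb ?b3 s2"
  have q2: "regs s2 2 = int n" "regs s2 3 = int L" "regs s2 7 = int sz" "regs s2 9 = int k" "regs s2 0 = int l" "regs s2 1 = int r" "regs s2 31 = int r" "regs s2 6 = int rem"
    using frD[OF s2(4)] q1 s1 by simp_all
  have s3: "mem s3 = mem s1" "regs s3 30 = int l'" "regs s3 52 = int x" "fr {30, 52} s2 s3"
    unfolding s3_def using q2 s2 l' by (simp_all add: fr_def)
  have R3': "run w (blk ?b3) (bsz ?b3) s2 (%s'. good s' & s' = s3)"
    by (rule run_blk[OF s2(1)]) (use q2 s2 l' U1 xyz nn in \<open>simp_all add: ok_exp_def s3_def\<close>)
  then have g3: "good s3" unfolding run_def by blast
  have R3: "run w (blk ?b3) (bsz ?b3) s2 (%s'. s' = s3)" using R3' by (rule run_mono) auto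
  have q3: "regs s3 2 = int n" "regs s3 3 = int L" "regs s3 7 = int sz" "regs s3 9 = int k" "regs s3 0 = int l" "regs s3 1 = int r" "regs s3 31 = int r" "regs s3 6 = int rem"
    using frD[OF s3(4)] q2 by simp_all
  obtain s4 where R4: "run w gcode (2000 * (sz * (L + 1))) s3 (%s'. s' = s4)" and s4: "good s4" "mem s4 = mem s3" "regs s4 32 = int y" "fr {32..46} s3 s4"
    using run_obtain[OF run_gcode[OF g3 bg[folded s3(1)] sz q3(1-4) s3(2) q3(7) l'(2) lr(3)]] unfolding y_def by blast
  have q4: "regs s4 2 = int n" "regs s4 3 = int L" "regs s4 7 = int sz" "regs s4 9 = int k" "regs s4 0 = int l" "regs s4 1 = int r" "regs s4 30 = int l'" "regs s4 52 = int x" "regs s4 6 = int rem"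
    using frD[OF s4(4)] q3 s3 by simp_all
  let ?b5 = "[As 52 (esub (V 52) (emul (N 2) (V 32))), As 31 (esub (V 0) (N 1))]"
  define s5 where "s5 = exb ?b5 s4"
  have s5: "mem s5 = mem s1" "regs s5 31 = int l'" "regs s5 52 = int x - 2 * int y" "fr {31, 52} s4 s5"
    unfolding s5_def using q4 s4 s3 l' by (simp_all add: fr_def)
  have xyU: "\<bar>int x - 2 * int y\<bar> <= U" using xyz nn by linarith
  have R5': "run w (blk ?b5) (bsz ?b5) s4 (%s'. good s' & s' = s5)"
    by (rule run_blk[OF s4(1)]) (use q4 s4 l' U1 xyU in \<open>simp_all add: ok_exp_def s5_def\<close>)
  then have g5: "good s5" unfolding run_def by blast
  have R5: "run w (blk ?b5) (bsz ?b5) s4 (%s'. s' = s5)" using R5' by (rule run_mono) auto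
  have q5: "regs s5 2 = int n" "regs s5 3 = int L" "regs s5 7 = int sz" "regs s5 9 = int k" "regs s5 0 = int l" "regs s5 1 = int r" "regs s5 30 = int l'" "regs s5 6 = int rem"
    using frD[OF s5(4)] q4 by simp_all
  obtain s6 where R6: "run w gcode (2000 * (sz * (L + 1))) s5 (%s'. s' = s6)" and s6: "good s6" "mem s6 = mem s5" "regs s6 32 = int z" "fr {32..46} s5 s6"
    using run_obtain[OF run_gcode[OF g5 bg[folded s5(1)] sz q5(1-4) q5(7) s5(2) l'(2,2)]] unfolding z_def by blast
  have q6: "regs s6 0 = int l" "regs s6 1 = int r" "regs s6 52 = int x - 2 * int y" "regs s6 6 = int rem"
    using frD[OF s6(4)] q5 s5 by simp_all
  have f6: "fr ?T s s6"
  proof -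
    have "fr ?T s s2" by (rule fr_trans[OF s1(5) s2(4)]) auto
    moreover have "fr ?T s2 s4" by (rule fr_trans[OF s3(4) s4(4)]) auto
    moreover have "fr ?T s4 s6" by (rule fr_trans[OF s5(4) s6(4)]) auto
    ultimately show ?thesis by (meson fr_trans order_refl)
  qed
  let ?Q = "%s'. inv n L LK a k s' & mem s' = mem s & regs s' 0 = int (eq_pairs A l r) & regs s' 6 = int rem & fr ?T s s'"
  let ?b7 = "[As 0 (ediv (esub (eadd (V 52) (V 32)) (eadd (esub (V 1) (V 0)) (N 1))) (N 2))]"
  define s7 where "s7 = exb ?b7 s6"
  have s7: "mem s7 = mem s" "regs s7 0 = int (eq_pairs A l r)" "regs s7 6 = int rem"
    unfolding s7_def using q6 s6 s5(1) s1(1) val by simp_all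
  have f7: "fr ?T s s7" unfolding s7_def using f6 by (auto intro!: fr_upd)
  have R7: "run w (blk ?b7) (bsz ?b7) s6 ?Q"
  proof (rule run_blk[OF s6(1)])
    show "bnb ?b7 s6" using q6 s6(3) val eU by simp
    assume g7: "good (exb ?b7 s6)"
    have "inv n L LK a k s7" by (rule inv_frame[OF inv _ s7(1) f7]) (use g7 in \<open>auto simp: s7_def\<close>)
    then show "?Q (exb ?b7 s6)" using s7 f7 unfolding s7_def by blast
  qed (auto simp: ok_exp_def)
  have "run w answer (bsz ?b1 + (2000 * (sz * (L + 1)) + (bsz ?b3 + (2000 * (sz * (L + 1)) + (bsz ?b5 + (2000 * (sz * (L + 1)) + bsz ?b7)))))) s ?Q"
    unfolding answer_def by (intro run_Seq run_then[OF R1] run_then[OF R2] run_then[OF R3] run_then[OF R4] run_then[OF R5] run_then[OF R6] R7)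
  then show ?thesis by (rule run_mono) auto
qed

definition AC0 :: nat where "AC0 = 2000 * n + 40 * KB * (18 * (\<beta> + cmax P) + 20) + 1000"
definition AC1 :: nat where "AC1 = 600 + LK * (5000 + bsz cl1 + cregs P + 40 * (KB * csz P)) + 1480 * KB * LK"

lemma acost_eq: "acost q sz = AC0 + AC1 * (q * sz)"
  by (simp add: acost_def AC0_def AC1_def algebra_simps)

definition rcost :: "nat => nat => nat" where
  "rcost q e = (e + 1) * (AC0 + 40) + 2 * AC1 * (q * 2 ^ e) + 50"

lemma M0_mono: "sz <= sz' ==> M0 q sz <= M0 q sz'"
  unfolding M0_def by (intro add_mono mult_le_mono order_refl)

text \<open>The size \<open>2 ^ e\<close> is certain to succeed, so at most \<open>e + 1\<close>
  constructions take place. Their cost is affine in \<open>q * sz\<close> with doubling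
  \<open>sz\<close>, hence the sum is governed by the last one. Success with a smaller block size
  only helps.\<close>

lemma run_rebuild:
  assumes inv: "inv n L LK a k s" and r: "regs s 53 = int q" and q1: "1 <= q"
    and e: "succ q (2 ^ e)" and MU: "int (M0 q (2 ^ e)) <= U" and gU: "regs s 11 + int ((e + 1) * (LK * q * 2 ^ e)) <= U"
    and kU: "int (k + e + 1) <= U" and qU: "2 * int q <= U" "2 * int (2 ^ e) <= U"
  shows "run w (rebuild P) (rcost q e) s (%s'. EX i<=e. EX k'<=k + e + 1. inv n L LK a k' s' & regs s' 7 = int (2 ^ i) &
     gtab (mem s') k' (2 ^ i) & regs s' 6 = int q & regs s' 53 = 2 * int q & regs s' 0 = regs s 0 & regs s' 1 = regs s 1 &
     regs s' 11 <= regs s 11 + int ((e + 1) * (LK * q * 2 ^ e)))"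
proof -
  let ?G = "LK * q * 2 ^ e"
  let ?b1 = "[As 5 (V 53), As 6 (V 5), As 53 (eadd (V 5) (V 5)), As 7 (N 1), As 8 (N 1)]"
  let ?T = "{5..30} \<union> {53} \<union> {99} \<union> {1000..} :: nat set"
  have g: "good s" using inv by (simp add: inv_dat)
  define s1 where "s1 = exb ?b1 s"
  have s1: "mem s1 = mem s" "regs s1 5 = int q" "regs s1 6 = int q" "regs s1 53 = 2 * int q" "regs s1 7 = 1" "regs s1 8 = 1" "fr ({5..8} \<union> {53}) s s1"
    unfolding s1_def using r by (simp_all add: fr_def)
  have R1': "run w (blk ?b1) (bsz ?b1) s (%s'. good s' & s' = s1)"
    by (rule run_blk[OF g]) (use r qU U100 in \<open>simp_all add: ok_exp_def s1_def\<close>)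
  then have g1: "good s1" unfolding run_def by blast
  have R1: "run w (blk ?b1) (bsz ?b1) s (%s'. s' = s1)" using R1' by (rule run_mono) auto
  have inv1: "inv n L LK a k s1" by (rule inv_frame[OF inv g1 s1(1,7)]) auto
  have r11: "regs s1 11 = regs s 11" "regs s1 0 = regs s 0" "regs s1 1 = regs s 1" using frD[OF s1(7)] by simp_all
  define c where "c = (%(s'::state). regs s' 5 = int q & regs s' 6 = int q & regs s' 53 = 2 * int q & regs s' 0 = regs s 0 & regs s' 1 = regs s 1)"
  \<comment> \<open>With \<open>m\<close> constructions left the next block size is
    \<open>2 ^ (e + 1 - m)\<close>. The allowance of generation numbers is used up at most at the
    same pace.\<close>
  define I where "I = (%m (s'::state). EX k'. k' + m <= k + e + 1 & inv n L LK a k' s' & c s' & regs s' 11 + int (m * ?G) <= regs s 11 + int ((e + 1) * ?G) &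
     (regs s' 8 = 1 & 0 < m & m <= e + 1 & regs s' 7 = int (2 ^ (e + 1 - m)) \<or>
      regs s' 8 = 0 & (EX i<=e. regs s' 7 = int (2 ^ i) & gtab (mem s') k' (2 ^ i))))"
  \<comment> \<open>The difference of powers is the sum of the block sizes still to come,
    \<open>2 ^ (e + 1 - m)\<close> up to \<open>2 ^ e\<close>.\<close>
  define C where "C = (%m (s'::state). m * (AC0 + 40) + AC1 * (q * (2 ^ (e + 1) - 2 ^ (e + 1 - m))))"
  have I1: "I (e + 1) s1"
    unfolding I_def using inv1 s1 r11 by (intro exI[of _ k]) (simp add: c_def)
  have ok8: "ok_exp (V 8)" by (simp add: ok_exp_def)
  have step: "m > 0 & (EX \<kappa>. run w (Seq (attempt P) (IfE (V 8) (blk [As 7 (eadd (V 7) (V 7))]) Skip)) \<kappa> s' (%s''. good s'' & I (m - 1) s'' & \<kappa> + esz (V 8) + 2 + C (m - 1) s'' <= C m s'))"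
    if m: "m <= e + 1" and g': "good s'" and Is: "I m s'" and p: "ev (V 8) (regs s') > 0" for m s'
  proof -
    obtain k' where k': "k' + m <= k + e + 1" "inv n L LK a k' s'" "c s'" "regs s' 11 + int (m * ?G) <= regs s 11 + int ((e + 1) * ?G)"
      "regs s' 8 = 1" "0 < m" "regs s' 7 = int (2 ^ (e + 1 - m))" using Is p unfolding I_def by auto
    define i where "i = e + 1 - m"
    have ie: "i <= e" "m = e + 1 - i" "(2::nat) ^ i <= 2 ^ e" using k'(6) m by (auto simp: i_def)
    have ci: "regs s' 5 = int q" using k'(3) by (simp add: c_def)
    have s7: "regs s' 7 = int (2 ^ i)" using k'(7) by (simp add: i_def)
    have MUi: "int (M0 q (2 ^ i)) <= U" using M0_mono[OF ie(3), of q] MU by linarith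
    have Gi: "LK * q * 2 ^ i <= ?G" using ie(3) by (intro mult_le_mono2)
    have mG: "m * ?G = (m - 1) * ?G + ?G" using k'(6) by (cases m) simp_all
    have gUi: "regs s' 11 + int (LK * q * 2 ^ i) <= U" using k'(4) gU Gi unfolding mG by linarith
    have kUi: "int (Suc k') <= U" using k'(1,6) kU by linarith
    obtain s2 where R2: "run w (attempt P) (acost q (2 ^ i)) s' (%s''. s'' = s2)" and s2: "inv n L LK a (Suc k') s2" "fr TA s' s2"
      "regs s2 11 <= regs s' 11 + int (LK * q * 2 ^ i)" "regs s2 8 \<in> {0, 1}" "regs s2 8 = 0 --> gtab (mem s2) (Suc k') (2 ^ i)" "succ q (2 ^ i) --> regs s2 8 = 0"
      using run_obtain[OF run_attempt[OF k'(2) ci s7 k'(5) q1 _ MUi gUi kUi]] by auto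
    have g2: "good s2" using s2(1) by (simp add: inv_dat)
    have c2: "c s2" "regs s2 7 = int (2 ^ i)" using k'(3) s7 frD[OF s2(2)] unfolding c_def by auto
    have b11: "regs s2 11 + int ((m - 1) * ?G) <= regs s 11 + int ((e + 1) * ?G)" using k'(4) s2(3) Gi unfolding mG by linarith
    define \<kappa> where "\<kappa> = acost q (2 ^ i) + (esz (V 8) + 2 + 9)"
    have Cm: "\<kappa> + esz (V 8) + 2 + C (m - 1) s'' <= C m s'" for s''
    proof -
      have x: "e + 1 - (m - 1) = Suc i" "e + 1 - m = i" using k'(6) m by (simp_all add: i_def)
      have "m * (AC0 + 40) = (m - 1) * (AC0 + 40) + (AC0 + 40)" using k'(6) by (cases m) simp_all
      moreover have "(2::nat) ^ (e + 1) - 2 ^ i = (2 ^ (e + 1) - 2 ^ Suc i) + 2 ^ i" using ie(3) by simp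
      then have "AC1 * (q * (2 ^ (e + 1) - 2 ^ i)) = AC1 * (q * (2 ^ (e + 1) - 2 ^ Suc i)) + AC1 * (q * 2 ^ i)"
        by (simp only: distrib_left)
      ultimately show ?thesis unfolding C_def \<kappa>_def acost_eq esz.simps x by linarith
    qed
    let ?Q = "%s''. good s'' & I (m - 1) s'' & \<kappa> + esz (V 8) + 2 + C (m - 1) s'' <= C m s'"
    have R3: "run w (IfE (V 8) (blk [As 7 (eadd (V 7) (V 7))]) Skip) (esz (V 8) + 2 + 9) s2 ?Q"
    proof (rule run_IfE[OF g2 ok8])
      assume "ev (V 8) (regs s2) > 0"
      then have 8: "regs s2 8 = 1" using s2(4) by auto
      then have "i ~= e" using s2(6) e by auto
      then have il: "Suc i <= e" using ie by simp
      have "(2::nat) ^ Suc i <= 2 ^ e" using il by (intro power_increasing) auto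
      then have "int (2 ^ Suc i) <= int (2 ^ e)" by (simp only: of_nat_le_iff)
      moreover have "0 <= int (2 ^ e)" "int (2 ^ Suc i) = 2 * int (2 ^ i)" by simp_all
      ultimately have iU: "2 * int (2 ^ i) <= U" using qU(2) by linarith
      let ?s = "s2(|regs := (regs s2)(7 := 2 * int (2 ^ i))|)"
      have fs: "fr {7} s2 ?s" by (simp add: fr_def)
      have gs: "good ?s" using g2 iU by (intro good_upd) auto
      have "inv n L LK a (Suc k') ?s" by (rule inv_frame[OF s2(1) gs _ fs]) auto
      moreover have "c ?s" using c2 by (simp add: c_def)
      moreover have "Suc k' + (m - 1) <= k + e + 1" "0 < m - 1" "m - 1 <= e + 1" "e + 1 - (m - 1) = Suc i"
        using k'(1,6) m il unfolding i_def by linarith+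
      moreover have "regs ?s 7 = int (2 ^ Suc i)" "regs ?s 8 = 1" "regs ?s 11 = regs s2 11" using 8 by simp_all
      ultimately have "I (m - 1) ?s"
        unfolding I_def using b11 by (intro exI[of _ "Suc k'"] conjI disjI1) (simp_all only:)
      then have "?Q ?s" using gs Cm by blast
      then show "run w (blk [As 7 (eadd (V 7) (V 7))]) 9 s2 ?Q"
        by (intro run_mono[OF run_blk[OF g2, where Q = ?Q]]) (use c2 iU in \<open>auto simp: ok_exp_def\<close>)
    next
      assume "ev (V 8) (regs s2) <= 0"
      then have 8: "regs s2 8 = 0" using s2(4) by auto
      have "Suc k' + (m - 1) <= k + e + 1" using k'(1,6) by linarith
      moreover have "EX i<=e. regs s2 7 = int (2 ^ i) & gtab (mem s2) (Suc k') (2 ^ i)" using ie(1) c2(2) s2(5) 8 by blast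
      ultimately have "I (m - 1) s2"
        unfolding I_def using b11 8 s2(1) c2(1) by - (rule exI[of _ "Suc k'"], intro conjI disjI2; assumption)
      then have "?Q s2" using g2 Cm by blast
      then have "run w Skip 1 s2 ?Q" by (intro run_Skip w1)
      then show "run w Skip 9 s2 ?Q" by (rule run_mono) auto
    qed
    have "run w (Seq (attempt P) (IfE (V 8) (blk [As 7 (eadd (V 7) (V 7))]) Skip)) \<kappa> s' ?Q"
      unfolding \<kappa>_def[of] by (intro run_Seq run_then[OF R2] R3[unfolded \<kappa>_def])
    then show ?thesis using k'(6) by blast
  qed
  have R2: "run w (WhileE (V 8) (Seq (attempt P) (IfE (V 8) (blk [As 7 (eadd (V 7) (V 7))]) Skip))) (C (e + 1) s1 + esz (V 8) + 2) s1
    (%s'. good s' & ev (V 8) (regs s') <= 0 & (EX m<=e + 1. I m s'))"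
    by (rule run_WhileE_gen[where I = I and C = C, OF g1 ok8 I1 step])
  have "run w (rebuild P) (bsz ?b1 + (C (e + 1) s1 + esz (V 8) + 2)) s (%s'. good s' & ev (V 8) (regs s') <= 0 & (EX m<=e + 1. I m s'))"
    unfolding rebuild_def by (intro run_Seq run_then[OF R1] R2)
  then show ?thesis
  proof (rule run_mono)
    have "AC1 * (q * (2 ^ (e + 1) - 1)) <= AC1 * (q * (2 * 2 ^ e))" by (intro mult_le_mono2) simp
    also have "\<dots> = 2 * AC1 * (q * 2 ^ e)" by simp
    finally have "AC1 * (q * (2 ^ (e + 1) - 1)) <= 2 * AC1 * (q * 2 ^ e)" .
    moreover have "C (e + 1) s1 = (e + 1) * (AC0 + 40) + AC1 * (q * (2 ^ (e + 1) - 1))" by (simp add: C_def)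
    moreover have "bsz ?b1 + esz (V 8) + 2 <= 50" by simp
    ultimately show "bsz ?b1 + (C (e + 1) s1 + esz (V 8) + 2) <= rcost q e" unfolding rcost_def by linarith
    fix s' assume "good s' & ev (V 8) (regs s') <= 0 & (EX m<=e + 1. I m s')"
    then obtain m where m: "regs s' 8 <= 0" "I m s'" by auto
    then obtain k' i where "k' + m <= k + e + 1" "inv n L LK a k' s'" "c s'" "regs s' 11 + int (m * ?G) <= regs s 11 + int ((e + 1) * ?G)"
      "i <= e" "regs s' 7 = int (2 ^ i)" "gtab (mem s') k' (2 ^ i)" unfolding I_def by auto
    moreover have "0 <= int (m * ?G)" by (rule of_nat_0_le_iff)
    ultimately show "EX i<=e. EX k'<=k + e + 1. inv n L LK a k' s' & regs s' 7 = int (2 ^ i) &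
     gtab (mem s') k' (2 ^ i) & regs s' 6 = int q & regs s' 53 = 2 * int q & regs s' 0 = regs s 0 & regs s' 1 = regs s 1 &
     regs s' 11 <= regs s 11 + int ((e + 1) * ?G)"
      unfolding c_def by (intro exI[of _ i] conjI exI[of _ k']) linarith+
  qed
qed

end

section \<open>Phases of a sequence of queries\<close>

locale server = attempts U \<beta> n L a P Tm LK for U \<beta> n L a P Tm LK +
  fixes A :: "nat => int" and PN :: nat and ex :: "nat => nat" and GM EM :: nat
  assumes aA: "\<And>i j. i < n ==> j < n ==> a i = a j \<longleftrightarrow> A (Suc i) = A (Suc j)"
    and succ_ex: "\<And>p. p < PN ==> succ (2 ^ p) (2 ^ ex p)"
    and MU: "\<And>p. p < PN ==> int (M0 (2 ^ p) (2 ^ ex p)) <= U"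
    and GM: "\<And>p. p < PN ==> (ex p + 1) * (LK * 2 ^ p * 2 ^ ex p) <= GM"
    and EM: "\<And>p. p < PN ==> ex p + 1 <= EM"
    and PNU: "int (PN * GM) <= U" "int (PN * EM) <= U" "\<And>p. p < PN ==> 2 * 2 ^ p <= U" "\<And>p. p < PN ==> 2 * 2 ^ ex p <= U"
begin

definition Qc :: "nat => nat" where "Qc p = 6000 * (2 ^ ex p * (L + 1)) + 110"
definition PC :: "nat => nat" where "PC p = rcost (2 ^ p) (ex p) + 2 ^ p * Qc p"

text \<open>The state after \<open>p\<close> rebuildings with \<open>rem\<close> queries left before
  the next one. The table in use comes from phase \<open>p - 1\<close>, hence
  \<open>ex (p - 1)\<close>; at the start \<open>p\<close> and \<open>rem\<close> are 0 and there is
  none. Each phase consumes at most \<open>GM\<close> generations and \<open>EM\<close> construction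
  numbers.\<close>

definition Sv :: "nat => nat => nat => state => bool" where
  "Sv p k rem s \<longleftrightarrow> inv n L LK a k s & regs s 11 <= int (p * GM) & k <= p * EM & regs s 53 = int (2 ^ p) & regs s 6 = int rem &
     (0 < rem --> (EX i<=ex (p - 1). regs s 7 = int (2 ^ i) & gtab (mem s) k (2 ^ i)))"

lemma Sv_upd:
  assumes "Sv p k rem s" "l <= n" "r <= n"
  shows "Sv p k rem (s(|regs := (regs s)(0 := int l, 1 := int r)|))"
proof -
  let ?s = "s(|regs := (regs s)(0 := int l, 1 := int r)|)"
  have i: "inv n L LK a k s" using assms by (simp add: Sv_def)
  have lr: "int l <= U" "int r <= U" using assms(2,3) nU(1) by linarith+
  have "good s" using i by (simp add: inv_dat)
  then have "good ?s" using lr by (auto simp: good_def)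
  moreover have "fr {0, 1} s ?s" by (simp add: fr_def)
  ultimately have "inv n L LK a k ?s" by (intro inv_frame[OF i, where T = "{0, 1}"]) auto
  then show ?thesis using assms(1) by (simp add: Sv_def)
qed

lemma run_old:
  assumes S: "Sv p k (Suc rem) s" and lr: "1 <= l" "l <= r" "r <= n" and r: "regs s 0 = int l" "regs s 1 = int r"
  shows "run w (query P) (Qc (p - 1)) s (%s'. Sv p k rem s' & regs s' 0 = int (eq_pairs A l r))"
proof -
  obtain i where i: "i <= ex (p - 1)" "regs s 7 = int (2 ^ i)" "gtab (mem s) k (2 ^ i)" using S by (auto simp: Sv_def)
  have inv: "inv n L LK a k s" and r6: "regs s 6 = int (Suc rem)" using S by (simp_all add: Sv_def)
  have g: "good s" using inv by (simp add: inv_dat)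
  let ?Q = "%s'. Sv p k rem s' & regs s' 0 = int (eq_pairs A l r)"
  have 1: "run w (IfE (V 6) Skip (rebuild P)) (esz (V 6) + 2 + 1) s (%s'. s' = s)"
    by (rule run_IfE[OF g]) (use r6 in \<open>auto simp: ok_exp_def intro: run_Skip[OF w1, unfolded One_nat_def]\<close>)
  have pow: "1 <= (2::nat) ^ i" by simp
  have "run w answer (6000 * (2 ^ i * (L + 1)) + 100) s (%s'. inv n L LK a k s' & mem s' = mem s & regs s' 0 = int (eq_pairs A l r) &
     regs s' 6 = int rem & fr ({0, 6} \<union> {30..46} \<union> {52}) s s')"
    by (rule run_answer[OF inv i(3) pow i(2) r r6 lr]) (use aA lr in auto)
  then have 2: "run w answer (6000 * (2 ^ i * (L + 1)) + 100) s ?Q"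
  proof (rule run_mono[OF _ order_refl])
    fix s' assume s': "inv n L LK a k s' & mem s' = mem s & regs s' 0 = int (eq_pairs A l r) &
     regs s' 6 = int rem & fr ({0, 6} \<union> {30..46} \<union> {52}) s s'"
    then have "regs s' 11 = regs s 11" "regs s' 53 = regs s 53" "regs s' 7 = regs s 7"
      using frD[of "{0, 6} \<union> {30..46} \<union> {52}" s s'] by auto
    then show "?Q s'" using s' S i unfolding Sv_def by auto
  qed
  have "run w (query P) ((esz (V 6) + 2 + 1) + (6000 * (2 ^ i * (L + 1)) + 100)) s ?Q"
    unfolding query_def by (intro run_Seq run_then[OF 1] 2)
  then show ?thesis
  proof (rule run_mono)
    have "2 ^ i * (L + 1) <= 2 ^ ex (p - 1) * (L + 1)" using i(1) by (intro mult_le_mono1 power_increasing) auto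
    then show "(esz (V 6) + 2 + 1) + (6000 * (2 ^ i * (L + 1)) + 100) <= Qc (p - 1)" unfolding Qc_def by simp
  qed
qed

lemma run_new:
  assumes S: "Sv p k 0 s" and p: "p < PN" and lr: "1 <= l" "l <= r" "r <= n" and r: "regs s 0 = int l" "regs s 1 = int r"
  shows "run w (query P) (rcost (2 ^ p) (ex p) + Qc p) s (%s'. EX k'. Sv (Suc p) k' (2 ^ p - 1) s' & regs s' 0 = int (eq_pairs A l r))"
proof -
  have inv: "inv n L LK a k s" and r6: "regs s 6 = 0" "regs s 53 = int (2 ^ p)" "regs s 11 <= int (p * GM)" "k <= p * EM" using S by (simp_all add: Sv_def)
  have g: "good s" using inv by (simp add: inv_dat)
  have pg: "p * GM + GM <= PN * GM" "p * EM + EM <= PN * EM"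
    using p mult_le_mono1[of "Suc p" PN GM] mult_le_mono1[of "Suc p" PN EM] by simp_all
  have gU: "regs s 11 + int ((ex p + 1) * (LK * 2 ^ p * 2 ^ ex p)) <= U" using GM[OF p] r6(3) pg(1) PNU(1) by linarith
  have kU: "int (k + ex p + 1) <= U" using EM[OF p] r6(4) pg(2) PNU(2) by linarith
  let ?R = "%s'. EX i<=ex p. EX k'<=k + ex p + 1. inv n L LK a k' s' & regs s' 7 = int (2 ^ i) &
     gtab (mem s') k' (2 ^ i) & regs s' 6 = int (2 ^ p) & regs s' 53 = 2 * int (2 ^ p) & regs s' 0 = regs s 0 & regs s' 1 = regs s 1 &
     regs s' 11 <= regs s 11 + int ((ex p + 1) * (LK * 2 ^ p * 2 ^ ex p))"
  have "run w (rebuild P) (rcost (2 ^ p) (ex p)) s ?R"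
    by (rule run_rebuild[OF inv r6(2) _ succ_ex[OF p] MU[OF p] gU kU]) (use PNU(3,4)[OF p] in auto)
  then have "run w (IfE (V 6) Skip (rebuild P)) (esz (V 6) + 2 + rcost (2 ^ p) (ex p)) s ?R"
    by (intro run_IfE[OF g]) (use r6 in \<open>auto simp: ok_exp_def\<close>)
  then obtain s1 where 1: "run w (IfE (V 6) Skip (rebuild P)) (esz (V 6) + 2 + rcost (2 ^ p) (ex p)) s (%s'. s' = s1)" and R: "?R s1"
    using run_obtain by blast
  obtain i k' where i: "i <= ex p" "k' <= k + ex p + 1" "inv n L LK a k' s1" "regs s1 7 = int (2 ^ i)"
     "gtab (mem s1) k' (2 ^ i)" "regs s1 6 = int (2 ^ p)" "regs s1 53 = 2 * int (2 ^ p)" "regs s1 0 = int l" "regs s1 1 = int r"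
     "regs s1 11 <= regs s 11 + int ((ex p + 1) * (LK * 2 ^ p * 2 ^ ex p))" using R r by auto
  let ?Q = "%s'. EX k'. Sv (Suc p) k' (2 ^ p - 1) s' & regs s' 0 = int (eq_pairs A l r)"
  have pow: "1 <= (2::nat) ^ i" "(2::nat) ^ p = Suc (2 ^ p - 1)" by simp_all
  have i6: "regs s1 6 = int (Suc (2 ^ p - 1))" unfolding pow(2)[symmetric] by (rule i(6))
  have "run w answer (6000 * (2 ^ i * (L + 1)) + 100) s1 (%s'. inv n L LK a k' s' & mem s' = mem s1 & regs s' 0 = int (eq_pairs A l r) &
     regs s' 6 = int (2 ^ p - 1) & fr ({0, 6} \<union> {30..46} \<union> {52}) s1 s')"
    by (rule run_answer[OF i(3,5) pow(1) i(4,8,9) i6 lr]) (use aA lr in auto)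
  then have 2: "run w answer (6000 * (2 ^ i * (L + 1)) + 100) s1 ?Q"
  proof (rule run_mono[OF _ order_refl])
    fix s' assume s': "inv n L LK a k' s' & mem s' = mem s1 & regs s' 0 = int (eq_pairs A l r) &
     regs s' 6 = int (2 ^ p - 1) & fr ({0, 6} \<union> {30..46} \<union> {52}) s1 s'"
    then have e: "regs s' 11 = regs s1 11" "regs s' 53 = regs s1 53" "regs s' 7 = regs s1 7"
      using frD[of "{0, 6} \<union> {30..46} \<union> {52}" s1 s'] by auto
    have "regs s' 11 <= int (Suc p * GM)" using i(10) r6(3) GM[OF p] unfolding e mult_Suc by linarith
    moreover have "k' <= Suc p * EM" using i(2) r6(4) EM[OF p] unfolding mult_Suc by linarith
    moreover have "regs s' 53 = int (2 ^ Suc p)" using e i(7) by simp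
    ultimately have "Sv (Suc p) k' (2 ^ p - 1) s'" using s' i(1,4,5) e unfolding Sv_def by (metis diff_Suc_1)
    then show "?Q s'" using s' by blast
  qed
  have "run w (query P) ((esz (V 6) + 2 + rcost (2 ^ p) (ex p)) + (6000 * (2 ^ i * (L + 1)) + 100)) s ?Q"
    unfolding query_def by (intro run_Seq run_then[OF 1] 2)
  then show ?thesis
  proof (rule run_mono)
    have "2 ^ i * (L + 1) <= 2 ^ ex p * (L + 1)" using i(1) by (intro mult_le_mono1 power_increasing) auto
    then show "(esz (V 6) + 2 + rcost (2 ^ p) (ex p)) + (6000 * (2 ^ i * (L + 1)) + 100) <= rcost (2 ^ p) (ex p) + Qc p" unfolding Qc_def by simp
  qed
qed

text \<open>\<open>j\<close> queries have been answered before. The first \<open>p\<close> phases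
  serve \<open>2 ^ p - 1\<close> queries together, which is \<open>j + rem\<close>. Every phase
  begun is charged in full.\<close>

lemma serve_main:
  assumes "Sv p k rem s" "p <= PN" "j + rem + 1 = 2 ^ p" "j + length qs <= M" "\<And>p. 2 ^ p <= M ==> p < PN"
    "\<And>l r. (l, r) \<in> set qs ==> 1 <= l & l <= r & r <= n"
  shows "EX u. serve (query P) s qs (map (%(l, r). int (eq_pairs A l r)) qs) u & u <= (rem * Qc (p - 1) + (\<Sum>p'=p..<PN. PC p')) * w"
  using assms
proof (induction qs arbitrary: s p rem k j)
  case Nil
  then show ?case using serve.Nil by fastforce
next
  case (Cons lr qs)
  obtain l r where lr: "lr = (l, r)" by (cases lr)
  have b: "1 <= l" "l <= r" "r <= n" "l <= n" using Cons.prems(6)[of l r] lr by auto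
  let ?s = "s(|regs := (regs s)(0 := int l, 1 := int r)|)"
  have r01: "regs ?s 0 = int l" "regs ?s 1 = int r" by simp_all
  have qs: "\<And>l r. (l, r) \<in> set qs ==> 1 <= l & l <= r & r <= n" using Cons.prems(6) by auto
  show ?case
  proof (cases rem)
    case 0
    have S: "Sv p k 0 ?s" using Sv_upd[OF Cons.prems(1) b(4,3)] 0 by simp
    have "2 ^ p <= M" using Cons.prems(3,4) 0 by simp
    then have p: "p < PN" by (rule Cons.prems(5))
    obtain t s' k' where t: "exec (query P) ?s t s'" "t <= (rcost (2 ^ p) (ex p) + Qc p) * w" "Sv (Suc p) k' (2 ^ p - 1) s'" "regs s' 0 = int (eq_pairs A l r)"
      using run_new[OF S p b(1-3) r01] unfolding run_def by blast
    have "j + 1 + (2 ^ p - 1) + 1 = 2 ^ Suc p" using Cons.prems(3) 0 by simp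
    moreover have "j + 1 + length qs <= M" using Cons.prems(4) by simp
    ultimately obtain u where u: "serve (query P) s' qs (map (%(l, r). int (eq_pairs A l r)) qs) u" "u <= ((2 ^ p - 1) * Qc (Suc p - 1) + (\<Sum>p'=Suc p..<PN. PC p')) * w"
      using Cons.IH[OF t(3) _ _ _ Cons.prems(5) qs] p by fastforce
    have "(2::nat) ^ p = Suc (2 ^ p - 1)" by simp
    from arg_cong[OF this, of "%x. x * Qc p"] have "2 ^ p * Qc p = (2 ^ p - 1) * Qc p + Qc p" unfolding mult_Suc by linarith
    then have "(\<Sum>p'=p..<PN. PC p') = (rcost (2 ^ p) (ex p) + Qc p) + ((2 ^ p - 1) * Qc p + (\<Sum>p'=Suc p..<PN. PC p'))"
      using p by (simp add: sum.atLeast_Suc_lessThan PC_def)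
    then have "t + u <= (rem * Qc (p - 1) + (\<Sum>p'=p..<PN. PC p')) * w"
      using t(2) u(2) 0 by (simp add: distrib_right)
    then show ?thesis using serve.Cons[OF t(1) u(1)] t(4) lr by auto
  next
    case (Suc m)
    have S: "Sv p k (Suc m) ?s" using Sv_upd[OF Cons.prems(1) b(4,3)] Suc by simp
    obtain t s' where t: "exec (query P) ?s t s'" "t <= Qc (p - 1) * w" "Sv p k m s'" "regs s' 0 = int (eq_pairs A l r)"
      using run_old[OF S b(1-3) r01] unfolding run_def by blast
    have "j + 1 + m + 1 = 2 ^ p" "j + 1 + length qs <= M" using Cons.prems(3,4) Suc by simp_all
    then obtain u where u: "serve (query P) s' qs (map (%(l, r). int (eq_pairs A l r)) qs) u" "u <= (m * Qc (p - 1) + (\<Sum>p'=p..<PN. PC p')) * w"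
      using Cons.IH[OF t(3) Cons.prems(2) _ _ Cons.prems(5) qs] by fastforce
    have "t + u <= (rem * Qc (p - 1) + (\<Sum>p'=p..<PN. PC p')) * w"
      using t(2) u(2) Suc by (simp add: distrib_right)
    then show ?thesis using serve.Cons[OF t(1) u(1)] t(4) lr by auto
  qed
qed

end

section \<open>The block size\<close>

text \<open>The logarithm of the ideal block size \<open>time_bound w n q / q\<close>, with
  \<open>v = ln n\<close> and \<open>u = ln q\<close>. In logarithms all estimates become piecewise
  linear.\<close>

definition lgS :: "real => real => real => real" where
  "lgS w v u = (if u <= v then v - (2 / (w + 1)) * u else if u <= 2 * v then ((w - 1) / (w + 1)) * (2 * v - u) else 0)"

lemma time_bound_exp:
  assumes "2 <= w" "1 <= n" "1 <= q"
  shows "time_bound w n q = exp (ln (real q) + lgS w (ln (real n)) (ln (real q)))"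
proof -
  define u v where "u = ln (real q)" and "v = ln (real n)"
  define a where "a = (w - 1) / (w + 1)"
  have a: "2 / (w + 1) = 1 - a" "(2 * w - 2) / (w + 1) = 2 * a" using assms(1) by (auto simp: a_def field_simps)
  have c: "q <= n \<longleftrightarrow> u <= v" "q <= n\<^sup>2 \<longleftrightarrow> u <= 2 * v"
  proof -
    show "q <= n \<longleftrightarrow> u <= v" using assms by (simp add: u_def v_def)
    have "2 * v = ln (real (n\<^sup>2))" using assms by (simp add: v_def ln_realpow)
    then show "q <= n\<^sup>2 \<longleftrightarrow> u <= 2 * v" using assms by (simp add: u_def del: of_nat_power)
  qed
  have e: "real q = exp u" "real n = exp v" using assms by (simp_all add: u_def v_def)
  have p: "real n * real q powr a = exp (v + a * u)" "real n powr (2 * a) * real q powr (1 - a) = exp (2 * a * v + (1 - a) * u)"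
    using assms unfolding powr_def by (simp_all add: u_def v_def exp_add)
  have l: "lgS w v u = (if u <= v then v - (1 - a) * u else if u <= 2 * v then a * (2 * v - u) else 0)"
    unfolding lgS_def a a_def ..
  show ?thesis
    unfolding time_bound_def a a_def[symmetric] c p u_def[symmetric] v_def[symmetric] l
    by (auto simp: e(1) algebra_simps)
qed

text \<open>The fourth inequality controls the table of pairs of blocks, the fifth the matrix
  products, the sixth is monotonicity in \<open>q\<close>. The exponent \<open>w >= 2\<close> enters
  as \<open>a >= 1 / 3\<close>; the cases \<open>q <= n\<close> and \<open>q > n\<close> of the
  fifth are merged by the maximum.\<close>

lemma lgS_bounds:
  assumes "2 <= w" "0 <= v" "0 <= u"
  shows "0 <= lgS w v u" "lgS w v u <= v" "v <= u + lgS w v u" "2 * v <= u + 3 * lgS w v u"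
    "(3 - w) * max u v + (2 * w - 2) * v <= 2 * u + (w + 1) * lgS w v u"
    "u <= u' ==> u + lgS w v u <= u' + lgS w v u'"
proof -
  define a where "a = (w - 1) / (w + 1)"
  have a: "2 / (w + 1) = 1 - a" using assms(1) by (auto simp: a_def field_simps)
  have a3: "1 / 3 <= a" "a < 1" using assms(1) by (auto simp: a_def field_simps)
  have wa: "(w + 1) * (1 - a) = 2" "(w + 1) * a = w - 1" using assms(1) by (auto simp: a_def field_simps)
  have l: "lgS w v u = (if u <= v then v - (1 - a) * u else if u <= 2 * v then a * (2 * v - u) else 0)" for u
    unfolding lgS_def a a_def ..
  have m1: "u <= v ==> (1 - a) * u <= 1 * v" using a3 assms by (intro mult_mono) auto
  have m2: "0 <= (1 - a) * u" using a3 assms by simp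
  have m3: "u <= 2 * v ==> 0 <= a * (2 * v - u)" using a3 by simp
  have m4: "0 <= a * u" "0 <= a * v" using a3 assms by simp_all
  have m5: "u <= 2 * v ==> a * (2 * v - u) <= 1 * (2 * v - u)" using a3 by (intro mult_right_mono) auto
  have m6: "u <= 2 * v ==> (1 / 3) * (2 * v - u) <= a * (2 * v - u)" using a3 by (intro mult_right_mono) auto
  have m7: "(1 - a) * u <= (2 / 3) * u" using a3 assms by (intro mult_right_mono) auto
  show "0 <= lgS w v u" unfolding l using m1 m3 by auto
  show "lgS w v u <= v" unfolding l using m2 m5 assms by auto
  show "v <= u + lgS w v u" unfolding l using m4 m3 assms by (auto simp: algebra_simps)
  show "2 * v <= u + 3 * lgS w v u" unfolding l using m6 m7 by auto
  show "(3 - w) * max u v + (2 * w - 2) * v <= 2 * u + (w + 1) * lgS w v u"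
  proof -
    have e1: "(w + 1) * (v - (1 - a) * u) = (w + 1) * v - 2 * u" using wa(1) by (simp only: right_diff_distrib mult.assoc[symmetric])
    have e2: "(w + 1) * (a * (2 * v - u)) = (w - 1) * (2 * v - u)" using wa(2) by (simp only: mult.assoc[symmetric])
    have e3: "\<not> u <= 2 * v ==> (w - 1) * (2 * v) <= (w - 1) * u" using assms by (intro mult_left_mono) auto
    show ?thesis unfolding l using e1 e2 e3 assms by (auto simp: max_def algebra_simps)
  qed
  show "u + lgS w v u <= u' + lgS w v u'" if uu: "u <= u'"
  proof -
    have 1: "a * u <= a * u'" "(1 - a) * u <= (1 - a) * u'" using uu a3 by (auto intro!: mult_left_mono)
    have 2: "v < u' ==> (1 - a) * v <= (1 - a) * u'" "u <= v ==> a * u <= a * v" "u <= 2 * v ==> (1 - a) * u <= (1 - a) * (2 * v)"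
      using a3 by (auto intro!: mult_left_mono)
    have 3: "a * v <= 1 * v" using a3 assms by (intro mult_right_mono) auto
    show ?thesis unfolding l using 1 2 3 uu assms m4 m1 by (auto simp: algebra_simps)
  qed
qed

text \<open>Undoes the logarithms. The last two statements say what a block size \<open>s\<close>
  with \<open>q * s\<close> at least the time bound provides: the conditions for the products and
  for the table in \<open>block_bounds\<close>.\<close>

lemma time_bound_block:
  assumes w: "2 <= w" and n: "1 <= n" and q: "1 <= q"
  shows "real q <= time_bound w n q" "real n <= time_bound w n q" "time_bound w n q <= real q * real n"
    "q <= q' ==> time_bound w n q <= time_bound w n q'"
    "time_bound w n q <= real q * real s ==> real (max q n) powr (3 - w) * real n powr (2 * w - 2) <= real q ^ 2 * real s powr (w + 1)"
    "time_bound w n q <= real q * real s ==> real n ^ 2 <= real q * real s ^ 3"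
proof -
  define u v where "u = ln (real q)" and "v = ln (real n)"
  have uv: "0 <= u" "0 <= v" using n q by (simp_all add: u_def v_def)
  have e: "real q = exp u" "real n = exp v" using n q by (simp_all add: u_def v_def)
  define z where "z = lgS w v u"
  note b = lgS_bounds[OF w uv(2,1), folded z_def]
  have T: "time_bound w n q = exp (u + z)" unfolding time_bound_exp[OF w n q] u_def v_def z_def ..
  show "real q <= time_bound w n q" "real n <= time_bound w n q" unfolding T e using b by auto
  show "time_bound w n q <= real q * real n" unfolding T e using b by (simp flip: exp_add)
  show "time_bound w n q <= time_bound w n q'" if "q <= q'"
  proof -
    have "1 <= q'" using that q by simp
    then have "time_bound w n q' = exp (ln (real q') + lgS w v (ln (real q')))" unfolding v_def by (rule time_bound_exp[OF w n])
    moreover have "u <= ln (real q')" using that q by (simp add: u_def)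
    ultimately show ?thesis unfolding T using b(6)[of "ln (real q')"] by simp
  qed
  have S: "exp z <= real s" if "time_bound w n q <= real q * real s"
    using that unfolding T e by (simp add: exp_add)
  show "real (max q n) powr (3 - w) * real n powr (2 * w - 2) <= real q ^ 2 * real s powr (w + 1)" if "time_bound w n q <= real q * real s"
  proof -
    have "q <= n \<longleftrightarrow> u <= v" by (metis e exp_le_cancel_iff of_nat_le_iff)
    then have "real (max q n) = exp (max u v)" using e by (auto simp: max_def)
    then have "real (max q n) powr (3 - w) * real n powr (2 * w - 2) = exp ((3 - w) * max u v + (2 * w - 2) * v)"
      unfolding e by (simp add: powr_def exp_add)
    also have "\<dots> <= exp (2 * u + (w + 1) * z)" using b by simp
    also have "\<dots> = real q ^ 2 * exp z powr (w + 1)" unfolding e by (simp add: powr_def exp_add flip: exp_of_nat_mult)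
    also have "\<dots> <= real q ^ 2 * real s powr (w + 1)" using S[OF that] w by (intro mult_left_mono powr_mono2) auto
    finally show ?thesis .
  qed
  show "real n ^ 2 <= real q * real s ^ 3" if "time_bound w n q <= real q * real s"
  proof -
    have "real n ^ 2 = exp (2 * v)" unfolding e by (simp flip: exp_of_nat_mult)
    also have "\<dots> <= exp (u + 3 * z)" using b by simp
    also have "\<dots> = real q * exp z ^ 3" unfolding e by (simp add: exp_add flip: exp_of_nat_mult)
    also have "\<dots> <= real q * real s ^ 3" using S[OF that] by (intro mult_left_mono power_mono) auto
    finally show ?thesis .
  qed
qed

lemma nat_div_bounds: "real (n div x) <= real n / real x" "real n / real x <= real (n div x) + 1"
  using real_of_int_div4[of "int n" "int x"] real_of_int_div3[of "int n" "int x"] by (simp_all flip: zdiv_int)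

text \<open>Let \<open>D = n^2 / (s * (q + n))\<close>. If \<open>D >= 1\<close>, then
  \<open>d\<close> is \<open>D\<close> up to a factor 2, there are at most
  \<open>32 * (q + n)^3 / (n^2 * q)\<close> products, and \<open>T3\<close> is the resulting
  condition; \<open>64 = 4 * 4 * 2 * 2\<close>. If \<open>D < 1\<close>, then \<open>d = 1\<close>
  and the products are single multiplications, whose number is bounded through
  \<open>n^2 <= 4 * q * s^2\<close>; \<open>576 = 6 * 6 * 4 * 4\<close>. The square of the number of
  blocks is covered by \<open>T4\<close>.\<close>

lemma block_bounds:
  fixes n q s h :: nat and w :: real
  assumes w: "2 <= w" and n: "1 <= n" and q: "1 <= q" and s: "1 <= s" "s <= 2 * n"
    and T3: "real (max q n) powr (3 - w) * real n powr (2 * w - 2) <= real q ^ 2 * real s powr (w + 1)"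
    and T4: "real n ^ 2 <= real q * real s ^ 3"
    and hf: "h * (q * s div n + 1 + 1) <= n"
  defines "b == n div s + 1" and "d == n * n div (s * (q + n)) + 1"
  defines "nb == b div d + 1" and "nh == (h + d - 1) div d"
  shows "real (b * b) <= 9 * (real q * real s)" "real (nb * nb * nh) * real d powr w <= (64 * 2 powr w + 576) * (real q * real s)"
proof -
  define N Q S x where "N = real n" and "Q = real q" and "S = real s" and "x = Q + N"
  have pos: "1 <= N" "1 <= Q" "1 <= S" "0 < x" using n q s by (auto simp: N_def Q_def S_def x_def)
  have b: "real b <= 3 * N / S"
  proof -
    have "real (n div s) <= N / S" unfolding N_def S_def by (rule nat_div_bounds)
    moreover have "S <= 2 * N" using s(2) unfolding N_def S_def by linarith
    then have "1 <= 2 * N / S" using pos by (simp add: field_simps)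
    ultimately show ?thesis unfolding b_def by simp
  qed
  have T4': "N * N <= Q * S * S * S" using T4 by (simp add: N_def Q_def S_def power2_eq_square power3_eq_cube mult.assoc)
  have "real (b * b) <= (3 * N / S) * (3 * N / S)" unfolding of_nat_mult using b by (intro mult_mono) auto
  also have "\<dots> = 9 * (N * N) / (S * S)" by simp
  also have "\<dots> <= 9 * (Q * S * S * S) / (S * S)" using T4' pos by (intro divide_right_mono mult_left_mono) auto
  also have "\<dots> = 9 * (Q * S)" using pos by simp
  finally show "real (b * b) <= 9 * (real q * real s)" unfolding Q_def S_def .
  have h: "real h <= N * N / (Q * S)"
  proof -
    have "Q * S / N <= real (q * s div n) + 1" using nat_div_bounds(2)[of "q * s" n] unfolding Q_def S_def N_def by simp
    then have "real h * (Q * S / N) <= real h * (real (q * s div n) + 1)" by (intro mult_left_mono) auto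
    also have "\<dots> <= real (h * (q * s div n + 1 + 1))" by (simp add: algebra_simps)
    also have "\<dots> <= N" using hf unfolding N_def by (simp only: of_nat_le_iff)
    finally show ?thesis using pos by (simp add: field_simps)
  qed
  define D where "D = N * N / (S * x)"
  have Dpos: "0 < D" using pos by (simp add: D_def)
  have De: "D = real (n * n) / real (s * (q + n))" by (simp add: D_def N_def S_def x_def Q_def)
  have d: "D <= real d" "real d <= D + 1"
    using nat_div_bounds(2)[of "n * n" "s * (q + n)"] nat_div_bounds(1)[of "n * n" "s * (q + n)"] unfolding De d_def by simp_all
  have d1: "1 <= d" by (simp add: d_def)
  have nb: "real nb <= real b / real d + 1" unfolding nb_def using nat_div_bounds(1)[of b d] by simp
  have nh: "real nh <= real h / real d + 1"
  proof -
    have "real nh <= real (h + d - 1) / real d" unfolding nh_def by (rule nat_div_bounds)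
    also have "\<dots> <= (real h + real d) / real d" using d1 by (intro divide_right_mono) auto
    also have "\<dots> = real h / real d + 1" using d1 by (simp add: add_divide_distrib)
    finally show ?thesis .
  qed
  define m where "m = max Q N"
  have m: "m <= x" "x <= 2 * m" "1 <= m" using pos by (auto simp: m_def x_def)
  have T3': "m powr (3 - w) * N powr (2 * w - 2) <= Q * Q * S powr (w + 1)"
    using T3 unfolding m_def Q_def N_def S_def by (simp add: power2_eq_square of_nat_max)
  have "real (nb * nb * nh) * real d powr w <= (64 * 2 powr w + 576) * (Q * S)"
  proof (cases "1 <= D")
    case True
    have "real b / real d <= (3 * N / S) / D" using b d Dpos by (intro frac_le) auto
    also have "\<dots> = 3 * x / N" using pos by (simp add: D_def field_simps)
    finally have "real nb <= 3 * x / N + 1" using nb by simp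
    also have "\<dots> <= 4 * x / N" using pos by (simp add: field_simps x_def)
    finally have nb': "real nb <= 4 * x / N" .
    have "real h / real d <= (N * N / (Q * S)) / D" using h d Dpos pos by (intro frac_le) auto
    also have "\<dots> = x / Q" using pos by (simp add: D_def field_simps)
    finally have "real nh <= x / Q + 1" using nh by simp
    also have "\<dots> <= 2 * x / Q" using pos by (simp add: field_simps x_def)
    finally have nh': "real nh <= 2 * x / Q" .
    have "real d powr w <= (2 * D) powr w" using d True w by (intro powr_mono2) auto
    also have "\<dots> = 2 powr w * D powr w" using Dpos by (simp add: powr_mult)
    finally have d': "real d powr w <= 2 powr w * D powr w" .
    have Dw: "D powr w = N powr (2 * w) / (S powr w * x powr w)"
    proof -
      have "D powr w = (N * N) powr w / (S * x) powr w" unfolding D_def using pos by (simp add: powr_divide)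
      also have "(N * N) powr w = N powr (2 * w)" using pos by (simp add: powr_mult flip: powr_add)
      also have "(S * x) powr w = S powr w * x powr w" using pos by (simp add: powr_mult)
      finally show ?thesis .
    qed
    \<comment> \<open>The exponent \<open>3 - w\<close> may have either sign. As \<open>x\<close>
      lies between \<open>m\<close> and \<open>2 * m\<close>, a factor 2 suffices in both cases,
      using \<open>w >= 2\<close> if the exponent is positive.\<close>
    have x3: "x powr (3 - w) <= 2 * m powr (3 - w)"
    proof (cases "3 - w <= 0")
      case True
      then have "x powr (3 - w) <= m powr (3 - w)" using m by (intro powr_mono2') auto
      then show ?thesis by (smt (verit) powr_ge_zero)
    next
      case False
      then have "x powr (3 - w) <= (2 * m) powr (3 - w)" using m pos by (intro powr_mono2) auto
      also have "\<dots> = 2 powr (3 - w) * m powr (3 - w)" using m by (simp add: powr_mult)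
      also have "\<dots> <= 2 powr 1 * m powr (3 - w)" using w by (intro mult_right_mono powr_mono) auto
      finally show ?thesis by simp
    qed
    have "real (nb * nb * nh) * real d powr w <= ((4 * x / N) * (4 * x / N) * (2 * x / Q)) * (2 powr w * D powr w)"
      unfolding of_nat_mult using nb' nh' d' pos by (intro mult_mono) auto
    also have "\<dots> = 32 * 2 powr w * ((x powr 3 / x powr w) * (N powr (2 * w) / N powr 2)) / (Q * S powr w)"
      unfolding Dw using pos by (simp add: field_simps power2_eq_square power3_eq_cube)
    also have "\<dots> = 32 * 2 powr w * (x powr (3 - w) * N powr (2 * w - 2)) / (Q * S powr w)"
      by (simp only: powr_diff)
    also have "\<dots> <= 32 * 2 powr w * ((2 * m powr (3 - w)) * N powr (2 * w - 2)) / (Q * S powr w)"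
      using x3 pos by (intro divide_right_mono mult_left_mono mult_right_mono) auto
    also have "\<dots> = 64 * 2 powr w * (m powr (3 - w) * N powr (2 * w - 2)) / (Q * S powr w)" by simp
    also have "\<dots> <= 64 * 2 powr w * (Q * Q * S powr (w + 1)) / (Q * S powr w)"
      using T3' pos by (intro divide_right_mono mult_left_mono) auto
    also have "\<dots> = 64 * 2 powr w * (Q * S)" using pos by (simp add: powr_add field_simps)
    also have "\<dots> <= (64 * 2 powr w + 576) * (Q * S)" using pos by (intro mult_right_mono) auto
    finally show ?thesis .
  next
    case False
    then have lt: "N * N < S * x" using pos by (simp add: D_def field_simps)
    then have "real (n * n) < real (s * (q + n))" by (simp add: N_def S_def x_def Q_def)
    then have "n * n < s * (q + n)" by (simp only: of_nat_less_iff)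
    then have d1: "d = 1" by (simp add: d_def)
    have "1 <= real b" by (simp add: b_def)
    then have nb': "real nb <= 6 * N / S" using nb b d1 by simp
    have nh': "real nh <= N * N / (Q * S)" using h by (simp add: nh_def d1)
    \<comment> \<open>From \<open>n^2 < s * (q + n)\<close>: if \<open>n <= q\<close>, the right
      side is at most \<open>2 * q * s\<close>; otherwise it is below \<open>2 * n * s\<close>,
      whence \<open>n < 2 * s\<close>.\<close>
    have n2: "N * N <= 4 * (Q * (S * S))"
    proof (cases "n <= q")
      case True
      then have "x <= 2 * Q" by (simp add: x_def N_def Q_def)
      then have "S * x <= S * (2 * Q)" using pos by (intro mult_left_mono) auto
      moreover have "S * (2 * Q) = 2 * (Q * S)" by simp
      moreover have "Q * S * 1 <= Q * S * S" using pos by (intro mult_left_mono) auto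
      then have "Q * S <= Q * (S * S)" by (simp add: mult.assoc)
      moreover have "0 <= Q * (S * S)" using pos by simp
      ultimately show ?thesis using lt by linarith
    next
      case False
      then have "x <= 2 * N" by (simp add: x_def N_def Q_def)
      then have "S * x <= S * (2 * N)" using pos by (intro mult_left_mono) auto
      moreover have "S * (2 * N) = (2 * S) * N" by simp
      ultimately have "N * N < (2 * S) * N" using lt by linarith
      then have "N < 2 * S" using pos by (simp add: mult_less_cancel_right)
      then have "N * N <= (2 * S) * (2 * S)" using pos by (intro mult_mono) auto
      moreover have "1 * (S * S) <= Q * (S * S)" using pos by (intro mult_right_mono) auto
      ultimately show ?thesis by simp
    qed
    have "real (nb * nb * nh) * real d powr w = real nb * real nb * real nh" by (simp add: d1)
    also have "\<dots> <= (6 * N / S) * (6 * N / S) * (N * N / (Q * S))" using nb' nh' pos by (intro mult_mono) auto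
    also have "\<dots> = 36 * ((N * N) * (N * N)) / (Q * S * S * S)" using pos by (simp add: field_simps)
    also have "\<dots> <= 36 * ((4 * (Q * (S * S))) * (4 * (Q * (S * S)))) / (Q * S * S * S)"
    proof -
      have "(N * N) * (N * N) <= (4 * (Q * (S * S))) * (4 * (Q * (S * S)))" by (rule mult_mono[OF n2 n2]) (use pos in auto)
      then show ?thesis using pos by (intro divide_right_mono mult_left_mono) auto
    qed
    also have "\<dots> = 576 * (Q * S)" using pos by (simp add: field_simps)
    also have "\<dots> <= (64 * 2 powr w + 576) * (Q * S)" using pos by (intro mult_right_mono) auto
    finally show ?thesis .
  qed
  then show "real (nb * nb * nh) * real d powr w <= (64 * 2 powr w + 576) * (real q * real s)" unfolding Q_def S_def .
qed

section \<open>The running time\<close>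

context attempts begin

text \<open>The condition on \<open>cb\<close> adds up three shares: 9 for the table,
  \<open>64 * 2 powr om + 576\<close> for copying (as \<open>d^2 <= d^om\<close>), and the same with
  \<open>40 * cc * 3 ^ k0\<close> for the products. The logarithm in the time of \<open>P\<close> is
  at most \<open>L + 2 <= 3 * L\<close>; this gives \<open>3 ^ k0\<close> and explains the factor
  \<open>L ^ k0\<close> in \<open>LK\<close>.\<close>

lemma succ_holds:
  fixes om cc :: real
  assumes om: "2 <= om" and cc: "0 <= cc" and TmB: "\<And>d. 1 <= d ==> real (Tm d) <= cc * real d powr om * log 2 (real (d + n + 2)) ^ k0"
    and LK: "LK = cb * L ^ k0" and cb: "9 + (64 * 2 powr om + 576) + 40 * cc * 3 ^ k0 * (64 * 2 powr om + 576) < real cb"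
    and q: "1 <= q" and s: "1 <= sz" "sz <= 2 * n" and TB: "time_bound om n q <= real q * real sz"
  shows "succ q sz"
  unfolding succ_def
proof (intro allI impI)
  fix h assume h: "h * (ff q sz + 1) <= n"
  define C1 where "C1 = 64 * 2 powr om + (576 :: real)"
  have C1: "0 <= C1" by (simp add: C1_def)
  define d where "d = dd q sz"
  define M where "M = NN q sz h"
  define Y where "Y = real q * real sz"
  define G where "G = real L ^ k0"
  note bds = block_bounds[OF om n1 q s time_bound_block(5)[OF om n1 q TB] time_bound_block(6)[OF om n1 q TB] h[unfolded ff_def]]
  have b1: "real (bb sz * bb sz) <= 9 * Y" using bds(1) unfolding bb_def Y_def .
  have b2: "real M * real d powr om <= C1 * Y" using bds(2) unfolding M_def d_def NN_def nbb_def bb_def dd_def C1_def Y_def .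
  have L1: "1 <= L" using nL n1 by (cases L) auto
  have G1: "1 <= G" using L1 by (simp add: G_def)
  have Y1: "1 <= Y" unfolding Y_def using q s mult_mono[of 1 "real q" 1 "real sz"] by simp
  have d1: "1 <= d" by (simp add: d_def dd_def)
  have Tmd: "real (Tm d) <= cc * 3 ^ k0 * G * real d powr om"
  proof -
    have "d + n + 2 <= 2 ^ (L + 2)" using dd_le[OF s(1), of q] nL by (simp add: d_def)
    then have "real (d + n + 2) <= real (2 ^ (L + 2))" by (simp only: of_nat_le_iff)
    then have "real (d + n + 2) <= 2 ^ (L + 2)" by simp
    then have "log 2 (real (d + n + 2)) <= real (L + 2)" by (intro log_of_power_le) auto
    then have "log 2 (real (d + n + 2)) <= 3 * real L" using L1 by simp
    then have "log 2 (real (d + n + 2)) ^ k0 <= (3 * real L) ^ k0" by (intro power_mono) auto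
    then have "cc * real d powr om * log 2 (real (d + n + 2)) ^ k0 <= cc * real d powr om * (3 * real L) ^ k0"
      using cc by (intro mult_left_mono) auto
    then show ?thesis using TmB[OF d1] by (simp add: G_def power_mult_distrib algebra_simps)
  qed
  have dd: "real M * (real d * real d) <= C1 * Y"
  proof -
    have "real d * real d = real d powr 2" using d1 by (simp add: power2_eq_square)
    also have "\<dots> <= real d powr om" using d1 om by (intro powr_mono) auto
    finally have "real M * (real d * real d) <= real M * real d powr om" by (intro mult_left_mono) auto
    then show ?thesis using b2 by linarith
  qed
  have MT: "real M * real (Tm d) <= (cc * 3 ^ k0) * C1 * (G * Y)"
  proof -
    have "real M * real (Tm d) <= real M * (cc * 3 ^ k0 * G * real d powr om)" using Tmd by (intro mult_left_mono) auto
    also have "\<dots> = (cc * 3 ^ k0 * G) * (real M * real d powr om)" by (simp add: algebra_simps)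
    also have "\<dots> <= (cc * 3 ^ k0 * G) * (C1 * Y)" using b2 cc G1 by (intro mult_left_mono) auto
    finally show ?thesis by (simp add: algebra_simps)
  qed
  have GY: "Y <= G * Y" using G1 Y1 by (simp add: mult_le_cancel_right1)
  have "real (bb sz * bb sz + M * (d * d) + 40 * M * Tm d) = real (bb sz * bb sz) + real M * (real d * real d) + 40 * (real M * real (Tm d))" by simp
  also have "\<dots> <= 9 * (G * Y) + C1 * (G * Y) + 40 * ((cc * 3 ^ k0) * C1 * (G * Y))"
    using b1 dd MT GY mult_left_mono[OF GY C1] by linarith
  also have "\<dots> = (9 + C1 + 40 * cc * 3 ^ k0 * C1) * (G * Y)" by (simp add: algebra_simps)
  also have "\<dots> < real cb * (G * Y)" using cb G1 Y1 unfolding C1_def by (intro mult_strict_right_mono) auto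
  also have "\<dots> = real (LK * q * sz)" by (simp add: LK G_def Y_def)
  finally have "real (bb sz * bb sz + M * (d * d) + 40 * M * Tm d) < real (LK * q * sz)" .
  then show "bb sz * bb sz + NN q sz h * (dd q sz * dd q sz) + 40 * NN q sz h * Tm (dd q sz) < LK * q * sz"
    unfolding M_def d_def by (simp only: of_nat_less_iff)
qed

end

text \<open>Collects the constants of \<open>PC_le\<close>: with \<open>KB <= 323 * l^2\<close>
  there, \<open>12920 = 40 * 323\<close> and \<open>478040 = 1480 * 323\<close>, while 6160 comes
  from the queries and fixed costs.\<close>

definition cost_const :: "com => nat => nat" where
  "cost_const P cb = (2000 + 12920 * (18 * (1 + cmax P) + 20) + 1040) +
     2 * ((600 + (5000 + bsz cl1 + cregs P + 12920 * csz P) + 478040) * cb) + 6160"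

context server begin

lemma PC_le:
  assumes b: "\<beta> + 1 <= l" "L + 1 <= l" and LK: "LK <= cb * l ^ k0" "1 <= cb" and p: "ex p + 1 <= l"
  shows "PC p <= cost_const P cb * l ^ (k0 + 4) * (n + 2 ^ p * 2 ^ ex p)"
proof -
  define Y where "Y = (2::nat) ^ p * 2 ^ ex p"
  have l1: "1 <= l" using b by simp
  have KB: "KB <= 323 * (l * l)"
  proof -
    have "KB <= (17 * l) * (19 * l)" unfolding KB_def using b by (intro mult_le_mono) auto
    then show ?thesis by simp
  qed
  define c0 where "c0 = 2000 + 12920 * (18 * (1 + cmax P) + 20) + 1040"
  define c1 where "c1 = 600 + (5000 + bsz cl1 + cregs P + 12920 * csz P) + 478040"
  have ll: "1 <= l * l" "1 <= l * l * l" using l1 by auto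
  have A0: "AC0 + 40 <= c0 * (l * l * l) * n"
  proof -
    have "40 * KB * (18 * (\<beta> + cmax P) + 20) <= 40 * (323 * (l * l)) * (l * (18 * (1 + cmax P) + 20))"
    proof (intro mult_le_mono order_refl KB)
      have "18 * \<beta> + 18 * cmax P + 20 <= 18 * l + 18 * (l * cmax P) + 20 * l" using b l1 by (intro add_mono mult_le_mono) auto
      then show "18 * (\<beta> + cmax P) + 20 <= l * (18 * (1 + cmax P) + 20)" by (simp add: algebra_simps)
    qed
    also have "\<dots> = (12920 * (18 * (1 + cmax P) + 20)) * (l * l * l)" by (simp add: algebra_simps)
    also have "\<dots> <= (12920 * (18 * (1 + cmax P) + 20)) * (l * l * l * n)" using n1 by (intro mult_le_mono2) simp
    finally have 1: "40 * KB * (18 * (\<beta> + cmax P) + 20) <= (12920 * (18 * (1 + cmax P) + 20)) * (l * l * l * n)" .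
    have 2: "n <= l * l * l * n" "1 <= l * l * l * n" using ll n1 mult_le_mono[of 1 "l * l * l" 1 n] by auto
    have "AC0 + 40 = 2000 * n + 40 * KB * (18 * (\<beta> + cmax P) + 20) + 1040 * 1" by (simp add: AC0_def)
    also have "\<dots> <= 2000 * (l * l * l * n) + (12920 * (18 * (1 + cmax P) + 20)) * (l * l * l * n) + 1040 * (l * l * l * n)"
      using 1 2 by (intro add_mono mult_le_mono2)
    also have "\<dots> = c0 * (l * l * l) * n" by (simp add: c0_def algebra_simps)
    finally show ?thesis .
  qed
  define J where "J = l ^ k0 * (l * l)"
  have J1: "1 <= J" using l1 ll by (simp add: J_def)
  have A1: "AC1 <= c1 * cb * J"
  proof -
    have k: "40 * (KB * csz P) <= 12920 * csz P * (l * l)"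
    proof -
      have "KB * csz P <= 323 * (l * l) * csz P" using KB by (intro mult_le_mono1)
      then show ?thesis by (simp add: algebra_simps)
    qed
    have "5000 + bsz cl1 + cregs P + 40 * (KB * csz P) <= (5000 + bsz cl1 + cregs P) * (l * l) + 12920 * csz P * (l * l)"
      using add_mono[OF mult_le_mono2[OF ll(1), of "5000 + bsz cl1 + cregs P"] k] by (simp only: mult_1_right)
    also have "\<dots> = (5000 + bsz cl1 + cregs P + 12920 * csz P) * (l * l)" by (simp add: algebra_simps)
    finally have "LK * (5000 + bsz cl1 + cregs P + 40 * (KB * csz P)) <= (cb * l ^ k0) * ((5000 + bsz cl1 + cregs P + 12920 * csz P) * (l * l))"
      using LK by (intro mult_le_mono)
    then have 1: "LK * (5000 + bsz cl1 + cregs P + 40 * (KB * csz P)) <= (5000 + bsz cl1 + cregs P + 12920 * csz P) * (cb * J)"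
      by (simp add: J_def algebra_simps)
    have "KB * LK <= (323 * (l * l)) * (cb * l ^ k0)" using KB LK by (intro mult_le_mono)
    then have 2: "1480 * KB * LK <= 478040 * (cb * J)" by (simp add: J_def algebra_simps)
    have 3: "1 <= cb * J" using J1 LK(2) by simp
    have "AC1 <= 600 * (cb * J) + (5000 + bsz cl1 + cregs P + 12920 * csz P) * (cb * J) + 478040 * (cb * J)"
      unfolding AC1_def using 1 2 3 by linarith
    then show ?thesis by (simp add: c1_def algebra_simps)
  qed
  \<comment> \<open>Dominates both \<open>l ^ 4\<close>, from at most \<open>l\<close> constructions
    with fixed cost of order \<open>l^3 * n\<close>, and \<open>l ^ (k0 + 2)\<close>, from
    \<open>LK\<close> and \<open>KB\<close>.\<close>
  define Z where "Z = l ^ (k0 + 4)"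
  have Zs: "l * (l * l * l) <= Z" "J <= Z" "l <= Z" "1 <= Z"
  proof -
    have "l * (l * l * l) = l ^ 4" "J = l ^ (k0 + 2)" by (simp_all add: J_def power_add numeral_eq_Suc)
    moreover have "l ^ 4 <= Z" "l ^ (k0 + 2) <= Z" "l ^ 1 <= Z" "l ^ 0 <= Z" unfolding Z_def using l1 by (intro power_increasing; simp)+
    ultimately show "l * (l * l * l) <= Z" "J <= Z" "l <= Z" "1 <= Z" by simp_all
  qed
  have Y1: "1 <= Y" "2 ^ p <= Y" by (simp_all add: Y_def)
  have "(ex p + 1) * (AC0 + 40) <= l * (c0 * (l * l * l) * n)" using p A0 by (intro mult_le_mono)
  also have "\<dots> = c0 * ((l * (l * l * l)) * n)" by (simp add: algebra_simps)
  also have "\<dots> <= c0 * (Z * n)" using Zs by (intro mult_le_mono order_refl)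
  finally have 1: "(ex p + 1) * (AC0 + 40) <= c0 * (Z * n)" .
  have "AC1 * Y <= (c1 * cb * Z) * Y" using A1 mult_le_mono2[OF Zs(2), of "c1 * cb"] by (intro mult_le_mono1) linarith
  then have 2: "2 * AC1 * (2 ^ p * 2 ^ ex p) <= 2 * (c1 * cb) * (Z * Y)" by (simp add: Y_def algebra_simps)
  have "Y * (L + 1) <= Y * Z" using b(2) Zs(3) by (intro mult_le_mono2) linarith
  then have 3: "2 ^ p * (6000 * (2 ^ ex p * (L + 1))) <= 6000 * (Z * Y)" by (simp add: Y_def algebra_simps)
  have "1 * Y <= Z * Y" using Zs(4) by (intro mult_le_mono1)
  then have 4: "2 ^ p * 110 + 50 <= 160 * (Z * Y)" using Y1 by linarith
  have "PC p = (ex p + 1) * (AC0 + 40) + 2 * AC1 * (2 ^ p * 2 ^ ex p) + 2 ^ p * (6000 * (2 ^ ex p * (L + 1))) + (2 ^ p * 110 + 50)"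
    by (simp add: PC_def Qc_def rcost_def distrib_left)
  also have "\<dots> <= c0 * (Z * n) + 2 * (c1 * cb) * (Z * Y) + 6000 * (Z * Y) + 160 * (Z * Y)"
    using 1 2 3 4 by linarith
  also have "\<dots> <= c0 * (Z * n + Z * Y) + 2 * (c1 * cb) * (Z * n + Z * Y) + 6000 * (Z * n + Z * Y) + 160 * (Z * n + Z * Y)"
    by (intro add_mono mult_le_mono2) auto
  also have "\<dots> = cost_const P cb * Z * (n + Y)"
    unfolding cost_const_def c0_def[symmetric] c1_def[symmetric] by (simp add: algebra_simps)
  finally show ?thesis unfolding Z_def Y_def .
qed

end

text \<open>The least sufficient power of 2 exceeds the ideal block size by a factor of at most 2;
  if the exponent is 0, this is \<open>q <= time_bound\<close>. The bound
  \<open>time_bound <= q * n\<close> limits it to \<open>2 * n\<close>.\<close>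

lemma block_exponent:
  assumes "2 <= om" "1 <= n" "1 <= q"
  shows "EX e. time_bound om n q <= real q * real (2 ^ e) & real q * real (2 ^ e) <= 2 * time_bound om n q & 2 ^ e <= 2 * n"
proof -
  define T where "T = time_bound om n q"
  have T: "real q <= T" "T <= real q * real n" using time_bound_block[OF assms] by (simp_all add: T_def)
  let ?P = "%e. T <= real q * real (2 ^ e)"
  have "real n <= real (2 ^ n)" using less_imp_le[OF less_exp[of n]] by (simp only: of_nat_le_iff)
  then have "real q * real n <= real q * real (2 ^ n)" by (intro mult_left_mono) auto
  then have ex: "?P n" using T by linarith
  define e where "e = (LEAST e. ?P e)"
  have e: "?P e" unfolding e_def by (rule LeastI[of ?P, OF ex])
  have "real q * real (2 ^ e) <= 2 * T & 2 ^ e <= 2 * n"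
  proof (cases e)
    case 0
    then show ?thesis using T assms by simp
  next
    case (Suc e')
    then have "\<not> ?P e'" using not_less_Least[of e' ?P] by (simp add: e_def)
    then have lt: "real q * real (2 ^ e) <= 2 * T" using Suc by simp
    then have "real q * real (2 ^ e) <= real q * real (2 * n)" using T by simp
    then have "real (2 ^ e) <= real (2 * n)" using assms(3) by (subst (asm) mult_le_cancel_left_pos) auto
    then show ?thesis using lt by (simp only: of_nat_le_iff)
  qed
  then show ?thesis using e unfolding T_def by blast
qed

text \<open>Resolves a circularity: \<open>U\<close> has to exceed a multiple of
  \<open>\<beta>\<close>, which in turn depends on \<open>U\<close>. Enlarging \<open>a\<close>
  multiplies \<open>U\<close> by a power of 2, but \<open>\<beta>\<close> grows only linearly in
  \<open>a\<close>.\<close>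

lemma exists_large_power: "EX a>=7. X + 100 * (128 * a + 256 * p + 3) <= (2::nat) ^ a"
proof -
  have "eventually (%a::nat. real X + 100 * (128 * real a + 256 * real p + 3) <= 2 ^ a) at_top" by real_asymp
  then have "eventually (%a::nat. 7 <= a & real X + 100 * (128 * real a + 256 * real p + 3) <= 2 ^ a) at_top"
    using eventually_ge_at_top[of 7] by eventually_elim simp
  then obtain a :: nat where a: "7 <= a" "real X + 100 * (128 * real a + 256 * real p + 3) <= 2 ^ a"
    using eventually_happens'[OF sequentially_bot] by blast
  then have "real (X + 100 * (128 * a + 256 * p + 3)) <= real (2 ^ a)" by simp
  then show ?thesis using a(1) by (simp only: of_nat_le_iff) blast
qed

theorem online_if_mm_in_time:
  assumes mm: "mm_in_time om"
  shows "range_eq_pairs_online_in_time (time_bound om)"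
proof -
  have om: "2 <= om" using mm by (rule mm_in_time_ge_2)
  obtain P c0 k0 where P: "ALL m>=1. ALL A B K. (ALL i<m. ALL j<m. \<bar>A i j\<bar> <= int K & \<bar>B i j\<bar> <= int K) -->
     (EX t s. exec P (mm_init m A B) t s &
        (ALL i<m. ALL j<m. mem s (int (2 * m * m + i * m + j)) = (\<Sum>l<m. A i l * B l j)) &
        real t <= c0 * real m powr om * log 2 (real (m + K + 2)) ^ k0)"
    using mm unfolding mm_in_time_def by blast
  define cc where "cc = max c0 1"
  define cb where "cb = nat \<lceil>9 + (64 * 2 powr om + 576) + 40 * cc * 3 ^ k0 * (64 * 2 powr om + 576)\<rceil> + 1"
  have cb: "9 + (64 * 2 powr om + 576) + 40 * cc * 3 ^ k0 * (64 * 2 powr om + 576) < real cb" unfolding cb_def by linarith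
  have cb1: "1 <= cb" by (simp add: cb_def)
  \<comment> \<open>\<open>V ^ p\<close> has to dominate \<open>(n + 3) ^ 5\<close> and, for the
    generation numbers, \<open>V ^ (k0 + 4)\<close>.\<close>
  define p where "p = k0 + 6"
  define X where "X = 100 * cmax P + cb * 2 ^ (k0 + 8) + 2000"
  obtain a where a: "7 <= a" "X + 100 * (128 * a + 256 * p + 3) <= 2 ^ a" using exists_large_power by blast
  define c1 where "c1 = 128 * a + 256 * p + 3"
  define Cc where "Cc = cost_const P cb"
  define Z0 where "Z0 = bsz (pre3 cb k0)"
  define ct where "ct = (real (1200 + Z0) + 3 * real Cc) * (2 * real c1) ^ (k0 + 6)"
  have main: "EX t s u. exec (pre cb k0) (array_init n A) t s &
        serve (query P) s qs (map (%(l, r). int (eq_pairs A l r)) qs) u &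
        real (t + u) <= ct * time_bound om n (length qs) * log 2 (real (n + length qs + K + 2)) ^ (k0 + 6)"
    if qs: "qs ~= []" "\<forall>(l, r) \<in> set qs. 1 <= l & l <= r & r <= n" and AK: "\<forall>i\<in>{1..n}. \<bar>A i\<bar> <= int K" for n A K qs
  proof -
    define N where "N = length qs"
    define T where "T = time_bound om n N"
    define V where "V = n + N + K + 2"
    have N1: "1 <= N" using qs(1) by (cases qs) (auto simp: N_def)
    have n1: "1 <= n" using qs by (cases qs) auto
    have V: "2 <= V" "n + 3 <= V" "N <= V" "K <= V" "n <= V" using N1 by (auto simp: V_def)
    define U where "U = 2 ^ a * int V ^ p"
    obtain \<beta> where \<beta>: "mbound U \<beta>" "real (2 * \<beta> + 1) <= real c1 * log 2 (real V)"
      using mbound_powers[OF V(1) a(1), of p] unfolding U_def c1_def by blast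
    interpret mbound U \<beta> by (rule \<beta>(1))
    have leU: "int x <= U" if "x <= (X + 100 * c1) * V ^ p" for x
    proof -
      have "x <= 2 ^ a * V ^ p" using that a(2) mult_le_mono1[of "X + 100 * c1" "2 ^ a" "V ^ p"] unfolding c1_def by linarith
      then have "int x <= int (2 ^ a * V ^ p)" by (simp only: of_nat_le_iff)
      then show ?thesis by (simp add: U_def)
    qed
    have Vp: "V ^ i <= V ^ p" if "i <= p" for i using that V by (intro power_increasing) auto
    have lg1: "1 <= log 2 (real V)" using V by simp
    have lgV: "log 2 (real V) <= real V"
    proof -
      have "real V <= real (2 ^ V)" using less_imp_le[OF less_exp[of V]] by (simp only: of_nat_le_iff)
      then show ?thesis using V(1) by (intro log_of_power_le) auto
    qed
    have \<beta>V: "\<beta> <= c1 * V ^ p"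
    proof -
      have "real c1 * log 2 (real V) <= real c1 * real V" using lgV by (intro mult_left_mono) auto
      then have "real \<beta> <= real (c1 * V)" using \<beta>(2) by simp
      then have "\<beta> <= c1 * V ^ 1" by (simp only: of_nat_le_iff power_one_right)
      then show ?thesis using mult_le_mono2[OF Vp[of 1], of c1] unfolding p_def by linarith
    qed
    have cbV: "cb * x ^ k0 * y <= cb * 2 ^ k0 * V ^ (k0 + j) * z" if "x <= 2 * n" "y <= z * V ^ j" for x y j z
    proof -
      have "x ^ k0 <= (2 * V) ^ k0" using that V by (intro power_mono) auto
      then have "cb * x ^ k0 * y <= cb * (2 * V) ^ k0 * (z * V ^ j)" using that by (intro mult_le_mono order_refl)
      then show ?thesis by (simp add: power_mult_distrib power_add algebra_simps)
    qed
    have XV: "cb * 2 ^ k0 * V ^ (k0 + j) * z <= X * V ^ p" if "z <= 200" "j <= 6" for j z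
    proof -
      have "cb * 2 ^ k0 * V ^ (k0 + j) * z <= cb * 2 ^ k0 * V ^ p * 256" using Vp[of "k0 + j"] that by (intro mult_le_mono order_refl) (auto simp: p_def)
      also have "\<dots> = (cb * 2 ^ (k0 + 8)) * V ^ p" by (simp add: power_add)
      also have "\<dots> <= X * V ^ p" unfolding X_def by (intro mult_le_mono1) simp
      finally show ?thesis .
    qed
    have XU: "int x <= U" if "x <= X * V ^ p" for x
      using that by (intro leU) (simp add: distrib_right)
    have V2: "n * n <= V ^ 2" "V ^ 2 <= V ^ p" "V ^ 1 <= V ^ p" "V ^ 5 <= V ^ p" "V ^ 0 <= V ^ p"
    proof -
      show "n * n <= V ^ 2" unfolding power2_eq_square using V by (intro mult_le_mono)
    qed (rule Vp, simp add: p_def)+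
    have Xc: "int x <= U" if "x <= 2000 * V ^ p" for x
    proof (rule XU)
      have "2000 * V ^ p <= X * V ^ p" by (intro mult_le_mono1) (simp add: X_def)
      then show "x <= X * V ^ p" using that by linarith
    qed
    have nn: "4 * (int n * int n + int n + 10) <= U"
    proof -
      have "4 * (n * n + n + 10) <= 2000 * V ^ p" using V2 V(5) by simp
      from Xc[OF this] show ?thesis by simp
    qed
    have AU: "\<bar>A i\<bar> <= U" if "1 <= i" "i <= n" for i
    proof -
      have "K <= 2000 * V ^ p" using V(4) V2(3) by simp
      from Xc[OF this] show ?thesis using AK that by (meson atLeastAtMost_iff order_trans)
    qed
    have lU: "int cb * int l ^ k0 <= U" if "2 ^ l <= 2 * n" for l
    proof -
      have "l <= 2 * n" using that less_exp[of l] by linarith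
      then have "cb * l ^ k0 * 1 <= cb * 2 ^ k0 * V ^ (k0 + 0) * 1" by (intro cbV) auto
      also have "\<dots> <= X * V ^ p" by (rule XV) auto
      finally have "cb * l ^ k0 * 1 <= X * V ^ p" .
      from XU[OF this] show ?thesis by simp
    qed
    obtain t s l where pre: "exec (pre cb k0) (array_init n A) t s" "t <= (1000 * n + 200 + Z0) * w"
      and l: "n < 2 ^ l" "2 ^ l <= 2 * n" "inv n l (cb * l ^ k0) (ids A) 0 s" "regs s 53 = 1" "regs s 6 = 0" "regs s 11 = 0"
      using run_pre[where A = A and cb = cb and kb = k0, OF n1 order_refl nn AU lU] unfolding run_def Z0_def by blast
    have l2n: "l <= 2 * n" using l(2) less_exp[of l] by linarith
    \<comment> \<open>The time bound of \<open>P\<close> for entries up to \<open>n\<close>, rounded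
      down since running times are integers. It occurs only in the analysis.\<close>
    define Tm where "Tm d = nat \<lfloor>cc * real d powr om * log 2 (real (d + n + 2)) ^ k0\<rfloor>" for d
    have Tm0: "0 <= cc * real d powr om * log 2 (real (d + n + 2)) ^ k0" for d by (simp add: cc_def)
    interpret At: attempts U \<beta> n l "ids A" P Tm "cb * l ^ k0"
    proof
      show "ids A i <= n" if "i < n" for i using ids_le[of A i] that by simp
      have "l <= 2000 * V ^ p" using l2n V(5) V2(3) by simp
      then show "int l <= U" by (rule Xc)
      fix d :: nat and A' B' :: "nat => nat => int"
      assume d: "1 <= d" and AB: "ALL i<d. ALL j<d. \<bar>A' i j\<bar> <= int n & \<bar>B' i j\<bar> <= int n"
      then obtain t s where ts: "exec P (mm_init d A' B') t s"
        "ALL i<d. ALL j<d. mem s (int (2 * d * d + i * d + j)) = (\<Sum>l<d. A' i l * B' l j)"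
        "real t <= c0 * real d powr om * log 2 (real (d + n + 2)) ^ k0" using P by blast
      have "c0 * (real d powr om * log 2 (real (d + n + 2)) ^ k0) <= cc * (real d powr om * log 2 (real (d + n + 2)) ^ k0)"
        unfolding cc_def by (intro mult_right_mono) auto
      then have "real t <= cc * real d powr om * log 2 (real (d + n + 2)) ^ k0" using ts(3) by (simp add: mult.assoc)
      then have "t <= Tm d" unfolding Tm_def by (rule le_nat_floor)
      then show "EX t s. exec P (mm_init d A' B') t s & t <= Tm d &
         (ALL i<d. ALL j<d. mem s (int (2 * d * d + i * d + j)) = (\<Sum>l<d. A' i l * B' l j))" using ts by blast
    qed (use n1 nn l in auto)
    have "ALL i. EX e. time_bound om n (2 ^ i) <= real (2 ^ i) * real (2 ^ e) & real (2 ^ i) * real (2 ^ e) <= 2 * time_bound om n (2 ^ i) & 2 ^ e <= 2 * n"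
      by (intro allI block_exponent[OF om n1]) simp
    then obtain ex where ex: "\<And>i. time_bound om n (2 ^ i) <= real (2 ^ i) * real (2 ^ ex i)"
      "\<And>i. real (2 ^ i) * real (2 ^ ex i) <= 2 * time_bound om n (2 ^ i)" "\<And>i. 2 ^ ex i <= 2 * n" by metis
    \<comment> \<open>The number of phases begun by \<open>N\<close> queries: phase \<open>i\<close>
      starts when \<open>2 ^ i - 1\<close> queries have been answered.\<close>
    define PN where "PN = floorlog 2 N"
    have PN: "2 ^ i <= N \<longleftrightarrow> i < PN" for i
    proof -
      have "PN <= i \<longleftrightarrow> N < 2 ^ i" unfolding PN_def using floorlog_leD[of 2 N i] floorlog_leI[of N 2 i] by auto
      then show ?thesis by linarith
    qed
    have PNN: "PN <= N" using PN[of N] less_exp[of N] by (meson not_le order.strict_trans2)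
    define EM where "EM = 2 * n"
    \<comment> \<open>A phase has at most \<open>EM\<close> constructions, each with a budget of at
      most \<open>cb * l ^ k0 * (N * (2 * n))\<close>, and a call that uses up a generation consumes
      at least one unit of the budget.\<close>
    define GM where "GM = EM * (cb * l ^ k0 * (N * (2 * n)))"
    have exn: "ex i + 1 <= 2 * n" for i using ex(3)[of i] less_exp[of "ex i"] by linarith
    have y: "2 ^ i * 2 ^ ex i <= N * (2 * n)" if "i < PN" for i using that PN[of i] ex(3)[of i] by (intro mult_le_mono) auto
    have N2n: "N * (2 * n) <= 2 * V ^ 2"
    proof -
      have "N * n <= V * V" using V by (intro mult_le_mono)
      then show ?thesis by (simp add: power2_eq_square)
    qed
    have M0U: "int (At.M0 (2 ^ i) (2 ^ ex i)) <= U" if i: "i < PN" for i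
    proof (rule leU)
      have eq: "cb * l ^ k0 * 2 ^ i * 2 ^ ex i = cb * l ^ k0 * (2 ^ i * 2 ^ ex i)" by (simp only: mult.assoc)
      have "cb * l ^ k0 * (2 ^ i * 2 ^ ex i) <= cb * 2 ^ k0 * V ^ (k0 + 2) * 2"
        by (rule cbV[OF l2n]) (use y[OF i] N2n in linarith)
      then have "100 * (cb * l ^ k0 * 2 ^ i * 2 ^ ex i) <= cb * 2 ^ k0 * V ^ (k0 + 2) * 200" unfolding eq by linarith
      also have "\<dots> <= (cb * 2 ^ (k0 + 8)) * V ^ p"
      proof -
        have "cb * 2 ^ k0 * V ^ (k0 + 2) * 200 <= cb * 2 ^ k0 * V ^ p * 256" using Vp[of "k0 + 2"] by (intro mult_le_mono order_refl) (auto simp: p_def)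
        then show ?thesis by (simp add: power_add)
      qed
      finally have 1: "100 * (cb * l ^ k0 * 2 ^ i * 2 ^ ex i) <= (cb * 2 ^ (k0 + 8)) * V ^ p" .
      have 2: "(n + 3) ^ 5 <= V ^ p" using power_mono[OF V(2), of 5] V2(4) by linarith
      have 3: "2 * (2 ^ i * 2 ^ ex i) <= 4 * V ^ p" using y[OF i] N2n V2(2) by linarith
      have 4: "100 * cmax P <= 100 * cmax P * V ^ p" "1000 <= 1000 * V ^ p" using V2(5) by simp_all
      have "At.M0 (2 ^ i) (2 ^ ex i) = 100 * \<beta> + 100 * cmax P + 100 * (cb * l ^ k0 * 2 ^ i * 2 ^ ex i) + 1000 + 4 * (n + 3) ^ 5 + 2 * (2 ^ i * 2 ^ ex i)"
        unfolding At.M0_def by (simp only: distrib_left)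
      also have "\<dots> <= 100 * (c1 * V ^ p) + 100 * cmax P * V ^ p + (cb * 2 ^ (k0 + 8)) * V ^ p + 1000 * V ^ p + 4 * V ^ p + 4 * V ^ p"
        using \<beta>V 1 2 3 4 by linarith
      also have "\<dots> <= (X + 100 * c1) * V ^ p" unfolding X_def by (simp add: algebra_simps)
      finally show "At.M0 (2 ^ i) (2 ^ ex i) <= (X + 100 * c1) * V ^ p" .
    qed
    interpret S: server U \<beta> n l "ids A" P Tm "cb * l ^ k0" A PN ex GM EM
    proof
      show "ids A i = ids A j \<longleftrightarrow> A (Suc i) = A (Suc j)" for i j by (rule ids_eq_iff)
      show "At.succ (2 ^ i) (2 ^ ex i)" for i
      proof (rule At.succ_holds[OF om _ _ refl cb])
        show "real (Tm d) <= cc * real d powr om * log 2 (real (d + n + 2)) ^ k0" for d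
          unfolding Tm_def using Tm0[of d] by simp
      qed (use ex in \<open>auto simp: cc_def\<close>)
      show "int (At.M0 (2 ^ i) (2 ^ ex i)) <= U" if "i < PN" for i by (rule M0U[OF that])
      show "(ex i + 1) * (cb * l ^ k0 * 2 ^ i * 2 ^ ex i) <= GM" if "i < PN" for i
        unfolding GM_def EM_def mult.assoc[of "cb * l ^ k0"] by (intro mult_le_mono exn y[OF that] order_refl)
      show "ex i + 1 <= EM" for i unfolding EM_def by (rule exn)
      have "PN * GM <= X * V ^ p"
      proof -
        have "PN * GM <= N * GM" using PNN by (rule mult_le_mono1)
        also have "\<dots> = cb * l ^ k0 * (N * (2 * n) * (N * (2 * n)))" by (simp add: GM_def EM_def algebra_simps)
        also have "\<dots> <= cb * 2 ^ k0 * V ^ (k0 + 4) * 4"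
        proof (rule cbV[OF l2n])
          have "N * (2 * n) * (N * (2 * n)) <= (2 * V ^ 2) * (2 * V ^ 2)" by (rule mult_le_mono[OF N2n N2n])
          then show "N * (2 * n) * (N * (2 * n)) <= 4 * V ^ 4" by (simp add: numeral_eq_Suc algebra_simps)
        qed
        also have "\<dots> <= X * V ^ p" by (rule XV) auto
        finally show ?thesis .
      qed
      then show "int (PN * GM) <= U" by (rule XU)
      have "PN * EM <= N * (2 * n)" unfolding EM_def using PNN by (rule mult_le_mono1)
      then have "PN * EM <= 2000 * V ^ p" using N2n V2(2) by linarith
      then show "int (PN * EM) <= U" by (rule Xc)
      show "2 * 2 ^ i <= U" if "i < PN" for i
      proof -
        have "2 * 2 ^ i <= 2000 * V ^ p" using PN[of i] that V(3) V2(3) by simp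
        from Xc[OF this] show ?thesis by simp
      qed
      show "2 * 2 ^ ex i <= U" for i
      proof -
        have "2 * 2 ^ ex i <= 2000 * V ^ p" using ex(3)[of i] V(5) V2(3) by simp
        from Xc[OF this] show ?thesis by simp
      qed
    qed
    have Sv0: "S.Sv 0 0 0 s" using l(3-6) by (simp add: S.Sv_def)
    have qs': "1 <= l & l <= r & r <= n" if "(l, r) \<in> set qs" for l r using qs(2) that by blast
    obtain u where u: "serve (query P) s qs (map (%(l, r). int (eq_pairs A l r)) qs) u" "u <= (\<Sum>i=0..<PN. S.PC i) * w"
      using S.serve_main[OF Sv0, of 0 qs N] PN qs' by (auto simp: N_def)
    \<comment> \<open>One logarithmic bound for everything that contributes a logarithm: the
      instruction cost \<open>w\<close>, the length \<open>l\<close> of the binary search, the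
      exponents of block sizes, and the number of phases.\<close>
    define m where "m = nat \<lceil>real c1 * log 2 (real V)\<rceil>"
    have m: "real c1 * log 2 (real V) <= real m" unfolding m_def by linarith
    have c13: "3 <= real c1" by (simp add: c1_def)
    have "3 * 1 <= real c1 * log 2 (real V)" using c13 lg1 by (intro mult_mono) auto
    then have mu: "real m <= 2 * real c1 * log 2 (real V)" "1 <= m" unfolding m_def by linarith+
    have small: "x + 1 <= m" if "2 ^ x <= 2 * V" for x
    proof -
      have "real (2 ^ x) <= real (2 * V)" using that by (simp only: of_nat_le_iff)
      then have "real x <= log 2 (2 * real V)" using V(1) by (intro le_log_of_power) auto
      then have "real x <= 1 + log 2 (real V)" using V(1) by (simp add: log_mult)
      moreover have "3 * log 2 (real V) <= real c1 * log 2 (real V)" using c13 lg1 by (intro mult_right_mono) auto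
      ultimately show ?thesis using lg1 m by linarith
    qed
    have wm: "w <= m" using \<beta>(2) m unfolding w_def by linarith
    have \<beta>m: "\<beta> + 1 <= m" if "1 <= \<beta>" using wm that unfolding w_def by linarith
    have \<beta>1: "1 <= \<beta>" using beta U100 self_le_power[of U 64] by (cases \<beta>) auto
    have lm: "l + 1 <= m" by (rule small) (use l(2) V(5) in linarith)
    have exm: "ex i + 1 <= m" for i by (rule small) (use ex(3)[of i] V(5) in linarith)
    have PNm: "PN <= m"
    proof (cases PN)
      case (Suc i)
      then have "2 ^ i <= N" using PN[of i] by simp
      then show ?thesis using small[of i] V(3) Suc by simp
    qed simp
    have lk: "cb * l ^ k0 <= cb * m ^ k0" using lm by (intro mult_le_mono2 power_mono) auto
    have nT: "real n <= T" unfolding T_def by (rule time_bound_block(2)[OF om n1 N1])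
    have PCT: "real (S.PC i) <= real Cc * real m ^ (k0 + 4) * (3 * T)" if i: "i < PN" for i
    proof -
      have "S.PC i <= Cc * m ^ (k0 + 4) * (n + 2 ^ i * 2 ^ ex i)"
        unfolding Cc_def by (rule S.PC_le[OF \<beta>m[OF \<beta>1] lm lk cb1 exm])
      then have "real (S.PC i) <= real (Cc * m ^ (k0 + 4) * (n + 2 ^ i * 2 ^ ex i))" by (simp only: of_nat_le_iff)
      also have "\<dots> = real Cc * real m ^ (k0 + 4) * (real n + real (2 ^ i) * real (2 ^ ex i))" by simp
      also have "\<dots> <= real Cc * real m ^ (k0 + 4) * (3 * T)"
      proof (intro mult_left_mono)
        have "time_bound om n (2 ^ i) <= T" unfolding T_def by (rule time_bound_block(4)[OF om n1]) (use PN[of i] i in auto)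
        then show "real n + real (2 ^ i) * real (2 ^ ex i) <= 3 * T" using nT ex(2)[of i] by linarith
      qed simp
      finally show ?thesis .
    qed
    have T0: "0 <= T" using nT by linarith
    define B where "B = real m ^ (k0 + 6)"
    have m1: "1 <= real m" using mu(2) by simp
    have B1: "real m <= B" unfolding B_def using m1 by (intro self_le_power) auto
    have t1: "real t <= real (1200 + Z0) * T * B"
    proof -
      have "1000 * n + 200 + Z0 <= (1200 + Z0) * n" using n1 mult_le_mono2[of 1 n "200 + Z0"] by (simp add: algebra_simps)
      then have "(1000 * n + 200 + Z0) * w <= ((1200 + Z0) * n) * m" using wm by (rule mult_le_mono)
      then have "t <= (1200 + Z0) * n * m" using pre(2) by linarith
      then have "real t <= real ((1200 + Z0) * n * m)" by (simp only: of_nat_le_iff)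
      also have "\<dots> = real (1200 + Z0) * real n * real m" by (simp only: of_nat_mult)
      also have "\<dots> <= real (1200 + Z0) * T * B" using nT B1 T0 by (intro mult_mono) auto
      finally show ?thesis .
    qed
    \<comment> \<open>The power of \<open>m\<close> is \<open>k0 + 4\<close> from
      \<open>PC_le\<close>, plus one for the number of phases and one for \<open>w\<close>. All
      phases are bounded by the time for \<open>N\<close> queries, by monotonicity.\<close>
    have u1: "real u <= 3 * real Cc * T * B"
    proof -
      have "real (\<Sum>i=0..<PN. S.PC i) <= (\<Sum>i=0..<PN. real Cc * real m ^ (k0 + 4) * (3 * T))"
        unfolding of_nat_sum by (intro sum_mono PCT) auto
      also have "\<dots> = real PN * (real Cc * real m ^ (k0 + 4) * (3 * T))" by simp
      also have "\<dots> <= real m * (real Cc * real m ^ (k0 + 4) * (3 * T))" using PNm T0 by (intro mult_right_mono) auto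
      finally have 1: "real (\<Sum>i=0..<PN. S.PC i) <= real m * (real Cc * real m ^ (k0 + 4) * (3 * T))" .
      have "real u <= real ((\<Sum>i=0..<PN. S.PC i) * w)" using u(2) by (simp only: of_nat_le_iff)
      also have "\<dots> = real (\<Sum>i=0..<PN. S.PC i) * real w" by (simp only: of_nat_mult)
      also have "\<dots> <= (real m * (real Cc * real m ^ (k0 + 4) * (3 * T))) * real m" using 1 wm T0 by (intro mult_mono) auto
      also have "\<dots> = 3 * real Cc * T * B" unfolding B_def by (simp add: power_add numeral_eq_Suc)
      finally show ?thesis .
    qed
    have B2: "B <= (2 * real c1) ^ (k0 + 6) * log 2 (real V) ^ (k0 + 6)"
      unfolding B_def power_mult_distrib[symmetric] using mu by (intro power_mono) auto
    have "real (t + u) <= (real (1200 + Z0) + 3 * real Cc) * T * B" using t1 u1 by (simp add: algebra_simps)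
    also have "\<dots> <= (real (1200 + Z0) + 3 * real Cc) * T * ((2 * real c1) ^ (k0 + 6) * log 2 (real V) ^ (k0 + 6))"
      using B2 T0 by (intro mult_left_mono) auto
    also have "\<dots> = ct * T * log 2 (real V) ^ (k0 + 6)" unfolding ct_def by (simp add: mult_ac)
    finally show ?thesis using pre(1) u(1) unfolding T_def N_def V_def by blast
  qed
  show ?thesis
    unfolding range_eq_pairs_online_in_time_def
    by (rule exI[of _ "pre cb k0"], rule exI[of _ "query P"], rule exI[of _ ct], rule exI[of _ "k0 + 6"]) (use main in blast)
qed

text \<open>\<open>omega\<close> is an infimum that multiplication need not attain up to logarithms.
  So the bound is claimed for \<open>omega\<close> itself if it is attained, and unconditionally for
  every larger exponent.\<close>

theorem theorem2:
  shows "(mm_in_time omega \<longrightarrow> range_eq_pairs_online_in_time (time_bound omega)) \<and>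
    (\<forall>\<epsilon>>0. range_eq_pairs_online_in_time (time_bound (omega + \<epsilon>)))"
  using online_if_mm_in_time mm_in_time_above_omega by blast

end
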